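(* Let $\mathfrak{g}$ be a finite-dimensional complex reductive Lie algebra. Let $\rho:D_2\to \mathrm{Inn}(\mathfrak{g})$ be a representation that factors through a representation $\overline{\rho}:PGL(2,\mathbb{C})\to\mathrm{Inn}(\mathfrak{g})$, and let $\sigma:D_2\to\mathrm{Aut}(T)$ be a homomorphism that embeds $D_2$ as translations of the complex torus $T=\mathbb{C}/\Lambda$, $\Lambda=\mathbb{Z}+\mathbb{Z}\tau$, $\mathrm{Im}(\tau)>0$. Let $S=\{p_0=0,p_1,\ldots,p_{n-1}\}\subset T$ and $\mathbb{T}=T\setminus D_2\cdot S$. Then there is an isomorphism of Lie algebras and $\mathcal{O}_{\mathbb{T}}^{\tilde\sigma(D_2)}$-modules $$(\mathfrak{g}\otimes_{\mathbb{C}}\mathcal{O}_{\mathbb{T}})^{\rho\otimes\tilde\sigma(D_2)}\cong \mathfrak{g}\otimes_{\mathbb{C}}\mathbb{C}[\wp_{\frac12\Lambda},\wp_{\frac12\Lambda}',\xi_{p_1},\ldots,\xi_{p_{n-1}}].$$ When $\mathfrak{g}$ is simple, the automorphic Lie algebra $(\mathfrak{g}\otimes_{\mathbb{C}}\mathcal{O}_{\mathbb{T}})^{\rho\otimes\tilde\sigma(D_2)}$ has a normal form $$(\mathfrak{g}\otimes_{\mathbb{C}}\mathcal{O}_{\mathbb{T}})^{\rho\otimes\tilde\sigma(D_2)}=\mathcal{O}_{\mathbb{T}}^{\tilde\sigma(D_2)}\big\langle\{\Omega_{\overline\rho}(h_i\otimes1),\ \Omega_{\overline\rho}(a_\alpha\otimes1)\}\big\rangle,$$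 where $\{h_i,a_\alpha: i=1,\ldots,\ell,\ \alpha\in\Phi\}$ is a Chevalley basis for $\mathfrak{g}$ and $\Omega_{\overline\rho}$ is the intertwiner whose construction is recalled in the context.
   Context: $D_2=\langle t_1,t_2\rangle\cong C_2\times C_2$ is the Klein four-group; $\mathrm{Aut}(T)$ is the group of biholomorphic maps of $T$; $D_2\cdot S=\sigma(D_2)\cdot S$. $\mathrm{Inn}(\mathfrak{g})=\mathrm{Ad}(G_{\mathrm{ad}})$ is the group of inner automorphisms of $\mathfrak g$ ($G_{\mathrm{ad}}$ the adjoint group); it acts trivially on the centre of $\mathfrak g$. That $\rho$ factors through $\overline\rho$ means $\rho=\overline\rho\circ\delta$ for a homomorphism $\delta:D_2\to PGL(2,\mathbb{C})$. $\mathcal{O}_{\mathbb{T}}$ is the ring of meromorphic functions on $T$ that are holomorphic on $\mathbb{T}$. $D_2$ acts on $\mathcal{O}_{\mathbb{T}}$ by $\tilde\sigma(\gamma)f=f\circ\sigma(\gamma^{-1})$ and on $\mathfrak{g}\otimes_{\mathbb C}\mathcal{O}_{\mathbb{T}}$ (with bracket $[A\otimes f,B\otimes g]=[A,B]\otimes fg$) by $\rho(\gamma)\otimes\tilde\sigma(\gamma)$. The superscripts $\tilde\sigma(D_2)$ and $\rho\otimes\tilde\sigma(D_2)$ denote fixed points; $(\mathfrak{g}\otimes\mathcal{O}_{\mathbb{T}})^{\rho\otimes\tilde\sigma(D_2)}$ is the automorphic Lie algebra, a module over $\mathcal{O}_{\mathbb{T}}^{\tilde\sigma(D_2)}$ via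 $g\cdot(A\otimes f)=A\otimes gf$. The right-hand side of the isomorphism is a module through the identification $\mathcal{O}_{\mathbb{T}}^{\tilde\sigma(D_2)}=\mathbb{C}[\wp_{\frac12\Lambda},\wp_{\frac12\Lambda}',\xi_{p_1},\ldots,\xi_{p_{n-1}}]$. $\mathcal{O}_{\mathbb{T}}^{\tilde\sigma(D_2)}\langle B\rangle$ denotes the free module with basis $B$. $\wp_{\frac12\Lambda}$ is the Weierstrass function of the lattice $\frac12\Lambda$. For $a,b\in\mathbb R$, $\theta_{a,b}(z|\tau)=\sum_{k\in\mathbb Z}\exp\{\pi \mathrm i\tau(k+a)^2+2\pi \mathrm i(k+a)(z+b)\}$, and $\theta_1=-\theta_{\frac12,\frac12}$, $\theta_2=\theta_{\frac12,0}$, $\theta_3=\theta_{0,0}$, $\theta_4=\theta_{0,\frac12}$. Put $\mu_1(z)=\frac{\theta_1'(0|\tau)}{\theta_2(0|\tau)}\frac{\theta_2(2z|\tau)}{\theta_1(2z|\tau)}$ and $\xi_p(z)=\mu_1(z)\mu_1(z-p)$. Normal form: for simple $\mathfrak g$ of rank $\ell$ with root system $\Phi$ and Chevalley basis $\{h_i,a_\alpha\}$, a collection $\{H_i,A_\alpha\}$ in the automorphic Lie algebra defines a normal form if the automorphic Lie algebra is the free $\mathcal{O}_{\mathbb{T}}^{\tilde\sigma(D_2)}$-module with basis $\{H_i,A_\alpha\}$ and the map $h_i\mapsto H_i$, $a_\alpha\mapsto A_\alpha$ is a Lie algebra embedding of $\mathfrak g$. Construction of the intertwiner $\Omega_{\overline\rho}$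 for simple $\mathfrak g$: without loss of generality $\sigma(t_1)z=z+\frac12$, $\sigma(t_2)z=z+\frac\tau2$, and $\delta$ is taken, without loss of generality, to be injective. Let $\tilde\delta:D_2\to PGL(2,\mathbb C)$, $\tilde\delta(t_1)=\left[\begin{pmatrix}1&0\\0&-1\end{pmatrix}\right]$, $\tilde\delta(t_2)=\left[\begin{pmatrix}0&1\\1&0\end{pmatrix}\right]$, and let $M\in PGL(2,\mathbb C)$ be such that $\delta(t)=M\tilde\delta(t)M^{-1}$ for all $t\in D_2$. Let $$\psi_\pm(z)=\pm\frac{\theta_4^2(0|\tau)}{\theta_3(0|\tau)}\frac{\theta_3(2z|\tau)}{\theta_1(2z|\tau)}-\frac{\theta_3^2(0|\tau)}{\theta_4(0|\tau)}\frac{\theta_4(2z|\tau)}{\theta_1(2z|\tau)},\qquad \Omega(z)=\begin{pmatrix}\psi_-(z)\theta_2(2z|2\tau)&\theta_3(2z|2\tau)\\ \psi_+(z)\theta_3(2z|2\tau)&\theta_2(2z|2\tau)\end{pmatrix}.$$ The class $[\Omega(z)]\in PGL(2,\mathbb{C})$ is well defined for $z\in T\setminus\{0,\frac12,\frac\tau2,\frac{1+\tau}2\}$, and $\Omega_{\overline\rho}(z)=\overline\rho(M)\,\overline\rho([\Omega(z)])$. It satisfies $\Omega_{\overline\rho}(\sigma(t)z)=\rho(t)\Omega_{\overline\rho}(z)$ for $t\in D_2$, $z\in\mathbb T$, and the same symbol denotes the induced automorphism $A\otimes f\mapsto f\cdot\Omega_{\overline\rho}(\cdot)A$ of $\mathfrak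 g\otimes_{\mathbb C}\mathcal{O}_{\mathbb{T}}$.
   Formalization: The isomorphism with 𝔤⊗ℂ[℘,℘′,ξ_{p_i}] is stated only if no p_i lies in 1/4+½Λ (there ξ_{p_i} is constant and the ring identification fails); for all S it is given with 𝔤⊗O_𝕋^{D₂}. Representations of PGL(2,ℂ) are holomorphic. *)

theory Defs
  imports "HOL-Complex_Analysis.Complex_Analysis" "HOL-Algebra.Bij" "HOL-Algebra.Elementary_Groups"
begin

section \<open>Finite-dimensional complex Lie algebras\<close>

locale fd_lie_algebra = vector_space scale
  for scale :: "complex \<Rightarrow> 'g::ab_group_add \<Rightarrow> 'g" +
  fixes bracket :: "'g \<Rightarrow> 'g \<Rightarrow> 'g"
  assumes finite_dim: "\<exists>B. finite B \<and> span B = UNIV"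
    and bracket_add_left: "bracket (x + y) z = bracket x z + bracket y z"
    and bracket_add_right: "bracket x (y + z) = bracket x y + bracket x z"
    and bracket_scale_left: "bracket (scale c x) y = scale c (bracket x y)"
    and bracket_scale_right: "bracket x (scale c y) = scale c (bracket x y)"
    and bracket_self: "bracket x x = 0"
    and jacobi: "bracket x (bracket y z) + bracket y (bracket z x) + bracket z (bracket x y) = 0"
begin

definition ideal :: "'g set \<Rightarrow> bool" where
  "ideal I \<longleftrightarrow> subspace I \<and> (\<forall>x. \<forall>y\<in>I. bracket x y \<in> I)"

text \<open>Reductive: the adjoint representation is completely reducible, i.e. every ideal has a
  complementary ideal.\<close>

definition reductive :: bool where
  "reductive \<longleftrightarrow>
     (\<forall>I. ideal I \<longrightarrow> (\<exists>J. ideal J \<and> I \<inter> J = {0} \<and> {x + y |x y. x \<in> I \<and> y \<in> J} = UNIV))"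

definition simple :: bool where
  "simple \<longleftrightarrow> (\<exists>x y. bracket x y \<noteq> 0) \<and> (\<forall>I. ideal I \<longrightarrow> I = {0} \<or> I = UNIV)"

definition functional :: "('g \<Rightarrow> complex) \<Rightarrow> bool" where
  "functional \<phi> \<longleftrightarrow> Vector_Spaces.linear scale (*) \<phi>"

text \<open>\<open>is_exp A E\<close> says \<open>E = exp A\<close>. The type \<^typ>\<open>'g\<close> carries no topology; since the space is
  finite-dimensional, convergence of the exponential series may be tested on linear functionals,
  and these determine \<^term>\<open>E\<close>.\<close>

definition is_exp :: "('g \<Rightarrow> 'g) \<Rightarrow> ('g \<Rightarrow> 'g) \<Rightarrow> bool" where
  "is_exp A E \<longleftrightarrow>
     (\<forall>v \<phi>. functional \<phi> \<longrightarrow> (\<lambda>n. \<phi> ((A ^^ n) v) / fact n) sums \<phi> (E v))"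

definition GL :: "('g \<Rightarrow> 'g) monoid" where
  "GL = \<lparr>carrier = {f. Vector_Spaces.linear scale scale f \<and> bij f}, mult = (\<circ>), one = id\<rparr>"

text \<open>The adjoint group is connected with Lie algebra \<open>ad \<gg>\<close>, so its image \<open>Inn(\<gg>)\<close> is the group
  generated by the exponentials \<open>exp (ad x)\<close>.\<close>

definition Inn :: "('g \<Rightarrow> 'g) monoid" where
  "Inn = subgroup_generated GL {E. \<exists>x. is_exp (bracket x) E}"

subsection \<open>Root systems and Chevalley bases\<close>

primrec lower_central :: "'g set \<Rightarrow> nat \<Rightarrow> 'g set" where
  "lower_central H 0 = H"
| "lower_central H (Suc k) = span {bracket x y |x y. x \<in> H \<and> y \<in> lower_central H k}"

definition cartan_subalgebra :: "'g set \<Rightarrow> bool" where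
  "cartan_subalgebra H \<longleftrightarrow>
     subspace H \<and> (\<forall>x\<in>H. \<forall>y\<in>H. bracket x y \<in> H) \<and>
     (\<exists>k. lower_central H k = {0}) \<and>
     {x. \<forall>y\<in>H. bracket x y \<in> H} = H"

text \<open>Functionals on \<^term>\<open>H\<close> are extended by zero outside \<^term>\<open>H\<close>, so that equality of
  functions is equality in the dual of \<^term>\<open>H\<close>.\<close>

definition dual :: "'g set \<Rightarrow> ('g \<Rightarrow> complex) set" where
  "dual H = {\<alpha>. (\<forall>x\<in>H. \<forall>y\<in>H. \<alpha> (x + y) = \<alpha> x + \<alpha> y) \<and>
                 (\<forall>c. \<forall>x\<in>H. \<alpha> (scale c x) = c * \<alpha> x) \<and>
                 (\<forall>x. x \<notin> H \<longrightarrow> \<alpha> x = 0)}"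

definition root_space :: "'g set \<Rightarrow> ('g \<Rightarrow> complex) \<Rightarrow> 'g set" where
  "root_space H \<alpha> = {x. \<forall>h\<in>H. bracket h x = scale (\<alpha> h) x}"

definition roots :: "'g set \<Rightarrow> ('g \<Rightarrow> complex) set" where
  "roots H = {\<alpha> \<in> dual H. \<alpha> \<noteq> (\<lambda>x. 0) \<and> root_space H \<alpha> \<noteq> {0}}"

definition coroot :: "'g set \<Rightarrow> ('g \<Rightarrow> complex) \<Rightarrow> 'g" where
  "coroot H \<alpha> =
     (THE h. h \<in> span {bracket x y |x y. x \<in> root_space H \<alpha> \<and> y \<in> root_space H (\<lambda>x. - \<alpha> x)} \<and>
             \<alpha> h = 2)"

definition root_base :: "'g set \<Rightarrow> nat \<Rightarrow> (nat \<Rightarrow> 'g \<Rightarrow> complex) \<Rightarrow> bool" where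
  "root_base H l \<Delta> \<longleftrightarrow>
     (\<forall>i<l. \<Delta> i \<in> roots H) \<and>
     (\<forall>c :: nat \<Rightarrow> real. (\<forall>x. (\<Sum>i<l. of_real (c i) * \<Delta> i x) = 0) \<longrightarrow> (\<forall>i<l. c i = 0)) \<and>
     (\<forall>\<beta>\<in>roots H. \<exists>k :: nat \<Rightarrow> int.
        ((\<forall>i<l. k i \<ge> 0) \<or> (\<forall>i<l. k i \<le> 0)) \<and> \<beta> = (\<lambda>x. \<Sum>i<l. of_int (k i) * \<Delta> i x))"

definition basis_family :: "'i set \<Rightarrow> ('i \<Rightarrow> 'g) \<Rightarrow> bool" where
  "basis_family K b \<longleftrightarrow> inj_on b K \<and> independent (b ` K) \<and> span (b ` K) = UNIV"

text \<open>The index set of the family \<open>{h\<^sub>i, a\<^sub>\<alpha>}\<close>, which itself is \<^term>\<open>case_sum h a\<close>.\<close>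

definition chevalley_index :: "'g set \<Rightarrow> nat \<Rightarrow> (nat + ('g \<Rightarrow> complex)) set" where
  "chevalley_index H l = {..<l} <+> roots H"

definition chevalley_basis ::
  "'g set \<Rightarrow> nat \<Rightarrow> (nat \<Rightarrow> 'g) \<Rightarrow> (('g \<Rightarrow> complex) \<Rightarrow> 'g) \<Rightarrow> bool" where
  "chevalley_basis H l h a \<longleftrightarrow>
     cartan_subalgebra H \<and>
     basis_family (chevalley_index H l) (case_sum h a) \<and>
     (\<exists>\<Delta>. root_base H l \<Delta> \<and> (\<forall>i<l. h i = coroot H (\<Delta> i))) \<and>
     (\<forall>\<alpha>\<in>roots H. a \<alpha> \<in> root_space H \<alpha> \<and> bracket (a \<alpha>) (a (\<lambda>x. - \<alpha> x)) = coroot H \<alpha>) \<and>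
     (\<forall>\<alpha>\<in>roots H. \<forall>\<beta>\<in>roots H. (\<lambda>x. \<alpha> x + \<beta> x) \<in> roots H \<longrightarrow>
        (\<exists>c. bracket (a \<alpha>) (a \<beta>) = scale c (a (\<lambda>x. \<alpha> x + \<beta> x)) \<and>
             bracket (a (\<lambda>x. - \<alpha> x)) (a (\<lambda>x. - \<beta> x)) =
               scale (- c) (a (\<lambda>x. - (\<alpha> x + \<beta> x)))))"

subsection \<open>Tensor products with rings of functions\<close>

text \<open>For a space \<^term>\<open>R\<close> of complex-valued functions on a set, \<open>\<gg> \<otimes> R\<close> is realised as the space
  of \<open>\<gg>\<close>-valued functions spanned by the elementary tensors \<open>A \<otimes> f = (p \<mapsto> f(p) A)\<close>.
  By the lemma below this map from the tensor product to functions is injective. The bracket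
  \<open>[A \<otimes> f, B \<otimes> g] = [A, B] \<otimes> fg\<close> and the module structure become the pointwise operations.\<close>

definition elem_tensor :: "'g \<Rightarrow> ('p \<Rightarrow> complex) \<Rightarrow> 'p \<Rightarrow> 'g" where
  "elem_tensor A f = (\<lambda>p. scale (f p) A)"

definition tensor :: "('p \<Rightarrow> complex) set \<Rightarrow> ('p \<Rightarrow> 'g) set" where
  "tensor R = {X. \<exists>m::nat. \<exists>A f. (\<forall>i<m. f i \<in> R) \<and> X = (\<lambda>p. \<Sum>i<m. elem_tensor (A i) (f i) p)}"

lemma tensor_coefficients_unique:
  assumes "finite K" and b: "basis_family K b"
    and eq: "(\<lambda>p. \<Sum>k\<in>K. elem_tensor (b k) (f k) p) = (\<lambda>p. \<Sum>k\<in>K. elem_tensor (b k) (g k) p)"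
    and "k \<in> K"
  shows "f k = g k"
proof
  fix p
  have inj: "inj_on b K" and ind: "independent (b ` K)"
    using b by (auto simp: basis_family_def)
  define u where "u = (\<lambda>v. f (inv_into K b v) p - g (inv_into K b v) p)"
  have "(\<Sum>v\<in>b ` K. scale (u v) v) = (\<Sum>k\<in>K. scale (u (b k)) (b k))"
    by (simp add: sum.reindex[OF inj])
  also have "\<dots> = (\<Sum>k\<in>K. scale (f k p) (b k)) - (\<Sum>k\<in>K. scale (g k p) (b k))"
    by (simp add: u_def inv_into_f_f[OF inj] scale_left_diff_distrib sum_subtractf)
  also have "\<dots> = 0"
    using fun_cong[OF eq, of p] by (simp add: elem_tensor_def)
  finally have "u (b k) = 0"
    using independentD[OF ind, of "b ` K" u "b k"] assms(1,4) by auto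
  then show "f k p = g k p"
    using assms(4) by (simp add: u_def inv_into_f_f[OF inj])
qed

definition lie_module_iso ::
  "('p \<Rightarrow> complex) set \<Rightarrow> ('p \<Rightarrow> 'g) set \<Rightarrow> ('p \<Rightarrow> 'g) set \<Rightarrow> (('p \<Rightarrow> 'g) \<Rightarrow> ('p \<Rightarrow> 'g)) \<Rightarrow> bool" where
  "lie_module_iso R L L' \<Psi> \<longleftrightarrow>
     bij_betw \<Psi> L L' \<and>
     (\<forall>X\<in>L. \<forall>Y\<in>L. \<Psi> (\<lambda>p. X p + Y p) = (\<lambda>p. \<Psi> X p + \<Psi> Y p)) \<and>
     (\<forall>f\<in>R. \<forall>X\<in>L. \<Psi> (\<lambda>p. scale (f p) (X p)) = (\<lambda>p. scale (f p) (\<Psi> X p))) \<and>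
     (\<forall>X\<in>L. \<forall>Y\<in>L. \<Psi> (\<lambda>p. bracket (X p) (Y p)) = (\<lambda>p. bracket (\<Psi> X p) (\<Psi> Y p)))"

definition free_module_basis ::
  "('p \<Rightarrow> complex) set \<Rightarrow> ('p \<Rightarrow> 'g) set \<Rightarrow> 'i set \<Rightarrow> ('i \<Rightarrow> 'p \<Rightarrow> 'g) \<Rightarrow> bool" where
  "free_module_basis R L K B \<longleftrightarrow>
     bij_betw (\<lambda>c. (\<lambda>p. \<Sum>k\<in>K. scale (c k p) (B k p))) (K \<rightarrow>\<^sub>E R) L"

text \<open>\<^term>\<open>b\<close> is the Chevalley basis of \<open>\<gg>\<close> and \<^term>\<open>B\<close> the candidate normal form of
  \<^term>\<open>L\<close>, both indexed by \<^term>\<open>K\<close>.\<close>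

definition normal_form ::
  "('p \<Rightarrow> complex) set \<Rightarrow> ('p \<Rightarrow> 'g) set \<Rightarrow> 'i set \<Rightarrow> ('i \<Rightarrow> 'g) \<Rightarrow> ('i \<Rightarrow> 'p \<Rightarrow> 'g) \<Rightarrow> bool" where
  "normal_form R L K b B \<longleftrightarrow>
     (\<forall>k\<in>K. B k \<in> L) \<and>
     free_module_basis R L K B \<and>
     (\<exists>\<iota> :: 'g \<Rightarrow> 'p \<Rightarrow> 'g.
        inj \<iota> \<and> range \<iota> \<subseteq> L \<and>
        (\<forall>x y. \<iota> (x + y) = (\<lambda>p. \<iota> x p + \<iota> y p)) \<and>
        (\<forall>c x. \<iota> (scale c x) = (\<lambda>p. scale c (\<iota> x p))) \<and>
        (\<forall>x y. \<iota> (bracket x y) = (\<lambda>p. bracket (\<iota> x p) (\<iota> y p))) \<and>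
        (\<forall>k\<in>K. \<iota> (b k) = B k))"

end

section \<open>The groups \<open>D\<^sub>2\<close> and \<open>PGL(2,\<complex>)\<close>\<close>

definition D2 :: "(int \<times> int) monoid" where
  "D2 = integer_mod_group 2 \<times>\<times> integer_mod_group 2"

definition GL2 :: "(complex^2^2) monoid" where
  "GL2 = \<lparr>carrier = {A. invertible A}, mult = (**), one = mat 1\<rparr>"

definition PGL2 :: "(complex^2^2) set monoid" where
  "PGL2 = GL2 Mod {mat c |c. c \<noteq> 0}"

definition PGL2_class :: "complex^2^2 \<Rightarrow> (complex^2^2) set" where
  "PGL2_class A = {mat c |c. c \<noteq> 0} #>\<^bsub>GL2\<^esub> A"

definition mat2 :: "complex \<Rightarrow> complex \<Rightarrow> complex \<Rightarrow> complex \<Rightarrow> complex^2^2" where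
  "mat2 a b c d = vector [vector [a, b], vector [c, d]]"

context fd_lie_algebra
begin

text \<open>Representations of the complex Lie group \<open>PGL(2,\<complex>)\<close> by inner automorphisms: homomorphisms
  whose matrix coefficients, pulled back to \<open>GL(2,\<complex>)\<close>, are holomorphic, i.e. differentiable with
  complex-linear derivative.\<close>

definition PGL2_rep :: "((complex^2^2) set \<Rightarrow> 'g \<Rightarrow> 'g) \<Rightarrow> bool" where
  "PGL2_rep \<rho>b \<longleftrightarrow>
     \<rho>b \<in> hom PGL2 Inn \<and>
     (\<forall>\<phi> v A. functional \<phi> \<longrightarrow> invertible A \<longrightarrow>
        (\<exists>D. ((\<lambda>X. \<phi> (\<rho>b (PGL2_class X) v)) has_derivative D) (at A) \<and>
             (\<forall>c X. D (mat c ** X) = c * D X)))"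

end

section \<open>The complex torus \<open>\<complex>/(\<int> + \<int>\<tau>)\<close>\<close>

definition period_lattice :: "complex \<Rightarrow> complex set" where
  "period_lattice \<tau> = {of_int a + of_int b * \<tau> |a b. True}"

definition half_lattice :: "complex \<Rightarrow> complex set" where
  "half_lattice \<tau> = (\<lambda>\<omega>. \<omega> / 2) ` period_lattice \<tau>"

definition tproj :: "complex \<Rightarrow> complex \<Rightarrow> complex set" where
  "tproj \<tau> z = {w. w - z \<in> period_lattice \<tau>}"

definition torus :: "complex \<Rightarrow> complex set set" where
  "torus \<tau> = range (tproj \<tau>)"

text \<open>A representative of a point of the torus, used only inside expressions that do not depend on
  its choice.\<close>

definition rep :: "complex set \<Rightarrow> complex" where
  "rep p = (SOME z. z \<in> p)"

definition holomorphic_torus_map :: "complex \<Rightarrow> (complex set \<Rightarrow> complex set) \<Rightarrow> bool" where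
  "holomorphic_torus_map \<tau> f \<longleftrightarrow>
     (\<forall>z. \<exists>U F. open U \<and> z \<in> U \<and> F holomorphic_on U \<and> (\<forall>w\<in>U. f (tproj \<tau> w) = tproj \<tau> (F w)))"

definition torus_aut :: "complex \<Rightarrow> (complex set \<Rightarrow> complex set) monoid" where
  "torus_aut \<tau> = (BijGroup (torus \<tau>))
     \<lparr>carrier := {f \<in> Bij (torus \<tau>).
        holomorphic_torus_map \<tau> f \<and> holomorphic_torus_map \<tau> (inv_into (torus \<tau>) f)}\<rparr>"

definition translation :: "complex \<Rightarrow> complex \<Rightarrow> complex set \<Rightarrow> complex set" where
  "translation \<tau> c = (\<lambda>p\<in>torus \<tau>. (+) c ` p)"

definition orbit_of :: "(int \<times> int \<Rightarrow> complex set \<Rightarrow> complex set) \<Rightarrow> complex set set \<Rightarrow> complex set set" where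
  "orbit_of \<sigma> S = (\<Union>\<gamma>\<in>carrier D2. \<sigma> \<gamma> ` S)"

section \<open>Function rings on the punctured torus and automorphic Lie algebras\<close>

definition zero_off :: "complex set set \<Rightarrow> (complex set \<Rightarrow> 'a::zero) \<Rightarrow> complex set \<Rightarrow> 'a" where
  "zero_off U F = (\<lambda>p. if p \<in> U then F p else 0)"

text \<open>An element of the ring of meromorphic functions holomorphic on \<^term>\<open>U\<close> is determined by its
  restriction to \<^term>\<open>U\<close>; as a total function it is given the value \<open>0\<close> off \<^term>\<open>U\<close>. The library's
  \<^const>\<open>meromorphic_on\<close> ignores the values at isolated points.\<close>

definition mero_ring :: "complex \<Rightarrow> complex set set \<Rightarrow> (complex set \<Rightarrow> complex) set" where
  "mero_ring \<tau> U = {f. (\<forall>p. p \<notin> U \<longrightarrow> f p = 0) \<and>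
     (\<lambda>z. f (tproj \<tau> z)) meromorphic_on UNIV \<and>
     (\<lambda>z. f (tproj \<tau> z)) holomorphic_on {z. tproj \<tau> z \<in> U}}"

definition act_fun :: "complex \<Rightarrow> (int \<times> int \<Rightarrow> complex set \<Rightarrow> complex set) \<Rightarrow> int \<times> int
    \<Rightarrow> (complex set \<Rightarrow> complex) \<Rightarrow> complex set \<Rightarrow> complex" where
  "act_fun \<tau> \<sigma> \<gamma> f = zero_off (torus \<tau>) (\<lambda>p. f (\<sigma> (inv\<^bsub>D2\<^esub> \<gamma>) p))"

definition inv_ring :: "complex \<Rightarrow> (int \<times> int \<Rightarrow> complex set \<Rightarrow> complex set) \<Rightarrow> complex set set
    \<Rightarrow> (complex set \<Rightarrow> complex) set" where
  "inv_ring \<tau> \<sigma> U = {f \<in> mero_ring \<tau> U. \<forall>\<gamma>\<in>carrier D2. act_fun \<tau> \<sigma> \<gamma> f = f}"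

definition act_tensor :: "complex \<Rightarrow> (int \<times> int \<Rightarrow> complex set \<Rightarrow> complex set)
    \<Rightarrow> (int \<times> int \<Rightarrow> 'g \<Rightarrow> 'g) \<Rightarrow> int \<times> int
    \<Rightarrow> (complex set \<Rightarrow> 'g::zero) \<Rightarrow> complex set \<Rightarrow> 'g" where
  "act_tensor \<tau> \<sigma> \<rho> \<gamma> X = zero_off (torus \<tau>) (\<lambda>p. \<rho> \<gamma> (X (\<sigma> (inv\<^bsub>D2\<^esub> \<gamma>) p)))"

definition (in fd_lie_algebra) automorphic_lie_algebra ::
  "complex \<Rightarrow> (int \<times> int \<Rightarrow> complex set \<Rightarrow> complex set) \<Rightarrow> (int \<times> int \<Rightarrow> 'g \<Rightarrow> 'g)
    \<Rightarrow> complex set set \<Rightarrow> (complex set \<Rightarrow> 'g) set" where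
  "automorphic_lie_algebra \<tau> \<sigma> \<rho> U =
     {X \<in> tensor (mero_ring \<tau> U). \<forall>\<gamma>\<in>carrier D2. act_tensor \<tau> \<sigma> \<rho> \<gamma> X = X}"

inductive_set generated_algebra ::
  "complex set set \<Rightarrow> (complex set \<Rightarrow> complex) set \<Rightarrow> (complex set \<Rightarrow> complex) set"
  for U :: "complex set set" and G :: "(complex set \<Rightarrow> complex) set" where
  const: "zero_off U (\<lambda>p. c) \<in> generated_algebra U G"
| gen: "g \<in> G \<Longrightarrow> g \<in> generated_algebra U G"
| add: "f \<in> generated_algebra U G \<Longrightarrow> g \<in> generated_algebra U G \<Longrightarrow>
    (\<lambda>p. f p + g p) \<in> generated_algebra U G"
| mult: "f \<in> generated_algebra U G \<Longrightarrow> g \<in> generated_algebra U G \<Longrightarrow>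
    (\<lambda>p. f p * g p) \<in> generated_algebra U G"

section \<open>Elliptic and theta functions\<close>

definition wp :: "complex set \<Rightarrow> complex \<Rightarrow> complex" where
  "wp L z = 1 / z\<^sup>2 + (\<Sum>\<^sub>\<infinity>\<omega>\<in>L - {0}. 1 / (z - \<omega>)\<^sup>2 - 1 / \<omega>\<^sup>2)"

definition theta :: "real \<Rightarrow> real \<Rightarrow> complex \<Rightarrow> complex \<Rightarrow> complex" where
  "theta a b z \<tau> = (\<Sum>\<^sub>\<infinity>k\<in>(UNIV :: int set).
     exp (of_real pi * \<i> * \<tau> * (of_int k + of_real a)\<^sup>2 +
          2 * of_real pi * \<i> * (of_int k + of_real a) * (z + of_real b)))"

definition theta1 :: "complex \<Rightarrow> complex \<Rightarrow> complex" where
  "theta1 z \<tau> = - theta (1/2) (1/2) z \<tau>"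

definition theta2 :: "complex \<Rightarrow> complex \<Rightarrow> complex" where
  "theta2 z \<tau> = theta (1/2) 0 z \<tau>"

definition theta3 :: "complex \<Rightarrow> complex \<Rightarrow> complex" where
  "theta3 z \<tau> = theta 0 0 z \<tau>"

definition theta4 :: "complex \<Rightarrow> complex \<Rightarrow> complex" where
  "theta4 z \<tau> = theta 0 (1/2) z \<tau>"

definition mu1 :: "complex \<Rightarrow> complex \<Rightarrow> complex" where
  "mu1 \<tau> z = deriv (\<lambda>w. theta1 w \<tau>) 0 / theta2 0 \<tau> * (theta2 (2 * z) \<tau> / theta1 (2 * z) \<tau>)"

definition xi :: "complex \<Rightarrow> complex \<Rightarrow> complex \<Rightarrow> complex" where
  "xi \<tau> p z = mu1 \<tau> z * mu1 \<tau> (z - p)"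

definition wp_xi_ring :: "complex \<Rightarrow> complex set set \<Rightarrow> nat \<Rightarrow> (nat \<Rightarrow> complex set)
    \<Rightarrow> (complex set \<Rightarrow> complex) set" where
  "wp_xi_ring \<tau> U n P = generated_algebra U
     ({zero_off U (\<lambda>p. wp (half_lattice \<tau>) (rep p)),
       zero_off U (\<lambda>p. deriv (wp (half_lattice \<tau>)) (rep p))} \<union>
      {zero_off U (\<lambda>p. xi \<tau> (rep (P i)) (rep p)) |i. 1 \<le> i \<and> i < n})"

section \<open>The intertwiner\<close>

text \<open>The parameter \<^term>\<open>s\<close> is the sign \<open>\<plusminus>1\<close> in \<open>\<psi>\<^sub>\<plusminus>\<close>.\<close>

definition psi :: "complex \<Rightarrow> complex \<Rightarrow> complex \<Rightarrow> complex" where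
  "psi \<tau> s z =
     s * ((theta4 0 \<tau>)\<^sup>2 / theta3 0 \<tau>) * (theta3 (2 * z) \<tau> / theta1 (2 * z) \<tau>) -
     ((theta3 0 \<tau>)\<^sup>2 / theta4 0 \<tau>) * (theta4 (2 * z) \<tau> / theta1 (2 * z) \<tau>)"

definition Omega :: "complex \<Rightarrow> complex \<Rightarrow> complex^2^2" where
  "Omega \<tau> z =
     mat2 (psi \<tau> (-1) z * theta2 (2 * z) (2 * \<tau>)) (theta3 (2 * z) (2 * \<tau>))
          (psi \<tau> 1 z * theta3 (2 * z) (2 * \<tau>)) (theta2 (2 * z) (2 * \<tau>))"

text \<open>\<open>M\<close> conjugates the standard embedding \<open>\<delta>'\<close> of \<open>D\<^sub>2\<close>, taken with respect to the generators
  \<^term>\<open>s1\<close>, \<^term>\<open>s2\<close>, to \<^term>\<open>\<delta>\<close>.\<close>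

definition conjugates_standard ::
  "int \<times> int \<Rightarrow> int \<times> int \<Rightarrow> (int \<times> int \<Rightarrow> (complex^2^2) set) \<Rightarrow> (complex^2^2) set \<Rightarrow> bool" where
  "conjugates_standard s1 s2 \<delta> M \<longleftrightarrow>
     M \<in> carrier PGL2 \<and>
     (\<exists>\<delta>'\<in>hom D2 PGL2.
        \<delta>' s1 = PGL2_class (mat2 1 0 0 (-1)) \<and>
        \<delta>' s2 = PGL2_class (mat2 0 1 1 0) \<and>
        (\<forall>t\<in>carrier D2. \<delta> t = M \<otimes>\<^bsub>PGL2\<^esub> \<delta>' t \<otimes>\<^bsub>PGL2\<^esub> inv\<^bsub>PGL2\<^esub> M))"

definition Omega_rep ::
  "complex \<Rightarrow> ((complex^2^2) set \<Rightarrow> 'g \<Rightarrow> 'g) \<Rightarrow> (complex^2^2) set \<Rightarrow> complex set \<Rightarrow> 'g \<Rightarrow> 'g" where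
  "Omega_rep \<tau> \<rho>b M p = \<rho>b M \<circ> \<rho>b (PGL2_class (Omega \<tau> (rep p)))"

definition intertwiner ::
  "complex \<Rightarrow> complex set set \<Rightarrow> ((complex^2^2) set \<Rightarrow> 'g \<Rightarrow> 'g) \<Rightarrow> (complex^2^2) set
    \<Rightarrow> (complex set \<Rightarrow> 'g::zero) \<Rightarrow> complex set \<Rightarrow> 'g" where
  "intertwiner \<tau> U \<rho>b M X = zero_off U (\<lambda>p. Omega_rep \<tau> \<rho>b M p (X p))"

end

theory Submission
  imports Defs
begin

text \<open>Suppose \<open>T\<close> assigns to the points of the punctured torus inner automorphisms with
  \<open>T(\<sigma>(\<gamma>) p) = \<rho>(\<gamma>) T(p)\<close>, such that the matrix coefficients of \<open>T\<close> and of its inverse are holomorphic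
  on the punctured torus and meromorphic at the punctures. Then \<open>X \<mapsto> T\<^sup>-\<^sup>1 X\<close> untwists the automorphic
  Lie algebra, and \<open>T\<close> maps a basis of the Lie algebra to a normal form. Such a \<open>T\<close> is the image under the
  representation of a matrix of theta quotients that transforms projectively according to \<open>\<delta>\<close>; meromorphy
  at the punctures holds because the operator norm of the representation is bounded by a polynomial in the
  matrix entries and the inverse determinant. If \<open>\<delta>\<close> is injective, it is conjugate to the standard
  embedding and the matrix is \<open>\<Omega>\<close>, whose determinant vanishes nowhere on the punctured torus.
  If the image of \<open>\<delta>\<close> has order two, it is conjugate to a group of diagonal classes, and quotients of
  translated theta functions with a quasi-period of order four provide the matrix.

  The generators of the invariant ring are found by eliminating poles: \<open>\<xi>\<^sub>p\<close> has a simple pole at \<open>p\<close>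
  unless \<open>\<mu>\<^sub>1(p) = 0\<close>, i.e. unless \<open>p\<close> is congruent to \<open>1/4\<close> modulo the half lattice, products of
  \<open>\<wp>\<close> and \<open>\<wp>'\<close> have poles of every order at least two at the origin, and an
  invariant function cannot have a simple pole at the origin as its only pole modulo the half lattice.\<close>

subsection \<open>Theta series\<close>

text \<open>The representation is only assumed holomorphic, and the Lie algebra carries no topology.
  So \<open>T\<close> is tested on linear functionals, and at a puncture, where the matrix
  degenerates or blows up, poles have to be told apart from essential singularities by an estimate;
  compactness together with scaling by powers of two takes the place of algebraicity. The three
  cases for \<delta> are forced, since \<Omega> realises the standard embedding only. For an image
  of order two a diagonal matrix diag(f, g) would be the natural choice, but if only the orbit of 0
  is removed, the square of f / g would be elliptic for the half lattice with zeros and poles at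
  most at 0, hence constant, and f / g could not change sign. This is why each row consists of two
  sections. Points congruent to 1/4 have to be excluded from the description by generators: for such
  a p the function 1 / (wp - wp(p)), with wp the Weierstrass function of the half lattice, is
  invariant with poles at p only, whereas none of the generators has a pole there. The isomorphism
  is therefore first stated with the invariant ring itself.\<close>

lemma summable_on_int_split:
  fixes f :: "int \<Rightarrow> real"
  assumes "summable (\<lambda>n. f (int n))" "summable (\<lambda>n. f (- int n))" "\<And>k. f k \<ge> 0"
  shows "f summable_on UNIV"
proof -
  have 1: "f summable_on range int"
    by (subst summable_on_reindex)
      (auto simp: o_def assms inj_def intro!: norm_summable_imp_summable_on)
  have 2: "f summable_on range (\<lambda>n. - int n)"
    by (subst summable_on_reindex)
      (auto simp: o_def assms inj_def intro!: norm_summable_imp_summable_on)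
  have "range int \<union> range (\<lambda>n. - int n) = UNIV"
    by (auto simp: image_def) (metis int_cases2)
  then show ?thesis
    using summable_on_union[OF 1 2] by simp
qed

lemma summable_on_exp_minus_abs: "(\<lambda>k::int. exp (- \<bar>real_of_int k\<bar>)) summable_on UNIV"
proof (rule summable_on_int_split)
  have "summable (\<lambda>n. exp (- 1 :: real) ^ n)"
    by (rule summable_geometric) simp
  then show "summable (\<lambda>n. exp (- \<bar>real_of_int (int n)\<bar>))" "summable (\<lambda>n. exp (- \<bar>real_of_int (- int n)\<bar>))"
    by (simp_all add: exp_of_nat_mult [symmetric])
qed auto

definition theta_term :: "real \<Rightarrow> real \<Rightarrow> complex \<Rightarrow> complex \<Rightarrow> int \<Rightarrow> complex" where
  "theta_term a b z \<tau> k = exp (of_real pi * \<i> * \<tau> * (of_int k + of_real a)\<^sup>2 +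
          2 * of_real pi * \<i> * (of_int k + of_real a) * (z + of_real b))"

lemma theta_eq_infsum: "theta a b z \<tau> = (\<Sum>\<^sub>\<infinity>k. theta_term a b z \<tau> k)"
  by (simp add: theta_def theta_term_def)

lemma norm_theta_term:
  "norm (theta_term a b z \<tau> k) = exp (- pi * Im \<tau> * (of_int k + a)\<^sup>2 - 2 * pi * (of_int k + a) * Im z)"
  by (simp add: theta_term_def power2_eq_square algebra_simps)

text \<open>Completing the square gives -c x^2 + d |x| <= d^2 / (4 c) with c = \<pi> Im \<tau>. The
  slope d exceeds the actual slope 2 \<pi> R by 1, so a factor exp(-|x|) is left over, and |x| >=
  |k| - |a| turns it into a majorant summable in k and uniform on the strip |Im z| <= R.\<close>

lemma norm_theta_term_le:
  assumes "Im \<tau> > 0" "\<bar>Im z\<bar> \<le> R"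
  shows "norm (theta_term a b z \<tau> k)
    \<le> exp ((2 * pi * R + 1)\<^sup>2 / (4 * pi * Im \<tau>) + \<bar>a\<bar>) * exp (- \<bar>real_of_int k\<bar>)"
proof -
  define x where "x = of_int k + a"
  define c where "c = pi * Im \<tau>"
  define d where "d = 2 * pi * R + 1"
  have c: "c > 0" using assms by (simp add: c_def)
  have "0 \<le> (2 * c * \<bar>x\<bar> - d)\<^sup>2 / (4 * c)" using c by simp
  also have "\<dots> = c * x\<^sup>2 - d * \<bar>x\<bar> + d\<^sup>2 / (4 * c)"
    using c by (simp add: power2_eq_square field_simps)
  finally have 1: "- c * x\<^sup>2 + d * \<bar>x\<bar> \<le> d\<^sup>2 / (4 * c)" by simp
  have "- (x * Im z) \<le> \<bar>x\<bar> * \<bar>Im z\<bar>" by (simp add: abs_mult[symmetric] abs_le_D2)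
  also have "\<dots> \<le> \<bar>x\<bar> * R" using assms by (intro mult_left_mono) auto
  finally have 2: "- (2 * pi * x * Im z) \<le> (d - 1) * \<bar>x\<bar>"
    using mult_left_mono[of "- (x * Im z)" "\<bar>x\<bar> * R" "2 * pi"] by (simp add: d_def algebra_simps)
  have "- c * x\<^sup>2 - 2 * pi * x * Im z \<le> d\<^sup>2 / (4 * c) - \<bar>x\<bar>"
    using 1 2 by (simp add: algebra_simps)
  also have "\<dots> \<le> d\<^sup>2 / (4 * c) + \<bar>a\<bar> - \<bar>real_of_int k\<bar>"
    by (simp add: x_def)
  finally show ?thesis
    unfolding norm_theta_term by (simp add: x_def c_def d_def exp_add [symmetric] mult.assoc)
qed

context
  fixes \<tau> :: complex
  assumes \<tau>: "Im \<tau> > 0"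
begin

lemma summable_on_theta_bound:
  "(\<lambda>k::int. C * exp (- \<bar>real_of_int k\<bar>)) summable_on UNIV"
  by (intro summable_on_cmult_right summable_on_exp_minus_abs)

lemma theta_term_abs_summable: "(\<lambda>k. norm (theta_term a b z \<tau> k)) summable_on UNIV"
  by (rule summable_on_comparison_test[OF summable_on_theta_bound])
    (use norm_theta_term_le[OF \<tau> order_refl] in auto)

lemma theta_has_sum: "(theta_term a b z \<tau> has_sum theta a b z \<tau>) UNIV"
  unfolding theta_eq_infsum
  using abs_summable_summable[OF theta_term_abs_summable] by simp

lemma theta_uniform_limit:
  assumes "\<And>z. z \<in> Y \<Longrightarrow> \<bar>Im z\<bar> \<le> R"
  shows "uniform_limit Y (\<lambda>K z. \<Sum>k\<in>K. theta_term a b z \<tau> k) (\<lambda>z. theta a b z \<tau>)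
    (finite_subsets_at_top UNIV)"
  unfolding theta_eq_infsum
  using norm_theta_term_le[OF \<tau> assms] summable_on_theta_bound
  by (rule Weierstrass_m_test_general)

lemma theta_holomorphic: "(\<lambda>z. theta a b z \<tau>) holomorphic_on UNIV"
proof -
  have "(\<lambda>z. theta a b z \<tau>) holomorphic_on ball z0 1" for z0
  proof -
    have "\<bar>Im z\<bar> \<le> \<bar>Im z0\<bar> + 1" if "z \<in> cball z0 1" for z
      using abs_Im_le_cmod[of "z0 - z"] that by (simp add: dist_norm)
    then have "uniform_limit (cball z0 1) (\<lambda>K z. \<Sum>k\<in>K. theta_term a b z \<tau> k)
            (\<lambda>z. theta a b z \<tau>) (finite_subsets_at_top UNIV)"
      by (rule theta_uniform_limit)
    moreover have "\<forall>\<^sub>F K in finite_subsets_at_top UNIV.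
        continuous_on (cball z0 1) (\<lambda>z. \<Sum>k\<in>K. theta_term a b z \<tau> k) \<and>
        (\<lambda>z. \<Sum>k\<in>K. theta_term a b z \<tau> k) holomorphic_on ball z0 1"
      unfolding theta_term_def
      by (intro always_eventually allI conjI continuous_intros holomorphic_intros)
    ultimately show ?thesis
      using holomorphic_uniform_limit[where F = "finite_subsets_at_top (UNIV :: int set)" and z = z0 and r = 1
        and f = "\<lambda>K z. \<Sum>k\<in>K. theta_term a b z \<tau> k"] by simp
  qed
  then show ?thesis
    by (intro holomorphic_onI) (meson centre_in_ball holomorphic_on_imp_differentiable_at open_ball
      zero_less_one field_differentiable_at_within)
qed

lemma theta_holomorphic' [holomorphic_intros]:
  assumes "f holomorphic_on A"
  shows "(\<lambda>z. theta a b (f z) \<tau>) holomorphic_on A"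
  using holomorphic_on_compose_gen[OF assms theta_holomorphic] by (auto simp: o_def)

lemma theta_shift_Suc: "theta (a + 1) b z \<tau> = theta a b z \<tau>"
proof -
  have "(theta_term a b z \<tau> has_sum theta (a + 1) b z \<tau>) UNIV
      \<longleftrightarrow> (theta_term (a + 1) b z \<tau> has_sum theta (a + 1) b z \<tau>) UNIV"
    by (rule has_sum_reindex_bij_witness[of _ "\<lambda>k. k + 1" "\<lambda>k. k - 1"])
      (auto simp: theta_term_def algebra_simps)
  then show ?thesis using theta_has_sum has_sum_unique by blast
qed

lemma theta_minus: "theta (- a) (- b) (- z) \<tau> = theta a b z \<tau>"
proof -
  have "(theta_term a b z \<tau> has_sum theta (- a) (- b) (- z) \<tau>) UNIV
      \<longleftrightarrow> (theta_term (- a) (- b) (- z) \<tau> has_sum theta (- a) (- b) (- z) \<tau>) UNIV"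
    by (rule has_sum_reindex_bij_witness[of _ "\<lambda>k. - k" "\<lambda>k. - k"])
      (auto simp: theta_term_def power2_eq_square algebra_simps)
  then show ?thesis using theta_has_sum has_sum_unique by blast
qed

end

lemma theta_shift_real: "theta a b (z + of_real c) \<tau> = theta a (b + c) z \<tau>"
  by (simp add: theta_def algebra_simps)

text \<open>Completing the square: \<tau> (k + a)^2 + 2 c \<tau> (k + a) = \<tau> (k + a + c)^2 -
  \<tau> c^2. With c real and not only integral this covers the half periods as well, where the
  characteristic a moves by 1/2.\<close>

lemma theta_shift_tau:
  "theta a b (z + of_real c * \<tau>) \<tau>
    = exp (- of_real pi * \<i> * \<tau> * of_real c ^ 2 - 2 * of_real pi * \<i> * of_real c * (z + of_real b))
      * theta (a + c) b z \<tau>"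
proof -
  have "theta_term a b (z + of_real c * \<tau>) \<tau> k =
    exp (- of_real pi * \<i> * \<tau> * of_real c ^ 2 - 2 * of_real pi * \<i> * of_real c * (z + of_real b))
      * theta_term (a + c) b z \<tau> k" for k
    unfolding theta_term_def exp_add [symmetric]
    by (simp add: power2_eq_square algebra_simps)
  then show ?thesis
    by (simp add: theta_eq_infsum infsum_cmult_right')
qed

lemma exp_2pi_int: "exp (2 * of_real pi * \<i> * of_int k) = 1"
  using exp_integer_2pi[of "of_int k"] by (simp add: mult_ac)

lemma theta_shift_one: "theta a (b + 1) z \<tau> = exp (2 * of_real pi * \<i> * of_real a) * theta a b z \<tau>"
proof -
  have "theta_term a (b + 1) z \<tau> k = exp (2 * of_real pi * \<i> * of_real a) * theta_term a b z \<tau> k" for k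
  proof -
    have "theta_term a (b + 1) z \<tau> k
       = exp (2 * of_real pi * \<i> * of_real a) * theta_term a b z \<tau> k * exp (2 * of_real pi * \<i> * of_int k)"
      unfolding theta_term_def exp_add [symmetric]
      by (simp add: power2_eq_square algebra_simps)
    then show ?thesis by (simp add: exp_2pi_int)
  qed
  then show ?thesis
    by (simp add: theta_eq_infsum infsum_cmult_right')
qed

section \<open>Products of series and the passage from \<tau> to 2 \<tau>\<close>

lemma abs_summable_on_product:
  fixes f :: "'a \<Rightarrow> complex" and g :: "'b \<Rightarrow> complex"
  assumes "(\<lambda>k. norm (f k)) summable_on A" "(\<lambda>l. norm (g l)) summable_on B"
  shows "(\<lambda>p. norm (f (fst p) * g (snd p))) summable_on (A \<times> B)"
proof (rule summable_on_SigmaI)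
  show "((\<lambda>l. norm (f (fst (k, l)) * g (snd (k, l)))) has_sum
      norm (f k) * (\<Sum>\<^sub>\<infinity>l\<in>B. norm (g l))) B" for k
    using has_sum_cmult_right[OF has_sum_infsum[OF assms(2)]] by (simp add: norm_mult)
  show "(\<lambda>k. norm (f k) * (\<Sum>\<^sub>\<infinity>l\<in>B. norm (g l))) summable_on A"
    using assms(1) by (rule summable_on_cmult_left)
qed auto

lemma has_sum_product:
  fixes f :: "'a \<Rightarrow> complex" and g :: "'b \<Rightarrow> complex"
  assumes "(f has_sum a) A" "(g has_sum b) B"
    and "(\<lambda>k. norm (f k)) summable_on A" "(\<lambda>l. norm (g l)) summable_on B"
  shows "((\<lambda>p. f (fst p) * g (snd p)) has_sum a * b) (A \<times> B)"
proof (rule has_sum_SigmaI)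
  show "((\<lambda>l. f (fst (k, l)) * g (snd (k, l))) has_sum f k * b) B" for k
    using has_sum_cmult_right[OF assms(2)] by simp
  show "((\<lambda>k. f k * b) has_sum a * b) A"
    using has_sum_cmult_left[OF assms(1)] by simp
  show "(\<lambda>p. f (fst p) * g (snd p)) summable_on A \<times> B"
    by (rule abs_summable_summable[OF abs_summable_on_product[OF assms(3,4)]])
qed

text \<open>The substitutions \<open>(k, l) = (m + n, m - n)\<close> and \<open>(k, l) = (m + n + 1, m - n)\<close> cover the
  index pairs with even and with odd \<open>k + l\<close>.\<close>

lemma theta3_mult:
  assumes \<tau>: "Im \<tau> > 0"
  shows "theta3 x \<tau> * theta3 y \<tau> =
    theta3 (x + y) (2 * \<tau>) * theta3 (x - y) (2 * \<tau>) + theta2 (x + y) (2 * \<tau>) * theta2 (x - y) (2 * \<tau>)"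
proof -
  define F where "F = (\<lambda>p. theta_term 0 0 x \<tau> (fst p) * theta_term 0 0 y \<tau> (snd p))"
  define G where "G = (\<lambda>a p. theta_term a 0 (x + y) (2 * \<tau>) (fst p) * theta_term a 0 (x - y) (2 * \<tau>) (snd p))"
  have \<tau>2: "Im (2 * \<tau>) > 0" using \<tau> by simp
  define h0 :: "int \<times> int \<Rightarrow> int \<times> int" where "h0 = (\<lambda>(m, n). (m + n, m - n))"
  define h1 :: "int \<times> int \<Rightarrow> int \<times> int" where "h1 = (\<lambda>(m, n). (m + n + 1, m - n))"
  have F: "(F has_sum theta3 x \<tau> * theta3 y \<tau>) UNIV"
    unfolding F_def theta3_def UNIV_Times_UNIV [symmetric]
    by (intro has_sum_product theta_has_sum theta_term_abs_summable \<tau>)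
  have G: "(G a has_sum theta a 0 (x + y) (2 * \<tau>) * theta a 0 (x - y) (2 * \<tau>)) UNIV" for a
    unfolding G_def UNIV_Times_UNIV [symmetric]
    by (intro has_sum_product theta_has_sum theta_term_abs_summable \<tau>2)
  have inj: "inj h0" "inj h1" by (auto simp: inj_def h0_def h1_def)
  \<comment> \<open>By (m + n)^2 + (m - n)^2 = 2 m^2 + 2 n^2 the quadratic exponent at \<tau>
    becomes one at 2 \<tau>. For odd k + l the same identity is used with m + 1/2 and n + 1/2, hence
    the characteristic 1/2 below.\<close>
  have "F \<circ> h0 = G 0"
    by (auto simp: F_def G_def h0_def fun_eq_iff theta_term_def exp_add [symmetric] power2_eq_square
        algebra_simps intro!: arg_cong[where f = exp])
  then have 0: "(F has_sum theta 0 0 (x + y) (2 * \<tau>) * theta 0 0 (x - y) (2 * \<tau>)) (range h0)"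
    using G[of 0] by (simp add: has_sum_reindex[OF inj(1)])
  have "F \<circ> h1 = G (1/2)"
    by (auto simp: F_def G_def h1_def fun_eq_iff theta_term_def exp_add [symmetric] power2_eq_square
        algebra_simps intro!: arg_cong[where f = exp])
  then have 1: "(F has_sum theta (1/2) 0 (x + y) (2 * \<tau>) * theta (1/2) 0 (x - y) (2 * \<tau>)) (range h1)"
    using G[of "1/2"] by (simp add: has_sum_reindex[OF inj(2)])
  have disj: "range h0 \<inter> range h1 = {}"
    by (auto simp: h0_def h1_def image_def) presburger
  have "(k, l) \<in> range h0 \<union> range h1" for k l
  proof (cases "even (k + l)")
    case True
    then have "(k, l) = h0 ((k + l) div 2, (k - l) div 2)" by (auto simp: h0_def; presburger)
    then have "(k, l) \<in> range h0" by (rule range_eqI)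
    then show ?thesis ..
  next
    case False
    then have "(k, l) = h1 ((k + l - 1) div 2, (k - l - 1) div 2)" by (auto simp: h1_def; presburger)
    then have "(k, l) \<in> range h1" by (rule range_eqI)
    then show ?thesis ..
  qed
  then have un: "range h0 \<union> range h1 = UNIV" by auto
  show ?thesis
    using has_sum_unique[OF F has_sum_Un_disjoint[OF 0 1 disj, unfolded un]]
    by (simp add: theta2_def theta3_def)
qed

section \<open>Translations of the theta functions by half periods and periods\<close>

lemma exp_pi_i_half [simp]: "exp (of_real pi * \<i> / 2) = \<i>" "exp (- (of_real pi * \<i> / 2)) = - \<i>"
proof -
  have "exp (\<i> * complex_of_real (pi / 2)) = \<i>" 
    by (simp only: cis_conv_exp [symmetric] cis_pi_half)
  then show 1: "exp (of_real pi * \<i> / 2) = \<i>" by (simp add: mult.commute)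
  show "exp (- (of_real pi * \<i> / 2)) = - \<i>" by (simp add: exp_minus 1)
qed

lemma theta1_add_half: "theta1 (z + 1/2) \<tau> = theta2 z \<tau>"
  using theta_shift_real[of "1/2" "1/2" z "1/2" \<tau>] theta_shift_one[of "1/2" 0 z \<tau>]
  by (simp add: theta1_def theta2_def)

lemma theta2_add_half: "theta2 (z + 1/2) \<tau> = - theta1 z \<tau>"
  using theta_shift_real[of "1/2" 0 z "1/2" \<tau>] by (simp add: theta1_def theta2_def)

lemma theta3_add_half: "theta3 (z + 1/2) \<tau> = theta4 z \<tau>"
  using theta_shift_real[of 0 0 z "1/2" \<tau>] by (simp add: theta3_def theta4_def)

lemma theta4_add_half: "theta4 (z + 1/2) \<tau> = theta3 z \<tau>"
  using theta_shift_real[of 0 "1/2" z "1/2" \<tau>] theta_shift_one[of 0 0 z \<tau>]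
  by (simp add: theta3_def theta4_def)

lemma theta_add_1:
  "theta1 (z + 1) \<tau> = - theta1 z \<tau>" "theta2 (z + 1) \<tau> = - theta2 z \<tau>"
  "theta3 (z + 1) \<tau> = theta3 z \<tau>" "theta4 (z + 1) \<tau> = theta4 z \<tau>"
  using theta1_add_half[of "z + 1/2" \<tau>] theta2_add_half[of "z + 1/2" \<tau>] theta2_add_half[of z \<tau>]
    theta1_add_half[of z \<tau>] theta3_add_half[of "z + 1/2" \<tau>] theta4_add_half[of "z + 1/2" \<tau>]
    theta3_add_half[of z \<tau>] theta4_add_half[of z \<tau>] by (simp_all add: add.assoc)

text \<open>\<open>qfac\<close> and \<open>qfac_half\<close> are the factors of automorphy
  exp(-\<pi> i \<tau> c^2 - 2 \<pi> i c z) of the translations by c \<tau>, for c = 1 and c =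
  1/2.\<close>

definition qfac :: "complex \<Rightarrow> complex \<Rightarrow> complex" where
  "qfac \<tau> z = exp (- of_real pi * \<i> * \<tau> - 2 * of_real pi * \<i> * z)"

definition qfac_half :: "complex \<Rightarrow> complex \<Rightarrow> complex" where
  "qfac_half \<tau> z = exp (- of_real pi * \<i> * \<tau> / 4 - of_real pi * \<i> * z)"

lemma qfac_nonzero [simp]: "qfac \<tau> z \<noteq> 0" "qfac_half \<tau> z \<noteq> 0"
  by (simp_all add: qfac_def qfac_half_def)

lemma theta3_add_half_tau: "theta3 (z + \<tau> / 2) \<tau> = qfac_half \<tau> z * theta2 z \<tau>"
  using theta_shift_tau[of 0 0 z "1/2" \<tau>]
  by (simp add: theta3_def theta2_def qfac_half_def power2_eq_square algebra_simps)

context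
  fixes \<tau> :: complex
  assumes \<tau>: "Im \<tau> > 0"
begin

lemma theta2_add_half_tau: "theta2 (z + \<tau> / 2) \<tau> = qfac_half \<tau> z * theta3 z \<tau>"
  using theta_shift_tau[of "1/2" 0 z "1/2" \<tau>] theta_shift_Suc[OF \<tau>, of 0 0 z]
  by (simp add: theta3_def theta2_def qfac_half_def power2_eq_square algebra_simps)

lemma theta1_add_half_tau: "theta1 (z + \<tau> / 2) \<tau> = \<i> * qfac_half \<tau> z * theta4 z \<tau>"
proof -
  have "theta1 (z + \<tau> / 2) \<tau> = - theta2 (z + \<tau> / 2 + 1 / 2) \<tau>"
    by (simp add: theta2_add_half)
  also have "\<dots> = - (qfac_half \<tau> (z + 1/2) * theta4 z \<tau>)"
    using theta2_add_half_tau[of "z + 1/2"] by (simp add: theta3_add_half algebra_simps)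
  also have "qfac_half \<tau> (z + 1/2) = qfac_half \<tau> z * exp (- (of_real pi * \<i> / 2))"
    unfolding qfac_half_def exp_add [symmetric] by (rule arg_cong[where f = exp]) (simp add: field_simps)
  finally show ?thesis by simp
qed

lemma theta_add_tau:
  "theta1 (z + \<tau>) \<tau> = - qfac \<tau> z * theta1 z \<tau>" "theta2 (z + \<tau>) \<tau> = qfac \<tau> z * theta2 z \<tau>"
  "theta3 (z + \<tau>) \<tau> = qfac \<tau> z * theta3 z \<tau>" "theta4 (z + \<tau>) \<tau> = - qfac \<tau> z * theta4 z \<tau>"
proof -
  have sh: "theta a b (z + \<tau>) \<tau> = qfac \<tau> z * exp (- 2 * of_real pi * \<i> * of_real b) * theta a b z \<tau>" for a b
  proof -
    have "theta a b (z + \<tau>) \<tau> = exp (- of_real pi * \<i> * \<tau> - 2 * of_real pi * \<i> * (z + of_real b))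
       * theta a b z \<tau>"
      using theta_shift_tau[of a b z 1 \<tau>] theta_shift_Suc[OF \<tau>] by simp
    also have "exp (- of_real pi * \<i> * \<tau> - 2 * of_real pi * \<i> * (z + of_real b))
      = qfac \<tau> z * exp (- 2 * of_real pi * \<i> * of_real b)"
      by (simp add: qfac_def exp_add [symmetric] algebra_simps)
    finally show ?thesis .
  qed
  have "exp (- (of_real pi * \<i>)) = - 1" by (simp add: exp_minus)
  then show "theta1 (z + \<tau>) \<tau> = - qfac \<tau> z * theta1 z \<tau>" "theta2 (z + \<tau>) \<tau> = qfac \<tau> z * theta2 z \<tau>"
    "theta3 (z + \<tau>) \<tau> = qfac \<tau> z * theta3 z \<tau>" "theta4 (z + \<tau>) \<tau> = - qfac \<tau> z * theta4 z \<tau>"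
    by (simp_all add: theta1_def theta2_def theta3_def theta4_def sh)
qed

lemma theta_even_odd:
  "theta1 (- z) \<tau> = - theta1 z \<tau>" "theta2 (- z) \<tau> = theta2 z \<tau>"
  "theta3 (- z) \<tau> = theta3 z \<tau>" "theta4 (- z) \<tau> = theta4 z \<tau>"
proof -
  show 2: "theta2 (- z) \<tau> = theta2 z \<tau>" for z
    using theta_minus[OF \<tau>, of "-1/2" 0 z] theta_shift_Suc[OF \<tau>, of "-1/2" 0 z]
    by (simp add: theta2_def)
  show 3: "theta3 (- z) \<tau> = theta3 z \<tau>" for z
    using theta_minus[OF \<tau>, of 0 0 z] by (simp add: theta3_def)
  show "theta1 (- z) \<tau> = - theta1 z \<tau>"
    using theta2_add_half[of "- z" \<tau>] theta2_add_half[of z \<tau>] 2[of "z - 1/2"]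
      theta_add_1(2)[of "z - 1/2" \<tau>] by (simp add: algebra_simps) (metis minus_equation_iff)
  show "theta4 (- z) \<tau> = theta4 z \<tau>"
    using theta3_add_half[of "- z" \<tau>] theta3_add_half[of z \<tau>] 3[of "z - 1/2"]
      theta_add_1(3)[of "z - 1/2" \<tau>] by (simp add: algebra_simps)
qed

lemma theta_holo [holomorphic_intros]:
  assumes "f holomorphic_on A"
  shows "(\<lambda>z. theta1 (f z) \<tau>) holomorphic_on A" "(\<lambda>z. theta2 (f z) \<tau>) holomorphic_on A"
    "(\<lambda>z. theta3 (f z) \<tau>) holomorphic_on A" "(\<lambda>z. theta4 (f z) \<tau>) holomorphic_on A"
  unfolding theta1_def theta2_def theta3_def theta4_def
  by (intro holomorphic_intros theta_holomorphic' \<tau> assms)+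

text \<open>Integrating over a period extracts the Fourier coefficient with index \<open>0\<close>.\<close>

lemma theta3_nonzero: "\<exists>z. theta3 z \<tau> \<noteq> 0"
proof (rule ccontr)
  assume "\<nexists>z. theta3 z \<tau> \<noteq> 0"
  then have zero: "theta3 z \<tau> = 0" for z by blast
  let ?t = "\<lambda>k x. theta_term 0 0 (of_real x) \<tau> k"
  have "uniform_limit (complex_of_real ` {0..1}) (\<lambda>K z. \<Sum>k\<in>K. theta_term 0 0 z \<tau> k)
      (\<lambda>z. theta 0 0 z \<tau>) (finite_subsets_at_top UNIV)"
    by (rule theta_uniform_limit[OF \<tau>, of _ 0]) auto
  then have ul: "uniform_limit {0..1::real} (\<lambda>K x. \<Sum>k\<in>K. ?t k x) (\<lambda>x. 0) (finite_subsets_at_top UNIV)"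
    using zero by (simp add: uniform_limit_iff theta3_def)
  have int: "((\<lambda>x. ?t k x) has_integral (if k = 0 then 1 else 0)) {0..1}" for k
  proof (cases "k = 0")
    case False
    define c where "c = 2 * of_real pi * \<i> * (of_int k :: complex)"
    have c: "c \<noteq> 0" using False by (simp add: c_def)
    define A where "A = of_real pi * \<i> * \<tau> * (of_int k)\<^sup>2"
    have t: "theta_term 0 0 z \<tau> k = exp (A + c * z)" for z
      by (simp add: theta_term_def A_def c_def)
    have "((\<lambda>x. ?t k x) has_integral ?t k 1 / c - ?t k 0 / c) {0..1}"
    proof (rule fundamental_theorem_of_calculus)
      fix x :: real
      show "((\<lambda>x. ?t k x / c) has_vector_derivative ?t k x) (at x within {0..1})"
      proof (rule has_vector_derivative_real_field)
        show "((\<lambda>z. theta_term 0 0 z \<tau> k / c) has_field_derivative ?t k x) (at (of_real x))"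
          unfolding t by (rule derivative_eq_intros refl | use c in simp)+
      qed
    qed simp
    moreover have "?t k 1 = ?t k 0"
      using exp_2pi_int[of k] by (simp add: theta_term_def exp_add)
    ultimately show ?thesis using False by simp
  qed (use has_integral_const_real[of "1::complex" 0 1] in \<open>simp add: theta_term_def\<close>)
  have cont: "continuous_on {0..1} (\<lambda>x. \<Sum>k\<in>K. ?t k x)" for K
    unfolding theta_term_def by (intro continuous_intros)
  obtain I J where I: "\<And>K. ((\<lambda>x. \<Sum>k\<in>K. ?t k x) has_integral I K) {0..1}"
    and J: "((\<lambda>x. 0) has_integral J) {0..1::real}" and lim: "(I \<longlongrightarrow> J) (finite_subsets_at_top UNIV)"
    using uniform_limit_integral[OF ul cont] by auto
  have "I K = 1" if "finite K" "{0} \<subseteq> K" for K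
  proof -
    have "((\<lambda>x. \<Sum>k\<in>K. ?t k x) has_integral (\<Sum>k\<in>K. if k = 0 then 1 else 0)) {0..1}"
      using that by (intro has_integral_sum int) auto
    then show ?thesis
      using has_integral_unique[OF I] that by simp
  qed
  then have "\<forall>\<^sub>F K in finite_subsets_at_top UNIV. I K = 1"
    unfolding eventually_finite_subsets_at_top by (intro exI[of _ "{0}"]) auto
  then have "(I \<longlongrightarrow> 1) (finite_subsets_at_top UNIV)"
    by (rule tendsto_eventually)
  moreover have "J = 0"
    using J by (simp add: has_integral_0_eq)
  ultimately show False
    using tendsto_unique[OF _ lim, of 1] by simp
qed

end

subsection \<open>Lattices and elliptic functions\<close>

definition doubly_periodic :: "complex \<Rightarrow> (complex \<Rightarrow> 'a) \<Rightarrow> bool" where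
  "doubly_periodic \<tau> f \<longleftrightarrow> (\<forall>z. f (z + 1) = f z) \<and> (\<forall>z. f (z + \<tau>) = f z)"

lemma period_latticeI: "of_int a + of_int b * \<tau> \<in> period_lattice \<tau>"
  by (auto simp: period_lattice_def)

lemma period_lattice_0 [simp]: "0 \<in> period_lattice \<tau>"
  using period_latticeI[of 0 0 \<tau>] by simp

lemma period_lattice_1 [simp]: "1 \<in> period_lattice \<tau>"
  using period_latticeI[of 1 0 \<tau>] by simp

lemma period_lattice_tau [simp]: "\<tau> \<in> period_lattice \<tau>"
  using period_latticeI[of 0 1 \<tau>] by simp

lemma period_lattice_add: "x \<in> period_lattice \<tau> \<Longrightarrow> y \<in> period_lattice \<tau> \<Longrightarrow> x + y \<in> period_lattice \<tau>"
proof -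
  assume "x \<in> period_lattice \<tau>" "y \<in> period_lattice \<tau>"
  then obtain a b c d :: int where "x = of_int a + of_int b * \<tau>" "y = of_int c + of_int d * \<tau>"
    by (auto simp: period_lattice_def)
  then have "x + y = of_int (a + c) + of_int (b + d) * \<tau>" by (simp add: algebra_simps)
  then show "x + y \<in> period_lattice \<tau>" using period_latticeI by metis
qed

lemma period_lattice_uminus: "x \<in> period_lattice \<tau> \<Longrightarrow> - x \<in> period_lattice \<tau>"
proof -
  assume "x \<in> period_lattice \<tau>"
  then obtain a b :: int where "x = of_int a + of_int b * \<tau>"
    by (auto simp: period_lattice_def)
  then have "- x = of_int (- a) + of_int (- b) * \<tau>" by (simp add: algebra_simps)
  then show "- x \<in> period_lattice \<tau>" using period_latticeI by metis
qed

lemma period_lattice_uminus_iff [simp]: "- x \<in> period_lattice \<tau> \<longleftrightarrow> x \<in> period_lattice \<tau>"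
  using period_lattice_uminus[of x] period_lattice_uminus[of "- x"] by auto

lemma period_lattice_diff: "x \<in> period_lattice \<tau> \<Longrightarrow> y \<in> period_lattice \<tau> \<Longrightarrow> x - y \<in> period_lattice \<tau>"
  using period_lattice_add[of x \<tau> "- y"] by simp

lemma period_lattice_add_cancel [simp]:
  assumes "w \<in> period_lattice \<tau>"
  shows "z + w \<in> period_lattice \<tau> \<longleftrightarrow> z \<in> period_lattice \<tau>"
  using assms period_lattice_add[of z \<tau> w] period_lattice_diff[of "z + w" \<tau> w] by auto

text \<open>Stated for a predicate instead of a function, so that it also transports the zeros of
  functions that are only quasi-periodic, whose values are multiplied by nonvanishing
  factors.\<close>

lemma lattice_induct:
  assumes "w \<in> period_lattice \<tau>"
    and "\<And>z. Q (z + 1) \<longleftrightarrow> Q z" "\<And>z. Q (z + \<tau>) \<longleftrightarrow> Q z"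
  shows "Q (z + w) \<longleftrightarrow> Q z"
proof -
  obtain a b :: int where w: "w = of_int a + of_int b * \<tau>"
    using assms(1) by (auto simp: period_lattice_def)
  have 1: "Q (z + of_int a) \<longleftrightarrow> Q z" for z
    by (induction a rule: int_induct[of _ 0])
      (use assms(2)[of "z + of_int _"] assms(2)[of "z + of_int (_ - 1)"] in \<open>auto simp: algebra_simps\<close>)
  have 2: "Q (z + of_int b * \<tau>) \<longleftrightarrow> Q z" for z
    by (induction b rule: int_induct[of _ 0])
      (use assms(3)[of "z + of_int _ * \<tau>"] assms(3)[of "z + of_int (_ - 1) * \<tau>"] in \<open>auto simp: algebra_simps\<close>)
  show ?thesis
    using 1[of "z + of_int b * \<tau>"] 2[of z] by (simp add: w algebra_simps)
qed

lemma doubly_periodic_lattice: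
  assumes "doubly_periodic \<tau> f" "w \<in> period_lattice \<tau>"
  shows "f (z + w) = f z"
  using lattice_induct[OF assms(2), of "\<lambda>x. f x = f z" z] assms(1) by (simp add: doubly_periodic_def)

lemma complex_eq_lattice_coords:
  assumes "Im \<tau> > 0"
  shows "z = of_real (Re z - Im z / Im \<tau> * Re \<tau>) + of_real (Im z / Im \<tau>) * \<tau>"
  using assms by (simp add: complex_eq_iff)

lemma lattice_coords_unique:
  assumes "Im \<tau> > 0" "of_real a + of_real b * \<tau> = of_real c + of_real d * \<tau>"
  shows "a = c" "b = d"
  using assms by (auto simp: complex_eq_iff)

lemma lattice_coords_iff:
  assumes "Im \<tau> > 0"
  shows "of_real a + of_real b * \<tau> \<in> period_lattice \<tau> \<longleftrightarrow> a \<in> \<int> \<and> b \<in> \<int>"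
proof
  assume "of_real a + of_real b * \<tau> \<in> period_lattice \<tau>"
  then obtain c d :: int where "of_real a + of_real b * \<tau> = of_real (of_int c) + of_real (of_int d) * \<tau>"
    by (auto simp: period_lattice_def)
  from lattice_coords_unique[OF assms this] show "a \<in> \<int> \<and> b \<in> \<int>" by simp
next
  assume "a \<in> \<int> \<and> b \<in> \<int>"
  then obtain c d :: int where "a = of_int c" "b = of_int d" by (auto elim!: Ints_cases)
  then show "of_real a + of_real b * \<tau> \<in> period_lattice \<tau>"
    using period_latticeI[of c d \<tau>] by simp
qed

text \<open>All values are taken on the compact period parallelogram, so the function is bounded and
  Liouville's theorem applies.\<close>

lemma elliptic_entire_const:
  assumes \<tau>: "Im \<tau> > 0" and hol: "f holomorphic_on UNIV" and per: "doubly_periodic \<tau> f"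
  shows "\<exists>c. \<forall>z. f z = c"
proof -
  define K where "K = (\<lambda>p. of_real (fst p) + of_real (snd p) * \<tau>) ` ({0..1::real} \<times> {0..1::real})"
  have "compact K"
    unfolding K_def by (intro compact_continuous_image continuous_intros compact_Times compact_Icc)
  then have "bounded (f ` K)"
    using hol by (intro compact_imp_bounded compact_continuous_image)
      (auto intro: holomorphic_on_imp_continuous_on holomorphic_on_subset)
  moreover have "range f \<subseteq> f ` K"
  proof
    fix y assume "y \<in> range f"
    then obtain z where y: "y = f z" by auto
    define b where "b = Im z / Im \<tau>"
    define a where "a = Re z - b * Re \<tau>"
    have z: "z = of_real a + of_real b * \<tau>"
      using complex_eq_lattice_coords[OF \<tau>, of z] by (simp add: a_def b_def)
    have "z = (of_real (frac a) + of_real (frac b) * \<tau>) + (of_int \<lfloor>a\<rfloor> + of_int \<lfloor>b\<rfloor> * \<tau>)"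
      by (simp add: z frac_def algebra_simps)
    then have "y = f (of_real (frac a) + of_real (frac b) * \<tau>)"
      using doubly_periodic_lattice[OF per period_latticeI] y by metis
    moreover have "of_real (frac a) + of_real (frac b) * \<tau> \<in> K"
      unfolding K_def by (rule image_eqI[of _ _ "(frac a, frac b)"]) (auto simp: frac_ge_0 less_imp_le[OF frac_lt_1])
    ultimately show "y \<in> f ` K" by blast
  qed
  ultimately have "bounded (range f)" using bounded_subset by blast
  then show ?thesis
    using Liouville_theorem[OF hol] by (auto simp: constant_on_def)
qed

text \<open>A removable singularity may carry an arbitrary value, so the constant is asserted for
  \<open>remove_sings f\<close>. This function is again doubly periodic, because its value at a
  point depends only on the germ of f there, and the periods translate germs.\<close>

lemma elliptic_mero_const:
  assumes \<tau>: "Im \<tau> > 0" and mero: "f meromorphic_on UNIV" and per: "doubly_periodic \<tau> f"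
    and no_pole: "\<And>z. \<not> is_pole f z"
  shows "\<exists>c. \<forall>z. remove_sings f z = c"
proof (rule elliptic_entire_const[OF \<tau>])
  have "remove_sings f analytic_on {z}" for z
  proof (rule remove_sings_analytic_at)
    have z: "isolated_singularity_at f z" "not_essential f z"
      using mero by (auto simp: meromorphic_on_altdef)
    show "isolated_singularity_at f z" by (rule z)
    show "f \<midarrow>z\<rightarrow> remove_sings f z"
      using z no_pole[of z] by (auto simp: not_essential_def dest: remove_sings_eqI)
  qed
  then show "remove_sings f holomorphic_on UNIV"
    using analytic_imp_holomorphic analytic_on_analytic_at by blast
  have "remove_sings f (z + w) = remove_sings f z" if "\<And>z. f (z + w) = f z" for w z
    using that remove_sings_shift_0[of f "z + w"] remove_sings_shift_0[of f z]
    by (simp add: add_ac) (metis add.commute add.left_commute)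
  then show "doubly_periodic \<tau> (remove_sings f)"
    using per by (simp add: doubly_periodic_def)
qed

lemma is_pole_shift_period:
  fixes f :: "complex \<Rightarrow> complex"
  assumes "\<And>z. f (z + w) = f z"
  shows "is_pole f (z + w) \<longleftrightarrow> is_pole f z"
proof -
  have "f \<circ> (+) w = f" using assms by (auto simp: fun_eq_iff add.commute)
  then show ?thesis
    using is_pole_shift_iff[of f w z] by simp
qed

subsection \<open>The zeros of the theta functions\<close>

text \<open>The q-Pochhammer symbol (x; q) with infinitely many factors, as the limit of partial
  products, the form in which uniform convergence delivers it.\<close>

definition qprod :: "complex \<Rightarrow> complex \<Rightarrow> complex" where
  "qprod q x = lim (\<lambda>N. \<Prod>n<N. 1 - q ^ n * x)"

context
  fixes q :: complex
  assumes q: "norm q < 1"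
begin

lemma qprod_uniform_limit: "uniform_limit (cball x0 R) (\<lambda>N x. \<Prod>n<N. 1 - q ^ n * x) (qprod q) sequentially"
proof -
  have "uniformly_convergent_on (cball x0 R) (\<lambda>N x. \<Prod>n<N. 1 - q ^ n * x)"
  proof (rule uniformly_convergent_on_prod')
    show "uniformly_convergent_on (cball x0 R) (\<lambda>N x. \<Sum>n<N. norm (1 - q ^ n * x - 1))"
    proof (rule Weierstrass_m_test')
      fix n x assume "x \<in> cball x0 R"
      then have "norm x \<le> norm x0 + R"
        using norm_triangle_ineq2[of x x0] by (simp add: dist_norm norm_minus_commute)
      then show "norm (norm (1 - q ^ n * x - 1)) \<le> norm q ^ n * (norm x0 + R)"
        by (simp add: norm_mult norm_power mult_left_mono)
    qed (use q in \<open>auto intro!: summable_mult2 summable_geometric\<close>)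
  qed (auto intro!: continuous_intros)
  then show ?thesis
    unfolding qprod_def uniformly_convergent_uniform_limit_iff .
qed

lemma qprod_LIMSEQ: "(\<lambda>N. \<Prod>n<N. 1 - q ^ n * x) \<longlonglongrightarrow> qprod q x"
  by (rule tendsto_uniform_limitI[OF qprod_uniform_limit[of x 0]]) simp

lemma qprod_holomorphic: "qprod q holomorphic_on UNIV"
proof -
  have "qprod q holomorphic_on ball x0 1" for x0
    by (rule holomorphic_uniform_limit[OF _ qprod_uniform_limit[of x0 1]])
      (auto intro!: always_eventually continuous_intros holomorphic_intros)
  then show ?thesis
    by (intro holomorphic_onI) (meson centre_in_ball holomorphic_on_imp_differentiable_at open_ball
      zero_less_one field_differentiable_at_within)
qed

lemma qprod_holomorphic' [holomorphic_intros]: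
  assumes "f holomorphic_on A"
  shows "(\<lambda>z. qprod q (f z)) holomorphic_on A"
  using holomorphic_on_compose_gen[OF assms qprod_holomorphic] by (auto simp: o_def)

text \<open>Splitting off the factor with n = 0 turns x into q x in all others. Both the
  quasi-period and the simplicity of the zero of \<open>theta_prod\<close> come from this.\<close>

lemma qprod_rec: "qprod q x = (1 - x) * qprod q (q * x)"
proof -
  have "(\<lambda>N. \<Prod>n<Suc N. 1 - q ^ n * x) \<longlonglongrightarrow> qprod q x"
    using qprod_LIMSEQ by (rule LIMSEQ_Suc)
  moreover have "(\<Prod>n<Suc N. 1 - q ^ n * x) = (1 - x) * (\<Prod>n<N. 1 - q ^ n * (q * x))" for N
    by (subst prod.lessThan_Suc_shift) (simp add: mult_ac)
  moreover have "(\<lambda>N. (1 - x) * (\<Prod>n<N. 1 - q ^ n * (q * x))) \<longlonglongrightarrow> (1 - x) * qprod q (q * x)"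
    by (intro tendsto_intros qprod_LIMSEQ)
  ultimately show ?thesis
    using LIMSEQ_unique by fastforce
qed

lemma qprod_nonzero:
  assumes "\<And>n. q ^ n * x \<noteq> 1"
  shows "qprod q x \<noteq> 0"
proof -
  have "abs_convergent_prod (\<lambda>n. 1 - q ^ n * x)"
    using q by (intro summable_imp_abs_convergent_prod)
      (auto simp: norm_mult norm_power intro!: summable_mult2 summable_geometric)
  then have conv: "convergent_prod (\<lambda>n. 1 - q ^ n * x)"
    by (rule abs_convergent_prod_imp_convergent_prod)
  have nz: "1 - q ^ n * x \<noteq> 0" for n
    using assms[of n] by auto
  show ?thesis
    using prodinf_nonzero[OF conv nz] prodinf_eq_lim'[OF conv nz] by (simp add: qprod_def)
qed

end

text \<open>The z-dependent part of Jacobi's triple product for \<open>theta1\<close>, up to an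
  exponential factor. Here the zeros can be read off from the factors, which the series does not
  allow.\<close>

definition theta_prod :: "complex \<Rightarrow> complex \<Rightarrow> complex" where
  "theta_prod \<tau> z = qprod (exp (2 * of_real pi * \<i> * \<tau>)) (exp (2 * of_real pi * \<i> * z))
     * qprod (exp (2 * of_real pi * \<i> * \<tau>)) (exp (2 * of_real pi * \<i> * (\<tau> - z)))"

lemma exp_2pi_eq_1_iff: "exp (2 * of_real pi * \<i> * z) = 1 \<longleftrightarrow> (\<exists>n::int. z = of_int n)"
proof
  assume "exp (2 * of_real pi * \<i> * z) = 1"
  then have "exp (2 * of_real pi * \<i> * z) = exp 0" by simp
  then obtain n :: int where "2 * of_real pi * \<i> * z = 0 + of_real (of_int (2 * n) * pi) * \<i>"
    unfolding exp_eq by (auto simp: mult_ac)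
  then have "z = of_int n" by (auto simp: field_simps)
  then show "\<exists>n::int. z = of_int n" ..
qed (auto simp: exp_2pi_int)

context
  fixes \<tau> :: complex
  assumes \<tau>: "Im \<tau> > 0"
begin

lemma norm_nome: "norm (exp (2 * of_real pi * \<i> * \<tau>)) < 1"
  using \<tau> by simp

lemma theta_prod_holomorphic: "theta_prod \<tau> holomorphic_on A"
  unfolding theta_prod_def by (intro holomorphic_intros qprod_holomorphic' norm_nome)

lemma theta_prod_zero: 
  assumes "theta_prod \<tau> z = 0"
  shows "z \<in> period_lattice \<tau>"
proof -
  let ?q = "exp (2 * of_real pi * \<i> * \<tau>)"
  have key: "\<exists>n m. x = of_int m + of_int n * \<tau>" if x: "qprod ?q (exp (2 * of_real pi * \<i> * x)) = 0" for x
  proof -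
    obtain n where "?q ^ n * exp (2 * of_real pi * \<i> * x) = 1"
      using qprod_nonzero[OF norm_nome] x by blast
    then have "exp (2 * of_real pi * \<i> * (of_nat n * \<tau> + x)) = 1"
      by (simp add: exp_of_nat_mult [symmetric] exp_add [symmetric] algebra_simps)
    then obtain m :: int where "of_nat n * \<tau> + x = of_int m"
      unfolding exp_2pi_eq_1_iff ..
    then have "x = of_int m + of_int (- int n) * \<tau>" by (simp add: algebra_simps)
    then show ?thesis by blast
  qed
  from assms consider "qprod ?q (exp (2 * of_real pi * \<i> * z)) = 0"
    | "qprod ?q (exp (2 * of_real pi * \<i> * (\<tau> - z))) = 0"
    by (auto simp: theta_prod_def)
  then show ?thesis
  proof cases
    case 1
    then show ?thesis using key period_latticeI by metis
  next
    case 2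
    then have "\<tau> - z \<in> period_lattice \<tau>" using key period_latticeI by metis
    then show ?thesis using period_lattice_diff[OF period_lattice_tau[of \<tau>], of "\<tau> - z"] by simp
  qed
qed

lemma theta_prod_shift:
  "theta_prod \<tau> (z + 1) = theta_prod \<tau> z"
  "theta_prod \<tau> (z + \<tau>) = - exp (- 2 * of_real pi * \<i> * z) * theta_prod \<tau> z"
proof -
  let ?e = "\<lambda>x. exp (2 * of_real pi * \<i> * x)"
  have e: "?e (x + 1) = ?e x" "?e (x - 1) = ?e x" "?e (x + y) = ?e x * ?e y" for x y
    using exp_2pi_int[of 1] by (simp_all add: exp_add exp_diff ring_distribs)
  have "?e (\<tau> - (z + 1)) = ?e (\<tau> - z)"
    using e(2)[of "\<tau> - z"] by (simp add: algebra_simps)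
  then show "theta_prod \<tau> (z + 1) = theta_prod \<tau> z"
    unfolding theta_prod_def e(1) by simp
  define A where "A = qprod (?e \<tau>) (?e \<tau> * ?e z)"
  define B where "B = qprod (?e \<tau>) (?e (\<tau> - z))"
  define x where "x = ?e z"
  define y where "y = ?e (- z)"
  have xy: "y * x = 1"
    unfolding x_def y_def e(3) [symmetric] by simp
  have 1: "qprod (?e \<tau>) x = (1 - x) * A"
    unfolding x_def A_def by (rule qprod_rec[OF norm_nome])
  have 2: "qprod (?e \<tau>) y = (1 - y) * B"
    using qprod_rec[OF norm_nome, of y] e(3)[of \<tau> "- z"] by (simp add: y_def B_def)
  have "\<tau> - (z + \<tau>) = - z" by simp
  moreover have "?e (z + \<tau>) = ?e \<tau> * ?e z"
    unfolding e(3) by (rule mult.commute)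
  ultimately have "theta_prod \<tau> (z + \<tau>) = A * qprod (?e \<tau>) y"
    unfolding theta_prod_def by (simp only: A_def y_def)
  \<comment> \<open>Since y x = 1, the new factor 1 - y equals -y (1 - x); this -y is the entire
    factor of automorphy.\<close>
  also have "\<dots> = - y * ((1 - x) * A * B)"
    using xy unfolding 2 by algebra
  also have "(1 - x) * A * B = theta_prod \<tau> z"
    unfolding 1 [symmetric] by (simp add: theta_prod_def x_def B_def)
  finally show "theta_prod \<tau> (z + \<tau>) = - exp (- 2 * of_real pi * \<i> * z) * theta_prod \<tau> z"
    by (simp add: y_def)
qed

lemma theta_prod_deriv_0: "\<exists>d. d \<noteq> 0 \<and> (theta_prod \<tau> has_field_derivative d) (at 0)"
proof -
  let ?e = "\<lambda>x. exp (2 * of_real pi * \<i> * x)"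
  define r where "r = (\<lambda>z. qprod (?e \<tau>) (?e (\<tau> + z)) * qprod (?e \<tau>) (?e (\<tau> - z)))"
  have eq: "theta_prod \<tau> = (\<lambda>z. (1 - ?e z) * r z)"
    by (rule ext, simp add: theta_prod_def r_def) (subst qprod_rec[OF norm_nome], simp add: exp_add ring_distribs)
  \<comment> \<open>\<open>r 0\<close> is the square of this value. Once the factor 1 - exp(2 \<pi>
    i z) is split off, nothing vanishes at 0 any more.\<close>
  have "qprod (?e \<tau>) (?e \<tau>) \<noteq> 0"
  proof (rule qprod_nonzero[OF norm_nome])
    fix n
    have "norm (?e \<tau> ^ n * ?e \<tau>) < 1"
      using norm_nome power_Suc_less_one[of "norm (?e \<tau>)" n] 
      by (simp add: norm_mult norm_power mult.commute)
    then show "?e \<tau> ^ n * ?e \<tau> \<noteq> 1" by force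
  qed
  then have r0: "r 0 \<noteq> 0" by (simp add: r_def)
  have "r holomorphic_on UNIV"
    unfolding r_def by (intro holomorphic_intros qprod_holomorphic' norm_nome)
  then have r': "(r has_field_derivative deriv r 0) (at 0)"
    using holomorphic_derivI by blast
  have "(theta_prod \<tau> has_field_derivative - (2 * of_real pi * \<i>) * r 0) (at 0)"
    unfolding eq by (rule derivative_eq_intros r' refl | simp)+
  then show ?thesis using r0 by (intro exI[of _ "- (2 * of_real pi * \<i>) * r 0"]) simp
qed

section \<open>The zeros of the theta functions, by comparison with the product\<close>

lemma theta1_eq_0_lattice: "w \<in> period_lattice \<tau> \<Longrightarrow> theta1 w \<tau> = 0"
  using lattice_induct[of w \<tau> "\<lambda>z. theta1 z \<tau> = 0" 0] theta_even_odd(1)[OF \<tau>, of 0]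
  by (simp add: theta_add_1 theta_add_tau[OF \<tau>])

lemma theta1_nonzero: "\<exists>z. theta1 z \<tau> \<noteq> 0"
proof -
  obtain z where "theta3 z \<tau> \<noteq> 0" using theta3_nonzero[OF \<tau>] by blast
  then have "theta1 (z + \<tau> / 2 + 1 / 2) \<tau> \<noteq> 0"
    by (simp add: theta1_add_half theta2_add_half_tau[OF \<tau>])
  then show ?thesis ..
qed

text \<open>The quotient \<open>f\<close> of the two sides is elliptic. Off the lattice its
  denominator has no zeros; at 0 the denominator has a simple zero and \<open>theta1\<close>
  vanishes too, so there is no pole, and by periodicity none at any lattice point. Hence
  \<open>f\<close> is constant, and the constant is nonzero because \<open>theta1\<close> does not
  vanish identically.\<close>

lemma theta1_product: "\<exists>c. c \<noteq> 0 \<and> (\<forall>z. theta1 z \<tau> = c * exp (- of_real pi * \<i> * z) * theta_prod \<tau> z)"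
proof -
  define f where "f = (\<lambda>z. exp (of_real pi * \<i> * z) * theta1 z \<tau> / theta_prod \<tau> z)"
  have holo: "(\<lambda>z. exp (of_real pi * \<i> * z) * theta1 z \<tau>) holomorphic_on A" for A
    by (intro holomorphic_intros theta_holo \<tau>)
  have mero: "f meromorphic_on UNIV"
    unfolding f_def
    by (intro meromorphic_intros analytic_on_imp_meromorphic_on)
      (use holo theta_prod_holomorphic in \<open>auto simp: analytic_on_open\<close>)
  have per: "doubly_periodic \<tau> f"
  proof -
    have "f (z + 1) = f z" for z
      by (simp add: f_def theta_add_1 theta_prod_shift exp_add ring_distribs)
    moreover have "f (z + \<tau>) = f z" for z
    proof -
      have "exp (of_real pi * \<i> * (z + \<tau>)) * qfac \<tau> z = exp (of_real pi * \<i> * z) * exp (- 2 * of_real pi * \<i> * z)"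
        by (simp add: qfac_def exp_add [symmetric] algebra_simps)
      then show ?thesis
        unfolding f_def theta_prod_shift theta_add_tau[OF \<tau>]
        by (simp add: field_simps)
    qed
    ultimately show ?thesis by (simp add: doubly_periodic_def)
  qed
  have ana: "f analytic_on {z}" if "z \<notin> period_lattice \<tau>" for z
  proof -
    have "theta_prod \<tau> z \<noteq> 0" using theta_prod_zero that by blast
    then show ?thesis
      unfolding f_def using holo theta_prod_holomorphic
      by (intro analytic_on_divide) (auto simp: analytic_on_open intro: analytic_on_subset[of _ UNIV])
  qed
  have no_pole_0: "\<not> is_pole f 0"
  proof -
    obtain d where d: "d \<noteq> 0" "(theta_prod \<tau> has_field_derivative d) (at 0)"
      using theta_prod_deriv_0 by blast
    let ?g = "\<lambda>z. exp (of_real pi * \<i> * z) * theta1 z \<tau>"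
    have "(?g has_field_derivative deriv ?g 0) (at 0)"
      using holo by (intro holomorphic_derivI[of _ UNIV]) auto
    then have "((\<lambda>z. (?g z / z) / (theta_prod \<tau> z / z)) \<longlongrightarrow> deriv ?g 0 / d) (at 0)"
      using d theta1_eq_0_lattice[OF period_lattice_0] 
      by (intro tendsto_divide) (auto simp: has_field_derivative_iff theta_prod_def qprod_rec[OF norm_nome, of 1])
    moreover have "\<forall>\<^sub>F z in at 0. (?g z / z) / (theta_prod \<tau> z / z) = f z"
      by (auto simp: f_def eventually_at intro!: exI[of _ 1])
    ultimately have "(f \<longlongrightarrow> deriv ?g 0 / d) (at 0)"
      by (simp add: tendsto_cong)
    then show ?thesis
      unfolding is_pole_def using not_tendsto_and_filterlim_at_infinity at_neq_bot by blast
  qed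
  have no_pole: "\<not> is_pole f z" for z
  proof (cases "z \<in> period_lattice \<tau>")
    case True
    then show ?thesis
      using no_pole_0 is_pole_shift_period[of f z 0] doubly_periodic_lattice[OF per] by simp
  next
    case False
    then show ?thesis using ana[OF False] analytic_at_imp_no_pole by blast
  qed
  obtain c where "\<And>z. remove_sings f z = c"
    using elliptic_mero_const[OF \<tau> mero per no_pole] by blast
  then have c: "f z = c" if "z \<notin> period_lattice \<tau>" for z
    using remove_sings_at_analytic[OF ana[OF that]] by metis
  have eq: "theta1 z \<tau> = c * exp (- of_real pi * \<i> * z) * theta_prod \<tau> z" for z
  proof (cases "z \<in> period_lattice \<tau>")
    case True
    have "theta_prod \<tau> z = 0"
      using lattice_induct[OF True, of "\<lambda>z. theta_prod \<tau> z = 0" 0]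
      by (simp add: theta_prod_shift) (simp add: theta_prod_def qprod_rec[OF norm_nome, of 1])
    then show ?thesis using theta1_eq_0_lattice[OF True] by simp
  next
    case False
    then have "theta_prod \<tau> z \<noteq> 0" using theta_prod_zero by blast
    then show ?thesis using c[OF False] by (simp add: f_def exp_minus field_simps)
  qed
  moreover have "c \<noteq> 0" using theta1_nonzero eq by auto
  ultimately show ?thesis by blast
qed

lemma theta1_zero_iff: "theta1 z \<tau> = 0 \<longleftrightarrow> z \<in> period_lattice \<tau>"
  using theta1_product theta_prod_zero theta1_eq_0_lattice by auto

lemma theta2_zero_iff: "theta2 z \<tau> = 0 \<longleftrightarrow> z + 1 / 2 \<in> period_lattice \<tau>"
  by (simp add: theta1_add_half [symmetric] theta1_zero_iff)

lemma theta3_zero_iff: "theta3 z \<tau> = 0 \<longleftrightarrow> z + 1 / 2 + \<tau> / 2 \<in> period_lattice \<tau>"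
  using theta1_add_half[of "z + \<tau> / 2" \<tau>] 
  by (simp add: theta1_zero_iff [symmetric] theta2_add_half_tau[OF \<tau>] add_ac)

lemma theta4_zero_iff: "theta4 z \<tau> = 0 \<longleftrightarrow> z + \<tau> / 2 \<in> period_lattice \<tau>"
  by (simp add: theta1_zero_iff [symmetric] theta1_add_half_tau[OF \<tau>])

lemma half_notin_Ints: "1 / 2 \<notin> (\<int> :: real set)"
proof
  assume "1 / 2 \<in> (\<int> :: real set)"
  then obtain k :: int where "1 / 2 = real_of_int k" by (elim Ints_cases)
  then have "1 = 2 * k" by linarith
  then show False by presburger
qed

lemma half_notin_lattice:
  "1 / 2 \<notin> period_lattice \<tau>" "\<tau> / 2 \<notin> period_lattice \<tau>" "1 / 2 + \<tau> / 2 \<notin> period_lattice \<tau>"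
  using lattice_coords_iff[OF \<tau>, of "1/2" 0] lattice_coords_iff[OF \<tau>, of 0 "1/2"]
    lattice_coords_iff[OF \<tau>, of "1/2" "1/2"] half_notin_Ints by simp_all

lemma theta_constants_nonzero: "theta2 0 \<tau> \<noteq> 0" "theta3 0 \<tau> \<noteq> 0" "theta4 0 \<tau> \<noteq> 0"
  using half_notin_lattice by (simp_all add: theta2_zero_iff theta3_zero_iff theta4_zero_iff)

lemma theta1_deriv: "((\<lambda>z. theta1 z \<tau>) has_field_derivative deriv (\<lambda>z. theta1 z \<tau>) z) (at z)"
  by (rule holomorphic_derivI[of _ UNIV]) (auto intro!: theta_holo \<tau> holomorphic_intros)

lemma theta1_deriv_0: "deriv (\<lambda>z. theta1 z \<tau>) 0 \<noteq> 0"
proof -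
  obtain c where c: "c \<noteq> 0" "\<And>z. theta1 z \<tau> = c * exp (- of_real pi * \<i> * z) * theta_prod \<tau> z"
    using theta1_product by blast
  obtain d where d: "d \<noteq> 0" "(theta_prod \<tau> has_field_derivative d) (at 0)"
    using theta_prod_deriv_0 by blast
  have "theta_prod \<tau> 0 = 0" using c(2)[of 0] c(1) theta1_eq_0_lattice[of 0] by simp
  then have "((\<lambda>z. theta1 z \<tau>) has_field_derivative c * d) (at 0)"
    unfolding c(2) by (auto intro!: derivative_eq_intros d(2))
  then show ?thesis using c d by (simp add: DERIV_imp_deriv)
qed

text \<open>Simplicity of the zero at 0 is carried along the lattice. Differentiating the
  quasi-periodicity under \<tau> produces a term with the derivative of \<open>qfac\<close>, which
  drops out only where \<open>theta1\<close> vanishes; this is why \<open>Q\<close> records both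
  conditions.\<close>

lemma theta1_deriv_lattice:
  assumes "w \<in> period_lattice \<tau>"
  shows "deriv (\<lambda>z. theta1 z \<tau>) w \<noteq> 0"
proof -
  define Q where "Q = (\<lambda>z. theta1 z \<tau> = 0 \<and> deriv (\<lambda>z. theta1 z \<tau>) z = 0)"
  have "deriv (\<lambda>z. theta1 z \<tau>) (z + 1) = - deriv (\<lambda>z. theta1 z \<tau>) z" for z
  proof -
    have "((\<lambda>z. theta1 (z + 1) \<tau>) has_field_derivative deriv (\<lambda>z. theta1 z \<tau>) (z + 1)) (at z)"
      using theta1_deriv[of "z + 1"] by (simp add: DERIV_shift)
    moreover have "((\<lambda>z. theta1 (z + 1) \<tau>) has_field_derivative - deriv (\<lambda>z. theta1 z \<tau>) z) (at z)"
      unfolding theta_add_1 by (intro DERIV_minus theta1_deriv)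
    ultimately show ?thesis by (rule DERIV_unique)
  qed
  then have Q1: "Q (z + 1) \<longleftrightarrow> Q z" for z by (simp add: Q_def theta_add_1)
  have "deriv (\<lambda>z. theta1 z \<tau>) (z + \<tau>) = - qfac \<tau> z * deriv (\<lambda>z. theta1 z \<tau>) z" if "theta1 z \<tau> = 0" for z
  proof -
    have "((\<lambda>z. theta1 (z + \<tau>) \<tau>) has_field_derivative deriv (\<lambda>z. theta1 z \<tau>) (z + \<tau>)) (at z)"
      using theta1_deriv[of "z + \<tau>"] by (simp add: DERIV_shift)
    moreover have "((\<lambda>z. theta1 (z + \<tau>) \<tau>) has_field_derivative - qfac \<tau> z * deriv (\<lambda>z. theta1 z \<tau>) z) (at z)"
      unfolding theta_add_tau[OF \<tau>] qfac_def 
      by (rule derivative_eq_intros theta1_deriv refl | simp add: that)+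
    ultimately show ?thesis by (rule DERIV_unique)
  qed
  then have Q2: "Q (z + \<tau>) \<longleftrightarrow> Q z" for z by (auto simp: Q_def theta_add_tau[OF \<tau>])
  have "\<not> Q w"
    using lattice_induct[OF assms, of Q 0, OF Q1 Q2] theta1_deriv_0 by (simp add: Q_def)
  then show ?thesis using theta1_eq_0_lattice[OF assms] by (simp add: Q_def)
qed

end

subsection \<open>Inner automorphisms\<close>

lemma linear_simps:
  assumes "Vector_Spaces.linear s1 s2 f"
  shows "f (x + y) = f x + f y" "f (s1 c x) = s2 c (f x)" "f 0 = 0" "f (- x) = - f x"
    "f (\<Sum>i\<in>I. g i) = (\<Sum>i\<in>I. f (g i))"
  using assms unfolding linear_iff_module_hom
  by (auto simp: module_hom.add module_hom.scale module_hom.zero module_hom.neg module_hom.sum)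

context fd_lie_algebra
begin

text \<open>Fixing one basis supplies coordinates, and with them norms and limits, for a type
  without topology.\<close>

definition coord_basis :: "'g set" where
  "coord_basis = (SOME B. finite B \<and> independent B \<and> span B = UNIV)"

lemma coord_basis: "finite coord_basis" "independent coord_basis" "span coord_basis = UNIV"
proof -
  obtain A where A: "finite A" "span A = UNIV" using finite_dim by blast
  obtain B where B: "B \<subseteq> A" "independent B" "A \<subseteq> span B"
    using maximal_independent_subset by blast
  then have "span B = UNIV" using A(2) span_minimal[OF B(3) subspace_span] by auto
  then have "\<exists>B. finite B \<and> independent B \<and> span B = UNIV"
    using A(1) B finite_subset by blast
  from someI_ex[OF this] show "finite coord_basis" "independent coord_basis" "span coord_basis = UNIV"
    by (auto simp: coord_basis_def)
qed

definition coord :: "'g \<Rightarrow> 'g \<Rightarrow> complex" where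
  "coord b v = representation coord_basis v b"

lemma functional_coord: "functional (coord b)"
  unfolding functional_def coord_def
  by unfold_locales (auto simp: coord_basis representation_add representation_scale algebra_simps)

lemma sum_coord: "(\<Sum>b\<in>coord_basis. scale (coord b v) b) = v"
  unfolding coord_def using coord_basis by (intro sum_representation_eq) auto

lemma functional_linear:
  assumes "functional \<phi>"
  shows "\<phi> (x + y) = \<phi> x + \<phi> y" "\<phi> (scale c x) = c * \<phi> x" "\<phi> 0 = 0"
    "\<phi> (\<Sum>i\<in>I. f i) = (\<Sum>i\<in>I. \<phi> (f i))"
  using assms unfolding functional_def by (rule linear_simps)+

lemma functional_expand:
  assumes "functional \<phi>"
  shows "\<phi> v = (\<Sum>b\<in>coord_basis. coord b v * \<phi> b)"
proof -
  have "\<phi> v = \<phi> (\<Sum>b\<in>coord_basis. scale (coord b v) b)"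
    by (simp only: sum_coord)
  then show ?thesis
    by (simp only: functional_linear(2,4)[OF assms])
qed

lemma eq_if_coord_eq:
  assumes "\<And>b. coord b v = coord b w"
  shows "v = w"
proof -
  have "(\<Sum>b\<in>coord_basis. scale (coord b v) b) = (\<Sum>b\<in>coord_basis. scale (coord b w) b)"
    by (simp only: assms)
  then show ?thesis by (simp only: sum_coord)
qed

lemma linear_bracket: "Vector_Spaces.linear scale scale (bracket x)"
  by unfold_locales (auto simp: bracket_add_right bracket_scale_right algebra_simps)

lemma bracket_sum_left: "bracket (\<Sum>i\<in>I. f i) y = (\<Sum>i\<in>I. bracket (f i) y)"
proof -
  have "Vector_Spaces.linear scale scale (\<lambda>x. bracket x y)"
    by unfold_locales (auto simp: bracket_add_left bracket_scale_left algebra_simps)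
  then show ?thesis by (rule linear_simps)
qed

lemma bracket_sum_right: "bracket x (\<Sum>i\<in>I. f i) = (\<Sum>i\<in>I. bracket x (f i))"
  using linear_bracket by (rule linear_simps)

lemma functional_bracket:
  assumes "functional \<phi>"
  shows "\<phi> (bracket u v) = (\<Sum>b\<in>coord_basis. \<Sum>c\<in>coord_basis. \<phi> (bracket b c) * (coord b u * coord c v))"
proof -
  have "bracket u v = bracket (\<Sum>b\<in>coord_basis. scale (coord b u) b) (\<Sum>c\<in>coord_basis. scale (coord c v) c)"
    by (simp add: sum_coord)
  also have "\<dots> = (\<Sum>b\<in>coord_basis. \<Sum>c\<in>coord_basis. scale (coord b u * coord c v) (bracket b c))"
    unfolding bracket_sum_left
    by (simp add: bracket_sum_right bracket_scale_left bracket_scale_right mult.commute)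
  finally show ?thesis
    by (simp add: functional_linear[OF assms] mult_ac)
qed

lemma bracket_antisym: "bracket y x = - bracket x y"
proof -
  have "bracket x y + bracket y x = 0"
    using bracket_self[of "x + y"] bracket_self[of x] bracket_self[of y]
    unfolding bracket_add_left bracket_add_right by (simp add: add.commute)
  then show ?thesis by (simp add: eq_neg_iff_add_eq_0 add.commute)
qed

lemma bracket_derivation: "bracket x (bracket u v) = bracket (bracket x u) v + bracket u (bracket x v)"
proof -
  have "bracket u (bracket v x) = - bracket u (bracket x v)"
    using linear_simps(4)[OF linear_bracket] by (simp add: bracket_antisym[of v x])
  moreover have "bracket v (bracket x u) = - bracket (bracket x u) v"
    by (rule bracket_antisym)
  ultimately show ?thesis
    using jacobi[of x u v] by (simp add: algebra_simps)
qed

text \<open>The Leibniz rule, with the factorials distributed so that it becomes a Cauchy product.\<close>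

lemma leibniz_divided:
  assumes \<phi>: "functional \<phi>"
  shows "\<phi> ((bracket x ^^ n) (bracket u v)) / fact n =
    (\<Sum>i\<le>n. \<phi> (bracket ((bracket x ^^ i) u) ((bracket x ^^ (n - i)) v)) / (fact i * fact (n - i)))"
proof -
  have leib: "(bracket x ^^ n) (bracket u v) =
    (\<Sum>i\<le>n. scale (of_nat (n choose i)) (bracket ((bracket x ^^ i) u) ((bracket x ^^ (n - i)) v)))"
  proof (induction n)
    case (Suc n)
    let ?D = "bracket x"
    let ?t = "\<lambda>i j. bracket ((?D ^^ i) u) ((?D ^^ j) v)"
    have D: "?D (?t i (n - i)) = ?t (Suc i) (n - i) + ?t i (Suc n - i)" if "i \<le> n" for i
      using bracket_derivation[of x "(?D ^^ i) u" "(?D ^^ (n - i)) v"] that by (simp add: Suc_diff_le)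
    have "(?D ^^ Suc n) (bracket u v) = (\<Sum>i\<le>n. scale (of_nat (n choose i)) (?D (?t i (n - i))))"
      by (simp add: Suc.IH bracket_sum_right bracket_scale_right)
    also have "\<dots> = (\<Sum>i\<le>n. scale (of_nat (n choose i)) (?t (Suc i) (n - i) + ?t i (Suc n - i)))"
      by (intro sum.cong refl) (simp only: D atMost_iff)
    also have "\<dots> = (\<Sum>i\<le>n. scale (of_nat (n choose i)) (?t (Suc i) (n - i)))
        + (\<Sum>i\<le>n. scale (of_nat (n choose i)) (?t i (Suc n - i)))"
      by (simp add: scale_right_distrib sum.distrib)
    also have "(\<Sum>i\<le>n. scale (of_nat (n choose i)) (?t i (Suc n - i)))
       = (\<Sum>i\<le>Suc n. scale (of_nat (n choose i)) (?t i (Suc n - i)))"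
      by simp
    also have "\<dots> = ?t 0 (Suc n) + (\<Sum>i\<le>n. scale (of_nat (n choose Suc i)) (?t (Suc i) (n - i)))"
      by (subst sum.atMost_Suc_shift) simp
    also have "(\<Sum>i\<le>n. scale (of_nat (n choose i)) (?t (Suc i) (n - i)))
        + (?t 0 (Suc n) + (\<Sum>i\<le>n. scale (of_nat (n choose Suc i)) (?t (Suc i) (n - i))))
      = ?t 0 (Suc n) + (\<Sum>i\<le>n. scale (of_nat (Suc n choose Suc i)) (?t (Suc i) (n - i)))"
      by (simp add: scale_left_distrib sum.distrib add_ac)
    also have "\<dots> = (\<Sum>i\<le>Suc n. scale (of_nat (Suc n choose i)) (?t i (Suc n - i)))"
      by (subst sum.atMost_Suc_shift) simp
    finally show ?case .
  qed simp
  show ?thesis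
    unfolding leib functional_linear[OF \<phi>] sum_divide_distrib
    by (intro sum.cong refl) (simp add: binomial_fact field_simps)
qed

text \<open>In the l1 norm \<open>N\<close> of the coordinates the operator norm of D is at most
  \<open>K\<close>, the sum of the norms of the images of the basis. Powers of D therefore grow
  geometrically, which gives absolute convergence of the exponential series.\<close>

lemma coord_power_bound:
  assumes "Vector_Spaces.linear scale scale D"
  shows "\<exists>K C. \<forall>n. norm (coord b ((D ^^ n) v)) \<le> C * K ^ n"
proof -
  define N where "N = (\<lambda>v. \<Sum>b\<in>coord_basis. norm (coord b v))"
  define K where "K = (\<Sum>c\<in>coord_basis. N (D c))"
  have K: "K \<ge> 0" by (simp add: K_def N_def sum_nonneg)
  have coord_N: "norm (coord b v) \<le> N v" for b v
  proof (cases "b \<in> coord_basis")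
    case True
    then show ?thesis unfolding N_def using coord_basis(1)
      by (intro member_le_sum) auto
  next
    case False
    then have "coord b v = 0"
      unfolding coord_def using representation_ne_zero by blast
    then show ?thesis by (simp add: N_def sum_nonneg)
  qed
  have step: "N (D v) \<le> K * N v" for v
  proof -
    have "coord b (D v) = (\<Sum>c\<in>coord_basis. coord c v * coord b (D c))" for b
    proof -
      have "functional (\<lambda>v. coord b (D v))"
        using functional_coord[of b] assms unfolding functional_def
        by (intro Vector_Spaces.linear_compose[OF assms, unfolded o_def])
      from functional_expand[OF this] show ?thesis .
    qed
    then have "N (D v) \<le> (\<Sum>b\<in>coord_basis. \<Sum>c\<in>coord_basis. norm (coord c v) * norm (coord b (D c)))"
      unfolding N_def by (intro sum_mono) (simp add: norm_mult[symmetric] sum_norm_le)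
    also have "\<dots> = (\<Sum>c\<in>coord_basis. norm (coord c v) * N (D c))"
      unfolding N_def sum_distrib_left by (rule sum.swap)
    also have "\<dots> \<le> (\<Sum>c\<in>coord_basis. N v * N (D c))"
      by (intro sum_mono mult_right_mono coord_N) (simp add: N_def sum_nonneg)
    finally show ?thesis by (simp add: K_def sum_distrib_left mult.commute)
  qed
  have "N ((D ^^ n) v) \<le> N v * K ^ n" for n
  proof (induction n)
    case (Suc n)
    have "N ((D ^^ Suc n) v) \<le> K * N ((D ^^ n) v)" using step by simp
    also have "\<dots> \<le> K * (N v * K ^ n)" using Suc K by (intro mult_left_mono)
    finally show ?case by (simp add: mult_ac)
  qed simp
  then show ?thesis using coord_N order_trans by blast
qed

text \<open>The exponential of a derivation is an automorphism: by the Leibniz rule the exponential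
  series at [u, v] is, coordinate by coordinate, the Cauchy product of the series at u and at
  v.\<close>

lemma is_exp_bracket_hom:
  assumes E: "is_exp (bracket x) E"
  shows "E (bracket u v) = bracket (E u) (E v)"
proof (rule eq_if_coord_eq)
  fix b0
  let ?D = "bracket x"
  let ?\<phi> = "coord b0"
  define \<alpha> where "\<alpha> = (\<lambda>u b n. coord b ((?D ^^ n) u) / fact n)"
  have abs: "summable (\<lambda>n. norm (\<alpha> u b n))" for u b
  proof -
    obtain K C where KC: "\<And>n. norm (coord b ((?D ^^ n) u)) \<le> C * K ^ n"
      using coord_power_bound[OF linear_bracket] by blast
    have "summable (\<lambda>n. C * (K ^ n / fact n))"
      using summable_exp[of K] by (intro summable_mult) (simp add: field_simps)
    then show ?thesis
      by (rule summable_comparison_test') (use KC in \<open>simp add: \<alpha>_def norm_divide divide_right_mono\<close>)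
  qed
  have sums: "(\<alpha> u b) sums coord b (E u)" for u b
    using E functional_coord unfolding is_exp_def \<alpha>_def by blast
  have cauchy: "(\<lambda>n. \<Sum>i\<le>n. \<alpha> u b i * \<alpha> v c (n - i)) sums (coord b (E u) * coord c (E v))" for b c
    using Cauchy_product_sums[OF abs[of u b] abs[of v c]] sums[of u b] sums[of v c]
    by (simp add: sums_iff)
  have 1: "(\<lambda>n. \<Sum>b\<in>coord_basis. \<Sum>c\<in>coord_basis. ?\<phi> (bracket b c) * (\<Sum>i\<le>n. \<alpha> u b i * \<alpha> v c (n - i)))
    sums (\<Sum>b\<in>coord_basis. \<Sum>c\<in>coord_basis. ?\<phi> (bracket b c) * (coord b (E u) * coord c (E v)))"
    by (intro sums_sum sums_mult cauchy)
  have 2: "(\<Sum>b\<in>coord_basis. \<Sum>c\<in>coord_basis. ?\<phi> (bracket b c) * (coord b (E u) * coord c (E v)))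
      = ?\<phi> (bracket (E u) (E v))"
    by (rule functional_bracket[OF functional_coord, symmetric])
  have 3: "(\<lambda>n. \<Sum>b\<in>coord_basis. \<Sum>c\<in>coord_basis. ?\<phi> (bracket b c) * (\<Sum>i\<le>n. \<alpha> u b i * \<alpha> v c (n - i)))
      = (\<lambda>n. ?\<phi> ((?D ^^ n) (bracket u v)) / fact n)"
  proof
    fix n
    have "?\<phi> ((?D ^^ n) (bracket u v)) / fact n
      = (\<Sum>i\<le>n. \<Sum>b\<in>coord_basis. \<Sum>c\<in>coord_basis. ?\<phi> (bracket b c) * (\<alpha> u b i * \<alpha> v c (n - i)))"
      unfolding leibniz_divided[OF functional_coord]
      by (intro sum.cong refl, subst functional_bracket[OF functional_coord])
        (simp add: \<alpha>_def sum_divide_distrib)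
    also have "\<dots> = (\<Sum>b\<in>coord_basis. \<Sum>c\<in>coord_basis. \<Sum>i\<le>n. ?\<phi> (bracket b c) * (\<alpha> u b i * \<alpha> v c (n - i)))"
      by (subst sum.swap, rule sum.cong[OF refl], rule sum.swap)
    finally show "(\<Sum>b\<in>coord_basis. \<Sum>c\<in>coord_basis. ?\<phi> (bracket b c) * (\<Sum>i\<le>n. \<alpha> u b i * \<alpha> v c (n - i)))
      = ?\<phi> ((?D ^^ n) (bracket u v)) / fact n"
      by (simp add: sum_distrib_left)
  qed
  have "(\<lambda>n. ?\<phi> ((?D ^^ n) (bracket u v)) / fact n) sums ?\<phi> (bracket (E u) (E v))"
    using 1 unfolding 2 3 .
  moreover have "(\<lambda>n. ?\<phi> ((?D ^^ n) (bracket u v)) / fact n) sums ?\<phi> (E (bracket u v))"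
    using E functional_coord unfolding is_exp_def by blast
  ultimately show "?\<phi> (E (bracket u v)) = ?\<phi> (bracket (E u) (E v))"
    using sums_unique2 by blast
qed

section \<open>The linear group and the group of inner automorphisms\<close>

lemma GL_simps: "carrier GL = {f. Vector_Spaces.linear scale scale f \<and> bij f}"
  "f \<otimes>\<^bsub>GL\<^esub> g = f \<circ> g" "\<one>\<^bsub>GL\<^esub> = id"
  by (simp_all add: GL_def)

lemma group_GL: "group GL"
proof (rule groupI)
  show "f \<otimes>\<^bsub>GL\<^esub> g \<in> carrier GL" if "f \<in> carrier GL" "g \<in> carrier GL" for f g
    using that by (auto simp: GL_simps bij_comp Vector_Spaces.linear_compose)
  show "\<one>\<^bsub>GL\<^esub> \<in> carrier GL" by (auto simp: GL_simps linear_id)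
  show "\<exists>g\<in>carrier GL. g \<otimes>\<^bsub>GL\<^esub> f = \<one>\<^bsub>GL\<^esub>" if "f \<in> carrier GL" for f
  proof (rule bexI[of _ "inv_into UNIV f"])
    have lin: "Vector_Spaces.linear scale scale f" and bij: "bij f" using that by (auto simp: GL_simps)
    have "Vector_Spaces.linear scale scale (inv_into UNIV f)"
      unfolding Vector_Spaces.linear_iff
      using vector_space_axioms linear_simps(1,2)[OF lin]
      by (auto intro!: inv_f_eq[OF bij_is_inj[OF bij]] simp: surj_f_inv_f[OF bij_is_surj[OF bij]])
    then show "inv_into UNIV f \<in> carrier GL" using bij by (simp add: GL_simps bij_imp_bij_inv)
    show "inv_into UNIV f \<otimes>\<^bsub>GL\<^esub> f = \<one>\<^bsub>GL\<^esub>" using bij by (simp add: GL_simps bij_is_inj)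
  qed
qed (auto simp: GL_simps o_assoc)

lemma Inn_simps: "f \<otimes>\<^bsub>Inn\<^esub> g = f \<circ> g" "\<one>\<^bsub>Inn\<^esub> = id"
  by (simp_all add: Inn_def GL_simps)

lemma group_Inn: "group Inn"
  unfolding Inn_def by (rule group.group_subgroup_generated[OF group_GL])

text \<open>The bracket-preserving elements of \<open>GL\<close> form a subgroup that contains the
  generators exp (ad x), hence everything they generate.\<close>

lemma carrier_Inn:
  assumes "f \<in> carrier Inn"
  shows "Vector_Spaces.linear scale scale f" "bij f" "f (bracket x y) = bracket (f x) (f y)"
proof -
  interpret GL: group GL by (rule group_GL)
  define A where "A = {f \<in> carrier GL. \<forall>x y. f (bracket x y) = bracket (f x) (f y)}"
  have "subgroup A GL"
  proof (rule GL.subgroupI)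
    show "A \<noteq> {}" using GL.one_closed by (auto simp: A_def GL_simps)
    show "inv\<^bsub>GL\<^esub> f \<in> A" if "f \<in> A" for f
    proof -
      have f: "f \<in> carrier GL" using that by (simp add: A_def)
      let ?g = "inv\<^bsub>GL\<^esub> f"
      have fg: "f (?g x) = x" for x
        using GL.r_inv[OF f] by (simp add: GL_simps fun_eq_iff)
      have inj: "inj f" using f by (simp add: GL_simps bij_is_inj)
      have "?g (bracket x y) = bracket (?g x) (?g y)" for x y
      proof (rule injD[OF inj])
        show "f (?g (bracket x y)) = f (bracket (?g x) (?g y))"
          using that by (simp add: A_def fg)
      qed
      then show ?thesis using f by (simp add: A_def)
    qed
    show "f \<otimes>\<^bsub>GL\<^esub> g \<in> A" if "f \<in> A" "g \<in> A" for f g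
      using that GL.m_closed[of f g] by (auto simp: A_def GL_simps(2))
  qed (auto simp: A_def)
  then have "carrier Inn \<subseteq> A"
    unfolding Inn_def carrier_subgroup_generated
    by (intro GL.generate_subgroup_incl) (auto simp: A_def is_exp_bracket_hom)
  then have "f \<in> A" using assms by blast
  then show "Vector_Spaces.linear scale scale f" "bij f" "f (bracket x y) = bracket (f x) (f y)"
    by (auto simp: A_def GL_simps)
qed

end

subsection \<open>Two-by-two matrices and \<open>PGL(2,\<complex>)\<close>\<close>

abbreviation entry :: "complex^2^2 \<Rightarrow> 2 \<Rightarrow> 2 \<Rightarrow> complex" where
  "entry A i j \<equiv> vec_nth (vec_nth A i) j"

lemma matrix2_eq_iff: "A = B \<longleftrightarrow> entry A 1 1 = entry B 1 1 \<and> entry A 1 2 = entry B 1 2 \<and>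
    entry A 2 1 = entry B 2 1 \<and> entry A 2 2 = entry B 2 2"
  by (simp only: vec_eq_iff forall_2 conj_assoc)

lemma mat2_nth [simp]:
  "entry (mat2 a b c d) 1 1 = a" "entry (mat2 a b c d) 1 2 = b"
  "entry (mat2 a b c d) 2 1 = c" "entry (mat2 a b c d) 2 2 = d"
  by (simp_all add: mat2_def)

lemma mat2_cases: obtains a b c d where "A = mat2 a b c d"
  using that[of "entry A 1 1" "entry A 1 2" "entry A 2 1" "entry A 2 2"] by (simp add: matrix2_eq_iff)

lemma mat2_eq_iff [simp]: "mat2 a b c d = mat2 a' b' c' d' \<longleftrightarrow> a = a' \<and> b = b' \<and> c = c' \<and> d = d'"
  by (simp add: matrix2_eq_iff)

lemma mat2_mult: "mat2 a b c d ** mat2 a' b' c' d' =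
    mat2 (a * a' + b * c') (a * b' + b * d') (c * a' + d * c') (c * b' + d * d')"
  by (simp add: matrix2_eq_iff matrix_matrix_mult_def sum_2)

lemma mat_eq_mat2: "mat c = mat2 c 0 0 c"
  by (simp add: matrix2_eq_iff mat_def)

lemma det_mat2: "det (mat2 a b c d) = a * d - b * c"
  by (simp add: det_2)

lemma invertible_mat2: "invertible (mat2 a b c d) \<longleftrightarrow> a * d - b * c \<noteq> 0"
  by (simp add: invertible_det_nz det_mat2)

lemma GL2_simps: "carrier GL2 = {A. invertible A}" "A \<otimes>\<^bsub>GL2\<^esub> B = A ** B" "\<one>\<^bsub>GL2\<^esub> = mat 1"
  by (simp_all add: GL2_def)

lemma invertible_mat_1: "invertible (mat 1 :: complex^2^2)"
  by (simp add: mat_eq_mat2 invertible_mat2)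

lemma group_GL2: "group GL2"
proof (rule groupI)
  show "\<exists>B\<in>carrier GL2. B \<otimes>\<^bsub>GL2\<^esub> A = \<one>\<^bsub>GL2\<^esub>" if "A \<in> carrier GL2" for A
    using that by (auto simp: GL2_simps invertible_def)
qed (auto simp: GL2_simps invertible_mult matrix_mul_assoc invertible_mat_1)

definition scalars :: "(complex^2^2) set" where
  "scalars = {mat c |c. c \<noteq> 0}"

lemma mat_mult_commute: "A ** mat c = mat c ** (A :: complex^2^2)"
  by (cases A rule: mat2_cases) (simp add: mat_eq_mat2 mat2_mult mult.commute)

lemma normal_scalars: "scalars \<lhd> GL2"
proof -
  interpret group GL2 by (rule group_GL2)
  have "subgroup scalars GL2"
  proof (rule subgroupI)
    show "inv\<^bsub>GL2\<^esub> A \<in> scalars" if A: "A \<in> scalars" for A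
    proof -
      obtain c where c: "A = mat c" "c \<noteq> 0" using A by (auto simp: scalars_def)
      have "inv\<^bsub>GL2\<^esub> A = mat (1 / c)"
        using c by (intro inv_equality) (auto simp: GL2_simps mat_eq_mat2 mat2_mult invertible_mat2)
      then show ?thesis using c(2) by (auto simp: scalars_def)
    qed
    show "A \<otimes>\<^bsub>GL2\<^esub> B \<in> scalars" if AB: "A \<in> scalars" "B \<in> scalars" for A B
    proof -
      obtain c d where "A = mat c" "c \<noteq> 0" "B = mat d" "d \<noteq> 0" using AB by (auto simp: scalars_def)
      then have "A \<otimes>\<^bsub>GL2\<^esub> B = mat (c * d)" "c * d \<noteq> 0" by (auto simp: GL2_simps mat_eq_mat2 mat2_mult)
      then show ?thesis by (auto simp: scalars_def)
    qed
  qed (auto simp: scalars_def GL2_simps mat_eq_mat2 invertible_mat2 intro: exI[of _ 1])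
  then show ?thesis
    by (rule normalI) (auto simp: r_coset_def l_coset_def scalars_def GL2_simps mat_mult_commute)
qed

lemma PGL2_eq: "PGL2 = GL2 Mod scalars"
  by (simp add: PGL2_def scalars_def)

lemma PGL2_class_eq: "PGL2_class A = scalars #>\<^bsub>GL2\<^esub> A"
  by (simp add: PGL2_class_def scalars_def)

lemma group_PGL2: "group PGL2"
  unfolding PGL2_eq by (rule normal.factorgroup_is_group[OF normal_scalars])

lemma PGL2_class_mult:
  assumes "invertible A" "invertible B"
  shows "PGL2_class (A ** B) = PGL2_class A \<otimes>\<^bsub>PGL2\<^esub> PGL2_class B"
  using hom_mult[OF normal.r_coset_hom_Mod[OF normal_scalars], of A B] assms
  by (simp add: GL2_simps PGL2_class_eq PGL2_eq)

lemma PGL2_class_in_carrier: "invertible A \<Longrightarrow> PGL2_class A \<in> carrier PGL2"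
  using hom_in_carrier[OF normal.r_coset_hom_Mod[OF normal_scalars], of A]
  by (simp add: GL2_simps PGL2_class_eq PGL2_eq)

lemma PGL2_carrierE:
  assumes "X \<in> carrier PGL2"
  obtains A where "invertible A" "X = PGL2_class A"
  using assms by (auto simp: PGL2_eq PGL2_class_eq FactGroup_def RCOSETS_def GL2_simps)

lemma PGL2_class_scale:
  assumes "c \<noteq> 0"
  shows "PGL2_class (mat c ** A) = PGL2_class A"
proof -
  have "\<exists>e. e \<noteq> 0 \<and> mat d ** (mat c ** A) = mat e ** A" if "d \<noteq> 0" for d
    using that assms by (intro exI[of _ "d * c"]) (simp add: matrix_mul_assoc mat_eq_mat2 mat2_mult)
  moreover have "\<exists>e. e \<noteq> 0 \<and> mat d ** A = mat e ** (mat c ** A)" if "d \<noteq> 0" for d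
    using that assms by (intro exI[of _ "d / c"]) (simp add: matrix_mul_assoc mat_eq_mat2 mat2_mult)
  ultimately show ?thesis
    unfolding PGL2_class_def r_coset_def by (fastforce simp: GL2_simps)
qed

lemma PGL2_class_eqD:
  assumes "PGL2_class A = PGL2_class B"
  shows "\<exists>c. c \<noteq> 0 \<and> A = mat c ** B"
proof -
  have "mat (1 :: complex) \<in> {mat c |c. c \<noteq> 0}" by (intro CollectI exI[of _ 1]) simp
  then have "A \<in> PGL2_class A"
    unfolding PGL2_class_def r_coset_def by (rule UN_I) (simp add: GL2_simps)
  then have "A \<in> PGL2_class B" by (simp only: assms)
  then show ?thesis
    unfolding PGL2_class_def r_coset_def by (auto simp: GL2_simps)
qed

lemma PGL2_one: "\<one>\<^bsub>PGL2\<^esub> = PGL2_class (mat 1)"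
proof -
  interpret group GL2 by (rule group_GL2)
  have "scalars \<subseteq> carrier GL2"
    using normal_imp_subgroup[OF normal_scalars] subgroup.subset by blast
  then show ?thesis
    using coset_mult_one[of scalars] by (simp add: PGL2_eq PGL2_class_eq GL2_simps)
qed

locale pgl2_representation = fd_lie_algebra scale bracket
  for scale :: "complex \<Rightarrow> 'g::ab_group_add \<Rightarrow> 'g" and bracket +
  fixes \<rho>b :: "(complex^2^2) set \<Rightarrow> 'g \<Rightarrow> 'g"
  assumes PGL2_rep: "PGL2_rep \<rho>b"
begin

definition R :: "complex^2^2 \<Rightarrow> 'g \<Rightarrow> 'g" where
  "R A = \<rho>b (PGL2_class A)"

lemma rho_hom: "\<rho>b \<in> hom PGL2 Inn"
  using PGL2_rep by (simp add: PGL2_rep_def)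

lemma R_carrier: "invertible A \<Longrightarrow> R A \<in> carrier Inn"
  unfolding R_def using rho_hom PGL2_class_in_carrier by (auto simp: hom_def)

lemma R_mult: "invertible A \<Longrightarrow> invertible B \<Longrightarrow> R (A ** B) = R A \<circ> R B"
  unfolding R_def PGL2_class_mult
  using hom_mult[OF rho_hom] PGL2_class_in_carrier by (simp add: Inn_simps)

lemma R_scale: "c \<noteq> 0 \<Longrightarrow> R (mat c ** A) = R A"
  by (simp add: R_def PGL2_class_scale)

lemma R_one: "R (mat 1) = id"
  unfolding R_def PGL2_one [symmetric]
  using hom_one[OF rho_hom group_PGL2 group_Inn] by (simp add: Inn_simps)

lemma R_scalar: "c \<noteq> 0 \<Longrightarrow> R (mat c) = id"
  using R_scale[of c "mat 1"] by (simp add: R_one)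

text \<open>The adjugate differs from the inverse by a scalar, which \<open>R\<close> ignores. Its
  entries are those of the matrix up to sign and order, so they stay holomorphic without dividing by
  the determinant.\<close>

lemma R_inverse:
  assumes "a * d - b * c \<noteq> 0"
  shows "R (mat2 a b c d) \<circ> R (mat2 d (- b) (- c) a) = id" "R (mat2 d (- b) (- c) a) \<circ> R (mat2 a b c d) = id"
proof -
  have "mat2 a b c d ** mat2 d (- b) (- c) a = mat (a * d - b * c)"
    "mat2 d (- b) (- c) a ** mat2 a b c d = mat (a * d - b * c)"
    by (auto simp: mat2_mult mat_eq_mat2 algebra_simps)
  then show "R (mat2 a b c d) \<circ> R (mat2 d (- b) (- c) a) = id" "R (mat2 d (- b) (- c) a) \<circ> R (mat2 a b c d) = id"
    using assms R_mult[of "mat2 a b c d" "mat2 d (- b) (- c) a"] R_mult[of "mat2 d (- b) (- c) a" "mat2 a b c d"]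
      R_scalar[of "a * d - b * c"] by (simp_all add: invertible_mat2 algebra_simps)
qed

end

subsection \<open>Matrix coefficients of the representation\<close>

lemma bounded_linear_mat2: "bounded_linear (\<lambda>p. mat2 (fst p) (fst (snd p)) (fst (snd (snd p))) (snd (snd (snd p))))"
proof -
  have "linear (\<lambda>p. mat2 (fst p) (fst (snd p)) (fst (snd (snd p))) (snd (snd (snd p))))"
    by (intro Real_Vector_Spaces.linearI) (simp_all add: matrix2_eq_iff)
  then show ?thesis by (rule linear_conv_bounded_linear[THEN iffD1])
qed

lemma continuous_on_mat2 [continuous_intros]:
  assumes "continuous_on S a" "continuous_on S b" "continuous_on S c" "continuous_on S d"
  shows "continuous_on S (\<lambda>x. mat2 (a x) (b x) (c x) (d x))"
proof -
  have "continuous_on S (\<lambda>x. (\<lambda>p. mat2 (fst p) (fst (snd p)) (fst (snd (snd p))) (snd (snd (snd p))))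
      (a x, b x, c x, d x))"
    by (rule bounded_linear.continuous_on[OF bounded_linear_mat2]) (intro continuous_intros assms)
  then show ?thesis by simp
qed

lemma has_derivative_mat2:
  assumes "(a has_derivative a') (at x within S)" "(b has_derivative b') (at x within S)" "(c has_derivative c') (at x within S)" "(d has_derivative d') (at x within S)"
  shows "((\<lambda>x. mat2 (a x) (b x) (c x) (d x)) has_derivative (\<lambda>x. mat2 (a' x) (b' x) (c' x) (d' x))) (at x within S)"
proof -
  have "((\<lambda>x. (\<lambda>p. mat2 (fst p) (fst (snd p)) (fst (snd (snd p))) (snd (snd (snd p)))) (a x, b x, c x, d x))
    has_derivative (\<lambda>x. (\<lambda>p. mat2 (fst p) (fst (snd p)) (fst (snd (snd p))) (snd (snd (snd p)))) (a' x, b' x, c' x, d' x))) (at x within S)"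
    by (rule bounded_linear.has_derivative[OF bounded_linear_mat2]) (intro has_derivative_Pair assms)
  then show ?thesis by simp
qed

context fd_lie_algebra
begin

text \<open>The entrywise l1 norm of the matrix of T in the fixed basis, chosen because it is
  submultiplicative and a finite sum of norms of matrix coefficients.\<close>

definition op_norm :: "('g \<Rightarrow> 'g) \<Rightarrow> real" where
  "op_norm T = (\<Sum>b\<in>coord_basis. \<Sum>c\<in>coord_basis. norm (coord c (T b)))"

lemma op_norm_nonneg: "op_norm T \<ge> 0"
  by (simp add: op_norm_def sum_nonneg)

lemma functional_comp:
  assumes "functional \<phi>" "Vector_Spaces.linear scale scale T"
  shows "functional (\<lambda>v. \<phi> (T v))"
  using assms Vector_Spaces.linear_compose unfolding functional_def o_def by blast

lemma norm_functional_le_op_norm: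
  assumes \<phi>: "functional \<phi>" and T: "Vector_Spaces.linear scale scale T"
  shows "norm (\<phi> (T v)) \<le> (\<Sum>b\<in>coord_basis. norm (coord b v)) * (\<Sum>c\<in>coord_basis. norm (\<phi> c)) * op_norm T"
proof -
  define V where "V = (\<Sum>b\<in>coord_basis. norm (coord b v))"
  define P where "P = (\<Sum>c\<in>coord_basis. norm (\<phi> c))"
  have "\<phi> (T v) = (\<Sum>b\<in>coord_basis. coord b v * \<phi> (T b))"
    by (rule functional_expand[OF functional_comp[OF \<phi> T]])
  also have "\<dots> = (\<Sum>b\<in>coord_basis. \<Sum>c\<in>coord_basis. coord b v * (coord c (T b) * \<phi> c))"
    by (simp add: functional_expand[OF \<phi>, of "T _"] sum_distrib_left)
  finally have "norm (\<phi> (T v)) \<le> (\<Sum>b\<in>coord_basis. \<Sum>c\<in>coord_basis. norm (coord b v * (coord c (T b) * \<phi> c)))"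
    by (simp add: sum_norm_le)
  also have "\<dots> \<le> (\<Sum>b\<in>coord_basis. \<Sum>c\<in>coord_basis. V * (norm (coord c (T b)) * P))"
    unfolding norm_mult
  proof (intro sum_mono)
    fix b c assume "b \<in> coord_basis" "c \<in> coord_basis"
    then have "norm (coord b v) \<le> V" "norm (\<phi> c) \<le> P"
      unfolding V_def P_def using coord_basis(1) by (auto intro: member_le_sum[of b _ "\<lambda>b. norm (coord b v)"]
          member_le_sum[of c _ "\<lambda>c. norm (\<phi> c)"])
    then show "norm (coord b v) * (norm (coord c (T b)) * norm (\<phi> c)) \<le> V * (norm (coord c (T b)) * P)"
      by (intro mult_mono) (auto simp: sum_nonneg V_def)
  qed
  also have "\<dots> = V * P * op_norm T"
    by (simp add: op_norm_def sum_distrib_left mult_ac)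
  finally show ?thesis by (simp only: V_def P_def)
qed

lemma op_norm_comp:
  assumes T: "Vector_Spaces.linear scale scale T" and S: "Vector_Spaces.linear scale scale S"
  shows "op_norm (T \<circ> S) \<le> op_norm T * op_norm S"
proof -
  have "op_norm (T \<circ> S) \<le> (\<Sum>b\<in>coord_basis. \<Sum>c\<in>coord_basis. \<Sum>e\<in>coord_basis. norm (coord e (S b)) * norm (coord c (T e)))"
    unfolding op_norm_def
  proof (intro sum_mono)
    fix b c
    have "coord c ((T \<circ> S) b) = (\<Sum>e\<in>coord_basis. coord e (S b) * coord c (T e))"
      using functional_expand[OF functional_comp[OF functional_coord T], of c "S b"] by simp
    then show "norm (coord c ((T \<circ> S) b)) \<le> (\<Sum>e\<in>coord_basis. norm (coord e (S b)) * norm (coord c (T e)))"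
      by (simp add: sum_norm_le norm_mult)
  qed
  also have "\<dots> = (\<Sum>b\<in>coord_basis. \<Sum>e\<in>coord_basis. norm (coord e (S b)) * (\<Sum>c\<in>coord_basis. norm (coord c (T e))))"
    unfolding sum_distrib_left by (intro sum.cong refl sum.swap)
  also have "\<dots> \<le> (\<Sum>b\<in>coord_basis. \<Sum>e\<in>coord_basis. norm (coord e (S b)) * op_norm T)"
  proof (intro sum_mono mult_left_mono)
    fix e assume "e \<in> coord_basis"
    then show "(\<Sum>c\<in>coord_basis. norm (coord c (T e))) \<le> op_norm T"
      unfolding op_norm_def using coord_basis(1)
      by (intro member_le_sum[of e coord_basis "\<lambda>e. \<Sum>c\<in>coord_basis. norm (coord c (T e))"])
        (auto simp: sum_nonneg)
  qed simp
  also have "\<dots> = op_norm T * op_norm S"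
    by (simp add: op_norm_def[of S] sum_distrib_left sum_distrib_right mult_ac)
  finally show ?thesis .
qed

end

context pgl2_representation
begin

lemma R_linear: "invertible A \<Longrightarrow> Vector_Spaces.linear scale scale (R A)"
  using R_carrier carrier_Inn(1) by blast

lemma op_norm_R_mult:
  assumes "invertible A" "invertible B"
  shows "op_norm (R (A ** B)) \<le> op_norm (R A) * op_norm (R B)"
  unfolding R_mult[OF assms] by (intro op_norm_comp R_linear assms)

lemma R_has_derivative:
  assumes "functional \<phi>" "invertible A"
  obtains D where "((\<lambda>X. \<phi> (R X v)) has_derivative D) (at A)" "\<And>c X. D (mat c ** X) = c * D X"
  using PGL2_rep assms unfolding PGL2_rep_def R_def by blast

lemma continuous_on_R:
  assumes "functional \<phi>"
  shows "continuous_on {A. invertible A} (\<lambda>X. \<phi> (R X v))"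
proof (intro continuous_at_imp_continuous_on ballI)
  fix A :: "complex^2^2" assume "A \<in> {A. invertible A}"
  then have "invertible A" by simp
  then obtain D where "((\<lambda>X. \<phi> (R X v)) has_derivative D) (at A)"
    by (rule R_has_derivative[OF assms])
  then show "continuous (at A) (\<lambda>X. \<phi> (R X v))"
    by (rule has_derivative_continuous)
qed

lemma op_norm_R_bounded:
  assumes "compact K" "\<And>A. A \<in> K \<Longrightarrow> invertible A"
  shows "\<exists>C\<ge>1. \<forall>A\<in>K. op_norm (R A) \<le> C"
proof -
  have "continuous_on K (\<lambda>A. op_norm (R A))"
    unfolding op_norm_def using assms(2)
    by (intro continuous_intros continuous_on_subset[OF continuous_on_R[OF functional_coord]]) auto
  then have "bounded ((\<lambda>A. op_norm (R A)) ` K)"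
    using assms(1) compact_continuous_image compact_imp_bounded by blast
  then obtain C where "\<And>A. A \<in> K \<Longrightarrow> norm (op_norm (R A)) \<le> C"
    unfolding bounded_iff by auto
  then show ?thesis
    by (intro exI[of _ "max 1 C"]) fastforce
qed

text \<open>Compactness bounds \<open>R\<close> on the annulus 1/2 <= |t| <= 2. A smaller t is
  reached by repeated factors diag(1, 1/2), whose number is logarithmic in 1 / |t|, so
  submultiplicativity yields a power of 1 / |t|.\<close>

lemma op_norm_R_torus:
  "\<exists>C\<ge>1. \<exists>k. \<forall>t. t \<noteq> 0 \<longrightarrow> norm t \<le> 2 \<longrightarrow> op_norm (R (mat2 1 0 0 t)) \<le> C * inverse (norm t) ^ k"
proof -
  define K where "K = (\<lambda>t. mat2 1 0 0 t) ` (cball 0 2 - ball (0::complex) (1 / 2))"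
  have "compact K"
    unfolding K_def by (intro compact_continuous_image continuous_intros compact_diff compact_cball open_ball)
  then obtain C where C: "C \<ge> 1" "\<And>A. A \<in> K \<Longrightarrow> op_norm (R A) \<le> C"
    using op_norm_R_bounded[of K] by (fastforce simp: K_def invertible_mat2)
  \<comment> \<open>Rounding the bound up to a power of two makes the exponent integral: j halvings
    cost 2^(k j), which is |t|^(-k) up to a constant factor.\<close>
  obtain k where k: "C < 2 ^ k"
    using real_arch_pow[of 2 C] by auto
  have C': "op_norm (R (mat2 1 0 0 t)) \<le> C" if "1 / 2 \<le> norm t" "norm t \<le> 2" for t
    using that by (intro C(2)) (auto simp: K_def)
  have main: "op_norm (R (mat2 1 0 0 t)) \<le> 2 ^ (k * Suc j)" if "(1 / 2) ^ j \<le> norm t" "norm t \<le> 2" for j t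
    using that
  proof (induction j arbitrary: t)
    case 0
    then show ?case using C'[of t] k by simp
  next
    case (Suc j)
    show ?case
    proof (cases "norm t \<le> 1")
      case True
      have "0 < norm t" 
        using Suc.prems(1) by (rule less_le_trans[rotated]) simp
      then have t0: "t \<noteq> 0" by simp
      have "op_norm (R (mat2 1 0 0 (2 * t))) \<le> 2 ^ (k * Suc j)"
        using Suc.prems True by (intro Suc.IH) (auto simp: norm_mult field_simps)
      moreover have "op_norm (R (mat2 1 0 0 (1 / 2))) \<le> 2 ^ k"
        using C'[of "1 / 2"] k by (simp add: norm_divide)
      ultimately have "op_norm (R (mat2 1 0 0 (1 / 2))) * op_norm (R (mat2 1 0 0 (2 * t))) \<le> 2 ^ k * 2 ^ (k * Suc j)"
        by (intro mult_mono op_norm_nonneg) auto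
      moreover have "mat2 1 0 0 t = mat2 1 0 0 (1 / 2) ** mat2 1 0 0 (2 * t)"
        by (simp add: mat2_mult)
      ultimately show ?thesis
        using op_norm_R_mult[of "mat2 1 0 0 (1 / 2)" "mat2 1 0 0 (2 * t)"] t0
        by (simp add: invertible_mat2 power_add)
    next
      case False
      then have "op_norm (R (mat2 1 0 0 t)) \<le> 2 ^ k"
        using C'[of t] k Suc.prems by simp
      also have "\<dots> \<le> 2 ^ (k * Suc (Suc j))" by (intro power_increasing) auto
      finally show ?thesis .
    qed
  qed
  have "op_norm (R (mat2 1 0 0 t)) \<le> (8 ^ k) * inverse (norm t) ^ k" if t: "t \<noteq> 0" "norm t \<le> 2" for t
  proof -
    \<comment> \<open>The least j with 2^(-j) <= |t| / 2 satisfies 2^j <= 4 / |t|. One more factor 2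
      in 2^(j + 1) gives the constant 8.\<close>
    obtain j where j: "(1 / 2) ^ j \<le> norm t / 2" "norm t / 2 \<le> 2 * (1/2) ^ j"
    proof -
      define j where "j = (LEAST j. (1 / 2) ^ j \<le> norm t / 2)"
      have "\<exists>j. (1 / 2 :: real) ^ j < norm t / 2"
        using t by (intro real_arch_pow_inv) auto
      then have 1: "(1 / 2) ^ j \<le> norm t / 2"
        unfolding j_def by (metis (mono_tags, lifting) LeastI less_imp_le)
      have "norm t / 2 \<le> 2 * (1/2) ^ j"
      proof (cases j)
        case 0
        then show ?thesis using t(2) by simp
      next
        case (Suc i)
        then have "\<not> (1 / 2) ^ i \<le> norm t / 2"
          using not_less_Least[of i "\<lambda>j. (1 / 2) ^ j \<le> norm t / 2"] by (simp add: j_def)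
        then show ?thesis by (simp add: Suc)
      qed
      with 1 show ?thesis by (rule that)
    qed
    have "op_norm (R (mat2 1 0 0 t)) \<le> 2 ^ (k * Suc j)"
    proof (rule main)
      have "norm t / 2 \<le> norm t" by simp
      then show "(1 / 2) ^ j \<le> norm t" using j(1) by (rule order_trans[rotated])
    qed (rule t)
    also have "\<dots> = (2 * 2 ^ j) ^ k"
      by (simp add: power_mult [symmetric] power_mult_distrib power_add mult.commute)
    also have "\<dots> \<le> (8 * inverse (norm t)) ^ k"
    proof (intro power_mono)
      have "(1/2::real) ^ j * 2 ^ j = 1" by (simp add: power_mult_distrib [symmetric])
      then have "norm t * 2 ^ j \<le> 4" 
        using mult_right_mono[OF j(2), of "2 ^ j"] by (simp add: mult.assoc)
      then show "2 * 2 ^ j \<le> 8 * inverse (norm t)" using t by (simp add: field_simps)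
    qed auto
    finally show ?thesis by (simp add: power_mult_distrib)
  qed
  then show ?thesis by (intro exI[of _ "8 ^ k"]) auto
qed

text \<open>Pivoting on the largest entry, \<open>A\<close> factors as a scalar times unipotent matrices from a compact
  set times \<open>diag(1, t)\<close> with \<open>1 / t\<close> of size at most \<open>m\<^sup>2 / |det A|\<close>.\<close>

lemma op_norm_R_growth:
  "\<exists>C\<ge>0. \<exists>k. \<forall>a b c d m. a * d - b * c \<noteq> 0 \<longrightarrow> norm a \<le> m \<longrightarrow> norm b \<le> m \<longrightarrow> norm c \<le> m \<longrightarrow> norm d \<le> m \<longrightarrow>
     op_norm (R (mat2 a b c d)) \<le> C * (m\<^sup>2 / norm (a * d - b * c)) ^ k"
proof -
  define L where "L = (\<lambda>x. mat2 1 0 x 1)"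
  define U where "U = (\<lambda>x. mat2 1 x 0 1)"
  define w where "w = mat2 0 1 1 0"
  define K where "K = L ` cball 0 1 \<union> U ` cball 0 1 \<union> {w}"
  have "compact K" unfolding K_def
    unfolding L_def U_def by (intro compact_Un compact_continuous_image continuous_intros compact_cball finite_imp_compact) simp
  moreover have "invertible A" if "A \<in> K" for A
    using that by (auto simp: K_def L_def U_def w_def invertible_mat2)
  ultimately have "\<exists>C\<ge>1. \<forall>A\<in>K. op_norm (R A) \<le> C"
    by (rule op_norm_R_bounded)
  then obtain C1 where C1: "C1 \<ge> 1" "\<And>A. A \<in> K \<Longrightarrow> op_norm (R A) \<le> C1"
    by blast
  obtain C2 k where C2: "C2 \<ge> 1" "\<And>t. t \<noteq> 0 \<Longrightarrow> norm t \<le> 2 \<Longrightarrow> op_norm (R (mat2 1 0 0 t)) \<le> C2 * inverse (norm t) ^ k"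
    using op_norm_R_torus by blast
  have w: "op_norm (R w) \<le> C1" "invertible w" "w ** w = mat 1"
    using C1(2)[of w] by (auto simp: K_def w_def invertible_mat2 mat2_mult mat_eq_mat2)
  have inv: "invertible (L x)" "invertible (U x)" "t \<noteq> 0 \<Longrightarrow> invertible (mat2 1 0 0 t)" for x t
    by (auto simp: L_def U_def invertible_mat2)
  have pivot: "op_norm (R (mat2 a b c d)) \<le> C1 * C2 * C1 * (m\<^sup>2 / norm (a * d - b * c)) ^ k"
    if det: "a * d - b * c \<noteq> 0" and m: "norm a \<le> m" and le: "norm b \<le> norm a" "norm c \<le> norm a" "norm d \<le> norm a"
    for a b c d m
  proof -
    have a: "a \<noteq> 0" using det le by auto
    \<comment> \<open>Gaussian elimination with the pivot a leaves det / a on the diagonal; taking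
      out the scalar a gives det / a^2. It has size at most 2, because a is the largest
      entry.\<close>
    define t where "t = (a * d - b * c) / a\<^sup>2"
    have t0: "t \<noteq> 0" using det a by (simp add: t_def)
    have "norm (a * d - b * c) \<le> norm a * norm d + norm b * norm c"
      by (metis norm_mult norm_triangle_ineq4)
    also have "\<dots> \<le> norm a * norm a + norm a * norm a"
      using le by (intro add_mono mult_mono) auto
    finally have t2: "norm t \<le> 2" 
      using a by (simp add: t_def norm_divide norm_mult power2_eq_square field_simps)
    have tm: "inverse (norm t) \<le> m\<^sup>2 / norm (a * d - b * c)"
      using m det by (simp add: t_def norm_divide norm_power divide_right_mono power_mono)
    have eq: "mat2 a b c d = mat a ** (L (c / a) ** mat2 1 0 0 t ** U (b / a))"
      using a by (simp add: L_def U_def mat_eq_mat2 mat2_mult t_def field_simps power2_eq_square)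
    have LU: "op_norm (R (L (c / a))) \<le> C1" "op_norm (R (U (b / a))) \<le> C1"
      using le a by (auto intro!: C1(2) imageI simp: K_def norm_divide)
    have "op_norm (R (mat2 a b c d)) = op_norm (R (L (c / a) ** mat2 1 0 0 t ** U (b / a)))"
      unfolding eq using R_scale[OF a] by simp
    also have "\<dots> \<le> op_norm (R (L (c / a) ** mat2 1 0 0 t)) * op_norm (R (U (b / a)))"
      by (intro op_norm_R_mult inv invertible_mult t0)
    also have "\<dots> \<le> (op_norm (R (L (c / a))) * op_norm (R (mat2 1 0 0 t))) * op_norm (R (U (b / a)))"
      by (intro op_norm_R_mult inv mult_right_mono op_norm_nonneg t0)
    also have "\<dots> \<le> (C1 * (C2 * inverse (norm t) ^ k)) * C1"
      using C1(1) C2(1) by (intro mult_mono LU C2(2) t0 t2 op_norm_nonneg mult_nonneg_nonneg) auto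
    also have "\<dots> = C1 * C2 * C1 * inverse (norm t) ^ k" by (simp add: mult_ac)
    also have "\<dots> \<le> C1 * C2 * C1 * (m\<^sup>2 / norm (a * d - b * c)) ^ k"
      using C1(1) C2(1) by (intro mult_left_mono power_mono tm) auto
    finally show ?thesis .
  qed
  have "op_norm (R (mat2 a b c d)) \<le> C1 * C1 * (C1 * C2 * C1) * (m\<^sup>2 / norm (a * d - b * c)) ^ k"
    if det: "a * d - b * c \<noteq> 0" and m: "norm a \<le> m" "norm b \<le> m" "norm c \<le> m" "norm d \<le> m" for a b c d m
  proof -
    define B where "B = C1 * C2 * C1 * (m\<^sup>2 / norm (a * d - b * c)) ^ k"
    have B: "B \<ge> 0" using C1(1) C2(1) by (simp add: B_def)
    \<comment> \<open>Multiplication by \<open>w\<close> exchanges rows or columns, at the cost of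
      one factor \<open>C1\<close>. Two such exchanges bring any entry to the pivot
      position.\<close>
    have swap: "op_norm (R (w ** A)) \<le> C1 * x" "op_norm (R (A ** w)) \<le> C1 * x"
      if "invertible A" "op_norm (R A) \<le> x" for A x
    proof -
      have "op_norm (R w) * op_norm (R A) \<le> C1 * x"
        using that(2) w(1) C1(1) op_norm_nonneg by (intro mult_mono) auto
      then show "op_norm (R (w ** A)) \<le> C1 * x" "op_norm (R (A ** w)) \<le> C1 * x"
        using op_norm_R_mult[OF w(2) that(1)] op_norm_R_mult[OF that(1) w(2)]
        by (simp_all add: mult.commute)
    qed
    have up: "x \<le> C1 * x" if "x \<ge> 0" for x
      using that C1(1) mult_right_mono[of 1 C1 x] by simp
    have BB: "B \<le> C1 * B" "C1 * B \<le> C1 * (C1 * B)"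
      using up[OF B] up[of "C1 * B"] B C1(1) by simp_all
    consider "norm b \<le> norm a" "norm c \<le> norm a" "norm d \<le> norm a"
      | "norm a \<le> norm b" "norm c \<le> norm b" "norm d \<le> norm b"
      | "norm a \<le> norm c" "norm b \<le> norm c" "norm d \<le> norm c"
      | "norm a \<le> norm d" "norm b \<le> norm d" "norm c \<le> norm d" by linarith
    then have "op_norm (R (mat2 a b c d)) \<le> C1 * (C1 * B)"
    proof cases
      case 1
      then have "op_norm (R (mat2 a b c d)) \<le> B" unfolding B_def using det m by (intro pivot)
      then show ?thesis using BB by linarith
    next
      case 2
      have eq: "mat2 a b c d = mat2 b a d c ** w" by (simp add: w_def mat2_mult)
      have "op_norm (R (mat2 b a d c)) \<le> B"
        using pivot[of b c a d m] 2 det m by (simp add: B_def norm_minus_commute mult.commute)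
      then have "op_norm (R (mat2 b a d c ** w)) \<le> C1 * B"
        using det by (intro swap) (auto simp: invertible_mat2 mult.commute)
      then show ?thesis using BB unfolding eq by linarith
    next
      case 3
      have eq: "mat2 a b c d = w ** mat2 c d a b" by (simp add: w_def mat2_mult)
      have "op_norm (R (mat2 c d a b)) \<le> B"
        using pivot[of c b d a m] 3 det m by (simp add: B_def norm_minus_commute mult.commute)
      then have "op_norm (R (w ** mat2 c d a b)) \<le> C1 * B"
        using det by (intro swap) (auto simp: invertible_mat2 mult.commute)
      then show ?thesis using BB unfolding eq by linarith
    next
      case 4
      have eq: "mat2 a b c d = w ** (mat2 d c b a ** w)" by (simp add: w_def mat2_mult)
      have inv: "invertible (mat2 d c b a)" using det by (simp add: invertible_mat2 mult.commute)
      have "op_norm (R (mat2 d c b a)) \<le> B"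
        using pivot[of d a c b m] 4 det m by (simp add: B_def mult.commute)
      then have "op_norm (R (w ** (mat2 d c b a ** w))) \<le> C1 * (C1 * B)"
        by (intro swap invertible_mult inv w(2))
      then show ?thesis unfolding eq .
    qed
    then show ?thesis by (simp add: B_def mult_ac)
  qed
  then show ?thesis
    using C1(1) C2(1) by (intro exI[of _ "C1 * C1 * (C1 * C2 * C1)"] conjI exI[of _ k]) auto
qed

text \<open>Chain rule: the real derivative \<open>D\<close> of a matrix coefficient is compatible
  with multiplication by scalar matrices, so the derivative of the composite along h is h times its
  value at 1, that is, complex linear.\<close>

lemma R_coefficient_analytic:
  assumes \<phi>: "functional \<phi>"
    and ana: "a analytic_on {z}" "b analytic_on {z}" "c analytic_on {z}" "d analytic_on {z}"
    and det: "a z * d z - b z * c z \<noteq> 0"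
  shows "(\<lambda>z. \<phi> (R (mat2 (a z) (b z) (c z) (d z)) v)) analytic_on {z}"
proof -
  obtain e where e: "e > 0" "a holomorphic_on ball z e" "b holomorphic_on ball z e"
    "c holomorphic_on ball z e" "d holomorphic_on ball z e"
  proof -
    obtain ea eb ec ed where "ea > 0" "a holomorphic_on ball z ea" "eb > 0" "b holomorphic_on ball z eb"
      "ec > 0" "c holomorphic_on ball z ec" "ed > 0" "d holomorphic_on ball z ed"
      using ana by (auto simp: analytic_on_def)
    then show ?thesis
      by (intro that[of "min (min ea eb) (min ec ed)"]) (auto elim!: holomorphic_on_subset)
  qed
  let ?U = "{w \<in> ball z e. a w * d w - b w * c w \<noteq> 0}"
  have "continuous_on (ball z e) (\<lambda>w. a w * d w - b w * c w)"
    using e by (intro continuous_intros holomorphic_on_imp_continuous_on)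
  from continuous_open_preimage[OF this open_ball, of "- {0}"]
  have "open (ball z e \<inter> (\<lambda>w. a w * d w - b w * c w) -` (- {0}))"
    by (simp add: open_Compl)
  also have "ball z e \<inter> (\<lambda>w. a w * d w - b w * c w) -` (- {0}) = ?U" by auto
  finally have U: "open ?U" .
  have diff: "(\<lambda>z. \<phi> (R (mat2 (a z) (b z) (c z) (d z)) v)) field_differentiable at w" if w: "w \<in> ?U" for w
  proof -
    have der: "(f has_derivative (\<lambda>h. deriv f w * h)) (at w)" if "f holomorphic_on ball z e" for f
      using holomorphic_derivI[OF that open_ball] w by (auto simp: has_field_derivative_def)
    have "invertible (mat2 (a w) (b w) (c w) (d w))" using w by (simp add: invertible_mat2)
    then obtain D where D: "((\<lambda>X. \<phi> (R X v)) has_derivative D) (at (mat2 (a w) (b w) (c w) (d w)))"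
      and D_mat: "\<And>c X. D (mat c ** X) = c * D X"
      by (rule R_has_derivative[OF \<phi>, where v = v]) blast
    have "((\<lambda>z. mat2 (a z) (b z) (c z) (d z)) has_derivative
       (\<lambda>h. mat2 (deriv a w * h) (deriv b w * h) (deriv c w * h) (deriv d w * h))) (at w)"
      by (intro has_derivative_mat2 der e)
    from has_derivative_compose[OF this D]
    have "((\<lambda>z. \<phi> (R (mat2 (a z) (b z) (c z) (d z)) v)) has_derivative
       (\<lambda>h. D (mat2 (deriv a w * h) (deriv b w * h) (deriv c w * h) (deriv d w * h)))) (at w)" .
    moreover have "D (mat2 (deriv a w * h) (deriv b w * h) (deriv c w * h) (deriv d w * h))
       = D (mat2 (deriv a w) (deriv b w) (deriv c w) (deriv d w)) * h" for h
      using D_mat [of h "mat2 (deriv a w) (deriv b w) (deriv c w) (deriv d w)"]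
      by (simp add: mat_eq_mat2 mat2_mult mult.commute)
    ultimately show ?thesis
      unfolding field_differentiable_def has_field_derivative_def
      by (intro exI[of _ "D (mat2 (deriv a w) (deriv b w) (deriv c w) (deriv d w))"]) simp
  qed
  have "(\<lambda>z. \<phi> (R (mat2 (a z) (b z) (c z) (d z)) v)) holomorphic_on ?U"
    by (rule holomorphic_onI, rule field_differentiable_at_within, rule diff)
  moreover have "z \<in> ?U" using e(1) det by simp
  ultimately show ?thesis
    using U analytic_at by blast
qed

end

section \<open>Meromorphy and polynomial growth\<close>

lemma meromorphic_bound:
  assumes "f meromorphic_on {z}"
  shows "\<exists>n M. \<forall>\<^sub>F w in at z. norm (f w) * norm (w - z) ^ n \<le> M"
proof -
  have sing: "isolated_singularity_at f z" "not_essential f z"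
    using assms by (auto simp: meromorphic_at_iff)
  show ?thesis
  proof (cases "is_pole f z")
    case False
    then obtain c where "(f \<longlongrightarrow> c) (at z)"
      using sing(2) by (auto simp: not_essential_def)
    then have "\<forall>\<^sub>F w in at z. norm (f w) < norm c + 1"
      using tendsto_norm order_tendstoD(2) by (metis less_add_one)
    then have "\<forall>\<^sub>F w in at z. norm (f w) * norm (w - z) ^ 0 \<le> norm c + 1"
      by (rule eventually_mono) simp
    then show ?thesis by blast
  next
    case True
    obtain r where r: "r > 0" "f holomorphic_on ball z r - {z}"
      using sing(1) by (auto simp: isolated_singularity_at_def analytic_imp_holomorphic)
    define n where "n = nat (- zorder f z)"
    obtain s where s: "s > 0" "zor_poly f z holomorphic_on cball z s"
      "\<And>w. w \<in> cball z s - {z} \<Longrightarrow> f w = zor_poly f z w / (w - z) ^ n"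
      using zorder_exist_pole[OF r(2) open_ball _ True] r(1) by (auto simp: n_def)
    obtain M where M: "\<forall>w\<in>cball z s. norm (zor_poly f z w) \<le> M"
      using compact_imp_bounded[OF compact_continuous_image[OF holomorphic_on_imp_continuous_on[OF s(2)] compact_cball]]
      by (auto simp: bounded_iff)
    have "norm (f w) * norm (w - z) ^ n \<le> M" if "w \<noteq> z" "dist w z < s" for w
      using s(3)[of w] bspec[OF M, of w] that by (simp add: norm_divide norm_power dist_commute)
    then have "\<forall>\<^sub>F w in at z. norm (f w) * norm (w - z) ^ n \<le> M"
      using s(1) by (auto simp: eventually_at)
    then show ?thesis by blast
  qed
qed

text \<open>One power of w - z more than the bound requires forces the limit 0; the product is then
  meromorphic, and dividing by the power gives back f.\<close>

lemma meromorphic_if_bound: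
  assumes sing: "isolated_singularity_at f z"
    and le: "\<forall>\<^sub>F w in at z. norm (f w) * norm (w - z) ^ n \<le> M"
  shows "f meromorphic_on {z}"
proof -
  define g where "g = (\<lambda>w. f w * (w - z) ^ Suc n)"
  have "((\<lambda>w. M * norm (w - z)) \<longlongrightarrow> M * norm (z - z)) (at z)" by (intro tendsto_intros)
  then have lim: "((\<lambda>w. M * norm (w - z)) \<longlongrightarrow> 0) (at z)" by simp
  have "\<forall>\<^sub>F w in at z. norm (g w) \<le> M * norm (w - z)"
    using le by (rule eventually_mono) (auto simp: g_def norm_mult norm_power mult_right_mono mult.assoc [symmetric]
        power_Suc2 simp del: power_Suc)
  then have "(g \<longlongrightarrow> 0) (at z)" by (rule Lim_null_comparison[OF _ lim])
  then have "not_essential g z" by (rule tendsto_imp_not_essential)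
  moreover have "isolated_singularity_at g z"
    unfolding g_def by (intro isolated_singularity_at_times sing isolated_singularity_at_analytic analytic_intros)
  ultimately have "g meromorphic_on {z}" by (simp add: meromorphic_at_iff)
  then have "(\<lambda>w. g w / (w - z) ^ Suc n) meromorphic_on {z}" by (intro meromorphic_intros)
  moreover have "\<forall>\<^sub>F w in at z. g w / (w - z) ^ Suc n = f w"
    unfolding g_def by (auto simp: eventually_at intro!: exI[of _ 1])
  ultimately show ?thesis
    using meromorphic_on_cong[of "{z}" "\<lambda>w. g w / (w - z) ^ Suc n" f "{z}"] by simp
qed

text \<open>The entries and the inverse determinant are each bounded by a power of 1 / |w - z|.
  Inserted into the growth estimate for \<open>R\<close>, these bounds control the coefficient by
  such a power too, so its isolated singularity is not essential.\<close>

lemma (in pgl2_representation) R_coefficient_meromorphic: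
  assumes \<phi>: "functional \<phi>"
    and mero: "a meromorphic_on {z}" "b meromorphic_on {z}" "c meromorphic_on {z}" "d meromorphic_on {z}"
    and ev: "\<forall>\<^sub>F w in at z. a analytic_on {w} \<and> b analytic_on {w} \<and> c analytic_on {w} \<and> d analytic_on {w} \<and>
      a w * d w - b w * c w \<noteq> 0"
  shows "(\<lambda>z. \<phi> (R (mat2 (a z) (b z) (c z) (d z)) v)) meromorphic_on {z}" (is "?F meromorphic_on _")
proof -
  have "\<forall>\<^sub>F w in at z. ?F analytic_on {w}"
    using ev by (rule eventually_mono) (auto intro!: R_coefficient_analytic[OF \<phi>])
  then obtain r where "r > 0" "\<And>w. w \<noteq> z \<Longrightarrow> dist w z < r \<Longrightarrow> ?F analytic_on {w}"
    by (auto simp: eventually_at)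
  then have sing: "isolated_singularity_at ?F z"
    unfolding isolated_singularity_at_def
    by (intro exI[of _ r]) (auto simp: analytic_on_analytic_at[of _ "ball z r - {z}"] dist_commute)
  define e where "e = (\<lambda>w. 1 / (a w * d w - b w * c w))"
  have e: "e meromorphic_on {z}"
    unfolding e_def using mero by (intro meromorphic_intros)
  \<comment> \<open>A single quantity dominating all four entries, to be used as \<open>m\<close> in
    the growth estimate.\<close>
  define q where "q = (\<lambda>w. norm (a w) + norm (b w) + norm (c w) + norm (d w))"
  obtain na Ma nb Mb nc Mc nd Md ne Me where bd:
    "\<forall>\<^sub>F w in at z. norm (a w) * norm (w - z) ^ na \<le> Ma"
    "\<forall>\<^sub>F w in at z. norm (b w) * norm (w - z) ^ nb \<le> Mb"
    "\<forall>\<^sub>F w in at z. norm (c w) * norm (w - z) ^ nc \<le> Mc"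
    "\<forall>\<^sub>F w in at z. norm (d w) * norm (w - z) ^ nd \<le> Md"
    "\<forall>\<^sub>F w in at z. norm (e w) * norm (w - z) ^ ne \<le> Me"
    using mero[THEN meromorphic_bound] meromorphic_bound[OF e] by blast
  define N where "N = na + nb + nc + nd"
  define M where "M = Ma + Mb + Mc + Md"
  have near: "\<forall>\<^sub>F w in at z. norm (w - z) \<le> 1"
    by (auto simp: eventually_at dist_norm intro!: exI[of _ 1])
  have q: "\<forall>\<^sub>F w in at z. q w * norm (w - z) ^ N \<le> M"
    using bd near
  proof eventually_elim
    case (elim w)
    let ?x = "norm (w - z)"
    have "y * ?x ^ N \<le> y * ?x ^ n" if "n \<le> N" "y \<ge> 0" for n y
      using that elim(6) by (intro mult_left_mono power_decreasing) auto
    from this[of na "norm (a w)"] this[of nb "norm (b w)"] this[of nc "norm (c w)"] this[of nd "norm (d w)"]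
    show ?case using elim by (simp add: q_def M_def N_def algebra_simps)
  qed
  obtain C k where C: "C \<ge> 0" "\<And>a b c d m. a * d - b * c \<noteq> 0 \<Longrightarrow> norm a \<le> m \<Longrightarrow> norm b \<le> m \<Longrightarrow> norm c \<le> m \<Longrightarrow> norm d \<le> m \<Longrightarrow>
     op_norm (R (mat2 a b c d)) \<le> C * (m\<^sup>2 / norm (a * d - b * c)) ^ k"
    using op_norm_R_growth by blast
  define V where "V = (\<Sum>b\<in>coord_basis. norm (coord b v)) * (\<Sum>c\<in>coord_basis. norm (\<phi> c))"
  have V: "V \<ge> 0" by (simp add: V_def sum_nonneg)
  have "\<forall>\<^sub>F w in at z. norm (?F w) * norm (w - z) ^ ((2 * N + ne) * k) \<le> V * C * (M\<^sup>2 * Me) ^ k"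
    using q bd(5) ev
  proof eventually_elim
    case (elim w)
    let ?x = "norm (w - z)"
    have det: "a w * d w - b w * c w \<noteq> 0" using elim by simp
    have "norm (?F w) \<le> V * op_norm (R (mat2 (a w) (b w) (c w) (d w)))"
      unfolding V_def using det
      by (intro norm_functional_le_op_norm[OF \<phi>] R_linear) (simp add: invertible_mat2)
    also have "\<dots> \<le> V * (C * ((q w)\<^sup>2 / norm (a w * d w - b w * c w)) ^ k)"
      using det V by (intro mult_left_mono C(2)) (auto simp: q_def)
    also have "\<dots> = V * C * ((q w)\<^sup>2 * norm (e w)) ^ k"
      by (simp add: e_def norm_divide)
    finally have "norm (?F w) * ?x ^ ((2 * N + ne) * k) \<le> V * C * ((q w)\<^sup>2 * norm (e w)) ^ k * ?x ^ ((2 * N + ne) * k)"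
      by (intro mult_right_mono) auto
    also have "?x ^ ((2 * N + ne) * k) = ((?x ^ N)\<^sup>2 * ?x ^ ne) ^ k"
      by (simp only: power_mult [of _ "2 * N + ne"] power_add power_even_eq)
    also have "V * C * ((q w)\<^sup>2 * norm (e w)) ^ k * ((?x ^ N)\<^sup>2 * ?x ^ ne) ^ k
        = V * C * ((q w * ?x ^ N)\<^sup>2 * (norm (e w) * ?x ^ ne)) ^ k"
      by (simp only: power_mult_distrib mult_ac)
    also have "\<dots> \<le> V * C * (M\<^sup>2 * Me) ^ k"
      using elim V C(1)
      by (intro mult_left_mono power_mono mult_mono mult_nonneg_nonneg) (auto simp: q_def)
    finally show ?case by (simp only: power_mult [of _ "2 * N + ne"] power_add power_even_eq)
  qed
  from meromorphic_if_bound[OF sing this] show ?thesis .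
qed

subsection \<open>The torus and its translations\<close>

lemma half_lattice_iff: "w \<in> half_lattice \<tau> \<longleftrightarrow> 2 * w \<in> period_lattice \<tau>"
  unfolding half_lattice_def by (auto intro: image_eqI[of _ _ "2 * w"])

lemma lattice_subset_half: "w \<in> period_lattice \<tau> \<Longrightarrow> w \<in> half_lattice \<tau>"
  using period_lattice_add[of w \<tau> w] by (simp only: half_lattice_iff mult_2)

lemma half_lattice_0 [simp]: "0 \<in> half_lattice \<tau>"
  by (simp add: half_lattice_iff)

lemma half_lattice_uminus [simp]: "- w \<in> half_lattice \<tau> \<longleftrightarrow> w \<in> half_lattice \<tau>"
  by (simp add: half_lattice_iff)

lemma half_lattice_add: "x \<in> half_lattice \<tau> \<Longrightarrow> y \<in> half_lattice \<tau> \<Longrightarrow> x + y \<in> half_lattice \<tau>"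
  by (simp add: half_lattice_iff period_lattice_add ring_distribs)

lemma half_lattice_diff: "x \<in> half_lattice \<tau> \<Longrightarrow> y \<in> half_lattice \<tau> \<Longrightarrow> x - y \<in> half_lattice \<tau>"
  using half_lattice_add[of x \<tau> "- y"] by simp

lemma half_lattice_add_cancel:
  assumes "w \<in> half_lattice \<tau>"
  shows "z + w \<in> half_lattice \<tau> \<longleftrightarrow> z \<in> half_lattice \<tau>"
  using assms half_lattice_add[of z \<tau> w] half_lattice_diff[of "z + w" \<tau> w] by auto

lemma tproj_eq_iff: "tproj \<tau> z = tproj \<tau> w \<longleftrightarrow> z - w \<in> period_lattice \<tau>"
proof
  assume eq: "tproj \<tau> z = tproj \<tau> w"
  have "z \<in> tproj \<tau> z" by (simp add: tproj_def)
  then have "z \<in> tproj \<tau> w" by (simp only: eq)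
  then show "z - w \<in> period_lattice \<tau>" by (simp add: tproj_def)
next
  assume *: "z - w \<in> period_lattice \<tau>"
  have "x - z \<in> period_lattice \<tau> \<longleftrightarrow> x - w \<in> period_lattice \<tau>" for x
    using period_lattice_add_cancel[OF *, of "x - z"] by simp
  then show "tproj \<tau> z = tproj \<tau> w" by (simp add: tproj_def)
qed

lemma tproj_in_torus [simp]: "tproj \<tau> z \<in> torus \<tau>"
  by (simp add: torus_def)

lemma torusE:
  assumes "p \<in> torus \<tau>"
  obtains z where "p = tproj \<tau> z"
  using assms by (auto simp: torus_def)

lemma rep_tproj: "rep (tproj \<tau> z) - z \<in> period_lattice \<tau>"
proof -
  have "z \<in> tproj \<tau> z" by (simp add: tproj_def)
  then have "rep (tproj \<tau> z) \<in> tproj \<tau> z" unfolding rep_def by (rule someI)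
  then show ?thesis by (simp add: tproj_def)
qed

lemma tproj_rep: "p \<in> torus \<tau> \<Longrightarrow> tproj \<tau> (rep p) = p"
  by (elim torusE) (simp add: tproj_eq_iff rep_tproj)

lemma translation_tproj: "translation \<tau> c (tproj \<tau> z) = tproj \<tau> (z + c)"
proof -
  have "w \<in> (+) c ` tproj \<tau> z \<longleftrightarrow> w \<in> tproj \<tau> (z + c)" for w
    by (auto simp: tproj_def algebra_simps intro!: image_eqI[of _ _ "w - c"])
  then show ?thesis by (auto simp: translation_def)
qed

lemma translation_cong:
  assumes "c - d \<in> period_lattice \<tau>"
  shows "translation \<tau> c = translation \<tau> d"
proof
  fix p
  show "translation \<tau> c p = translation \<tau> d p"
  proof (cases "p \<in> torus \<tau>")
    case True
    then obtain z where "p = tproj \<tau> z" by (rule torusE)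
    then show ?thesis using assms by (simp add: translation_tproj tproj_eq_iff)
  qed (simp add: translation_def)
qed

section \<open>The Klein four-group\<close>

lemma group_D2: "group D2"
  unfolding D2_def by (intro DirProd_group group_integer_mod_group)

lemma carrier_D2: "carrier D2 = {(0, 0), (0, 1), (1, 0), (1, 1)}"
proof -
  have "{0..<2::int} = {0, 1}" by auto
  then show ?thesis by (auto simp: D2_def carrier_integer_mod_group)
qed

lemma one_D2: "\<one>\<^bsub>D2\<^esub> = (0, 0)"
  by (simp add: D2_def)

lemma D2_square: "\<gamma> \<in> carrier D2 \<Longrightarrow> \<gamma> \<otimes>\<^bsub>D2\<^esub> \<gamma> = \<one>\<^bsub>D2\<^esub>"
  by (auto simp: D2_def carrier_integer_mod_group mult_DirProd')

lemma D2_inv: "\<gamma> \<in> carrier D2 \<Longrightarrow> inv\<^bsub>D2\<^esub> \<gamma> = \<gamma>"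
  using group.inv_equality[OF group_D2 D2_square] by blast

text \<open>The translated half lattice is the zero set of the entire function theta1 (2 (w - c)),
  which is not identically zero; discreteness follows from isolated zeros.\<close>

lemma eventually_notin_half_lattice:
  assumes \<tau>: "Im \<tau> > 0"
  shows "\<forall>\<^sub>F w in at z. w - c \<notin> half_lattice \<tau>"
proof -
  obtain x where x: "theta1 x \<tau> \<noteq> 0" using theta1_nonzero[OF \<tau>] by blast
  have "\<forall>\<^sub>F w in at z. theta1 (2 * (w - c)) \<tau> \<noteq> 0 \<and> w \<in> UNIV"
    by (rule non_zero_neighbour_alt[of _ _ _ "x / 2 + c"])
      (use x in \<open>auto intro!: theta_holo \<tau> holomorphic_intros\<close>)
  then show ?thesis
    by (rule eventually_mono) (simp add: theta1_zero_iff[OF \<tau>] half_lattice_iff)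
qed

locale torus_setting =
  fixes \<tau> :: complex and \<sigma> :: "int \<times> int \<Rightarrow> complex set \<Rightarrow> complex set"
    and n :: nat and P :: "nat \<Rightarrow> complex set" and U :: "complex set set"
  assumes \<tau>: "Im \<tau> > 0"
    and \<sigma>: "\<sigma> \<in> hom D2 (torus_aut \<tau>)"
    and \<sigma>_inj: "inj_on \<sigma> (carrier D2)"
    and \<sigma>_translations: "\<forall>t\<in>carrier D2. \<exists>c. \<sigma> t = translation \<tau> c"
    and n: "n \<ge> 1"
    and P: "\<forall>i<n. P i \<in> torus \<tau>"
    and P0: "P 0 = tproj \<tau> 0"
    and U_def: "U = torus \<tau> - orbit_of \<sigma> (P ` {..<n})"
begin

definition shift :: "int \<times> int \<Rightarrow> complex" where
  "shift \<gamma> = (SOME c. \<sigma> \<gamma> = translation \<tau> c)"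

lemma sigma_shift: "\<gamma> \<in> carrier D2 \<Longrightarrow> \<sigma> \<gamma> = translation \<tau> (shift \<gamma>)"
  using \<sigma>_translations someI_ex[of "\<lambda>c. \<sigma> \<gamma> = translation \<tau> c"] unfolding shift_def by blast

lemma sigma_tproj: "\<gamma> \<in> carrier D2 \<Longrightarrow> \<sigma> \<gamma> (tproj \<tau> z) = tproj \<tau> (z + shift \<gamma>)"
  by (simp add: sigma_shift translation_tproj)

lemma sigma_mult:
  assumes "\<gamma> \<in> carrier D2" "\<gamma>' \<in> carrier D2" "p \<in> torus \<tau>"
  shows "\<sigma> (\<gamma> \<otimes>\<^bsub>D2\<^esub> \<gamma>') p = \<sigma> \<gamma> (\<sigma> \<gamma>' p)"
proof -
  have "\<sigma> \<gamma> \<in> Bij (torus \<tau>)" "\<sigma> \<gamma>' \<in> Bij (torus \<tau>)"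
    using \<sigma> assms by (auto simp: hom_def torus_aut_def)
  then show ?thesis
    using hom_mult[OF \<sigma> assms(1,2)] assms(3) by (simp add: torus_aut_def BijGroup_def compose_def)
qed

lemma shift_one: "shift \<one>\<^bsub>D2\<^esub> \<in> period_lattice \<tau>"
proof -
  have 1: "\<one>\<^bsub>D2\<^esub> \<in> carrier D2" using group_D2 by (simp add: group.is_monoid)
  have "tproj \<tau> (shift \<one>\<^bsub>D2\<^esub>) = tproj \<tau> (shift \<one>\<^bsub>D2\<^esub> + shift \<one>\<^bsub>D2\<^esub>)"
    using sigma_mult[OF 1 1, of "tproj \<tau> 0"] sigma_tproj[OF 1] monoid.l_one[OF group.is_monoid[OF group_D2] 1]
    by simp
  then show ?thesis by (simp add: tproj_eq_iff)
qed

lemma shift_half: "\<gamma> \<in> carrier D2 \<Longrightarrow> shift \<gamma> \<in> half_lattice \<tau>"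
proof -
  assume \<gamma>: "\<gamma> \<in> carrier D2"
  have 1: "\<one>\<^bsub>D2\<^esub> \<in> carrier D2" using group_D2 by (simp add: group.is_monoid)
  have "tproj \<tau> (shift \<one>\<^bsub>D2\<^esub>) = tproj \<tau> (shift \<gamma> + shift \<gamma>)"
    using sigma_mult[OF \<gamma> \<gamma>, of "tproj \<tau> 0"] sigma_tproj[OF \<gamma>] sigma_tproj[OF 1] D2_square[OF \<gamma>] by simp
  then have "shift \<one>\<^bsub>D2\<^esub> - (shift \<gamma> + shift \<gamma>) \<in> period_lattice \<tau>" by (simp add: tproj_eq_iff)
  from period_lattice_diff[OF shift_one this] show ?thesis by (simp add: half_lattice_iff)
qed

text \<open>The image of \<sigma> consists of all translations by half periods: modulo the period
  lattice there are at most four half periods, and the four shifts are pairwise incongruent by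
  injectivity of \<sigma>. This replaces a normalisation of \<sigma> by relabelling the
  group.\<close>

lemma shift_surj:
  assumes "w \<in> half_lattice \<tau>"
  obtains \<gamma> where "\<gamma> \<in> carrier D2" "w - shift \<gamma> \<in> period_lattice \<tau>"
proof -
  define K where "K = (\<lambda>x. tproj \<tau> x) ` {0, 1/2, \<tau>/2, 1/2 + \<tau>/2}"
  have K: "tproj \<tau> w \<in> K" if w: "w \<in> half_lattice \<tau>" for w
  proof -
    obtain a b :: int where ab: "2 * w = of_int a + of_int b * \<tau>"
      using w unfolding half_lattice_iff period_lattice_def by blast
    define x where "x = (of_int (a mod 2) + of_int (b mod 2) * \<tau>) / 2"
    have a: "complex_of_int a = 2 * of_int (a div 2) + of_int (a mod 2)"
      by (metis mult_div_mod_eq of_int_add of_int_mult of_int_numeral)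
    have b: "complex_of_int b = 2 * of_int (b div 2) + of_int (b mod 2)"
      by (metis mult_div_mod_eq of_int_add of_int_mult of_int_numeral)
    have "w = 2 * w / 2" by simp
    also have "\<dots> = (of_int a + of_int b * \<tau>) / 2" by (simp only: ab)
    also have "\<dots> = x + (of_int (a div 2) + of_int (b div 2) * \<tau>)"
      by (subst a, subst b) (simp add: x_def field_simps)
    finally have "tproj \<tau> w = tproj \<tau> x"
      by (simp add: tproj_eq_iff period_latticeI)
    moreover have "a mod 2 = 0 \<or> a mod 2 = 1" "b mod 2 = 0 \<or> b mod 2 = 1" by auto
    then have "x \<in> {0, 1/2, \<tau>/2, 1/2 + \<tau>/2}"
      by (auto simp: x_def add_divide_distrib)
    ultimately show ?thesis unfolding K_def by (rule image_eqI)
  qed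
  have inj: "inj_on (\<lambda>\<gamma>. tproj \<tau> (shift \<gamma>)) (carrier D2)"
  proof (rule inj_onI)
    fix x y assume xy: "x \<in> carrier D2" "y \<in> carrier D2" "tproj \<tau> (shift x) = tproj \<tau> (shift y)"
    then have "\<sigma> x = \<sigma> y" by (simp add: sigma_shift translation_cong tproj_eq_iff)
    then show "x = y" using \<sigma>_inj xy by (simp add: inj_on_def)
  qed
  have "finite K" by (simp add: K_def)
  \<comment> \<open>An upper bound for the size of \<open>K\<close> suffices, since \<open>K\<close>
    contains the four distinct shifts.\<close>
  have "card K \<le> length [tproj \<tau> 0, tproj \<tau> (1/2), tproj \<tau> (\<tau>/2), tproj \<tau> (1/2 + \<tau>/2)]"
    using card_length[of "[tproj \<tau> 0, tproj \<tau> (1/2), tproj \<tau> (\<tau>/2), tproj \<tau> (1/2 + \<tau>/2)]"]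
    by (simp add: K_def)
  also have "\<dots> = 4" by simp
  also have "4 = card ((\<lambda>\<gamma>. tproj \<tau> (shift \<gamma>)) ` carrier D2)"
    by (subst card_image[OF inj]) (simp add: carrier_D2)
  finally have "(\<lambda>\<gamma>. tproj \<tau> (shift \<gamma>)) ` carrier D2 = K"
    using \<open>finite K\<close> K[OF shift_half] by (intro card_seteq) auto
  then obtain \<gamma> where "\<gamma> \<in> carrier D2" "tproj \<tau> w = tproj \<tau> (shift \<gamma>)"
    using K[OF assms] by auto
  then show ?thesis using that by (simp add: tproj_eq_iff)
qed

definition pt :: "nat \<Rightarrow> complex" where
  "pt i = rep (P i)"

lemma tproj_pt: "i < n \<Longrightarrow> tproj \<tau> (pt i) = P i"
  using P by (simp add: pt_def tproj_rep)

text \<open>The preimage in the plane of the removed orbit: orbits of the group lift to translates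
  of the half lattice.\<close>

definition poles :: "complex set" where
  "poles = {z. \<exists>i<n. z - pt i \<in> half_lattice \<tau>}"

lemma pt_0: "pt 0 \<in> period_lattice \<tau>"
  using rep_tproj[of \<tau> 0] by (simp add: pt_def P0)

lemma half_lattice_poles: "z \<in> half_lattice \<tau> \<Longrightarrow> z \<in> poles"
  unfolding poles_def using n half_lattice_diff[OF _ lattice_subset_half[OF pt_0]]
  by (auto intro!: exI[of _ 0])

lemma tproj_U_iff: "tproj \<tau> z \<in> U \<longleftrightarrow> z \<notin> poles"
proof -
  have "tproj \<tau> z \<in> orbit_of \<sigma> (P ` {..<n}) \<longleftrightarrow> (\<exists>i<n. \<exists>\<gamma>\<in>carrier D2. z - (pt i + shift \<gamma>) \<in> period_lattice \<tau>)"
  proof -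
    have "\<sigma> \<gamma> (P i) = tproj \<tau> (pt i + shift \<gamma>)" if "i < n" "\<gamma> \<in> carrier D2" for i \<gamma>
      using that tproj_pt[of i] sigma_tproj[of \<gamma> "pt i"] by simp
    then have "tproj \<tau> z = \<sigma> \<gamma> (P i) \<longleftrightarrow> z - (pt i + shift \<gamma>) \<in> period_lattice \<tau>"
      if "i < n" "\<gamma> \<in> carrier D2" for i \<gamma>
      using that by (simp add: tproj_eq_iff)
    then show ?thesis
      unfolding orbit_of_def UN_iff image_iff lessThan_iff Bex_def by blast
  qed
  also have "\<dots> \<longleftrightarrow> (\<exists>i<n. z - pt i \<in> half_lattice \<tau>)"
  proof (intro iff_exI conj_cong refl iffI)
    fix i assume "\<exists>\<gamma>\<in>carrier D2. z - (pt i + shift \<gamma>) \<in> period_lattice \<tau>"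
    then obtain \<gamma> where "\<gamma> \<in> carrier D2" "z - (pt i + shift \<gamma>) \<in> period_lattice \<tau>" by blast
    then show "z - pt i \<in> half_lattice \<tau>"
      using half_lattice_add[OF lattice_subset_half[of "z - (pt i + shift \<gamma>)"] shift_half[of \<gamma>]] by simp
  next
    fix i assume "z - pt i \<in> half_lattice \<tau>"
    then show "\<exists>\<gamma>\<in>carrier D2. z - (pt i + shift \<gamma>) \<in> period_lattice \<tau>"
      by (rule shift_surj) (auto simp: algebra_simps)
  qed
  finally show ?thesis by (simp add: U_def poles_def)
qed

lemma U_torus: "p \<in> U \<Longrightarrow> p \<in> torus \<tau>"
  by (simp add: U_def)

lemma poles_add_half: "w \<in> half_lattice \<tau> \<Longrightarrow> z + w \<in> poles \<longleftrightarrow> z \<in> poles"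
  using half_lattice_add_cancel[of w \<tau> "z - pt _"] by (simp add: poles_def algebra_simps)

lemma sigma_U_iff: "\<gamma> \<in> carrier D2 \<Longrightarrow> p \<in> torus \<tau> \<Longrightarrow> \<sigma> \<gamma> p \<in> U \<longleftrightarrow> p \<in> U"
  by (elim torusE) (simp add: sigma_tproj tproj_U_iff poles_add_half shift_half)

lemma sigma_torus: "\<gamma> \<in> carrier D2 \<Longrightarrow> p \<in> torus \<tau> \<Longrightarrow> \<sigma> \<gamma> p \<in> torus \<tau>"
  by (elim torusE) (simp add: sigma_tproj)

lemma eventually_notin_poles: "\<forall>\<^sub>F w in at z. w \<notin> poles"
proof -
  have "\<forall>\<^sub>F w in at z. \<forall>i\<in>{..<n}. w - pt i \<notin> half_lattice \<tau>"
    by (intro eventually_ball_finite ballI eventually_notin_half_lattice \<tau>) simp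
  then show ?thesis by (rule eventually_mono) (auto simp: poles_def)
qed

lemma open_compl_poles: "open (- poles)"
proof -
  have "closed poles"
    unfolding closed_limpt islimpt_iff_eventually using eventually_notin_poles by blast
  then show ?thesis by (simp add: open_Compl)
qed

lemma U_preimage: "{z. tproj \<tau> z \<in> U} = - poles"
  by (auto simp: tproj_U_iff)

lemma U_nonempty: "\<exists>p. p \<in> U"
proof -
  obtain w where "w \<notin> poles"
    using eventually_happens[OF eventually_notin_poles[of 0]] by auto
  then show ?thesis using tproj_U_iff by blast
qed

subsection \<open>The rings of functions\<close>

abbreviation "\<O> \<equiv> mero_ring \<tau> U"

abbreviation "\<O>\<^sub>D \<equiv> inv_ring \<tau> \<sigma> U"

text \<open>The plane function \<open>G\<close> has to agree with the lift of f only off the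
  punctures. The convention that f is 0 there does not disturb meromorphy, because the punctures are
  discrete.\<close>

lemma mero_ringI:
  assumes "\<And>p. p \<notin> U \<Longrightarrow> f p = 0"
    and eq: "\<And>z. z \<notin> poles \<Longrightarrow> f (tproj \<tau> z) = G z"
    and "G meromorphic_on UNIV" "\<And>z. z \<notin> poles \<Longrightarrow> G analytic_on {z}"
  shows "f \<in> \<O>"
proof -
  have "(\<lambda>z. f (tproj \<tau> z)) meromorphic_on UNIV \<longleftrightarrow> G meromorphic_on UNIV"
    by (intro meromorphic_on_cong eventually_mono[OF eventually_notin_poles]) (auto simp: eq)
  moreover have "G holomorphic_on - poles"
    using assms(4) by (intro analytic_imp_holomorphic) (auto simp: analytic_on_analytic_at[of _ "- poles"])
  then have "(\<lambda>z. f (tproj \<tau> z)) holomorphic_on - poles"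
    by (rule holomorphic_transform) (simp add: eq)
  ultimately show ?thesis
    using assms by (simp add: mero_ring_def U_preimage)
qed

lemma mero_ringD:
  assumes "f \<in> \<O>"
  shows "p \<notin> U \<Longrightarrow> f p = 0" "(\<lambda>z. f (tproj \<tau> z)) meromorphic_on UNIV"
    "z \<notin> poles \<Longrightarrow> (\<lambda>z. f (tproj \<tau> z)) analytic_on {z}"
proof -
  show "p \<notin> U \<Longrightarrow> f p = 0" "(\<lambda>z. f (tproj \<tau> z)) meromorphic_on UNIV"
    using assms by (auto simp: mero_ring_def)
  have "(\<lambda>z. f (tproj \<tau> z)) holomorphic_on - poles"
    using assms by (simp add: mero_ring_def U_preimage)
  then show "z \<notin> poles \<Longrightarrow> (\<lambda>z. f (tproj \<tau> z)) analytic_on {z}"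
    using open_compl_poles analytic_at by (metis ComplI)
qed

lemma mero_ring_const: "zero_off U (\<lambda>p. c) \<in> \<O>"
  by (rule mero_ringI[of _ "\<lambda>z. c"]) (auto simp: zero_off_def tproj_U_iff)

lemma mero_ring_add: "f \<in> \<O> \<Longrightarrow> g \<in> \<O> \<Longrightarrow> (\<lambda>p. f p + g p) \<in> \<O>"
  by (rule mero_ringI[of _ "\<lambda>z. f (tproj \<tau> z) + g (tproj \<tau> z)"])
    (auto simp: mero_ringD intro!: meromorphic_intros analytic_intros)

lemma mero_ring_mult: "f \<in> \<O> \<Longrightarrow> g \<in> \<O> \<Longrightarrow> (\<lambda>p. f p * g p) \<in> \<O>"
  by (rule mero_ringI[of _ "\<lambda>z. f (tproj \<tau> z) * g (tproj \<tau> z)"])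
    (auto simp: mero_ringD intro!: meromorphic_intros analytic_intros)

lemma mero_ring_scale: "f \<in> \<O> \<Longrightarrow> (\<lambda>p. c * f p) \<in> \<O>"
  by (rule mero_ringI[of _ "\<lambda>z. c * f (tproj \<tau> z)"])
    (auto simp: mero_ringD intro!: meromorphic_intros analytic_intros)

lemma act_fun_eq_iff:
  assumes "\<gamma> \<in> carrier D2" "f \<in> \<O>"
  shows "act_fun \<tau> \<sigma> \<gamma> f = f \<longleftrightarrow> (\<forall>p\<in>torus \<tau>. f (\<sigma> \<gamma> p) = f p)"
  using mero_ringD(1)[OF assms(2)] U_torus D2_inv[OF assms(1)]
  by (auto simp: act_fun_def zero_off_def fun_eq_iff)

lemma inv_ring_iff: "f \<in> \<O>\<^sub>D \<longleftrightarrow> f \<in> \<O> \<and> (\<forall>\<gamma>\<in>carrier D2. \<forall>p\<in>torus \<tau>. f (\<sigma> \<gamma> p) = f p)"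
  by (auto simp: inv_ring_def act_fun_eq_iff)

text \<open>Invariants are the functions with the half periods as periods; by
  \<open>shift_surj\<close> nothing of \<sigma> is left in the description.\<close>

lemma inv_ring_iff_periodic:
  "f \<in> \<O>\<^sub>D \<longleftrightarrow> f \<in> \<O> \<and> (\<forall>w\<in>half_lattice \<tau>. \<forall>z. f (tproj \<tau> (z + w)) = f (tproj \<tau> z))"
proof -
  have "(\<forall>\<gamma>\<in>carrier D2. \<forall>p\<in>torus \<tau>. f (\<sigma> \<gamma> p) = f p) \<longleftrightarrow>
      (\<forall>w\<in>half_lattice \<tau>. \<forall>z. f (tproj \<tau> (z + w)) = f (tproj \<tau> z))"
  proof (intro iffI ballI allI)
    fix w z assume *: "\<forall>\<gamma>\<in>carrier D2. \<forall>p\<in>torus \<tau>. f (\<sigma> \<gamma> p) = f p" "w \<in> half_lattice \<tau>"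
    obtain \<gamma> where \<gamma>: "\<gamma> \<in> carrier D2" "w - shift \<gamma> \<in> period_lattice \<tau>"
      using *(2) by (rule shift_surj)
    then have "tproj \<tau> (z + w) = \<sigma> \<gamma> (tproj \<tau> z)" by (simp add: sigma_tproj tproj_eq_iff)
    then show "f (tproj \<tau> (z + w)) = f (tproj \<tau> z)" using *(1) \<gamma>(1) by simp
  next
    fix \<gamma> p assume *: "\<forall>w\<in>half_lattice \<tau>. \<forall>z. f (tproj \<tau> (z + w)) = f (tproj \<tau> z)"
      "\<gamma> \<in> carrier D2" "p \<in> torus \<tau>"
    then show "f (\<sigma> \<gamma> p) = f p" by (auto elim!: torusE simp: sigma_tproj shift_half)
  qed
  then show ?thesis by (simp add: inv_ring_iff)
qed

lemma inv_ring_subset: "f \<in> \<O>\<^sub>D \<Longrightarrow> f \<in> \<O>"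
  by (simp add: inv_ring_iff)

lemma inv_ring_const: "zero_off U (\<lambda>p. c) \<in> \<O>\<^sub>D"
  by (simp add: inv_ring_iff mero_ring_const) (simp add: zero_off_def sigma_U_iff)

lemma inv_ring_add: "f \<in> \<O>\<^sub>D \<Longrightarrow> g \<in> \<O>\<^sub>D \<Longrightarrow> (\<lambda>p. f p + g p) \<in> \<O>\<^sub>D"
  by (simp add: inv_ring_iff mero_ring_add)

lemma inv_ring_mult: "f \<in> \<O>\<^sub>D \<Longrightarrow> g \<in> \<O>\<^sub>D \<Longrightarrow> (\<lambda>p. f p * g p) \<in> \<O>\<^sub>D"
  by (simp add: inv_ring_iff mero_ring_mult)

lemma inv_ring_scale: "f \<in> \<O>\<^sub>D \<Longrightarrow> (\<lambda>p. c * f p) \<in> \<O>\<^sub>D"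
  by (simp add: inv_ring_iff mero_ring_scale)

end

context fd_lie_algebra
begin

text \<open>Expansion in the fixed basis writes X as a sum of elementary tensors whose coefficients
  are linear functionals of X. This reduces statements about Lie-algebra-valued functions to scalar
  ones.\<close>

lemma tensor_iff:
  assumes add: "\<And>f g. f \<in> Rg \<Longrightarrow> g \<in> Rg \<Longrightarrow> (\<lambda>p. f p + g p) \<in> Rg"
    and scale: "\<And>f c. f \<in> Rg \<Longrightarrow> (\<lambda>p. c * f p) \<in> Rg"
    and zero: "(\<lambda>p. 0) \<in> Rg"
  shows "X \<in> tensor Rg \<longleftrightarrow> (\<forall>\<phi>. functional \<phi> \<longrightarrow> (\<lambda>p. \<phi> (X p)) \<in> Rg)"
proof
  assume "X \<in> tensor Rg"
  then obtain m :: nat and A f where f: "\<forall>i<m. f i \<in> Rg" and X: "X = (\<lambda>p. \<Sum>i<m. elem_tensor (A i) (f i) p)"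
    by (auto simp: tensor_def)
  show "\<forall>\<phi>. functional \<phi> \<longrightarrow> (\<lambda>p. \<phi> (X p)) \<in> Rg"
  proof (intro allI impI)
    fix \<phi> assume \<phi>: "functional \<phi>"
    have "(\<lambda>p. \<Sum>i<k. \<phi> (A i) * f i p) \<in> Rg" if "k \<le> m" for k
      using that by (induction k) (auto simp: zero intro!: add scale f[rule_format])
    then show "(\<lambda>p. \<phi> (X p)) \<in> Rg"
      by (simp add: X elem_tensor_def functional_linear[OF \<phi>] mult.commute)
  qed
next
  assume *: "\<forall>\<phi>. functional \<phi> \<longrightarrow> (\<lambda>p. \<phi> (X p)) \<in> Rg"
  obtain A where A: "bij_betw A {..<card coord_basis} coord_basis"
    using ex_bij_betw_nat_finite[OF coord_basis(1)] by (auto simp: atLeast0LessThan)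
  have "X p = (\<Sum>i<card coord_basis. elem_tensor (A i) (\<lambda>p. coord (A i) (X p)) p)" for p
    using sum.reindex_bij_betw[OF A, of "\<lambda>b. scale (coord b (X p)) b"] sum_coord[of "X p"]
    by (simp add: elem_tensor_def)
  then have X: "X = (\<lambda>p. \<Sum>i<card coord_basis. elem_tensor (A i) (\<lambda>p. coord (A i) (X p)) p)"
    by (rule ext)
  have "\<forall>i<card coord_basis. (\<lambda>p. coord (A i) (X p)) \<in> Rg"
    using * functional_coord by simp
  then show "X \<in> tensor Rg"
    unfolding tensor_def using X
    by (intro CollectI exI[of _ "card coord_basis"] exI[of _ A] exI[of _ "\<lambda>i p. coord (A i) (X p)"] conjI)
qed

end

locale automorphic_setting = fd_lie_algebra scale bracket + torus_setting \<tau> \<sigma> n P U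
  for scale :: "complex \<Rightarrow> 'g::ab_group_add \<Rightarrow> 'g" and bracket and \<tau> \<sigma> n P U +
  fixes \<rho> :: "int \<times> int \<Rightarrow> 'g \<Rightarrow> 'g"
  assumes \<rho>: "\<rho> \<in> hom D2 Inn"
begin

abbreviation "\<L> \<equiv> automorphic_lie_algebra \<tau> \<sigma> \<rho> U"

lemma zero_fun: "zero_off U (\<lambda>p. 0 :: 'b::zero) = (\<lambda>p. 0)"
  by (auto simp: zero_off_def)

lemma tensor_mero_iff: "X \<in> tensor \<O> \<longleftrightarrow> (\<forall>\<phi>. functional \<phi> \<longrightarrow> (\<lambda>p. \<phi> (X p)) \<in> \<O>)"
  using mero_ring_const[of 0] by (intro tensor_iff mero_ring_add mero_ring_scale) (simp_all add: zero_fun)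

lemma tensor_inv_iff: "X \<in> tensor \<O>\<^sub>D \<longleftrightarrow> (\<forall>\<phi>. functional \<phi> \<longrightarrow> (\<lambda>p. \<phi> (X p)) \<in> \<O>\<^sub>D)"
  using inv_ring_const[of 0] by (intro tensor_iff inv_ring_add inv_ring_scale) (simp_all add: zero_fun)

lemma tensor_mero_zero:
  assumes "X \<in> tensor \<O>" "p \<notin> U"
  shows "X p = 0"
proof (rule eq_if_coord_eq)
  fix b
  have "(\<lambda>p. coord b (X p)) \<in> \<O>"
    using assms(1) functional_coord by (simp add: tensor_mero_iff)
  from mero_ringD(1)[OF this assms(2)] show "coord b (X p) = coord b 0"
    by (simp add: functional_linear(3)[OF functional_coord])
qed

lemma rho_Inn: "\<gamma> \<in> carrier D2 \<Longrightarrow> \<rho> \<gamma> \<in> carrier Inn"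
  using \<rho> by (auto simp: hom_def)

lemma rho_involution: "\<gamma> \<in> carrier D2 \<Longrightarrow> \<rho> \<gamma> (\<rho> \<gamma> v) = v"
  using hom_mult[OF \<rho>, of \<gamma> \<gamma>] hom_one[OF \<rho> group_D2 group_Inn] D2_square[of \<gamma>]
  by (simp add: Inn_simps fun_eq_iff)

text \<open>Because every element is its own inverse and \<rho>(\<gamma>) is an involution, the
  fixed-point condition can be written as equivariance without inverses.\<close>

lemma automorphic_iff:
  "X \<in> \<L> \<longleftrightarrow> X \<in> tensor \<O> \<and> (\<forall>\<gamma>\<in>carrier D2. \<forall>p\<in>U. X (\<sigma> \<gamma> p) = \<rho> \<gamma> (X p))"
proof -
  have "act_tensor \<tau> \<sigma> \<rho> \<gamma> X = X \<longleftrightarrow> (\<forall>p\<in>U. X (\<sigma> \<gamma> p) = \<rho> \<gamma> (X p))"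
    if X: "X \<in> tensor \<O>" and \<gamma>: "\<gamma> \<in> carrier D2" for \<gamma>
  proof -
    have 0: "\<rho> \<gamma> 0 = 0" using linear_simps(3)[OF carrier_Inn(1)[OF rho_Inn[OF \<gamma>]]] .
    have "act_tensor \<tau> \<sigma> \<rho> \<gamma> X = X \<longleftrightarrow> (\<forall>p\<in>U. \<rho> \<gamma> (X (\<sigma> \<gamma> p)) = X p)"
      using tensor_mero_zero[OF X] U_torus sigma_U_iff[OF \<gamma>] 0
      by (auto simp: act_tensor_def zero_off_def fun_eq_iff D2_inv[OF \<gamma>])
    also have "\<dots> \<longleftrightarrow> (\<forall>p\<in>U. X (\<sigma> \<gamma> p) = \<rho> \<gamma> (X p))"
      using rho_involution[OF \<gamma>] by metis
    finally show ?thesis .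
  qed
  then show ?thesis by (auto simp: automorphic_lie_algebra_def)
qed

end

subsection \<open>Trivialisations\<close>

context automorphic_setting
begin

text \<open>An equivariant frame over the punctured torus. The coefficients of the pointwise inverse
  are part of the definition, since untwisting applies the inverse.\<close>

definition trivialises :: "(complex set \<Rightarrow> 'g \<Rightarrow> 'g) \<Rightarrow> bool" where
  "trivialises T \<longleftrightarrow> (\<forall>p\<in>U. T p \<in> carrier Inn) \<and>
     (\<forall>\<gamma>\<in>carrier D2. \<forall>p\<in>U. T (\<sigma> \<gamma> p) = \<rho> \<gamma> \<circ> T p) \<and>
     (\<forall>\<phi> v. functional \<phi> \<longrightarrow> zero_off U (\<lambda>p. \<phi> (T p v)) \<in> \<O>) \<and>
     (\<forall>\<phi> v. functional \<phi> \<longrightarrow> zero_off U (\<lambda>p. \<phi> (inv_into UNIV (T p) v)) \<in> \<O>)"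

lemma mero_ring_sum: "finite B \<Longrightarrow> (\<And>b. b \<in> B \<Longrightarrow> f b \<in> \<O>) \<Longrightarrow> (\<lambda>p. \<Sum>b\<in>B. f b p) \<in> \<O>"
proof (induction B rule: finite_induct)
  case empty
  then show ?case using mero_ring_const[of 0] by (simp add: zero_fun)
qed (simp add: mero_ring_add)

lemma apply_in_tensor:
  assumes lin: "\<And>p. p \<in> U \<Longrightarrow> Vector_Spaces.linear scale scale (T p)"
    and coeff: "\<And>\<phi> v. functional \<phi> \<Longrightarrow> zero_off U (\<lambda>p. \<phi> (T p v)) \<in> \<O>"
    and X: "X \<in> tensor \<O>"
  shows "zero_off U (\<lambda>p. T p (X p)) \<in> tensor \<O>"
  unfolding tensor_mero_iff
proof (intro allI impI)
  fix \<phi> assume \<phi>: "functional \<phi>"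
  have "\<phi> (zero_off U (\<lambda>p. T p (X p)) p)
      = (\<Sum>b\<in>coord_basis. coord b (X p) * zero_off U (\<lambda>p. \<phi> (T p b)) p)" for p
  proof (cases "p \<in> U")
    case True
    then show ?thesis
      using functional_expand[OF functional_comp[OF \<phi> lin[OF True]], of "X p"] by (simp add: zero_off_def)
  next
    case False
    then show ?thesis using functional_linear(3)[OF \<phi>] by (simp add: zero_off_def)
  qed
  moreover have "(\<lambda>p. \<Sum>b\<in>coord_basis. coord b (X p) * zero_off U (\<lambda>p. \<phi> (T p b)) p) \<in> \<O>"
    using X functional_coord
    by (intro mero_ring_sum coord_basis mero_ring_mult coeff \<phi>) (auto simp: tensor_mero_iff)
  ultimately show "(\<lambda>p. \<phi> (zero_off U (\<lambda>p. T p (X p)) p)) \<in> \<O>" by simp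
qed

context
  fixes T :: "complex set \<Rightarrow> 'g \<Rightarrow> 'g"
  assumes T: "trivialises T"
begin

abbreviation Ti :: "complex set \<Rightarrow> 'g \<Rightarrow> 'g" where
  "Ti p \<equiv> inv_into UNIV (T p)"

lemma T_props:
  assumes "p \<in> U"
  shows "Vector_Spaces.linear scale scale (T p)" "bij (T p)" "T p (bracket x y) = bracket (T p x) (T p y)"
    "T p (Ti p x) = x" "Ti p (T p x) = x"
    "Vector_Spaces.linear scale scale (Ti p)" "Ti p (bracket x y) = bracket (Ti p x) (Ti p y)"
proof -
  have Inn: "T p \<in> carrier Inn" using T assms by (simp add: trivialises_def)
  show lin: "Vector_Spaces.linear scale scale (T p)" and bij: "bij (T p)"
    and hom: "\<And>x y. T p (bracket x y) = bracket (T p x) (T p y)"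
    using carrier_Inn[OF Inn] by auto
  show 1: "\<And>x. T p (Ti p x) = x" "\<And>x. Ti p (T p x) = x"
    using bij by (simp_all add: bij_is_surj surj_f_inv_f bij_is_inj)
  have inj: "T p x = T p y \<Longrightarrow> x = y" for x y
    by (rule injD[OF bij_is_inj[OF bij]])
  have "Ti p (x + y) = Ti p x + Ti p y" for x y
    by (rule inj) (simp add: 1 linear_simps(1)[OF lin])
  moreover have "Ti p (scale c x) = scale c (Ti p x)" for c x
    by (rule inj) (simp add: 1 linear_simps(2)[OF lin])
  ultimately show "Vector_Spaces.linear scale scale (Ti p)"
    unfolding Vector_Spaces.linear_iff using vector_space_axioms by blast
  show "Ti p (bracket x y) = bracket (Ti p x) (Ti p y)"
    by (rule inj) (simp add: 1 hom)
qed

lemma T_equiv: "\<gamma> \<in> carrier D2 \<Longrightarrow> p \<in> U \<Longrightarrow> T (\<sigma> \<gamma> p) x = \<rho> \<gamma> (T p x)"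
  using T by (simp add: trivialises_def)

lemma T_coeff:
  assumes "functional \<phi>"
  shows "zero_off U (\<lambda>p. \<phi> (T p v)) \<in> \<O>" "zero_off U (\<lambda>p. \<phi> (Ti p v)) \<in> \<O>"
  using T assms by (auto simp: trivialises_def)

lemma sigma_U: "\<gamma> \<in> carrier D2 \<Longrightarrow> p \<in> U \<Longrightarrow> \<sigma> \<gamma> p \<in> U"
  using sigma_U_iff U_torus by blast

text \<open>X and T acquire the same factor \<rho>(\<gamma>) under \<sigma>(\<gamma>), and it
  cancels in \<open>Ti p (X p)\<close>.\<close>

lemma untwist:
  assumes "X \<in> \<L>"
  shows "zero_off U (\<lambda>p. Ti p (X p)) \<in> tensor \<O>\<^sub>D"
proof -
  have X: "X \<in> tensor \<O>" "\<And>\<gamma> p. \<gamma> \<in> carrier D2 \<Longrightarrow> p \<in> U \<Longrightarrow> X (\<sigma> \<gamma> p) = \<rho> \<gamma> (X p)"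
    using assms by (auto simp: automorphic_iff)
  have 1: "zero_off U (\<lambda>p. Ti p (X p)) \<in> tensor \<O>"
    by (intro apply_in_tensor X T_props T_coeff)
  have 2: "Ti (\<sigma> \<gamma> p) (X (\<sigma> \<gamma> p)) = Ti p (X p)" if "\<gamma> \<in> carrier D2" "p \<in> U" for \<gamma> p
  proof -
    have "X (\<sigma> \<gamma> p) = T (\<sigma> \<gamma> p) (Ti p (X p))"
      using that by (simp add: X(2) T_equiv T_props)
    then show ?thesis using that by (simp add: T_props sigma_U)
  qed
  have "(\<lambda>p. \<phi> (zero_off U (\<lambda>p. Ti p (X p)) p)) \<in> \<O>\<^sub>D" if \<phi>: "functional \<phi>" for \<phi>
    unfolding inv_ring_iff
  proof (intro conjI ballI)
    show "(\<lambda>p. \<phi> (zero_off U (\<lambda>p. Ti p (X p)) p)) \<in> \<O>" using 1 \<phi> by (simp add: tensor_mero_iff)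
    show "\<phi> (zero_off U (\<lambda>p. Ti p (X p)) (\<sigma> \<gamma> p)) = \<phi> (zero_off U (\<lambda>p. Ti p (X p)) p)"
      if "\<gamma> \<in> carrier D2" "p \<in> torus \<tau>" for \<gamma> p
      using 2[of \<gamma> p] that by (simp add: zero_off_def sigma_U_iff)
  qed
  then show ?thesis by (simp add: tensor_inv_iff)
qed

lemma twist:
  assumes "Y \<in> tensor \<O>\<^sub>D"
  shows "zero_off U (\<lambda>p. T p (Y p)) \<in> \<L>"
  unfolding automorphic_iff
proof (intro conjI ballI)
  have Y: "(\<lambda>p. \<phi> (Y p)) \<in> \<O>\<^sub>D" if "functional \<phi>" for \<phi>
    using assms that by (simp add: tensor_inv_iff)
  then have "Y \<in> tensor \<O>" by (simp add: tensor_mero_iff inv_ring_subset)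
  then show "zero_off U (\<lambda>p. T p (Y p)) \<in> tensor \<O>"
    by (intro apply_in_tensor T_props T_coeff)
  fix \<gamma> p assume *: "\<gamma> \<in> carrier D2" "p \<in> U"
  have "Y (\<sigma> \<gamma> p) = Y p"
    using Y[OF functional_coord] * U_torus by (intro eq_if_coord_eq) (simp add: inv_ring_iff)
  then show "zero_off U (\<lambda>p. T p (Y p)) (\<sigma> \<gamma> p) = \<rho> \<gamma> (zero_off U (\<lambda>p. T p (Y p)) p)"
    using * by (simp add: zero_off_def sigma_U T_equiv)
qed

lemma tensor_inv_zero: "Y \<in> tensor \<O>\<^sub>D \<Longrightarrow> p \<notin> U \<Longrightarrow> Y p = 0"
  using tensor_mero_zero by (simp add: tensor_mero_iff tensor_inv_iff inv_ring_subset)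

lemma automorphic_zero: "X \<in> \<L> \<Longrightarrow> p \<notin> U \<Longrightarrow> X p = 0"
  using tensor_mero_zero by (simp add: automorphic_iff)

lemma untwist_iso: "lie_module_iso \<O>\<^sub>D \<L> (tensor \<O>\<^sub>D) (\<lambda>X. zero_off U (\<lambda>p. Ti p (X p)))"
  unfolding lie_module_iso_def
proof (intro conjI ballI)
  show "bij_betw (\<lambda>X. zero_off U (\<lambda>p. Ti p (X p))) \<L> (tensor \<O>\<^sub>D)"
  proof (rule bij_betw_byWitness[where f' = "\<lambda>Y. zero_off U (\<lambda>p. T p (Y p))"])
    show "\<forall>X\<in>\<L>. zero_off U (\<lambda>p. T p (zero_off U (\<lambda>p. Ti p (X p)) p)) = X"
      using automorphic_zero by (auto simp: zero_off_def fun_eq_iff T_props)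
    show "\<forall>Y\<in>tensor \<O>\<^sub>D. zero_off U (\<lambda>p. Ti p (zero_off U (\<lambda>p. T p (Y p)) p)) = Y"
      using tensor_inv_zero by (auto simp: zero_off_def fun_eq_iff T_props)
  qed (use untwist twist in auto)
  fix X Y
  show "zero_off U (\<lambda>p. Ti p (X p + Y p)) = (\<lambda>p. zero_off U (\<lambda>p. Ti p (X p)) p + zero_off U (\<lambda>p. Ti p (Y p)) p)"
    by (auto simp: zero_off_def fun_eq_iff linear_simps(1)[OF T_props(6)])
  show "zero_off U (\<lambda>p. Ti p (bracket (X p) (Y p)))
      = (\<lambda>p. bracket (zero_off U (\<lambda>p. Ti p (X p)) p) (zero_off U (\<lambda>p. Ti p (Y p)) p))"
    by (auto simp: zero_off_def fun_eq_iff T_props(7) bracket_self)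
next
  fix f X
  show "zero_off U (\<lambda>p. Ti p (scale (f p) (X p))) = (\<lambda>p. scale (f p) (zero_off U (\<lambda>p. Ti p (X p)) p))"
    by (auto simp: zero_off_def fun_eq_iff linear_simps(2)[OF T_props(6)])
qed

lemma constant_tensor: "zero_off U (\<lambda>p. x) \<in> tensor \<O>\<^sub>D"
proof -
  have "(\<lambda>p. \<phi> (zero_off U (\<lambda>p. x) p)) = zero_off U (\<lambda>p. \<phi> x)" if "functional \<phi>" for \<phi>
    using functional_linear(3)[OF that] by (auto simp: zero_off_def)
  then show ?thesis by (simp add: tensor_inv_iff inv_ring_const)
qed

lemma twist_constant: "zero_off U (\<lambda>p. T p x) \<in> \<L>"
proof -
  have "zero_off U (\<lambda>p. T p (zero_off U (\<lambda>p. x) p)) = zero_off U (\<lambda>p. T p x)"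
    by (auto simp: zero_off_def)
  then show ?thesis using twist[OF constant_tensor] by metis
qed

text \<open>The coefficients of X are the coordinates of the untwisted function, which are
  invariant; spanning and uniqueness are then those of b at each point. The embedding sends x to the
  section p \<mapsto> T p x: it respects brackets because each \<open>T p\<close> is an inner
  automorphism, and it is injective already at a single point of U.\<close>

lemma normal_form_of_trivialisation:
  assumes b: "basis_family K b"
  shows "normal_form \<O>\<^sub>D \<L> K b (\<lambda>k. zero_off U (\<lambda>p. T p (b k)))"
  unfolding normal_form_def
proof (intro conjI ballI)
  have inj: "inj_on b K" and ind: "independent (b ` K)" and span: "span (b ` K) = UNIV"
    using b by (auto simp: basis_family_def)
  have "finite (b ` K)"
    using independent_span_bound[OF coord_basis(1) ind] coord_basis(3) by simp
  then have K: "finite K" using inj finite_imageD by blast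
  define \<kappa> where "\<kappa> = (\<lambda>k v. representation (b ` K) v (b k))"
  have \<kappa>: "functional (\<kappa> k)" for k
    unfolding functional_def \<kappa>_def
    by unfold_locales (auto simp: ind span representation_add representation_scale algebra_simps)
  have sum_\<kappa>: "(\<Sum>k\<in>K. scale (\<kappa> k v) (b k)) = v" for v
  proof -
    have "(\<Sum>k\<in>K. scale (\<kappa> k v) (b k)) = (\<Sum>x\<in>b ` K. scale (representation (b ` K) v x) x)"
      by (simp add: sum.reindex[OF inj] \<kappa>_def)
    also have "\<dots> = v"
      using ind span K by (intro sum_representation_eq) auto
    finally show ?thesis .
  qed
  have T_sum: "T p (\<Sum>k\<in>K. scale (c k) (b k)) = (\<Sum>k\<in>K. scale (c k) (T p (b k)))" if "p \<in> U" for p c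
    by (simp add: linear_simps(2,5)[OF T_props(1)[OF that]])
  show "zero_off U (\<lambda>p. T p (b k)) \<in> \<L>" for k by (rule twist_constant)
  show "free_module_basis \<O>\<^sub>D \<L> K (\<lambda>k. zero_off U (\<lambda>p. T p (b k)))"
    unfolding free_module_basis_def
  proof (rule bij_betwI')
    fix c d assume c: "c \<in> K \<rightarrow>\<^sub>E \<O>\<^sub>D" and d: "d \<in> K \<rightarrow>\<^sub>E \<O>\<^sub>D"
    show "((\<lambda>p. \<Sum>k\<in>K. scale (c k p) (zero_off U (\<lambda>p. T p (b k)) p)) =
         (\<lambda>p. \<Sum>k\<in>K. scale (d k p) (zero_off U (\<lambda>p. T p (b k)) p))) = (c = d)"
    proof
      assume eq: "(\<lambda>p. \<Sum>k\<in>K. scale (c k p) (zero_off U (\<lambda>p. T p (b k)) p)) =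
         (\<lambda>p. \<Sum>k\<in>K. scale (d k p) (zero_off U (\<lambda>p. T p (b k)) p))"
      have eqU: "(\<Sum>k\<in>K. scale (c k p) (b k)) = (\<Sum>k\<in>K. scale (d k p) (b k))" if p: "p \<in> U" for p
      proof -
        have "T p (\<Sum>k\<in>K. scale (c k p) (b k)) = T p (\<Sum>k\<in>K. scale (d k p) (b k))"
          using fun_cong[OF eq, of p] p by (simp add: T_sum zero_off_def)
        then show ?thesis using T_props(2)[OF p] by (simp add: bij_is_inj inj_eq)
      qed
      \<comment> \<open>Cutting the coefficients off outside U makes the two sums agree at every
        point, as \<open>tensor_coefficients_unique\<close> demands; elements of the ring vanish
        there by convention.\<close>
      have e: "(\<lambda>p. \<Sum>k\<in>K. elem_tensor (b k) (\<lambda>p. if p \<in> U then c k p else 0) p)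
          = (\<lambda>p. \<Sum>k\<in>K. elem_tensor (b k) (\<lambda>p. if p \<in> U then d k p else 0) p)"
      proof (intro ext)
        fix p
        show "(\<Sum>k\<in>K. elem_tensor (b k) (\<lambda>p. if p \<in> U then c k p else 0) p)
          = (\<Sum>k\<in>K. elem_tensor (b k) (\<lambda>p. if p \<in> U then d k p else 0) p)"
          using eqU[of p] by (cases "p \<in> U") (simp_all add: elem_tensor_def)
      qed
      show "c = d"
      proof (rule PiE_ext[OF c d], rule ext)
        fix k p assume k: "k \<in> K"
        have "c k \<in> \<O>" "d k \<in> \<O>" using c d k by (auto intro: inv_ring_subset)
        then show "c k p = d k p"
          using fun_cong[OF tensor_coefficients_unique[OF K b e k], of p]
            mero_ringD(1)[of "c k" p] mero_ringD(1)[of "d k" p]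
          by (cases "p \<in> U") simp_all
      qed
    qed simp
  next
    fix c assume c: "c \<in> K \<rightarrow>\<^sub>E \<O>\<^sub>D"
    have "(\<lambda>p. \<Sum>k\<in>K. scale (c k p) (b k)) \<in> tensor \<O>\<^sub>D"
      unfolding tensor_inv_iff
    proof (intro allI impI)
      fix \<phi> assume \<phi>: "functional \<phi>"
      have "(\<lambda>p. \<Sum>k\<in>J. \<phi> (b k) * c k p) \<in> \<O>\<^sub>D" if "finite J" "J \<subseteq> K" for J
        using that
      proof (induction J rule: finite_induct)
        case empty
        then show ?case using inv_ring_const[of 0] by (simp add: zero_fun)
      next
        case (insert x J)
        then show ?case using c by (auto intro!: inv_ring_add inv_ring_scale)
      qed
      from this[OF K order_refl] show "(\<lambda>p. \<phi> (\<Sum>k\<in>K. scale (c k p) (b k))) \<in> \<O>\<^sub>D"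
        by (simp add: functional_linear[OF \<phi>] mult.commute)
    qed
    from twist[OF this] show "(\<lambda>p. \<Sum>k\<in>K. scale (c k p) (zero_off U (\<lambda>p. T p (b k)) p)) \<in> \<L>"
      by (rule back_subst[of "\<lambda>X. X \<in> \<L>"]) (auto simp: zero_off_def fun_eq_iff T_sum)
  next
    fix X assume X: "X \<in> \<L>"
    define Y where "Y = zero_off U (\<lambda>p. Ti p (X p))"
    have Y: "Y \<in> tensor \<O>\<^sub>D" unfolding Y_def by (rule untwist[OF X])
    show "\<exists>c\<in>K \<rightarrow>\<^sub>E \<O>\<^sub>D. X = (\<lambda>p. \<Sum>k\<in>K. scale (c k p) (zero_off U (\<lambda>p. T p (b k)) p))"
    proof (rule bexI[of _ "restrict (\<lambda>k p. \<kappa> k (Y p)) K"])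
      show "restrict (\<lambda>k p. \<kappa> k (Y p)) K \<in> K \<rightarrow>\<^sub>E \<O>\<^sub>D"
        using Y \<kappa> by (auto simp: tensor_inv_iff)
      show "X = (\<lambda>p. \<Sum>k\<in>K. scale (restrict (\<lambda>k p. \<kappa> k (Y p)) K k p) (zero_off U (\<lambda>p. T p (b k)) p))"
      proof
        fix p
        show "X p = (\<Sum>k\<in>K. scale (restrict (\<lambda>k p. \<kappa> k (Y p)) K k p) (zero_off U (\<lambda>p. T p (b k)) p))"
        proof (cases "p \<in> U")
          case True
          have "X p = T p (\<Sum>k\<in>K. scale (\<kappa> k (Y p)) (b k))"
            using True by (simp add: sum_\<kappa> Y_def zero_off_def T_props)
          then show ?thesis using True by (simp add: T_sum zero_off_def)
        qed (use automorphic_zero[OF X] in \<open>simp add: zero_off_def\<close>)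
      qed
    qed
  qed
  show "\<exists>\<iota>. inj \<iota> \<and> range \<iota> \<subseteq> \<L> \<and>
        (\<forall>x y. \<iota> (x + y) = (\<lambda>p. \<iota> x p + \<iota> y p)) \<and>
        (\<forall>c x. \<iota> (scale c x) = (\<lambda>p. scale c (\<iota> x p))) \<and>
        (\<forall>x y. \<iota> (bracket x y) = (\<lambda>p. bracket (\<iota> x p) (\<iota> y p))) \<and>
        (\<forall>k\<in>K. \<iota> (b k) = zero_off U (\<lambda>p. T p (b k)))"
  proof (rule exI[of _ "\<lambda>x. zero_off U (\<lambda>p. T p x)"], intro conjI allI ballI refl)
    show "inj (\<lambda>x. zero_off U (\<lambda>p. T p x))"
    proof (rule injI)
      fix x y assume eq: "zero_off U (\<lambda>p. T p x) = zero_off U (\<lambda>p. T p y)"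
      obtain p where p: "p \<in> U" using U_nonempty by blast
      have "T p x = T p y" using fun_cong[OF eq, of p] p by (simp add: zero_off_def)
      then show "x = y" using T_props(2)[OF p] by (simp add: bij_is_inj inj_eq)
    qed
    show "range (\<lambda>x. zero_off U (\<lambda>p. T p x)) \<subseteq> \<L>" using twist_constant by blast
  qed (auto simp: zero_off_def fun_eq_iff linear_simps(1,2)[OF T_props(1)] T_props(3) bracket_self)
qed

end

end

subsection \<open>Trivialisations from matrix functions\<close>

lemma holomorphic_imp_analytic: "f holomorphic_on UNIV \<Longrightarrow> f analytic_on A"
  using analytic_on_subset[of f UNIV A] by (simp add: analytic_on_open)

lemma holomorphic_imp_meromorphic: "f holomorphic_on UNIV \<Longrightarrow> f meromorphic_on A"
  by (rule analytic_on_imp_meromorphic_on[OF holomorphic_imp_analytic])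

locale automorphic_pgl2 =
  automorphic_setting scale bracket \<tau> \<sigma> n P U \<rho> + pgl2_representation scale bracket \<rho>b
  for scale :: "complex \<Rightarrow> 'g::ab_group_add \<Rightarrow> 'g" and bracket and \<tau> \<sigma> n P U \<rho> \<rho>b +
  fixes \<delta> :: "int \<times> int \<Rightarrow> (complex^2^2) set"
  assumes \<delta>: "\<delta> \<in> hom D2 PGL2"
    and factors: "\<forall>t\<in>carrier D2. \<rho> t = \<rho>b (\<delta> t)"
begin

definition s1 :: "int \<times> int" where
  "s1 = (SOME s. s \<in> carrier D2 \<and> 1 / 2 - shift s \<in> period_lattice \<tau>)"

definition s2 :: "int \<times> int" where
  "s2 = (SOME s. s \<in> carrier D2 \<and> \<tau> / 2 - shift s \<in> period_lattice \<tau>)"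

lemma s1: "s1 \<in> carrier D2" "1 / 2 - shift s1 \<in> period_lattice \<tau>"
  and s2: "s2 \<in> carrier D2" "\<tau> / 2 - shift s2 \<in> period_lattice \<tau>"
proof -
  have "1 / 2 \<in> half_lattice \<tau>" "\<tau> / 2 \<in> half_lattice \<tau>" by (simp_all add: half_lattice_iff)
  then have "\<exists>s. s \<in> carrier D2 \<and> 1 / 2 - shift s \<in> period_lattice \<tau>"
    "\<exists>s. s \<in> carrier D2 \<and> \<tau> / 2 - shift s \<in> period_lattice \<tau>"
    by (meson shift_surj)+
  from someI_ex[OF this(1)] someI_ex[OF this(2)]
  show "s1 \<in> carrier D2" "1 / 2 - shift s1 \<in> period_lattice \<tau>"
    "s2 \<in> carrier D2" "\<tau> / 2 - shift s2 \<in> period_lattice \<tau>"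
    by (simp_all add: s1_def s2_def)
qed

lemma sigma_s: "\<sigma> s1 = translation \<tau> (1 / 2)" "\<sigma> s2 = translation \<tau> (\<tau> / 2)"
  using translation_cong[OF s1(2)] translation_cong[OF s2(2)] sigma_shift s1(1) s2(1) by simp_all

lemma s_distinct: "s1 \<noteq> \<one>\<^bsub>D2\<^esub>" "s2 \<noteq> \<one>\<^bsub>D2\<^esub>" "s1 \<noteq> s2"
proof -
  show "s1 \<noteq> \<one>\<^bsub>D2\<^esub>"
  proof
    assume "s1 = \<one>\<^bsub>D2\<^esub>"
    then show False
      using period_lattice_add[OF s1(2), of "shift s1"] shift_one half_notin_lattice(1)[OF \<tau>] by simp
  qed
  show "s2 \<noteq> \<one>\<^bsub>D2\<^esub>"
  proof
    assume "s2 = \<one>\<^bsub>D2\<^esub>"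
    then show False
      using period_lattice_add[OF s2(2), of "shift s2"] shift_one half_notin_lattice(2)[OF \<tau>] by simp
  qed
  show "s1 \<noteq> s2"
  proof
    assume "s1 = s2"
    then have "1 / 2 - \<tau> / 2 \<in> period_lattice \<tau>"
      using period_lattice_diff[OF s1(2) s2(2)] by simp
    from period_lattice_add[OF this period_lattice_tau] show False
      using half_notin_lattice(3)[OF \<tau>] by (simp add: add.commute)
  qed
qed

lemma D2_generated: "carrier D2 = {\<one>\<^bsub>D2\<^esub>, s1, s2, s1 \<otimes>\<^bsub>D2\<^esub> s2}"
proof -
  have "(0, 1) \<otimes>\<^bsub>D2\<^esub> (1, 0) = (1, 1)" "(1, 0) \<otimes>\<^bsub>D2\<^esub> (0, 1) = (1, 1)" "(0, 1) \<otimes>\<^bsub>D2\<^esub> (1, 1) = (1, 0)"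
    "(1, 1) \<otimes>\<^bsub>D2\<^esub> (0, 1) = (1, 0)" "(1, 0) \<otimes>\<^bsub>D2\<^esub> (1, 1) = (0, 1)" "(1, 1) \<otimes>\<^bsub>D2\<^esub> (1, 0) = (0, 1)"
    by (simp_all add: D2_def)
  moreover have "s1 = (0, 1) \<or> s1 = (1, 0) \<or> s1 = (1, 1)" "s2 = (0, 1) \<or> s2 = (1, 0) \<or> s2 = (1, 1)"
    using s1(1) s2(1) s_distinct(1,2) by (simp_all add: carrier_D2 one_D2)
  ultimately show ?thesis
    using s_distinct(3) by (elim disjE) (simp_all add: carrier_D2 one_D2 insert_commute)
qed

lemma shift_prod:
  assumes "\<gamma> \<in> carrier D2" "\<gamma>' \<in> carrier D2"
  shows "shift (\<gamma> \<otimes>\<^bsub>D2\<^esub> \<gamma>') - (shift \<gamma> + shift \<gamma>') \<in> period_lattice \<tau>"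
proof -
  have "\<gamma> \<otimes>\<^bsub>D2\<^esub> \<gamma>' \<in> carrier D2"
    using assms group_D2 by (simp add: group.is_monoid monoid.m_closed)
  then have "tproj \<tau> (shift (\<gamma> \<otimes>\<^bsub>D2\<^esub> \<gamma>')) = tproj \<tau> (shift \<gamma>' + shift \<gamma>)"
    using sigma_mult[OF assms, of "tproj \<tau> 0"] by (simp add: sigma_tproj assms)
  then show ?thesis by (simp add: tproj_eq_iff add.commute)
qed

text \<open>If M G(z) is to transform by \<delta>, then G itself has to transform by the conjugate
  of \<delta> by the inverse of M. For suitable M this conjugate is diagonal or the standard
  embedding.\<close>

definition twisted :: "(complex^2^2) set \<Rightarrow> int \<times> int \<Rightarrow> (complex^2^2) set" where
  "twisted M \<gamma> = inv\<^bsub>PGL2\<^esub> M \<otimes>\<^bsub>PGL2\<^esub> \<delta> \<gamma> \<otimes>\<^bsub>PGL2\<^esub> M"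

lemma twisted_hom:
  assumes "M \<in> carrier PGL2"
  shows "twisted M \<in> hom D2 PGL2"
    and "\<gamma> \<in> carrier D2 \<Longrightarrow> M \<otimes>\<^bsub>PGL2\<^esub> twisted M \<gamma> = \<delta> \<gamma> \<otimes>\<^bsub>PGL2\<^esub> M"
    and "\<gamma> \<in> carrier D2 \<Longrightarrow> \<delta> \<gamma> = M \<otimes>\<^bsub>PGL2\<^esub> twisted M \<gamma> \<otimes>\<^bsub>PGL2\<^esub> inv\<^bsub>PGL2\<^esub> M"
proof -
  interpret H: group PGL2 by (rule group_PGL2)
  have \<delta>c: "\<gamma> \<in> carrier D2 \<Longrightarrow> \<delta> \<gamma> \<in> carrier PGL2" for \<gamma>
    using \<delta> by (auto simp: hom_def)
  show *: "M \<otimes>\<^bsub>PGL2\<^esub> twisted M \<gamma> = \<delta> \<gamma> \<otimes>\<^bsub>PGL2\<^esub> M" if "\<gamma> \<in> carrier D2" for \<gamma>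
    using assms \<delta>c[OF that] by (simp add: twisted_def H.m_assoc [symmetric])
  show "\<delta> \<gamma> = M \<otimes>\<^bsub>PGL2\<^esub> twisted M \<gamma> \<otimes>\<^bsub>PGL2\<^esub> inv\<^bsub>PGL2\<^esub> M" if "\<gamma> \<in> carrier D2" for \<gamma>
    unfolding *[OF that] using assms \<delta>c[OF that] by (simp add: H.m_assoc)
  show "twisted M \<in> hom D2 PGL2"
  proof (rule homI)
    show "twisted M \<gamma> \<in> carrier PGL2" if "\<gamma> \<in> carrier D2" for \<gamma>
      using assms \<delta>c[OF that] by (simp add: twisted_def)
    fix x y assume xy: "x \<in> carrier D2" "y \<in> carrier D2"
    have cancel: "M \<otimes>\<^bsub>PGL2\<^esub> (inv\<^bsub>PGL2\<^esub> M \<otimes>\<^bsub>PGL2\<^esub> z) = z" if "z \<in> carrier PGL2" for z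
      using assms that by (simp add: H.m_assoc [symmetric])
    show "twisted M (x \<otimes>\<^bsub>D2\<^esub> y) = twisted M x \<otimes>\<^bsub>PGL2\<^esub> twisted M y"
      using assms \<delta>c xy hom_mult[OF \<delta> xy] by (simp add: twisted_def H.m_assoc cancel)
  qed
qed

section \<open>From a projectively equivariant matrix function to a trivialisation\<close>

context
  fixes a b c d :: "complex \<Rightarrow> complex" and M :: "(complex^2^2) set"
  assumes mero: "a meromorphic_on UNIV" "b meromorphic_on UNIV" "c meromorphic_on UNIV" "d meromorphic_on UNIV"
    and ana: "\<And>z. z \<notin> half_lattice \<tau> \<Longrightarrow> a analytic_on {z}" "\<And>z. z \<notin> half_lattice \<tau> \<Longrightarrow> b analytic_on {z}"
      "\<And>z. z \<notin> half_lattice \<tau> \<Longrightarrow> c analytic_on {z}" "\<And>z. z \<notin> half_lattice \<tau> \<Longrightarrow> d analytic_on {z}"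
    and det: "\<And>z. z \<notin> half_lattice \<tau> \<Longrightarrow> a z * d z - b z * c z \<noteq> 0"
    and M: "M \<in> carrier PGL2"
    and shift1: "\<And>z. z \<notin> half_lattice \<tau> \<Longrightarrow> PGL2_class (mat2 (a (z + 1/2)) (b (z + 1/2)) (c (z + 1/2)) (d (z + 1/2)))
      = twisted M s1 \<otimes>\<^bsub>PGL2\<^esub> PGL2_class (mat2 (a z) (b z) (c z) (d z))"
    and shift2: "\<And>z. z \<notin> half_lattice \<tau> \<Longrightarrow> PGL2_class (mat2 (a (z + \<tau>/2)) (b (z + \<tau>/2)) (c (z + \<tau>/2)) (d (z + \<tau>/2)))
      = twisted M s2 \<otimes>\<^bsub>PGL2\<^esub> PGL2_class (mat2 (a z) (b z) (c z) (d z))"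
begin

abbreviation G :: "complex \<Rightarrow> complex^2^2" where
  "G z \<equiv> mat2 (a z) (b z) (c z) (d z)"

lemma G_invertible: "z \<notin> half_lattice \<tau> \<Longrightarrow> invertible (G z)"
  using det by (simp add: invertible_mat2)

lemma G_carrier: "z \<notin> half_lattice \<tau> \<Longrightarrow> PGL2_class (G z) \<in> carrier PGL2"
  by (intro PGL2_class_in_carrier G_invertible)

lemma half_shifts:
  "z + 1/2 \<in> half_lattice \<tau> \<longleftrightarrow> z \<in> half_lattice \<tau>" "z + \<tau>/2 \<in> half_lattice \<tau> \<longleftrightarrow> z \<in> half_lattice \<tau>"
  by (rule half_lattice_add_cancel, simp add: half_lattice_iff)+

lemma twisted_square:
  assumes "\<gamma> \<in> carrier D2" "X \<in> carrier PGL2"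
  shows "twisted M \<gamma> \<otimes>\<^bsub>PGL2\<^esub> (twisted M \<gamma> \<otimes>\<^bsub>PGL2\<^esub> X) = X"
proof -
  interpret H: group PGL2 by (rule group_PGL2)
  have "twisted M \<gamma> \<in> carrier PGL2" using twisted_hom(1)[OF M] assms(1) by (auto simp: hom_def)
  moreover have "twisted M \<gamma> \<otimes>\<^bsub>PGL2\<^esub> twisted M \<gamma> = \<one>\<^bsub>PGL2\<^esub>"
    using hom_mult[OF twisted_hom(1)[OF M] assms(1,1)] hom_one[OF twisted_hom(1)[OF M] group_D2 group_PGL2]
    by (simp add: D2_square assms(1))
  ultimately show ?thesis using assms(2) by (simp add: H.m_assoc [symmetric])
qed

text \<open>Each generator of the lattice is twice a half period, and the projective factor picked
  up by a half period squares to one.\<close>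

lemma G_periodic:
  assumes z: "z \<notin> half_lattice \<tau>" and w: "w \<in> period_lattice \<tau>"
  shows "PGL2_class (G (z + w)) = PGL2_class (G z)"
proof -
  \<comment> \<open>The value {} on the half lattice makes \<open>g\<close> a total function for
    which periodicity is trivial there, so that lattice induction applies.\<close>
  define g where "g = (\<lambda>z. if z \<in> half_lattice \<tau> then {} else PGL2_class (G z))"
  have "g (z + 1) = g z" for z
    using shift1[of "z + 1/2"] shift1[of z] half_shifts(1)[of z] half_shifts(1)[of "z + 1/2"]
      twisted_square[OF s1(1) G_carrier[of z]] by (simp add: g_def add.assoc)
  moreover have "g (z + \<tau>) = g z" for z
    using shift2[of "z + \<tau>/2"] shift2[of z] half_shifts(2)[of z] half_shifts(2)[of "z + \<tau>/2"]
      twisted_square[OF s2(1) G_carrier[of z]] by (simp add: g_def add.assoc)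
  ultimately have "g (z + w) = g z"
    by (intro doubly_periodic_lattice[OF _ w]) (simp add: doubly_periodic_def)
  moreover have "z + w \<notin> half_lattice \<tau>"
    using z half_lattice_add_cancel[OF lattice_subset_half[OF w]] by simp
  ultimately show ?thesis using z by (simp add: g_def)
qed

lemma G_shift:
  assumes z: "z \<notin> half_lattice \<tau>" and \<gamma>: "\<gamma> \<in> carrier D2" and w: "w - shift \<gamma> \<in> period_lattice \<tau>"
  shows "PGL2_class (G (z + w)) = twisted M \<gamma> \<otimes>\<^bsub>PGL2\<^esub> PGL2_class (G z)"
proof -
  interpret H: group PGL2 by (rule group_PGL2)
  have tw: "twisted M \<gamma> \<in> carrier PGL2" if "\<gamma> \<in> carrier D2" for \<gamma>
    using twisted_hom(1)[OF M] that by (auto simp: hom_def)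
  have red: "PGL2_class (G (z + w)) = PGL2_class (G (z + w'))"
    if "w' - shift \<gamma> \<in> period_lattice \<tau>" "z + w' \<notin> half_lattice \<tau>" for w'
    using G_periodic[OF that(2) period_lattice_diff[OF w that(1)]] by (simp add: algebra_simps)
  from \<gamma> consider "\<gamma> = \<one>\<^bsub>D2\<^esub>" | "\<gamma> = s1" | "\<gamma> = s2" | "\<gamma> = s1 \<otimes>\<^bsub>D2\<^esub> s2"
    unfolding D2_generated by blast
  then show ?thesis
  proof cases
    case 1
    then show ?thesis
      using red[of 0] shift_one z G_carrier[OF z] hom_one[OF twisted_hom(1)[OF M] group_D2 group_PGL2]
      by simp
  next
    case 2
    then show ?thesis using red[of "1/2"] s1 shift1[OF z] half_shifts z by simp
  next
    case 3
    then show ?thesis using red[of "\<tau>/2"] s2 shift2[OF z] half_shifts z by simp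
  next
    case 4
    have "1/2 + \<tau>/2 - shift \<gamma> \<in> period_lattice \<tau>"
      using period_lattice_diff[OF period_lattice_add[OF s1(2) s2(2)] shift_prod[OF s1(1) s2(1)]]
      by (simp add: 4 algebra_simps)
    moreover have "z + (1/2 + \<tau>/2) \<notin> half_lattice \<tau>"
      using z half_shifts(1)[of "z + \<tau>/2"] half_shifts(2)[of z] by (simp add: add_ac)
    ultimately have "PGL2_class (G (z + w)) = PGL2_class (G (z + (1/2 + \<tau>/2)))" by (rule red)
    also have "\<dots> = twisted M s1 \<otimes>\<^bsub>PGL2\<^esub> (twisted M s2 \<otimes>\<^bsub>PGL2\<^esub> PGL2_class (G z))"
      using shift1[of "z + \<tau>/2"] shift2[OF z] half_shifts(2)[of z] z by (simp add: add_ac)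
    also have "\<dots> = twisted M \<gamma> \<otimes>\<^bsub>PGL2\<^esub> PGL2_class (G z)"
      unfolding 4 using hom_mult[OF twisted_hom(1)[OF M] s1(1) s2(1)] tw[OF s1(1)] tw[OF s2(1)] G_carrier[OF z]
      by (simp add: H.m_assoc)
    finally show ?thesis .
  qed
qed

text \<open>Formulated for arbitrary entries because it is applied to \<open>G\<close> and to its
  adjugate. Periodicity is asked of \<open>R\<close> only, as the entries themselves change by
  factors of automorphy.\<close>

lemma coefficient_in_mero_ring:
  assumes \<phi>: "functional \<phi>"
    and mero': "a' meromorphic_on UNIV" "b' meromorphic_on UNIV" "c' meromorphic_on UNIV" "d' meromorphic_on UNIV"
    and ana': "\<And>z. z \<notin> half_lattice \<tau> \<Longrightarrow> a' analytic_on {z} \<and> b' analytic_on {z} \<and> c' analytic_on {z} \<and> d' analytic_on {z}"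
    and det': "\<And>z. z \<notin> half_lattice \<tau> \<Longrightarrow> a' z * d' z - b' z * c' z \<noteq> 0"
    and per: "\<And>z w. z \<notin> half_lattice \<tau> \<Longrightarrow> w \<in> period_lattice \<tau> \<Longrightarrow>
      R (mat2 (a' (z + w)) (b' (z + w)) (c' (z + w)) (d' (z + w))) = R (mat2 (a' z) (b' z) (c' z) (d' z))"
  shows "zero_off U (\<lambda>p. \<phi> (R (mat2 (a' (rep p)) (b' (rep p)) (c' (rep p)) (d' (rep p))) v)) \<in> \<O>"
proof (rule mero_ringI[of _ "\<lambda>z. \<phi> (R (mat2 (a' z) (b' z) (c' z) (d' z)) v)"])
  fix z assume z: "z \<notin> poles"
  then have z': "z \<notin> half_lattice \<tau>" using half_lattice_poles by blast
  have "R (mat2 (a' (rep (tproj \<tau> z))) (b' (rep (tproj \<tau> z))) (c' (rep (tproj \<tau> z))) (d' (rep (tproj \<tau> z))))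
     = R (mat2 (a' z) (b' z) (c' z) (d' z))"
    using per[OF z' rep_tproj[of \<tau> z]] by simp
  then show "zero_off U (\<lambda>p. \<phi> (R (mat2 (a' (rep p)) (b' (rep p)) (c' (rep p)) (d' (rep p))) v)) (tproj \<tau> z)
    = \<phi> (R (mat2 (a' z) (b' z) (c' z) (d' z)) v)"
    using z by (simp add: zero_off_def tproj_U_iff)
  show "(\<lambda>z. \<phi> (R (mat2 (a' z) (b' z) (c' z) (d' z)) v)) analytic_on {z}"
    using ana'[OF z'] det'[OF z'] by (intro R_coefficient_analytic \<phi>) auto
next
  have "(\<lambda>z. \<phi> (R (mat2 (a' z) (b' z) (c' z) (d' z)) v)) meromorphic_on {z}" for z
  proof (rule R_coefficient_meromorphic[OF \<phi>])
    have "\<forall>\<^sub>F w in at z. w \<notin> half_lattice \<tau>" using eventually_notin_half_lattice[OF \<tau>, of 0 z] by simp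
    then show "\<forall>\<^sub>F w in at z. a' analytic_on {w} \<and> b' analytic_on {w} \<and> c' analytic_on {w} \<and> d' analytic_on {w} \<and>
      a' w * d' w - b' w * c' w \<noteq> 0"
      by (rule eventually_mono) (use ana' det' in blast)
  qed (use mero' in \<open>auto intro: meromorphic_on_subset\<close>)
  then show "(\<lambda>z. \<phi> (R (mat2 (a' z) (b' z) (c' z) (d' z)) v)) meromorphic_on UNIV"
    using meromorphic_on_meromorphic_at by blast
qed (simp add: zero_off_def)

text \<open>The pointwise inverse is expressed by the adjugates of M and of G, so the same lemma
  handles its coefficients. Equivariance follows from M twisted(\<gamma>) = \<delta>(\<gamma>)
  M.\<close>

lemma trivialises_matrix: "trivialises (\<lambda>p. \<rho>b M \<circ> \<rho>b (PGL2_class (G (rep p))))"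
proof -
  interpret H: group PGL2 by (rule group_PGL2)
  obtain m1 m2 m3 m4 where m: "invertible (mat2 m1 m2 m3 m4)" "M = PGL2_class (mat2 m1 m2 m3 m4)"
    using PGL2_carrierE[OF M] mat2_cases by metis
  have m_det: "m1 * m4 - m2 * m3 \<noteq> 0" using m(1) by (simp add: invertible_mat2)
  define A where "A = mat2 m1 m2 m3 m4"
  define A' where "A' = mat2 m4 (- m2) (- m3) m1"
  define G' where "G' = (\<lambda>z. mat2 (d z) (- b z) (- c z) (a z))"
  have A: "invertible A" "\<rho>b M = R A" using m by (simp_all add: A_def R_def)
  have A': "R A \<circ> R A' = id" "R A' \<circ> R A = id" "invertible A'"
    unfolding A_def A'_def using R_inverse[OF m_det] m_det by (simp_all add: invertible_mat2 mult.commute)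
  have rep_U: "rep p \<notin> half_lattice \<tau>" if "p \<in> U" for p
    using that half_lattice_poles[of "rep p"] tproj_U_iff[of "rep p"] tproj_rep[OF U_torus[OF that]] by auto
  have GG': "R (G z) \<circ> R (G' z) = id" "R (G' z) \<circ> R (G z) = id" if "z \<notin> half_lattice \<tau>" for z
    unfolding G'_def using R_inverse[OF det[OF that]] by auto
  have perG: "R (G (z + w)) = R (G z)" if "z \<notin> half_lattice \<tau>" "w \<in> period_lattice \<tau>" for z w
    using G_periodic[OF that] by (simp add: R_def)
  \<comment> \<open>Periodicity passes from \<open>R (G z)\<close> to \<open>R (G' z)\<close> by
    uniqueness of inverses.\<close>
  have perG': "R (G' (z + w)) = R (G' z)" if zw: "z \<notin> half_lattice \<tau>" "w \<in> period_lattice \<tau>" for z w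
  proof -
    have zw': "z + w \<notin> half_lattice \<tau>" using zw half_lattice_add_cancel[OF lattice_subset_half] by blast
    have "R (G' (z + w)) = R (G' (z + w)) \<circ> (R (G z) \<circ> R (G' z))" using GG'(1)[OF zw(1)] by simp
    also have "\<dots> = (R (G' (z + w)) \<circ> R (G (z + w))) \<circ> R (G' z)" by (simp add: perG[OF zw] o_assoc)
    finally show ?thesis using GG'(2)[OF zw'] by simp
  qed
  have inv_T: "inv_into UNIV (\<rho>b M \<circ> \<rho>b (PGL2_class (G (rep p)))) = R (G' (rep p)) \<circ> R A'" if "p \<in> U" for p
  proof (rule inv_unique_comp)
    have "(R A \<circ> R (G (rep p))) \<circ> (R (G' (rep p)) \<circ> R A') = R A \<circ> (R (G (rep p)) \<circ> R (G' (rep p))) \<circ> R A'"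
      by (simp only: o_assoc)
    then show "(\<rho>b M \<circ> \<rho>b (PGL2_class (G (rep p)))) \<circ> (R (G' (rep p)) \<circ> R A') = id"
      using GG'(1)[OF rep_U[OF that]] A'(1) A(2) by (simp add: R_def)
    have "(R (G' (rep p)) \<circ> R A') \<circ> (R A \<circ> R (G (rep p))) = R (G' (rep p)) \<circ> (R A' \<circ> R A) \<circ> R (G (rep p))"
      by (simp only: o_assoc)
    then show "(R (G' (rep p)) \<circ> R A') \<circ> (\<rho>b M \<circ> \<rho>b (PGL2_class (G (rep p)))) = id"
      using GG'(2)[OF rep_U[OF that]] A'(2) A(2) by (simp add: R_def)
  qed
  show ?thesis
    unfolding trivialises_def
  proof (intro conjI ballI allI impI)
    fix p assume p: "p \<in> U"
    have "R A \<in> carrier Inn" "R (G (rep p)) \<in> carrier Inn"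
      using A(1) G_invertible[OF rep_U[OF p]] R_carrier by blast+
    then show "\<rho>b M \<circ> \<rho>b (PGL2_class (G (rep p))) \<in> carrier Inn"
      using monoid.m_closed[OF group.is_monoid[OF group_Inn]] A(2) by (fastforce simp: Inn_simps R_def)
  next
    fix \<gamma> p assume \<gamma>: "\<gamma> \<in> carrier D2" and p: "p \<in> U"
    have "tproj \<tau> (rep (\<sigma> \<gamma> p)) = tproj \<tau> (rep p + shift \<gamma>)"
      using tproj_rep[OF sigma_torus[OF \<gamma> U_torus[OF p]]] sigma_tproj[OF \<gamma>, of "rep p"] tproj_rep[OF U_torus[OF p]]
      by simp
    then have w: "(rep (\<sigma> \<gamma> p) - rep p) - shift \<gamma> \<in> period_lattice \<tau>"
      by (simp add: tproj_eq_iff algebra_simps)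
    have Gs: "PGL2_class (G (rep (\<sigma> \<gamma> p))) = twisted M \<gamma> \<otimes>\<^bsub>PGL2\<^esub> PGL2_class (G (rep p))"
      using G_shift[OF rep_U[OF p] \<gamma> w] by simp
    have tw: "twisted M \<gamma> \<in> carrier PGL2" "\<delta> \<gamma> \<in> carrier PGL2"
      using twisted_hom(1)[OF M] \<delta> \<gamma> by (auto simp: hom_def)
    have "\<rho>b M \<circ> \<rho>b (PGL2_class (G (rep (\<sigma> \<gamma> p)))) = \<rho>b (M \<otimes>\<^bsub>PGL2\<^esub> (twisted M \<gamma> \<otimes>\<^bsub>PGL2\<^esub> PGL2_class (G (rep p))))"
      unfolding Gs using hom_mult[OF rho_hom] M tw G_carrier[OF rep_U[OF p]] by (simp add: Inn_simps)
    also have "M \<otimes>\<^bsub>PGL2\<^esub> (twisted M \<gamma> \<otimes>\<^bsub>PGL2\<^esub> PGL2_class (G (rep p))) = \<delta> \<gamma> \<otimes>\<^bsub>PGL2\<^esub> (M \<otimes>\<^bsub>PGL2\<^esub> PGL2_class (G (rep p)))"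
      using M tw G_carrier[OF rep_U[OF p]] twisted_hom(2)[OF M \<gamma>] by (simp add: H.m_assoc [symmetric])
    also have "\<rho>b \<dots> = \<rho> \<gamma> \<circ> (\<rho>b M \<circ> \<rho>b (PGL2_class (G (rep p))))"
      using hom_mult[OF rho_hom] M tw G_carrier[OF rep_U[OF p]] factors \<gamma> by (simp add: Inn_simps)
    finally show "\<rho>b M \<circ> \<rho>b (PGL2_class (G (rep (\<sigma> \<gamma> p)))) = \<rho> \<gamma> \<circ> (\<rho>b M \<circ> \<rho>b (PGL2_class (G (rep p))))" .
  next
    fix \<phi> v assume \<phi>: "functional \<phi>"
    have "zero_off U (\<lambda>p. \<phi> (R A (R (G (rep p)) v))) \<in> \<O>"
      using coefficient_in_mero_ring[OF functional_comp[OF \<phi> R_linear[OF A(1)]] mero _ det perG] ana by blast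
    then show "zero_off U (\<lambda>p. \<phi> ((\<rho>b M \<circ> \<rho>b (PGL2_class (G (rep p)))) v)) \<in> \<O>"
      by (simp add: A(2) R_def)
    have "zero_off U (\<lambda>p. \<phi> (R (G' (rep p)) (R A' v))) \<in> \<O>"
      unfolding G'_def
    proof (rule coefficient_in_mero_ring[OF \<phi>])
      show "(\<lambda>z. - b z) meromorphic_on UNIV" "(\<lambda>z. - c z) meromorphic_on UNIV"
        using mero by (auto intro!: meromorphic_intros)
      show "d analytic_on {z} \<and> (\<lambda>z. - b z) analytic_on {z} \<and> (\<lambda>z. - c z) analytic_on {z} \<and> a analytic_on {z}"
        if "z \<notin> half_lattice \<tau>" for z using ana that by (auto intro!: analytic_intros)
      show "d z * a z - - b z * - c z \<noteq> 0" if "z \<notin> half_lattice \<tau>" for z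
        using det[OF that] by (simp add: mult.commute)
      show "R (mat2 (d (z + w)) (- b (z + w)) (- c (z + w)) (a (z + w))) = R (mat2 (d z) (- b z) (- c z) (a z))"
        if "z \<notin> half_lattice \<tau>" "w \<in> period_lattice \<tau>" for z w
        using perG'[OF that] by (simp add: G'_def)
    qed (use mero in auto)
    moreover have "zero_off U (\<lambda>p. \<phi> (inv_into UNIV (\<rho>b M \<circ> \<rho>b (PGL2_class (G (rep p)))) v))
        = zero_off U (\<lambda>p. \<phi> (R (G' (rep p)) (R A' v)))"
      by (auto simp: zero_off_def fun_eq_iff inv_T simp del: comp_apply) simp
    ultimately show "zero_off U (\<lambda>p. \<phi> (inv_into UNIV (\<rho>b M \<circ> \<rho>b (PGL2_class (G (rep p)))) v)) \<in> \<O>" by simp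
  qed
qed

end

end

subsection \<open>The explicit intertwiner\<close>

context
  fixes \<tau> :: complex
  assumes \<tau>: "Im \<tau> > 0"
begin

lemma \<tau>2: "Im (2 * \<tau>) > 0"
  using \<tau> by simp

text \<open>The case of \<open>theta3\<close> is \<open>theta3_mult\<close> with equal arguments.
  Translating w by 1/2, by \<tau> / 2 and by both produces the other three.\<close>

lemma theta_squares:
  defines "\<alpha> \<equiv> theta3 0 (2 * \<tau>)" and "\<beta> \<equiv> theta2 0 (2 * \<tau>)"
  shows "theta3 w \<tau> ^ 2 = \<alpha> * theta3 (2 * w) (2 * \<tau>) + \<beta> * theta2 (2 * w) (2 * \<tau>)"
    "theta4 w \<tau> ^ 2 = \<alpha> * theta3 (2 * w) (2 * \<tau>) - \<beta> * theta2 (2 * w) (2 * \<tau>)"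
    "theta2 w \<tau> ^ 2 = \<alpha> * theta2 (2 * w) (2 * \<tau>) + \<beta> * theta3 (2 * w) (2 * \<tau>)"
    "theta1 w \<tau> ^ 2 = \<beta> * theta3 (2 * w) (2 * \<tau>) - \<alpha> * theta2 (2 * w) (2 * \<tau>)"
proof -
  show 3: "theta3 w \<tau> ^ 2 = \<alpha> * theta3 (2 * w) (2 * \<tau>) + \<beta> * theta2 (2 * w) (2 * \<tau>)" for w
    using theta3_mult[OF \<tau>, of w w] by (simp add: \<alpha>_def \<beta>_def power2_eq_square mult.commute)
  show "theta4 w \<tau> ^ 2 = \<alpha> * theta3 (2 * w) (2 * \<tau>) - \<beta> * theta2 (2 * w) (2 * \<tau>)"
    using 3[of "w + 1/2"] by (simp add: theta3_add_half theta_add_1 ring_distribs)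
  \<comment> \<open>Translating w by \<tau> / 2 translates 2 w by half of the period 2 \<tau>, so
    the square of the factor at \<tau> has to agree with the factor at 2 \<tau>.\<close>
  have "exp (- (of_real pi * \<i> * \<tau>) / 4 - of_real pi * \<i> * w) ^ 2 = exp (- (of_real pi * \<i> * (2 * \<tau>)) / 4 - of_real pi * \<i> * (2 * w))" for w
    by (simp add: power2_eq_square exp_add [symmetric]) (simp add: field_simps)
  then have q: "qfac_half \<tau> w ^ 2 = qfac_half (2 * \<tau>) (2 * w)" for w
    by (simp add: qfac_half_def)
  show 2: "theta2 w \<tau> ^ 2 = \<alpha> * theta2 (2 * w) (2 * \<tau>) + \<beta> * theta3 (2 * w) (2 * \<tau>)" for w
  proof -
    have "qfac_half \<tau> w ^ 2 * theta2 w \<tau> ^ 2 = theta3 (w + \<tau> / 2) \<tau> ^ 2"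
      by (simp add: theta3_add_half_tau power_mult_distrib)
    also have "\<dots> = \<alpha> * theta3 (2 * w + (2 * \<tau>) / 2) (2 * \<tau>) + \<beta> * theta2 (2 * w + (2 * \<tau>) / 2) (2 * \<tau>)"
      unfolding 3 by (simp add: ring_distribs)
    also have "\<dots> = qfac_half \<tau> w ^ 2 * (\<alpha> * theta2 (2 * w) (2 * \<tau>) + \<beta> * theta3 (2 * w) (2 * \<tau>))"
      unfolding q theta3_add_half_tau theta2_add_half_tau[OF \<tau>2] by (simp add: algebra_simps)
    finally show ?thesis by simp
  qed
  show "theta1 w \<tau> ^ 2 = \<beta> * theta3 (2 * w) (2 * \<tau>) - \<alpha> * theta2 (2 * w) (2 * \<tau>)"
    using 2[of "w + 1/2"] by (simp add: theta2_add_half theta_add_1 ring_distribs)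
qed

text \<open>These are \<open>theta3_mult\<close> at (w, 0) and at (w + 1/2, 1/2).\<close>

lemma theta_doubling:
  "theta3 w \<tau> * theta3 0 \<tau> = theta3 w (2 * \<tau>) ^ 2 + theta2 w (2 * \<tau>) ^ 2"
  "theta4 w \<tau> * theta4 0 \<tau> = theta3 w (2 * \<tau>) ^ 2 - theta2 w (2 * \<tau>) ^ 2"
proof -
  show "theta3 w \<tau> * theta3 0 \<tau> = theta3 w (2 * \<tau>) ^ 2 + theta2 w (2 * \<tau>) ^ 2"
    using theta3_mult[OF \<tau>, of w 0] by (simp add: power2_eq_square)
  show "theta4 w \<tau> * theta4 0 \<tau> = theta3 w (2 * \<tau>) ^ 2 - theta2 w (2 * \<tau>) ^ 2"
    using theta3_mult[OF \<tau>, of "w + 1/2" "1/2"] theta3_add_half[of 0 \<tau>]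
    by (simp add: theta3_add_half theta_add_1 power2_eq_square add.assoc)
qed

text \<open>All squares are linear in theta2 (2 w) and theta3 (2 w) at 2 \<tau>, and the constants
  become \<alpha>^2 + \<beta>^2, \<alpha>^2 - \<beta>^2 and 2 \<alpha> \<beta>. What remains is a
  polynomial identity.\<close>

lemma theta_jacobi:
  "theta2 0 \<tau> ^ 2 * theta1 w \<tau> ^ 2 = theta3 0 \<tau> ^ 2 * theta4 w \<tau> ^ 2 - theta4 0 \<tau> ^ 2 * theta3 w \<tau> ^ 2"
  unfolding theta_squares[of w] theta_squares[of 0] by simp algebra

text \<open>Multiplying by theta1 (w) clears the denominators of \<open>psi\<close>. The doubling
  formulas turn x^2 + y^2 and x^2 - y^2 into multiples of theta3 and theta4, and Jacobi's identity
  collapses the result. The determinant thus has no zeros off the half lattice.\<close>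

lemma Omega_det:
  assumes "z \<notin> half_lattice \<tau>"
  shows "psi \<tau> (-1) z * theta2 (2 * z) (2 * \<tau>) * theta2 (2 * z) (2 * \<tau>)
      - theta3 (2 * z) (2 * \<tau>) * (psi \<tau> 1 z * theta3 (2 * z) (2 * \<tau>)) = theta2 0 \<tau> ^ 2 * theta1 (2 * z) \<tau>"
proof -
  define w where "w = 2 * z"
  have t1: "theta1 w \<tau> \<noteq> 0"
    using assms by (simp add: theta1_zero_iff[OF \<tau>] half_lattice_iff w_def)
  define x where "x = theta3 w (2 * \<tau>)"
  define y where "y = theta2 w (2 * \<tau>)"
  define A where "A = theta4 0 \<tau> ^ 2 / theta3 0 \<tau>"
  define B where "B = theta3 0 \<tau> ^ 2 / theta4 0 \<tau>"
  have psi: "psi \<tau> s z * theta1 w \<tau> = s * A * theta3 w \<tau> - B * theta4 w \<tau>" for s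
    using t1 by (simp add: psi_def A_def B_def w_def field_simps)
  have nz: "theta3 0 \<tau> \<noteq> 0" "theta4 0 \<tau> \<noteq> 0" using theta_constants_nonzero[OF \<tau>] by auto
  have "(psi \<tau> (-1) z * y * y - x * (psi \<tau> 1 z * x)) * theta1 w \<tau>
      = (psi \<tau> (-1) z * theta1 w \<tau>) * y ^ 2 - (psi \<tau> 1 z * theta1 w \<tau>) * x ^ 2"
    by (simp add: power2_eq_square algebra_simps)
  also have "\<dots> = B * theta4 w \<tau> * (x ^ 2 - y ^ 2) - A * theta3 w \<tau> * (x ^ 2 + y ^ 2)"
    unfolding psi by (simp add: algebra_simps)
  also have "\<dots> = (B * theta4 0 \<tau>) * theta4 w \<tau> ^ 2 - (A * theta3 0 \<tau>) * theta3 w \<tau> ^ 2"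
    unfolding x_def y_def theta_doubling [symmetric] by (simp add: power2_eq_square algebra_simps)
  also have "\<dots> = (theta2 0 \<tau> ^ 2 * theta1 w \<tau>) * theta1 w \<tau>"
    using theta_jacobi[of w] nz by (simp add: A_def B_def power2_eq_square mult.assoc)
  finally show ?thesis
    using t1 by (simp add: x_def y_def w_def)
qed

lemma psi_shift:
  "psi \<tau> s (z + 1/2) = - psi \<tau> s z" "psi \<tau> s (z + \<tau>/2) = psi \<tau> (- s) z"
  by (simp_all add: psi_def ring_distribs theta_add_1 theta_add_tau[OF \<tau>] qfac_nonzero)

lemma theta_double_shift:
  "theta2 (2 * (z + 1/2)) (2 * \<tau>) = - theta2 (2 * z) (2 * \<tau>)"
  "theta3 (2 * (z + 1/2)) (2 * \<tau>) = theta3 (2 * z) (2 * \<tau>)"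
  "theta2 (2 * (z + \<tau>/2)) (2 * \<tau>) = qfac_half (2 * \<tau>) (2 * z) * theta3 (2 * z) (2 * \<tau>)"
  "theta3 (2 * (z + \<tau>/2)) (2 * \<tau>) = qfac_half (2 * \<tau>) (2 * z) * theta2 (2 * z) (2 * \<tau>)"
  using theta2_add_half_tau[OF \<tau>2, of "2 * z"] theta3_add_half_tau[of "2 * z" "2 * \<tau>"]
  by (simp_all add: ring_distribs theta_add_1)

text \<open>Translation by \<tau> / 2 exchanges the two signs in \<open>psi\<close> and also
  exchanges theta2 and theta3 at 2 \<tau>, so the rows are swapped up to a common scalar, which
  disappears in \<open>PGL2\<close>.\<close>

lemma Omega_shift:
  "Omega \<tau> (z + 1/2) = mat2 1 0 0 (-1) ** Omega \<tau> z"
  "Omega \<tau> (z + \<tau>/2) = mat (qfac_half (2 * \<tau>) (2 * z)) ** (mat2 0 1 1 0 ** Omega \<tau> z)"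
  unfolding Omega_def psi_shift theta_double_shift
  by (simp_all add: mat2_mult mat_eq_mat2)

lemma theta_holo_2 [holomorphic_intros]:
  assumes "f holomorphic_on A"
  shows "(\<lambda>z. theta2 (f z) (2 * \<tau>)) holomorphic_on A" "(\<lambda>z. theta3 (f z) (2 * \<tau>)) holomorphic_on A"
  using theta_holo[OF \<tau>2 assms] by auto

lemma psi_meromorphic: "psi \<tau> s meromorphic_on A"
  unfolding psi_def
  by (intro meromorphic_intros holomorphic_imp_meromorphic holomorphic_intros theta_holo \<tau>)

lemma psi_analytic:
  assumes "z \<notin> half_lattice \<tau>"
  shows "psi \<tau> s analytic_on {z}"
  unfolding psi_def using assms
  by (intro analytic_intros holomorphic_imp_analytic theta_holo \<tau> holomorphic_intros)
    (auto simp: theta1_zero_iff[OF \<tau>] half_lattice_iff)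

subsection \<open>A trivialisation for homomorphisms with image of order two\<close>

text \<open>The rows of the matrix are sections of a line bundle of order four and of its inverse over the
  elliptic curve with the origin removed; its square is the line bundle of the character.\<close>

definition twist_fun :: "complex \<Rightarrow> real \<Rightarrow> complex \<Rightarrow> complex" where
  "twist_fun s \<alpha> w = exp (- 2 * of_real pi * \<i> * of_real \<alpha> * w) * theta1 (w + s) \<tau> / theta1 w \<tau>"

text \<open>A constant multiple of the derivative of the Weierstrass function of the period lattice:
  odd, with a triple pole at the lattice points and zeros at the three nontrivial half
  periods.\<close>

definition theta_quot :: "complex \<Rightarrow> complex" where
  "theta_quot w = theta2 w \<tau> * theta3 w \<tau> * theta4 w \<tau> / theta1 w \<tau> ^ 3"

text \<open>The product with \<open>twist_fun s \<alpha>\<close> is elliptic, so this function has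
  the inverse multipliers. Since \<open>theta_quot\<close> is odd, the products for (s, \<alpha>)
  and (-s, -\<alpha>) differ by a constant, which becomes the determinant of the matrix.\<close>

definition second_fun :: "complex \<Rightarrow> real \<Rightarrow> complex \<Rightarrow> complex" where
  "second_fun s \<alpha> = remove_sings (\<lambda>w. (theta_quot w + theta_quot s) / twist_fun s \<alpha> w)"

lemma theta_quot_periodic: "doubly_periodic \<tau> theta_quot"
  by (simp add: doubly_periodic_def theta_quot_def theta_add_1 theta_add_tau[OF \<tau>] power3_eq_cube qfac_nonzero mult.assoc)

lemma theta_quot_minus: "theta_quot (- w) = - theta_quot w"
  by (simp add: theta_quot_def theta_even_odd[OF \<tau>] power3_eq_cube)

lemma twist_fun_shift:
  "twist_fun s \<alpha> (w + 1) = exp (- 2 * of_real pi * \<i> * of_real \<alpha>) * twist_fun s \<alpha> w"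
  "twist_fun s \<alpha> (w + \<tau>) = exp (- 2 * of_real pi * \<i> * (of_real \<alpha> * \<tau> + s)) * twist_fun s \<alpha> w"
proof -
  have s: "theta1 (w + 1 + s) \<tau> = - theta1 (w + s) \<tau>" "theta1 (w + \<tau> + s) \<tau> = - qfac \<tau> (w + s) * theta1 (w + s) \<tau>"
    using theta_add_1(1)[of "w + s" \<tau>] theta_add_tau(1)[OF \<tau>, of "w + s"] by (simp_all add: add_ac)
  show "twist_fun s \<alpha> (w + 1) = exp (- 2 * of_real pi * \<i> * of_real \<alpha>) * twist_fun s \<alpha> w"
  proof -
    have "exp (- 2 * of_real pi * \<i> * of_real \<alpha> * (w + 1))
        = exp (- 2 * of_real pi * \<i> * of_real \<alpha>) * exp (- 2 * of_real pi * \<i> * of_real \<alpha> * w)"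
      unfolding exp_add [symmetric] by (simp add: ring_distribs add.commute)
    then show ?thesis unfolding twist_fun_def s theta_add_1 by simp
  qed
  have q: "qfac \<tau> (w + s) = exp (- 2 * of_real pi * \<i> * s) * qfac \<tau> w"
    by (simp add: qfac_def exp_add [symmetric] algebra_simps)
  have e: "exp (- 2 * of_real pi * \<i> * of_real \<alpha> * (w + \<tau>)) * exp (- 2 * of_real pi * \<i> * s)
     = exp (- 2 * of_real pi * \<i> * (of_real \<alpha> * \<tau> + s)) * exp (- 2 * of_real pi * \<i> * of_real \<alpha> * w)"
    by (simp add: exp_add [symmetric] algebra_simps)
  have "twist_fun s \<alpha> (w + \<tau>) = (exp (- 2 * of_real pi * \<i> * of_real \<alpha> * (w + \<tau>)) * exp (- 2 * of_real pi * \<i> * s))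
      * theta1 (w + s) \<tau> / theta1 w \<tau>"
    unfolding twist_fun_def s q theta_add_tau[OF \<tau>] by (simp add: qfac_nonzero)
  then show "twist_fun s \<alpha> (w + \<tau>) = exp (- 2 * of_real pi * \<i> * (of_real \<alpha> * \<tau> + s)) * twist_fun s \<alpha> w"
    unfolding e by (simp add: twist_fun_def)
qed

lemma twist_fun_meromorphic: "twist_fun s \<alpha> meromorphic_on A"
  unfolding twist_fun_def
  by (intro meromorphic_intros holomorphic_imp_meromorphic holomorphic_intros theta_holo \<tau>)

lemma theta_quot_meromorphic: "theta_quot meromorphic_on A"
  unfolding theta_quot_def
  by (intro meromorphic_intros holomorphic_imp_meromorphic holomorphic_intros theta_holo \<tau>)

lemma twist_fun_analytic: "w \<notin> period_lattice \<tau> \<Longrightarrow> twist_fun s \<alpha> analytic_on {w}"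
  unfolding twist_fun_def
  by (intro analytic_on_divide holomorphic_imp_analytic holomorphic_intros theta_holo \<tau>)
    (simp add: theta1_zero_iff[OF \<tau>])

lemma theta_quot_analytic: "w \<notin> period_lattice \<tau> \<Longrightarrow> theta_quot analytic_on {w}"
  unfolding theta_quot_def
  by (intro analytic_on_divide holomorphic_imp_analytic holomorphic_intros theta_holo \<tau>)
    (simp add: theta1_zero_iff[OF \<tau>])

lemma twist_fun_zero_iff: "w \<notin> period_lattice \<tau> \<Longrightarrow> twist_fun s \<alpha> w = 0 \<longleftrightarrow> w + s \<in> period_lattice \<tau>"
  by (simp add: twist_fun_def theta1_zero_iff[OF \<tau>])

lemma second_fun_meromorphic: "second_fun s \<alpha> meromorphic_on A"
  unfolding second_fun_def
  by (intro remove_sings_meromorphic meromorphic_intros theta_quot_meromorphic twist_fun_meromorphic)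

text \<open>Where \<open>twist_fun s \<alpha>\<close> vanishes, to first order, so does the numerator of \<open>second_fun s \<alpha>\<close>.\<close>

lemma second_fun_analytic:
  assumes w: "w \<notin> period_lattice \<tau>"
  shows "second_fun s \<alpha> analytic_on {w}"
proof (cases "twist_fun s \<alpha> w = 0")
  case False
  then show ?thesis
    unfolding second_fun_def using w
    by (intro remove_sings_analytic_on analytic_on_divide analytic_on_add theta_quot_analytic twist_fun_analytic
        analytic_on_const) auto
next
  case True
  let ?num = "\<lambda>x. theta_quot x + theta_quot s"
  let ?f = "\<lambda>x. ?num x / twist_fun s \<alpha> x"
  have ws: "w + s \<in> period_lattice \<tau>" using True twist_fun_zero_iff[OF w] by simp
  have "theta_quot w = theta_quot (- s + (w + s))" by simp
  also have "\<dots> = theta_quot (- s)" by (rule doubly_periodic_lattice[OF theta_quot_periodic ws])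
  finally have num0: "?num w = 0" by (simp add: theta_quot_minus)
  have num': "(?num has_field_derivative deriv ?num w) (at w)"
    using theta_quot_analytic[OF w] by (intro analytic_derivI analytic_intros) auto
  define e where "e = exp (- 2 * of_real pi * \<i> * of_real \<alpha> * w) / theta1 w \<tau>"
  have e: "e \<noteq> 0" using w by (simp add: e_def theta1_zero_iff[OF \<tau>])
  have "(twist_fun s \<alpha> has_field_derivative e * deriv (\<lambda>z. theta1 z \<tau>) (w + s)) (at w)"
  proof -
    define E where "E = (\<lambda>x. exp (- 2 * of_real pi * \<i> * of_real \<alpha> * x) / theta1 x \<tau>)"
    have "E analytic_on {w}" unfolding E_def using w
      by (intro analytic_on_divide holomorphic_imp_analytic holomorphic_intros theta_holo \<tau>)
        (simp add: theta1_zero_iff[OF \<tau>])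
    then have E': "(E has_field_derivative deriv E w) (at w)" by (rule analytic_derivI)
    have t': "((\<lambda>x. theta1 (x + s) \<tau>) has_field_derivative deriv (\<lambda>z. theta1 z \<tau>) (w + s)) (at w)"
      using theta1_deriv[OF \<tau>, of "w + s"] by (simp add: DERIV_shift)
    have "((\<lambda>x. E x * theta1 (x + s) \<tau>) has_field_derivative
      deriv E w * theta1 (w + s) \<tau> + deriv (\<lambda>z. theta1 z \<tau>) (w + s) * E w) (at w)"
      by (rule DERIV_mult[OF E' t'])
    moreover have "theta1 (w + s) \<tau> = 0" using ws by (simp add: theta1_zero_iff[OF \<tau>])
    moreover have "E w = e" by (simp add: E_def e_def)
    moreover have "(\<lambda>x. E x * theta1 (x + s) \<tau>) = twist_fun s \<alpha>"
      by (simp add: fun_eq_iff twist_fun_def E_def)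
    ultimately show ?thesis by (simp add: mult.commute)
  qed
  then have "((\<lambda>x. (?num x / (x - w)) / (twist_fun s \<alpha> x / (x - w))) \<longlongrightarrow>
      deriv ?num w / (e * deriv (\<lambda>z. theta1 z \<tau>) (w + s))) (at w)"
    using num' num0 True e theta1_deriv_lattice[OF \<tau> ws]
    by (intro tendsto_divide) (auto simp: has_field_derivative_iff)
  moreover have "\<forall>\<^sub>F x in at w. (?num x / (x - w)) / (twist_fun s \<alpha> x / (x - w)) = ?f x"
    by (auto simp: eventually_at intro!: exI[of _ 1])
  ultimately have lim: "(?f \<longlongrightarrow> deriv ?num w / (e * deriv (\<lambda>z. theta1 z \<tau>) (w + s))) (at w)"
    by (rule Lim_transform_eventually)
  have "?f meromorphic_on {w}"
    by (intro meromorphic_intros theta_quot_meromorphic twist_fun_meromorphic)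
  then have "isolated_singularity_at ?f w" by (simp add: meromorphic_at_iff)
  then show ?thesis unfolding second_fun_def using lim by (rule remove_sings_analytic_at)
qed

lemma second_fun_eq:
  assumes "w \<notin> period_lattice \<tau>" "w + s \<notin> period_lattice \<tau>"
  shows "second_fun s \<alpha> w * twist_fun s \<alpha> w = theta_quot w + theta_quot s"
proof -
  have nz: "twist_fun s \<alpha> w \<noteq> 0" using assms by (simp add: twist_fun_zero_iff)
  have "(\<lambda>w. (theta_quot w + theta_quot s) / twist_fun s \<alpha> w) analytic_on {w}"
    using assms nz
    by (intro analytic_on_divide analytic_on_add theta_quot_analytic twist_fun_analytic analytic_on_const) auto
  then show ?thesis using nz by (simp add: second_fun_def)
qed

end

text \<open>Extends by continuity an identity checked only off isolated exceptional points, such as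
  the zeros of \<open>twist_fun\<close> or the punctures.\<close>

lemma analytic_eq_at:
  assumes "f analytic_on {z}" "g analytic_on {z}" "\<forall>\<^sub>F w in at z. f w = g w"
  shows "f z = g z"
proof -
  have "(f \<longlongrightarrow> f z) (at z)" "(g \<longlongrightarrow> g z) (at z)"
    using assms(1,2) by (auto intro!: isContD analytic_at_imp_isCont)
  then have "(f \<longlongrightarrow> g z) (at z)" using assms(3) by (simp add: tendsto_cong)
  then show ?thesis using \<open>(f \<longlongrightarrow> f z) (at z)\<close> tendsto_unique at_neq_bot by blast
qed

lemma eventually_notin_lattice:
  assumes \<tau>: "Im \<tau> > 0"
  shows "\<forall>\<^sub>F w in at z. w + s \<notin> period_lattice \<tau>"
  by (rule eventually_mono[OF eventually_notin_half_lattice[OF \<tau>, of "- s"]]) (auto dest: lattice_subset_half)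

context
  fixes \<tau> :: complex
  assumes \<tau>: "Im \<tau> > 0"
begin

lemma second_fun_shift:
  assumes w: "w \<notin> period_lattice \<tau>" and p: "p \<in> period_lattice \<tau>"
    and k: "k \<noteq> 0" "\<And>w. twist_fun \<tau> s \<alpha> (w + p) = k * twist_fun \<tau> s \<alpha> w"
  shows "second_fun \<tau> s \<alpha> (w + p) = second_fun \<tau> s \<alpha> w / k"
proof (rule analytic_eq_at[of "\<lambda>w. second_fun \<tau> s \<alpha> (w + p)" w "\<lambda>w. second_fun \<tau> s \<alpha> w / k"])
  have "second_fun \<tau> s \<alpha> analytic_on (\<lambda>w. w + p) ` {w}"
    using second_fun_analytic[OF \<tau>, of "w + p"] w p by simp
  then show "(\<lambda>w. second_fun \<tau> s \<alpha> (w + p)) analytic_on {w}"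
    using analytic_on_compose[of "\<lambda>w. w + p" "{w}" "second_fun \<tau> s \<alpha>"]
    by (simp add: o_def analytic_on_add analytic_on_ident analytic_on_const)
  show "(\<lambda>w. second_fun \<tau> s \<alpha> w / k) analytic_on {w}"
    using second_fun_analytic[OF \<tau> w] k(1) by (intro analytic_on_divide analytic_on_const) auto
  show "\<forall>\<^sub>F w in at w. second_fun \<tau> s \<alpha> (w + p) = second_fun \<tau> s \<alpha> w / k"
    using eventually_notin_lattice[OF \<tau>, of 0 w] eventually_notin_lattice[OF \<tau>, of s w]
  proof eventually_elim
    case (elim x)
    have x: "x \<notin> period_lattice \<tau>" "x + s \<notin> period_lattice \<tau>" using elim by auto
    have xp: "x + p \<notin> period_lattice \<tau>" "x + p + s \<notin> period_lattice \<tau>"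
      using x period_lattice_add_cancel[OF p, of x] period_lattice_add_cancel[OF p, of "x + s"]
      by (simp_all add: add_ac)
    have "second_fun \<tau> s \<alpha> (x + p) * (k * twist_fun \<tau> s \<alpha> x) = theta_quot \<tau> (x + p) + theta_quot \<tau> s"
      using second_fun_eq[OF \<tau> xp, of \<alpha>] by (simp add: k(2))
    also have "\<dots> = second_fun \<tau> s \<alpha> x * twist_fun \<tau> s \<alpha> x"
      using second_fun_eq[OF \<tau> x, of \<alpha>] doubly_periodic_lattice[OF theta_quot_periodic[OF \<tau>] p] by simp
    finally show ?case
      using k(1) twist_fun_zero_iff[OF \<tau> x(1)] x(2) by (simp add: field_simps)
  qed
qed

text \<open>The two products are theta_quot w - theta_quot s and theta_quot w + theta_quot s, so the
  dependence on w cancels.\<close>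

lemma second_fun_det:
  assumes w: "w \<notin> period_lattice \<tau>"
  shows "twist_fun \<tau> (- s) (- \<alpha>) w * second_fun \<tau> (- s) (- \<alpha>) w - second_fun \<tau> s \<alpha> w * twist_fun \<tau> s \<alpha> w
    = - 2 * theta_quot \<tau> s"
proof (rule analytic_eq_at[of "\<lambda>w. twist_fun \<tau> (- s) (- \<alpha>) w * second_fun \<tau> (- s) (- \<alpha>) w
    - second_fun \<tau> s \<alpha> w * twist_fun \<tau> s \<alpha> w" w "\<lambda>w. - 2 * theta_quot \<tau> s"])
  show "(\<lambda>w. twist_fun \<tau> (- s) (- \<alpha>) w * second_fun \<tau> (- s) (- \<alpha>) w - second_fun \<tau> s \<alpha> w * twist_fun \<tau> s \<alpha> w)
    analytic_on {w}"
    by (intro analytic_intros twist_fun_analytic second_fun_analytic \<tau> w)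
  show "\<forall>\<^sub>F w in at w. twist_fun \<tau> (- s) (- \<alpha>) w * second_fun \<tau> (- s) (- \<alpha>) w
      - second_fun \<tau> s \<alpha> w * twist_fun \<tau> s \<alpha> w = - 2 * theta_quot \<tau> s"
    using eventually_notin_lattice[OF \<tau>, of 0 w] eventually_notin_lattice[OF \<tau>, of s w]
      eventually_notin_lattice[OF \<tau>, of "- s" w]
  proof eventually_elim
    case (elim x)
    then show ?case
      using second_fun_eq[OF \<tau>, of x s \<alpha>] second_fun_eq[OF \<tau>, of x "- s" "- \<alpha>"]
      by (simp add: theta_quot_minus[OF \<tau>] mult.commute)
  qed
qed simp

text \<open>A zero of one of the theta factors in the numerator, or of \<open>theta1\<close> in the
  denominator, would make s a half period.\<close>

lemma theta_quot_nonzero: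
  assumes "2 * s \<notin> period_lattice \<tau>"
  shows "theta_quot \<tau> s \<noteq> 0"
proof -
  have "s + h \<notin> period_lattice \<tau>" if h: "2 * h \<in> period_lattice \<tau>" for h
  proof
    assume *: "s + h \<in> period_lattice \<tau>"
    have "2 * s = (s + h) + (s + h) - 2 * h" by simp
    also have "\<dots> \<in> period_lattice \<tau>"
      using period_lattice_diff[OF period_lattice_add[OF * *] h] .
    finally show False using assms by simp
  qed
  from this[of 0] this[of "1/2"] this[of "\<tau>/2"] this[of "1/2 + \<tau>/2"]
  have "s \<notin> period_lattice \<tau>" "s + 1/2 \<notin> period_lattice \<tau>" "s + \<tau>/2 \<notin> period_lattice \<tau>"
    "s + 1/2 + \<tau>/2 \<notin> period_lattice \<tau>"
    by (simp_all add: period_lattice_add add.assoc ring_distribs)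
  then show ?thesis
    unfolding theta_quot_def[OF \<tau>]
    by (simp add: theta1_zero_iff[OF \<tau>] theta2_zero_iff[OF \<tau>] theta3_zero_iff[OF \<tau>] theta4_zero_iff[OF \<tau>])
qed

end

subsection \<open>Involutions in \<open>PGL(2,\<complex>)\<close>\<close>

definition diag_class :: "complex \<Rightarrow> (complex^2^2) set" where
  "diag_class x = PGL2_class (mat2 1 0 0 x)"

definition swap_class :: "(complex^2^2) set" where
  "swap_class = PGL2_class (mat2 0 1 1 0)"

lemma diag_class_carrier: "x \<noteq> 0 \<Longrightarrow> diag_class x \<in> carrier PGL2"
  by (simp add: diag_class_def PGL2_class_in_carrier invertible_mat2)

lemma swap_class_carrier: "swap_class \<in> carrier PGL2"
  by (simp add: swap_class_def PGL2_class_in_carrier invertible_mat2)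

lemma diag_class_1: "diag_class 1 = \<one>\<^bsub>PGL2\<^esub>"
  by (simp add: diag_class_def PGL2_one mat_eq_mat2)

lemma PGL2_conjugate:
  assumes "invertible A" "invertible B" "invertible M" "k \<noteq> 0" "A ** M = mat k ** (M ** B)"
  shows "PGL2_class A = PGL2_class M \<otimes>\<^bsub>PGL2\<^esub> PGL2_class B \<otimes>\<^bsub>PGL2\<^esub> inv\<^bsub>PGL2\<^esub> (PGL2_class M)"
proof -
  interpret H: group PGL2 by (rule group_PGL2)
  have c: "PGL2_class A \<in> carrier PGL2" "PGL2_class B \<in> carrier PGL2" "PGL2_class M \<in> carrier PGL2"
    using assms PGL2_class_in_carrier by auto
  have "PGL2_class A \<otimes>\<^bsub>PGL2\<^esub> PGL2_class M = PGL2_class M \<otimes>\<^bsub>PGL2\<^esub> PGL2_class B"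
    using assms PGL2_class_mult[of A M] PGL2_class_mult[of M B] PGL2_class_scale[OF assms(4), of "M ** B"] by simp
  then have "PGL2_class A \<otimes>\<^bsub>PGL2\<^esub> PGL2_class M \<otimes>\<^bsub>PGL2\<^esub> inv\<^bsub>PGL2\<^esub> (PGL2_class M)
      = PGL2_class M \<otimes>\<^bsub>PGL2\<^esub> PGL2_class B \<otimes>\<^bsub>PGL2\<^esub> inv\<^bsub>PGL2\<^esub> (PGL2_class M)" by simp
  then show ?thesis using c by (simp add: H.m_assoc)
qed

text \<open>A representative has a scalar square without being scalar, so its trace vanishes: the
  off-diagonal entries of the square are (a + d) b and (a + d) c, the diagonal ones differ by (a +
  d)(a - d). The eigenvalues are then r and -r with r^2 = -det.\<close>

lemma involution_diagonalisable:
  assumes X: "X \<in> carrier PGL2" "X \<otimes>\<^bsub>PGL2\<^esub> X = \<one>\<^bsub>PGL2\<^esub>" "X \<noteq> \<one>\<^bsub>PGL2\<^esub>"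
  obtains m where "m \<in> carrier PGL2" "X = m \<otimes>\<^bsub>PGL2\<^esub> diag_class (-1) \<otimes>\<^bsub>PGL2\<^esub> inv\<^bsub>PGL2\<^esub> m"
proof -
  obtain a b c d where A: "invertible (mat2 a b c d)" "X = PGL2_class (mat2 a b c d)"
    using PGL2_carrierE[OF X(1)] mat2_cases by metis
  have "PGL2_class (mat2 a b c d ** mat2 a b c d) = PGL2_class (mat 1)"
    using X(2) PGL2_class_mult[OF A(1) A(1)] by (simp add: A(2) PGL2_one)
  then obtain k where k: "mat2 a b c d ** mat2 a b c d = mat k ** mat 1"
    using PGL2_class_eqD by blast
  then have sq: "a * b + b * d = 0" "c * a + d * c = 0" "a * a + b * c = c * b + d * d"
    by (auto simp: mat2_mult mat_eq_mat2)
  have d: "d = - a"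
  proof (rule ccontr)
    assume "d \<noteq> - a"
    then have ad: "a + d \<noteq> 0" by (simp add: eq_neg_iff_add_eq_0 add.commute)
    have "(a + d) * b = 0" "(a + d) * c = 0" "(a + d) * (a - d) = 0"
      using sq by (simp_all add: algebra_simps)
    then have bcd: "b = 0" "c = 0" "d = a" using ad by auto
    have "a \<noteq> 0" using A(1) bcd by (simp add: invertible_mat2)
    then have "X = \<one>\<^bsub>PGL2\<^esub>"
      using PGL2_class_scale[of a "mat 1"] bcd by (simp add: A(2) PGL2_one mat_eq_mat2 mat2_mult)
    then show False using X(3) by simp
  qed
  \<comment> \<open>For b = 0 the root is fixed to be a, since \<open>csqrt\<close> of a^2 might
    return -a and the matrix below uses the order of the eigenvalues.\<close>
  define r where "r = (if b = 0 then a else csqrt (a * a + b * c))"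
  have r2: "r * r = a * a + b * c" 
    using power2_csqrt[of "a * a + b * c"] by (simp add: r_def power2_eq_square)
  have "a * (- a) - b * c \<noteq> 0" using A(1) by (simp add: invertible_mat2 d)
  moreover have "r * r = - (a * (- a) - b * c)" using r2 by simp
  ultimately have r0: "r \<noteq> 0" by (metis mult_zero_left neg_equal_0_iff_equal)
  \<comment> \<open>The columns are eigenvectors for r and -r. For b = 0 the general formulas (b, r
    - a) and (b, -r - a) degenerate, and (2 a, c), (0, 1) are used instead.\<close>
  define M where "M = (if b = 0 then mat2 (2 * a) 0 c 1 else mat2 b b (r - a) (- r - a))"
  have M: "invertible M"
    using r0 by (auto simp: M_def invertible_mat2 r_def algebra_simps)
  have "mat2 a b c d ** M = mat r ** (M ** mat2 1 0 0 (-1))"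
    using r2 by (auto simp: M_def d mat2_mult mat_eq_mat2 algebra_simps r_def)
  from PGL2_conjugate[OF A(1) _ M r0 this]
  have "X = PGL2_class M \<otimes>\<^bsub>PGL2\<^esub> diag_class (-1) \<otimes>\<^bsub>PGL2\<^esub> inv\<^bsub>PGL2\<^esub> (PGL2_class M)"
    by (simp add: A(2) diag_class_def invertible_mat2)
  then show ?thesis using that PGL2_class_in_carrier[OF M] by blast
qed

text \<open>Commuting in \<open>PGL2\<close> means commuting up to a scalar k. A nonzero diagonal
  entry forces k = 1 and makes the matrix diagonal, so X would be trivial or diag(1, -1). Hence X is
  antidiagonal.\<close>

lemma commuting_involution:
  assumes X: "X \<in> carrier PGL2" "X \<otimes>\<^bsub>PGL2\<^esub> X = \<one>\<^bsub>PGL2\<^esub>" "X \<noteq> \<one>\<^bsub>PGL2\<^esub>" "X \<noteq> diag_class (-1)"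
    and comm: "diag_class (-1) \<otimes>\<^bsub>PGL2\<^esub> X = X \<otimes>\<^bsub>PGL2\<^esub> diag_class (-1)"
  obtains m where "m \<in> carrier PGL2" "X = m \<otimes>\<^bsub>PGL2\<^esub> swap_class \<otimes>\<^bsub>PGL2\<^esub> inv\<^bsub>PGL2\<^esub> m"
    "diag_class (-1) = m \<otimes>\<^bsub>PGL2\<^esub> diag_class (-1) \<otimes>\<^bsub>PGL2\<^esub> inv\<^bsub>PGL2\<^esub> m"
proof -
  let ?D = "mat2 1 0 0 (-1)"
  have D: "invertible ?D" by (simp add: invertible_mat2)
  obtain a b c d where A: "invertible (mat2 a b c d)" "X = PGL2_class (mat2 a b c d)"
    using PGL2_carrierE[OF X(1)] mat2_cases by metis
  have "PGL2_class (mat2 a b c d ** mat2 a b c d) = PGL2_class (mat 1)"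
    using X(2) PGL2_class_mult[OF A(1) A(1)] by (simp add: A(2) PGL2_one)
  then obtain j where "mat2 a b c d ** mat2 a b c d = mat j ** mat 1"
    using PGL2_class_eqD by blast
  then have sq: "a * a + b * c = c * b + d * d" by (auto simp: mat2_mult mat_eq_mat2)
  have "PGL2_class (?D ** mat2 a b c d) = PGL2_class (mat2 a b c d ** ?D)"
    using comm PGL2_class_mult[OF A(1) D] PGL2_class_mult[OF D A(1)] by (simp add: A(2) diag_class_def)
  then obtain k where k: "k \<noteq> 0" "?D ** mat2 a b c d = mat k ** (mat2 a b c d ** ?D)"
    using PGL2_class_eqD by blast
  then have eqs: "a = k * a" "b = - (k * b)" "- c = k * c" "d = k * d"
    by (auto simp: mat2_mult mat_eq_mat2)
  have ad: "a = 0 \<and> d = 0"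
  proof (rule ccontr)
    assume "\<not> (a = 0 \<and> d = 0)"
    then have "k = 1" using eqs(1,4) by auto
    then have bc: "b = 0" "c = 0" using eqs(2,3) by (simp_all add: eq_neg_iff_add_eq_0 neg_eq_iff_add_eq_0)
    then have "(a - d) * (a + d) = 0" using sq by (simp add: algebra_simps)
    then consider "d = a" | "d = - a" by (auto simp: eq_neg_iff_add_eq_0 add.commute)
    moreover have "a \<noteq> 0" using A(1) bc by (auto simp: invertible_mat2)
    ultimately show False
      using X(3,4) PGL2_class_scale[of a "mat 1"] PGL2_class_scale[of a ?D] bc
      by cases (simp_all add: A(2) PGL2_one mat_eq_mat2 mat2_mult diag_class_def)
  qed
  have bc: "b \<noteq> 0" "c \<noteq> 0" using A(1) ad by (auto simp: invertible_mat2)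
  \<comment> \<open>Conjugation by diag(\<mu>, 1) turns both antidiagonal entries into c \<mu>, and
    being diagonal this matrix leaves diag(1, -1) alone.\<close>
  define \<mu> where "\<mu> = csqrt (b / c)"
  have \<mu>: "\<mu> * \<mu> = b / c" using power2_csqrt[of "b / c"] by (simp add: \<mu>_def power2_eq_square)
  have \<mu>0: "\<mu> \<noteq> 0" using \<mu> bc by auto
  have M: "invertible (mat2 \<mu> 0 0 1)" using \<mu>0 by (simp add: invertible_mat2)
  have "mat2 a b c d ** mat2 \<mu> 0 0 1 = mat (c * \<mu>) ** (mat2 \<mu> 0 0 1 ** mat2 0 1 1 0)"
    using ad \<mu> bc by (simp add: mat2_mult mat_eq_mat2 mult.assoc)
  from PGL2_conjugate[OF A(1) _ M _ this]
  have 1: "X = PGL2_class (mat2 \<mu> 0 0 1) \<otimes>\<^bsub>PGL2\<^esub> swap_class \<otimes>\<^bsub>PGL2\<^esub> inv\<^bsub>PGL2\<^esub> (PGL2_class (mat2 \<mu> 0 0 1))"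
    using bc \<mu>0 by (simp add: A(2) swap_class_def invertible_mat2)
  have "?D ** mat2 \<mu> 0 0 1 = mat 1 ** (mat2 \<mu> 0 0 1 ** ?D)"
    by (simp add: mat2_mult mat_eq_mat2)
  from PGL2_conjugate[OF D D M _ this]
  have 2: "diag_class (-1) = PGL2_class (mat2 \<mu> 0 0 1) \<otimes>\<^bsub>PGL2\<^esub> diag_class (-1) \<otimes>\<^bsub>PGL2\<^esub> inv\<^bsub>PGL2\<^esub> (PGL2_class (mat2 \<mu> 0 0 1))"
    by (simp add: diag_class_def)
  show ?thesis using that[OF PGL2_class_in_carrier[OF M] 1 2] .
qed

subsection \<open>Existence of trivialisations\<close>

context automorphic_pgl2
begin

lemma delta_carrier: "\<gamma> \<in> carrier D2 \<Longrightarrow> \<delta> \<gamma> \<in> carrier PGL2"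
  using \<delta> by (auto simp: hom_def)

lemma delta_square: "\<gamma> \<in> carrier D2 \<Longrightarrow> \<delta> \<gamma> \<otimes>\<^bsub>PGL2\<^esub> \<delta> \<gamma> = \<one>\<^bsub>PGL2\<^esub>"
  using hom_mult[OF \<delta>, of \<gamma> \<gamma>] hom_one[OF \<delta> group_D2 group_PGL2] D2_square[of \<gamma>] by simp

lemma delta_one: "\<delta> \<one>\<^bsub>D2\<^esub> = \<one>\<^bsub>PGL2\<^esub>"
  by (rule hom_one[OF \<delta> group_D2 group_PGL2])

lemma twisted_eqI:
  assumes "M \<in> carrier PGL2" "X \<in> carrier PGL2" "\<delta> \<gamma> = M \<otimes>\<^bsub>PGL2\<^esub> X \<otimes>\<^bsub>PGL2\<^esub> inv\<^bsub>PGL2\<^esub> M"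
  shows "twisted M \<gamma> = X"
proof -
  interpret H: group PGL2 by (rule group_PGL2)
  have "inv\<^bsub>PGL2\<^esub> M \<otimes>\<^bsub>PGL2\<^esub> (M \<otimes>\<^bsub>PGL2\<^esub> z) = z" if "z \<in> carrier PGL2" for z
    using assms that by (simp add: H.m_assoc [symmetric])
  then show ?thesis using assms by (simp add: twisted_def H.m_assoc)
qed

text \<open>First \<delta>(s1) is diagonalised; the conjugate of \<delta>(s2) is a different
  involution commuting with it, and is brought to the swap by a conjugation that fixes diag(1,
  -1).\<close>

lemma ex_conjugates_standard:
  assumes inj: "inj_on \<delta> (carrier D2)"
  shows "\<exists>M. conjugates_standard s1 s2 \<delta> M"
proof -
  interpret H: group PGL2 by (rule group_PGL2)
  have one: "\<one>\<^bsub>D2\<^esub> \<in> carrier D2" using group_D2 by (simp add: group.is_monoid)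
  have ne: "\<delta> s1 \<noteq> \<one>\<^bsub>PGL2\<^esub>" "\<delta> s2 \<noteq> \<one>\<^bsub>PGL2\<^esub>" "\<delta> s1 \<noteq> \<delta> s2"
    using inj_onD[OF inj _ s1(1) one] inj_onD[OF inj _ s2(1) one] inj_onD[OF inj _ s1(1) s2(1)] s_distinct delta_one
    by auto
  obtain m where m: "m \<in> carrier PGL2" "\<delta> s1 = m \<otimes>\<^bsub>PGL2\<^esub> diag_class (-1) \<otimes>\<^bsub>PGL2\<^esub> inv\<^bsub>PGL2\<^esub> m"
    using involution_diagonalisable[OF delta_carrier[OF s1(1)] delta_square[OF s1(1)] ne(1)] by blast
  note th = twisted_hom[OF m(1)]
  have D: "diag_class (-1) \<in> carrier PGL2" by (simp add: diag_class_carrier)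
  have t1: "twisted m s1 = diag_class (-1)" by (rule twisted_eqI[OF m(1) D m(2)])
  have tc: "twisted m s2 \<in> carrier PGL2" using th(1) s2(1) by (auto simp: hom_def)
  have "s1 \<otimes>\<^bsub>D2\<^esub> s2 = s2 \<otimes>\<^bsub>D2\<^esub> s1"
    using s1(1) s2(1) by (auto simp: carrier_D2) (simp_all add: D2_def)
  then have comm: "diag_class (-1) \<otimes>\<^bsub>PGL2\<^esub> twisted m s2 = twisted m s2 \<otimes>\<^bsub>PGL2\<^esub> diag_class (-1)"
    using hom_mult[OF th(1) s1(1) s2(1)] hom_mult[OF th(1) s2(1) s1(1)] t1 by simp
  have sq: "twisted m s2 \<otimes>\<^bsub>PGL2\<^esub> twisted m s2 = \<one>\<^bsub>PGL2\<^esub>"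
    using hom_mult[OF th(1) s2(1) s2(1)] hom_one[OF th(1) group_D2 group_PGL2] by (simp add: D2_square s2(1))
  have n1: "twisted m s2 \<noteq> \<one>\<^bsub>PGL2\<^esub>"
    using th(3)[OF s2(1)] ne(2) m(1) by auto
  have n2: "twisted m s2 \<noteq> diag_class (-1)"
    using th(3)[OF s2(1)] m(2) ne(3) by auto
  obtain m' where m': "m' \<in> carrier PGL2" "twisted m s2 = m' \<otimes>\<^bsub>PGL2\<^esub> swap_class \<otimes>\<^bsub>PGL2\<^esub> inv\<^bsub>PGL2\<^esub> m'"
    "diag_class (-1) = m' \<otimes>\<^bsub>PGL2\<^esub> diag_class (-1) \<otimes>\<^bsub>PGL2\<^esub> inv\<^bsub>PGL2\<^esub> m'"
    using commuting_involution[OF tc sq n1 n2 comm] by blast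
  define M where "M = m \<otimes>\<^bsub>PGL2\<^esub> m'"
  have M: "M \<in> carrier PGL2" using m m' by (simp add: M_def)
  have conj: "m \<otimes>\<^bsub>PGL2\<^esub> (m' \<otimes>\<^bsub>PGL2\<^esub> X \<otimes>\<^bsub>PGL2\<^esub> inv\<^bsub>PGL2\<^esub> m') \<otimes>\<^bsub>PGL2\<^esub> inv\<^bsub>PGL2\<^esub> m
      = M \<otimes>\<^bsub>PGL2\<^esub> X \<otimes>\<^bsub>PGL2\<^esub> inv\<^bsub>PGL2\<^esub> M" if "X \<in> carrier PGL2" for X
    using m(1) m'(1) that by (simp add: M_def H.inv_mult_group H.m_assoc)
  have d1: "\<delta> s1 = M \<otimes>\<^bsub>PGL2\<^esub> diag_class (-1) \<otimes>\<^bsub>PGL2\<^esub> inv\<^bsub>PGL2\<^esub> M"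
    using conj[OF D] m(2) m'(3) by simp
  have d2: "\<delta> s2 = M \<otimes>\<^bsub>PGL2\<^esub> swap_class \<otimes>\<^bsub>PGL2\<^esub> inv\<^bsub>PGL2\<^esub> M"
    using conj[OF swap_class_carrier] th(3)[OF s2(1)] m'(2) by simp
  show ?thesis
    unfolding conjugates_standard_def
  proof (intro exI[of _ M] conjI bexI[of _ "twisted M"] ballI M)
    show "twisted M s1 = PGL2_class (mat2 1 0 0 (-1))"
      using twisted_eqI[OF M D d1] by (simp add: diag_class_def)
    show "twisted M s2 = PGL2_class (mat2 0 1 1 0)"
      using twisted_eqI[OF M swap_class_carrier d2] by (simp add: swap_class_def)
    show "twisted M \<in> hom D2 PGL2" by (rule twisted_hom(1)[OF M])
    show "\<delta> t = M \<otimes>\<^bsub>PGL2\<^esub> twisted M t \<otimes>\<^bsub>PGL2\<^esub> inv\<^bsub>PGL2\<^esub> M" if "t \<in> carrier D2" for t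
      by (rule twisted_hom(3)[OF M that])
  qed
qed

lemma trivialises_Omega:
  assumes "conjugates_standard s1 s2 \<delta> M"
  shows "trivialises (Omega_rep \<tau> \<rho>b M)"
proof -
  obtain \<delta>' where M: "M \<in> carrier PGL2" and \<delta>': "\<delta>' s1 = PGL2_class (mat2 1 0 0 (-1))"
    "\<delta>' s2 = PGL2_class (mat2 0 1 1 0)" "\<forall>t\<in>carrier D2. \<delta> t = M \<otimes>\<^bsub>PGL2\<^esub> \<delta>' t \<otimes>\<^bsub>PGL2\<^esub> inv\<^bsub>PGL2\<^esub> M"
    using assms by (auto simp: conjugates_standard_def)
  have J: "invertible (mat2 0 1 1 0)" "invertible (mat2 1 0 0 (-1))" by (simp_all add: invertible_mat2)
  have tw: "twisted M s1 = PGL2_class (mat2 1 0 0 (-1))" "twisted M s2 = PGL2_class (mat2 0 1 1 0)"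
    using \<delta>' s1(1) s2(1) J by (auto intro!: twisted_eqI[OF M] PGL2_class_in_carrier)
  have nz: "theta2 0 \<tau> \<noteq> 0" by (rule theta_constants_nonzero[OF \<tau>])
  have det: "psi \<tau> (-1) z * theta2 (2 * z) (2 * \<tau>) * theta2 (2 * z) (2 * \<tau>)
      - theta3 (2 * z) (2 * \<tau>) * (psi \<tau> 1 z * theta3 (2 * z) (2 * \<tau>)) \<noteq> 0" if "z \<notin> half_lattice \<tau>" for z
    using that nz unfolding Omega_det[OF \<tau> that] by (simp add: theta1_zero_iff[OF \<tau>] half_lattice_iff)
  have Oinv: "invertible (Omega \<tau> z)" if "z \<notin> half_lattice \<tau>" for z
    using det[OF that] by (simp add: Omega_def invertible_mat2)
  have holo: "(\<lambda>z. theta2 (2 * z) (2 * \<tau>)) holomorphic_on UNIV" "(\<lambda>z. theta3 (2 * z) (2 * \<tau>)) holomorphic_on UNIV"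
    by (intro theta_holo_2 \<tau> holomorphic_intros)+
  have m: "(\<lambda>z. psi \<tau> (-1) z * theta2 (2 * z) (2 * \<tau>)) meromorphic_on UNIV"
    "(\<lambda>z. theta3 (2 * z) (2 * \<tau>)) meromorphic_on UNIV"
    "(\<lambda>z. psi \<tau> 1 z * theta3 (2 * z) (2 * \<tau>)) meromorphic_on UNIV"
    "(\<lambda>z. theta2 (2 * z) (2 * \<tau>)) meromorphic_on UNIV"
    by (intro meromorphic_on_mult psi_meromorphic[OF \<tau>] holomorphic_imp_meromorphic[OF holo(1)]
        holomorphic_imp_meromorphic[OF holo(2)])+
  have an: "(\<lambda>z. psi \<tau> (-1) z * theta2 (2 * z) (2 * \<tau>)) analytic_on {z}"
    "(\<lambda>z. theta3 (2 * z) (2 * \<tau>)) analytic_on {z}"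
    "(\<lambda>z. psi \<tau> 1 z * theta3 (2 * z) (2 * \<tau>)) analytic_on {z}"
    "(\<lambda>z. theta2 (2 * z) (2 * \<tau>)) analytic_on {z}" if "z \<notin> half_lattice \<tau>" for z
    by (intro analytic_on_mult psi_analytic[OF \<tau> that] holomorphic_imp_analytic[OF holo(1)]
        holomorphic_imp_analytic[OF holo(2)])+
  have "trivialises (\<lambda>p. \<rho>b M \<circ> \<rho>b (PGL2_class (mat2
      (psi \<tau> (-1) (rep p) * theta2 (2 * rep p) (2 * \<tau>)) (theta3 (2 * rep p) (2 * \<tau>))
      (psi \<tau> 1 (rep p) * theta3 (2 * rep p) (2 * \<tau>)) (theta2 (2 * rep p) (2 * \<tau>)))))"
  proof (rule trivialises_matrix[OF m(1) m(2) m(3) m(4) an(1) an(2) an(3) an(4) det M])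
    show "PGL2_class (mat2 (psi \<tau> (-1) (z + 1/2) * theta2 (2 * (z + 1/2)) (2 * \<tau>)) (theta3 (2 * (z + 1/2)) (2 * \<tau>))
        (psi \<tau> 1 (z + 1/2) * theta3 (2 * (z + 1/2)) (2 * \<tau>)) (theta2 (2 * (z + 1/2)) (2 * \<tau>)))
      = twisted M s1 \<otimes>\<^bsub>PGL2\<^esub> PGL2_class (mat2 (psi \<tau> (-1) z * theta2 (2 * z) (2 * \<tau>)) (theta3 (2 * z) (2 * \<tau>))
        (psi \<tau> 1 z * theta3 (2 * z) (2 * \<tau>)) (theta2 (2 * z) (2 * \<tau>)))" if "z \<notin> half_lattice \<tau>" for z
      using Omega_shift(1)[OF \<tau>, of z] PGL2_class_mult[OF J(2) Oinv[OF that]] by (simp add: tw Omega_def)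
    show "PGL2_class (mat2 (psi \<tau> (-1) (z + \<tau>/2) * theta2 (2 * (z + \<tau>/2)) (2 * \<tau>)) (theta3 (2 * (z + \<tau>/2)) (2 * \<tau>))
        (psi \<tau> 1 (z + \<tau>/2) * theta3 (2 * (z + \<tau>/2)) (2 * \<tau>)) (theta2 (2 * (z + \<tau>/2)) (2 * \<tau>)))
      = twisted M s2 \<otimes>\<^bsub>PGL2\<^esub> PGL2_class (mat2 (psi \<tau> (-1) z * theta2 (2 * z) (2 * \<tau>)) (theta3 (2 * z) (2 * \<tau>))
        (psi \<tau> 1 z * theta3 (2 * z) (2 * \<tau>)) (theta2 (2 * z) (2 * \<tau>)))" if "z \<notin> half_lattice \<tau>" for z
      using arg_cong[OF Omega_shift(2)[OF \<tau>, of z], of PGL2_class] PGL2_class_mult[OF J(1) Oinv[OF that]]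
        PGL2_class_scale[of "qfac_half (2 * \<tau>) (2 * z)" "mat2 0 1 1 0 ** Omega \<tau> z"]
      by (simp add: tw Omega_def)
  qed
  moreover have "Omega_rep \<tau> \<rho>b M = (\<lambda>p. \<rho>b M \<circ> \<rho>b (PGL2_class (mat2
      (psi \<tau> (-1) (rep p) * theta2 (2 * rep p) (2 * \<tau>)) (theta3 (2 * rep p) (2 * \<tau>))
      (psi \<tau> 1 (rep p) * theta3 (2 * rep p) (2 * \<tau>)) (theta2 (2 * rep p) (2 * \<tau>)))))"
    by (rule ext) (simp only: Omega_rep_def Omega_def)
  ultimately show ?thesis by simp
qed

lemma trivialises_trivial:
  assumes "\<And>\<gamma>. \<gamma> \<in> carrier D2 \<Longrightarrow> \<delta> \<gamma> = \<one>\<^bsub>PGL2\<^esub>"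
  shows "trivialises (\<lambda>p. id)"
proof -
  have "\<rho> \<gamma> = id" if "\<gamma> \<in> carrier D2" for \<gamma>
    using factors assms that hom_one[OF rho_hom group_PGL2 group_Inn] by (simp add: Inn_simps)
  moreover have "(id :: 'g \<Rightarrow> 'g) \<in> carrier Inn"
    using monoid.one_closed[OF group.is_monoid[OF group_Inn]] by (simp add: Inn_simps)
  ultimately show ?thesis
    by (simp add: trivialises_def mero_ring_const inv_id)
qed

lemma analytic_compose_double:
  assumes "f analytic_on {2 * z}"
  shows "(\<lambda>z. f (2 * z)) analytic_on {z :: complex}"
  using analytic_on_compose[of "\<lambda>z. 2 * z" "{z}" f] assms by (simp add: o_def analytic_intros)

lemma meromorphic_compose_double:
  assumes "f meromorphic_on UNIV"
  shows "(\<lambda>z. f (2 * z)) meromorphic_on (UNIV :: complex set)"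
  using meromorphic_on_compose[OF assms, of "\<lambda>z. 2 * z" UNIV] by (simp add: o_def analytic_intros)

text \<open>The exponents b and a record whether \<open>s1\<close> and \<open>s2\<close> map to the
  involution. The first row has the multipliers 1 / k1 and 1 / k2, the second k1 and k2, so
  projectively the matrix is multiplied by diag(1, k^2); fourth roots k with k^2 = -1 produce the
  involution.\<close>

lemma trivialises_order_two:
  assumes M: "M \<in> carrier PGL2" and ab: "(a, b) \<in> {(1, 0), (0, 1), (1, 1 :: nat)}"
    and tw: "twisted M s1 = diag_class ((-1) ^ b)" "twisted M s2 = diag_class ((-1) ^ a)"
  shows "\<exists>T. trivialises T"
proof -
  \<comment> \<open>A quarter period. The exponent \<alpha> = -b / 4 gives k1 = i^b and cancels the
    part of s along \<tau> in the multiplier k2 = i^(-a).\<close>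
  define s where "s = (of_nat a + of_nat b * \<tau>) / 4"
  define \<alpha> where "\<alpha> = - real b / 4"
  let ?u = "\<lambda>z. twist_fun \<tau> (- s) (- \<alpha>) (2 * z)"
  let ?v = "\<lambda>z. twist_fun \<tau> s \<alpha> (2 * z)"
  let ?b = "\<lambda>z. second_fun \<tau> s \<alpha> (2 * z)"
  let ?d = "\<lambda>z. second_fun \<tau> (- s) (- \<alpha>) (2 * z)"
  define k1 where "k1 = exp (- 2 * of_real pi * \<i> * of_real \<alpha>)"
  define k2 where "k2 = exp (- 2 * of_real pi * \<i> * (of_real \<alpha> * \<tau> + s))"
  have k0: "k1 \<noteq> 0" "k2 \<noteq> 0" by (simp_all add: k1_def k2_def)
  have e: "of_real \<alpha> * \<tau> + s = of_nat a / 4"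
    by (simp add: \<alpha>_def s_def field_simps)
  have "k1 * k1 = exp (of_real pi * \<i> * of_nat b)"
    unfolding k1_def exp_add [symmetric] by (rule arg_cong[where f = exp]) (simp add: \<alpha>_def)
  moreover have "k2 * k2 = exp (- (of_real pi * \<i> * of_nat a))"
    unfolding k2_def e exp_add [symmetric] by (rule arg_cong[where f = exp]) simp
  ultimately have kk: "k1 * k1 = (-1) ^ b" "k2 * k2 = (-1) ^ a"
    using ab by (auto simp: exp_minus)
  have v_shift: "twist_fun \<tau> s \<alpha> (w + 1) = k1 * twist_fun \<tau> s \<alpha> w"
    "twist_fun \<tau> s \<alpha> (w + \<tau>) = k2 * twist_fun \<tau> s \<alpha> w" for w
    using twist_fun_shift[OF \<tau>, of s \<alpha> w] by (simp_all add: k1_def k2_def)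
  have inv: "inverse k1 = exp (- 2 * of_real pi * \<i> * of_real (- \<alpha>))"
    "inverse k2 = exp (- 2 * of_real pi * \<i> * (of_real (- \<alpha>) * \<tau> + - s))"
    unfolding k1_def k2_def exp_minus [symmetric] by (simp_all add: algebra_simps)
  have u_shift: "twist_fun \<tau> (- s) (- \<alpha>) (w + 1) = inverse k1 * twist_fun \<tau> (- s) (- \<alpha>) w"
    "twist_fun \<tau> (- s) (- \<alpha>) (w + \<tau>) = inverse k2 * twist_fun \<tau> (- s) (- \<alpha>) w" for w
    unfolding inv by (rule twist_fun_shift[OF \<tau>])+
  have b_shift: "second_fun \<tau> s \<alpha> (w + 1) = inverse k1 * second_fun \<tau> s \<alpha> w"
    "second_fun \<tau> s \<alpha> (w + \<tau>) = inverse k2 * second_fun \<tau> s \<alpha> w" if "w \<notin> period_lattice \<tau>" for w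
    using second_fun_shift[OF \<tau> that period_lattice_1 k0(1) v_shift(1)]
      second_fun_shift[OF \<tau> that period_lattice_tau k0(2) v_shift(2)] by (simp_all add: field_simps)
  have d_shift: "second_fun \<tau> (- s) (- \<alpha>) (w + 1) = k1 * second_fun \<tau> (- s) (- \<alpha>) w"
    "second_fun \<tau> (- s) (- \<alpha>) (w + \<tau>) = k2 * second_fun \<tau> (- s) (- \<alpha>) w" if "w \<notin> period_lattice \<tau>" for w
    using second_fun_shift[OF \<tau> that period_lattice_1 _ u_shift(1)]
      second_fun_shift[OF \<tau> that period_lattice_tau _ u_shift(2)] k0 by (simp_all add: field_simps)
  have lat: "2 * z \<notin> period_lattice \<tau>" if "z \<notin> half_lattice \<tau>" for z
    using that by (simp add: half_lattice_iff)
  \<comment> \<open>2 s is a nontrivial half period, so the constant determinant -2 theta_quot s is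
    nonzero.\<close>
  have "2 * s \<notin> period_lattice \<tau>"
    using ab half_notin_lattice[OF \<tau>] by (auto simp: s_def add_divide_distrib)
  then have det: "?u z * ?d z - ?b z * ?v z \<noteq> 0" if "z \<notin> half_lattice \<tau>" for z
    using second_fun_det[OF \<tau> lat[OF that], of s \<alpha>] theta_quot_nonzero[OF \<tau>] by simp
  have m: "?u meromorphic_on UNIV" "?b meromorphic_on UNIV" "?v meromorphic_on UNIV" "?d meromorphic_on UNIV"
    by (intro meromorphic_compose_double twist_fun_meromorphic[OF \<tau>] second_fun_meromorphic[OF \<tau>])+
  have an: "?u analytic_on {z}" "?b analytic_on {z}" "?v analytic_on {z}" "?d analytic_on {z}"
    if "z \<notin> half_lattice \<tau>" for z
    by (intro analytic_compose_double twist_fun_analytic[OF \<tau>] second_fun_analytic[OF \<tau>] lat[OF that])+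
  have inv_G: "invertible (mat2 (?u z) (?b z) (?v z) (?d z))" if "z \<notin> half_lattice \<tau>" for z
    using det[OF that] by (simp add: invertible_mat2)
  have cls: "PGL2_class (mat2 (inverse k * p) (inverse k * q) (k * r) (k * t)) = diag_class x \<otimes>\<^bsub>PGL2\<^esub> PGL2_class (mat2 p q r t)"
    if "k \<noteq> 0" "k * k = x" "invertible (mat2 p q r t)" for k x p q r t
  proof -
    have "mat2 (inverse k * p) (inverse k * q) (k * r) (k * t) = mat (inverse k) ** (mat2 1 0 0 x ** mat2 p q r t)"
      using that by (simp add: mat_eq_mat2 mat2_mult flip: that(2))
    moreover have "invertible (mat2 1 0 0 x)" using that(1,2) by (auto simp: invertible_mat2)
    ultimately show ?thesis
      using that PGL2_class_scale[of "inverse k" "mat2 1 0 0 x ** mat2 p q r t"] PGL2_class_mult[of "mat2 1 0 0 x" "mat2 p q r t"]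
      by (simp add: diag_class_def)
  qed
  have "trivialises (\<lambda>p. \<rho>b M \<circ> \<rho>b (PGL2_class (mat2 (?u (rep p)) (?b (rep p)) (?v (rep p)) (?d (rep p)))))"
  proof (rule trivialises_matrix[OF m(1) m(2) m(3) m(4) an(1) an(2) an(3) an(4) det M])
    show "PGL2_class (mat2 (?u (z + 1/2)) (?b (z + 1/2)) (?v (z + 1/2)) (?d (z + 1/2)))
        = twisted M s1 \<otimes>\<^bsub>PGL2\<^esub> PGL2_class (mat2 (?u z) (?b z) (?v z) (?d z))" if z: "z \<notin> half_lattice \<tau>" for z
    proof -
      have "2 * (z + 1/2) = 2 * z + 1" by simp
      then show ?thesis
        unfolding tw by (simp only: u_shift v_shift b_shift[OF lat[OF z]] d_shift[OF lat[OF z]] cls[OF k0(1) kk(1) inv_G[OF z]])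
    qed
    show "PGL2_class (mat2 (?u (z + \<tau>/2)) (?b (z + \<tau>/2)) (?v (z + \<tau>/2)) (?d (z + \<tau>/2)))
        = twisted M s2 \<otimes>\<^bsub>PGL2\<^esub> PGL2_class (mat2 (?u z) (?b z) (?v z) (?d z))" if z: "z \<notin> half_lattice \<tau>" for z
    proof -
      have "2 * (z + \<tau>/2) = 2 * z + \<tau>" by simp
      then show ?thesis
        unfolding tw by (simp only: u_shift v_shift b_shift[OF lat[OF z]] d_shift[OF lat[OF z]] cls[OF k0(2) kk(2) inv_G[OF z]])
    qed
  qed
  then show ?thesis by blast
qed

lemma ex_trivialisation: "\<exists>T. trivialises T"
proof -
  interpret H: group PGL2 by (rule group_PGL2)
  interpret D: group D2 by (rule group_D2)
  consider (inj) "inj_on \<delta> (carrier D2)" | (triv) "\<And>\<gamma>. \<gamma> \<in> carrier D2 \<Longrightarrow> \<delta> \<gamma> = \<one>\<^bsub>PGL2\<^esub>"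
    | (two) "\<not> inj_on \<delta> (carrier D2)" "\<exists>\<gamma>\<in>carrier D2. \<delta> \<gamma> \<noteq> \<one>\<^bsub>PGL2\<^esub>" by blast
  then show ?thesis
  proof cases
    case inj
    then show ?thesis using ex_conjugates_standard trivialises_Omega by blast
  next
    case triv
    then show ?thesis using trivialises_trivial by blast
  next
    case two
    have d12: "\<delta> (s1 \<otimes>\<^bsub>D2\<^esub> s2) = \<delta> s1 \<otimes>\<^bsub>PGL2\<^esub> \<delta> s2" by (rule hom_mult[OF \<delta> s1(1) s2(1)])
    note dc = delta_carrier[OF s1(1)] delta_carrier[OF s2(1)]
    have sq: "\<delta> s1 \<otimes>\<^bsub>PGL2\<^esub> \<delta> s1 = \<one>\<^bsub>PGL2\<^esub>" "\<delta> s2 \<otimes>\<^bsub>PGL2\<^esub> \<delta> s2 = \<one>\<^bsub>PGL2\<^esub>"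
      using delta_square s1(1) s2(1) by auto
    have eq_iff: "\<delta> s1 \<otimes>\<^bsub>PGL2\<^esub> \<delta> s2 = \<one>\<^bsub>PGL2\<^esub> \<longleftrightarrow> \<delta> s1 = \<delta> s2"
      using dc sq by (metis H.right_cancel)
    \<comment> \<open>A non-injective homomorphism kills \<open>s1\<close>, \<open>s2\<close> or
      their product, and the product is killed exactly when the two images agree, since each squares
      to one.\<close>
    have cases: "\<delta> s1 = \<one>\<^bsub>PGL2\<^esub> \<or> \<delta> s2 = \<one>\<^bsub>PGL2\<^esub> \<or> \<delta> s1 = \<delta> s2"
    proof (rule ccontr)
      assume ne: "\<not> (\<delta> s1 = \<one>\<^bsub>PGL2\<^esub> \<or> \<delta> s2 = \<one>\<^bsub>PGL2\<^esub> \<or> \<delta> s1 = \<delta> s2)"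
      have "\<delta> s1 \<otimes>\<^bsub>PGL2\<^esub> \<delta> s2 \<noteq> \<delta> s1" "\<delta> s1 \<otimes>\<^bsub>PGL2\<^esub> \<delta> s2 \<noteq> \<delta> s2"
        using ne dc by (metis H.l_cancel_one, metis H.r_cancel_one)
      then have "inj_on \<delta> (carrier D2)"
        unfolding D2_generated using ne eq_iff by (auto simp: inj_on_def delta_one d12)
      then show False using two(1) by simp
    qed
    have nontriv: "\<not> (\<delta> s1 = \<one>\<^bsub>PGL2\<^esub> \<and> \<delta> s2 = \<one>\<^bsub>PGL2\<^esub>)"
      using two(2) unfolding D2_generated by (auto simp: delta_one d12)
    \<comment> \<open>The nontrivial element of the image.\<close>
    define X where "X = (if \<delta> s1 = \<one>\<^bsub>PGL2\<^esub> then \<delta> s2 else \<delta> s1)"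
    have X: "X \<in> carrier PGL2" "X \<otimes>\<^bsub>PGL2\<^esub> X = \<one>\<^bsub>PGL2\<^esub>" "X \<noteq> \<one>\<^bsub>PGL2\<^esub>"
      using dc sq nontriv by (auto simp: X_def)
    obtain M where M: "M \<in> carrier PGL2" "X = M \<otimes>\<^bsub>PGL2\<^esub> diag_class (-1) \<otimes>\<^bsub>PGL2\<^esub> inv\<^bsub>PGL2\<^esub> M"
      using involution_diagonalisable[OF X] by blast
    define b :: nat where "b = (if \<delta> s1 = \<one>\<^bsub>PGL2\<^esub> then 0 else 1)"
    define a :: nat where "a = (if \<delta> s2 = \<one>\<^bsub>PGL2\<^esub> then 0 else 1)"
    have one: "\<one>\<^bsub>PGL2\<^esub> = M \<otimes>\<^bsub>PGL2\<^esub> diag_class 1 \<otimes>\<^bsub>PGL2\<^esub> inv\<^bsub>PGL2\<^esub> M"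
      using M(1) by (simp add: diag_class_1)
    have "\<delta> s1 = M \<otimes>\<^bsub>PGL2\<^esub> diag_class ((-1) ^ b) \<otimes>\<^bsub>PGL2\<^esub> inv\<^bsub>PGL2\<^esub> M"
    proof (cases "\<delta> s1 = \<one>\<^bsub>PGL2\<^esub>")
      case True
      then have "b = 0" by (simp add: b_def)
      then show ?thesis unfolding True using one by simp
    next
      case False
      then have "b = 1" "X = \<delta> s1" by (simp_all add: b_def X_def)
      then show ?thesis using M(2) by simp
    qed
    moreover have "\<delta> s2 = M \<otimes>\<^bsub>PGL2\<^esub> diag_class ((-1) ^ a) \<otimes>\<^bsub>PGL2\<^esub> inv\<^bsub>PGL2\<^esub> M"
    proof (cases "\<delta> s2 = \<one>\<^bsub>PGL2\<^esub>")
      case True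
      then have "a = 0" by (simp add: a_def)
      then show ?thesis unfolding True using one by simp
    next
      case False
      then have "a = 1" "X = \<delta> s2" using cases by (auto simp: a_def X_def)
      then show ?thesis using M(2) by simp
    qed
    ultimately have "twisted M s1 = diag_class ((-1) ^ b)" "twisted M s2 = diag_class ((-1) ^ a)"
      by (auto intro!: twisted_eqI[OF M(1)] diag_class_carrier)
    moreover have "(a, b) \<in> {(1, 0), (0, 1), (1, 1)}"
      using nontriv by (auto simp: a_def b_def)
    ultimately show ?thesis using trivialises_order_two[OF M(1)] by blast
  qed
qed

end

subsection \<open>The Weierstrass function of the half lattice\<close>

lemma lattice_norm_bound:
  assumes \<tau>: "Im \<tau> > 0"
  shows "\<exists>K>0. \<forall>a b :: real. max \<bar>a\<bar> \<bar>b\<bar> \<le> K * norm (of_real a + of_real b * \<tau>)"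
proof (intro exI[of _ "1 / Im \<tau> + (1 + norm \<tau> / Im \<tau>)"] conjI allI)
  fix a b :: real
  let ?w = "of_real a + of_real b * \<tau>"
  have "\<bar>b\<bar> * Im \<tau> = \<bar>Im ?w\<bar>" using \<tau> by (simp add: abs_mult)
  also have "\<dots> \<le> norm ?w" by (rule abs_Im_le_cmod)
  finally have b: "\<bar>b\<bar> \<le> norm ?w / Im \<tau>" using \<tau> by (simp add: field_simps)
  have "\<bar>a\<bar> = norm (?w - of_real b * \<tau>)" by simp
  also have "\<dots> \<le> norm ?w + norm (of_real b * \<tau>)" by (rule norm_triangle_ineq4)
  also have "norm (of_real b * \<tau>) = \<bar>b\<bar> * norm \<tau>" by (simp add: norm_mult)
  also have "\<bar>b\<bar> * norm \<tau> \<le> (norm ?w / Im \<tau>) * norm \<tau>" by (intro mult_right_mono b) simp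
  finally have a: "\<bar>a\<bar> \<le> (1 + norm \<tau> / Im \<tau>) * norm ?w" by (simp add: algebra_simps)
  have "0 \<le> norm ?w / Im \<tau>" "0 \<le> (1 + norm \<tau> / Im \<tau>) * norm ?w" using \<tau> by auto
  then show "max \<bar>a\<bar> \<bar>b\<bar> \<le> (1 / Im \<tau> + (1 + norm \<tau> / Im \<tau>)) * norm ?w"
    using a b by (simp add: distrib_right)
qed (use \<tau> in \<open>auto intro!: add_pos_nonneg\<close>)

lemma summable_on_max_powr:
  "(\<lambda>k::int. (max 1 \<bar>real_of_int k\<bar>) powr (- (3 / 2))) summable_on UNIV"
proof (rule summable_on_int_split)
  have "summable (\<lambda>n. real n powr (- (3 / 2)))" by (simp add: summable_real_powr_iff)
  moreover have "\<forall>\<^sub>F n in sequentially. (max 1 (real n)) powr (- (3 / 2)) = real n powr (- (3 / 2))"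
    by (rule eventually_sequentiallyI[of 1]) (simp add: max_def)
  ultimately have "summable (\<lambda>n. (max 1 (real n)) powr (- (3 / 2)))"
    using summable_cong by fastforce
  then show "summable (\<lambda>n. (max 1 \<bar>real_of_int (int n)\<bar>) powr (- (3 / 2)))"
    "summable (\<lambda>n. (max 1 \<bar>real_of_int (- int n)\<bar>) powr (- (3 / 2)))" by simp_all
qed simp

text \<open>With m the larger of the two coordinates, |w|^(-3) is at most a constant times m^(-3),
  and m^(-3) is at most the product of the -3/2 powers of the coordinates. Summability over pairs
  thus reduces to one index, as 3/2 > 1. The maximum with 1 takes care of vanishing coordinates, and
  at w = 0 the convention inverse 0 = 0 applies.\<close>

lemma half_lattice_summable:
  assumes \<tau>: "Im \<tau> > 0"
  shows "(\<lambda>w. inverse (norm w) ^ 3) summable_on half_lattice \<tau>"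
proof -
  define h where "h = (\<lambda>p::int \<times> int. (of_int (fst p) + of_int (snd p) * \<tau>) / 2)"
  have range: "half_lattice \<tau> = range h"
    by (auto simp: half_lattice_def period_lattice_def h_def image_def)
  have inj: "inj h"
  proof (rule injI)
    fix x y assume "h x = h y"
    then have "2 * h x = 2 * h y" by simp
    then have "of_real (of_int (fst x)) + of_real (of_int (snd x)) * \<tau>
        = of_real (of_int (fst y)) + of_real (of_int (snd y)) * \<tau>"
      unfolding h_def nonzero_mult_div_cancel_left[OF zero_neq_numeral[symmetric]] times_divide_eq_right
      by simp
    from lattice_coords_unique[OF \<tau> this] show "x = y" by (simp add: prod_eq_iff)
  qed
  obtain K where K: "K > 0" "\<And>a b :: real. max \<bar>a\<bar> \<bar>b\<bar> \<le> K * norm (of_real a + of_real b * \<tau>)"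
    using lattice_norm_bound[OF \<tau>] by blast
  let ?f = "\<lambda>k::int. (max 1 \<bar>real_of_int k\<bar>) powr (- (3 / 2))"
  have "(\<lambda>k. norm (complex_of_real (?f k))) summable_on UNIV"
    using summable_on_max_powr by simp
  from abs_summable_on_product[OF this this]
  have "(\<lambda>p. ?f (fst p) * ?f (snd p)) summable_on UNIV"
    by (simp add: norm_mult)
  then have "(\<lambda>p. 8 * K ^ 3 * (?f (fst p) * ?f (snd p))) summable_on UNIV"
    by (rule summable_on_cmult_right)
  then have "(\<lambda>p. inverse (norm (h p)) ^ 3) summable_on UNIV"
  proof (rule summable_on_comparison_test)
    fix p :: "int \<times> int"
    show "inverse (norm (h p)) ^ 3 \<le> 8 * K ^ 3 * (?f (fst p) * ?f (snd p))"
    proof (cases "p = (0, 0)")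
      case True
      then show ?thesis using K(1) by (simp add: h_def)
    next
      case False
      define m where "m = max \<bar>real_of_int (fst p)\<bar> \<bar>real_of_int (snd p)\<bar>"
      have m1: "m \<ge> 1" using False by (cases p) (auto simp: m_def max_def)
      have "m \<le> K * (2 * norm (h p))"
        using K(2)[of "of_int (fst p)" "of_int (snd p)"] by (simp add: m_def h_def norm_divide)
      then have "m ^ 3 \<le> (K * (2 * norm (h p))) ^ 3" using m1 by (intro power_mono) auto
      then have 1: "m ^ 3 \<le> 8 * K ^ 3 * norm (h p) ^ 3" by (simp add: power_mult_distrib)
      have hp: "norm (h p) > 0"
        using \<open>m \<le> K * (2 * norm (h p))\<close> m1 K(1) by (smt (verit) mult_pos_pos norm_ge_zero mult_eq_0_iff)
      have "?f (fst p) * ?f (snd p) \<ge> m powr (- (3 / 2)) * m powr (- (3 / 2))"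
        using m1 by (intro mult_mono powr_mono2') (auto simp: m_def)
      also have "m powr (- (3 / 2)) * m powr (- (3 / 2)) = m powr (- 3)"
        by (simp only: powr_add [symmetric]) simp
      also have "\<dots> = inverse (m ^ 3)"
        using m1 powr_minus[of m 3] by (simp add: powr_numeral)
      finally have 2: "inverse (m ^ 3) \<le> ?f (fst p) * ?f (snd p)" .
      have "inverse (norm (h p)) ^ 3 \<le> 8 * K ^ 3 * inverse (m ^ 3)"
        using 1 hp m1 by (simp add: field_simps)
      also have "\<dots> \<le> 8 * K ^ 3 * (?f (fst p) * ?f (snd p))"
        using K(1) by (intro mult_left_mono 2) auto
      finally show ?thesis .
    qed
  qed simp
  then show ?thesis
    unfolding range by (subst summable_on_reindex[OF inj]) (simp add: o_def)
qed

lemma finite_half_lattice_cball: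
  assumes \<tau>: "Im \<tau> > 0"
  shows "finite (half_lattice \<tau> \<inter> cball 0 r)"
proof -
  have "finite (cball 0 r \<inter> half_lattice \<tau>)"
    using eventually_notin_half_lattice[OF \<tau>, of 0]
    by (intro finite_not_islimpt_in_compact) (auto simp: islimpt_iff_eventually)
  then show ?thesis by (simp add: Int_commute)
qed

text \<open>The principal part at 0 is made a term of the series, so that the sum runs over the
  whole lattice and can be reindexed by translations.\<close>

definition wp_term :: "complex \<Rightarrow> complex \<Rightarrow> complex" where
  "wp_term z w = (if w = 0 then 1 / z\<^sup>2 else 1 / (z - w)\<^sup>2 - 1 / w\<^sup>2)"

text \<open>The constant is 10 = (5/2) 2^2, from |2 w - z| <= (5/2) |w| and |z - w| >= |w| /
  2.\<close>

lemma norm_wp_term_le: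
  assumes "norm z \<le> r" "2 * r \<le> norm w" "r > 0"
  shows "norm (wp_term z w) \<le> 10 * r * inverse (norm w) ^ 3"
proof -
  have w: "norm w > 0" "w \<noteq> 0" using assms by auto
  have zw: "norm (z - w) \<ge> norm w / 2"
    using assms norm_triangle_ineq2[of w z] by (simp add: norm_minus_commute)
  then have "z - w \<noteq> 0" using w by auto
  then have "1 / (z - w)\<^sup>2 - 1 / w\<^sup>2 = (w\<^sup>2 - (z - w)\<^sup>2) / (w\<^sup>2 * (z - w)\<^sup>2)"
    using w(2) by (subst diff_frac_eq) (simp_all add: mult.commute)
  also have "w\<^sup>2 - (z - w)\<^sup>2 = z * (2 * w - z)"
    by (simp add: power2_eq_square algebra_simps)
  finally have "wp_term z w = z * (2 * w - z) / (w\<^sup>2 * (z - w)\<^sup>2)"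
    using w(2) by (simp add: wp_term_def)
  then have "norm (wp_term z w) = norm z * norm (2 * w - z) / (norm w ^ 2 * norm (z - w) ^ 2)"
    by (simp add: norm_mult norm_divide norm_power)
  also have "\<dots> \<le> r * (5 / 2 * norm w) / (norm w ^ 2 * (norm w / 2) ^ 2)"
  proof (intro frac_le mult_mono power_mono zw)
    have "norm (2 * w - z) \<le> 2 * norm w + norm z"
      using norm_triangle_ineq4[of "2 * w" z] by (simp add: norm_mult)
    then show "norm (2 * w - z) \<le> 5 / 2 * norm w" using assms by simp
  qed (use assms w in auto)
  also have "\<dots> = 10 * r * inverse (norm w) ^ 3"
    using w by (simp add: field_simps power2_eq_square power3_eq_cube)
  finally show ?thesis .
qed

context
  fixes \<tau> :: complex
  assumes \<tau>: "Im \<tau> > 0"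
begin

abbreviation wph :: "complex \<Rightarrow> complex" where
  "wph \<equiv> wp (half_lattice \<tau>)"

text \<open>The radius 2 r is the threshold of \<open>norm_wp_term_le\<close> for z in the disc of
  radius r; only finitely many lattice points are left out.\<close>

abbreviation far :: "real \<Rightarrow> complex set" where
  "far r \<equiv> half_lattice \<tau> - cball 0 (2 * r)"

lemma far_bound_summable: "(\<lambda>w. 10 * r * inverse (norm w) ^ 3) summable_on far r"
  by (intro summable_on_cmult_right summable_on_subset_banach[OF half_lattice_summable[OF \<tau>]]) auto

lemma wp_term_summable_far:
  assumes "norm z \<le> r" "r > 0"
  shows "wp_term z summable_on far r"
proof (rule abs_summable_summable, rule summable_on_comparison_test[OF far_bound_summable[of r]])
  show "norm (wp_term z w) \<le> 10 * r * inverse (norm w) ^ 3" if "w \<in> far r" for w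
    using that assms by (intro norm_wp_term_le) auto
qed simp

lemma wp_term_has_sum:
  "(wp_term z has_sum wph z) (half_lattice \<tau>)"
proof -
  define r where "r = norm z + 1"
  have r: "norm z \<le> r" "r > 0" by (auto simp: r_def add_nonneg_pos)
  have "wp_term z summable_on (half_lattice \<tau> \<inter> cball 0 (2 * r)) \<union> far r"
    using wp_term_summable_far[OF r] finite_half_lattice_cball[OF \<tau>]
    by (intro summable_on_union) auto
  also have "(half_lattice \<tau> \<inter> cball 0 (2 * r)) \<union> far r = half_lattice \<tau>" by auto
  finally have summ: "wp_term z summable_on half_lattice \<tau>" .
  then have "wp_term z summable_on half_lattice \<tau> - {0}"
    by (rule summable_on_subset_banach) auto
  then have 1: "(wp_term z has_sum (\<Sum>\<^sub>\<infinity>w\<in>half_lattice \<tau> - {0}. wp_term z w)) (half_lattice \<tau> - {0})"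
    by simp
  have 0: "(wp_term z has_sum wp_term z 0) {0}" using has_sum_finite[of "{0}" "wp_term z"] by simp
  have "(wp_term z has_sum (\<Sum>\<^sub>\<infinity>w\<in>half_lattice \<tau> - {0}. wp_term z w) + wp_term z 0) ((half_lattice \<tau> - {0}) \<union> {0})"
    by (intro has_sum_Un_disjoint 0 1) auto
  also have "(half_lattice \<tau> - {0}) \<union> {0} = half_lattice \<tau>" by auto
  also have "(\<Sum>\<^sub>\<infinity>w\<in>half_lattice \<tau> - {0}. wp_term z w) = (\<Sum>\<^sub>\<infinity>w\<in>half_lattice \<tau> - {0}. 1 / (z - w)\<^sup>2 - 1 / w\<^sup>2)"
    by (rule infsum_cong) (simp add: wp_term_def)
  finally show ?thesis by (simp add: wp_def wp_term_def[of z 0] add.commute)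
qed

text \<open>Reindexing the series shows that the difference of the two values does not depend on \<open>z\<close>;
  it vanishes because the function is even.\<close>

lemma wp_shift_const:
  assumes v: "v \<in> half_lattice \<tau>"
  shows "\<exists>C. \<forall>z. wph (z + v) - wph z = C"
proof -
  have "wph (z + v) - wph z = (\<Sum>\<^sub>\<infinity>w\<in>half_lattice \<tau>. (if w = 0 then 0 else 1 / w\<^sup>2)
      - (if w + v = 0 then 0 else 1 / (w + v)\<^sup>2))" for z
  proof -
    have "((\<lambda>w. wp_term (z + v) (w + v)) has_sum wph (z + v)) (half_lattice \<tau>) \<longleftrightarrow>
        (wp_term (z + v) has_sum wph (z + v)) (half_lattice \<tau>)"
      using v by (intro has_sum_reindex_bij_witness[of _ "\<lambda>w. w - v" "\<lambda>w. w + v"])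
        (auto intro: half_lattice_add half_lattice_diff)
    then have "((\<lambda>w. wp_term (z + v) (w + v)) has_sum wph (z + v)) (half_lattice \<tau>)"
      using wp_term_has_sum by blast
    moreover have "((\<lambda>w. - wp_term z w) has_sum - wph z) (half_lattice \<tau>)"
      using wp_term_has_sum[of z] by (simp add: has_sum_uminus)
    ultimately have "((\<lambda>w. wp_term (z + v) (w + v) + - wp_term z w) has_sum wph (z + v) + - wph z) (half_lattice \<tau>)"
      by (rule has_sum_add)
    then have "((\<lambda>w. wp_term (z + v) (w + v) - wp_term z w) has_sum wph (z + v) - wph z) (half_lattice \<tau>)"
      by simp
    \<comment> \<open>With 1 / 0 = 0 this formula also holds for w = 0 and for z = w, so the
      z-dependent terms cancel at every index, poles included.\<close>
    moreover have gen: "wp_term z w = 1 / (z - w)\<^sup>2 - (if w = 0 then 0 else 1 / w\<^sup>2)" for z w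
      by (simp add: wp_term_def)
    have "wp_term (z + v) (w + v) - wp_term z w
      = (if w = 0 then 0 else 1 / w\<^sup>2) - (if w + v = 0 then 0 else 1 / (w + v)\<^sup>2)" for w
      by (simp only: gen add_diff_cancel_right) simp
    ultimately show ?thesis by (simp add: infsumI)
  qed
  then show ?thesis by blast
qed

lemma wp_even: "wph (- z) = wph z"
proof -
  have "((\<lambda>w. wp_term (- z) (- w)) has_sum wph (- z)) (half_lattice \<tau>) \<longleftrightarrow>
      (wp_term (- z) has_sum wph (- z)) (half_lattice \<tau>)"
    by (intro has_sum_reindex_bij_witness[of _ uminus uminus]) auto
  then have "((\<lambda>w. wp_term (- z) (- w)) has_sum wph (- z)) (half_lattice \<tau>)"
    using wp_term_has_sum by blast
  moreover have "wp_term (- z) (- w) = wp_term z w" for w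
    by (simp add: wp_term_def power2_commute)
  ultimately show ?thesis using has_sum_unique[OF wp_term_has_sum[of z]] by simp
qed

lemma wp_shift_gen:
  assumes "v \<in> half_lattice \<tau>"
  shows "wph (z + v) = wph z"
proof -
  obtain C where C: "\<And>z. wph (z + v) - wph z = C" using wp_shift_const[OF assms] by blast
  \<comment> \<open>At z = -v/2 the translate is v/2 = -z. Evenness has been proved for the total
    function, so this works even when v/2 is itself a lattice point.\<close>
  have "wph (- (v / 2) + v) = wph (- (v / 2))" using wp_even[of "v / 2"] by (simp add: field_simps)
  then have "C = 0" using C[of "- (v / 2)"] by simp
  then show ?thesis using C[of z] by simp
qed

lemma wp_far_holomorphic:
  assumes "r > 0"
  shows "(\<lambda>z. \<Sum>\<^sub>\<infinity>w\<in>far r. wp_term z w) holomorphic_on ball 0 r"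
proof -
  have "uniform_limit (cball 0 r) (\<lambda>K z. \<Sum>w\<in>K. wp_term z w) (\<lambda>z. \<Sum>\<^sub>\<infinity>w\<in>far r. wp_term z w)
      (finite_subsets_at_top (far r))"
  proof (rule Weierstrass_m_test_general[OF _ far_bound_summable])
    show "norm (wp_term z w) \<le> 10 * r * inverse (norm w) ^ 3" if "w \<in> far r" "z \<in> cball 0 r" for w z
      using that assms by (intro norm_wp_term_le) auto
  qed
  moreover have "\<forall>\<^sub>F K in finite_subsets_at_top (far r).
      continuous_on (cball 0 r) (\<lambda>z. \<Sum>w\<in>K. wp_term z w) \<and> (\<lambda>z. \<Sum>w\<in>K. wp_term z w) holomorphic_on ball 0 r"
  proof (rule eventually_finite_subsets_at_top_weakI)
    fix K assume K: "finite K" "K \<subseteq> far r"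
    have "wp_term z w = 1 / (z - w)\<^sup>2 - 1 / w\<^sup>2" "z - w \<noteq> 0" if "w \<in> K" "z \<in> cball 0 r" for z w
      using that K assms by (auto simp: wp_term_def)
    then have eq: "(\<Sum>w\<in>K. wp_term z w) = (\<Sum>w\<in>K. 1 / (z - w)\<^sup>2 - 1 / w\<^sup>2)"
      and nz: "\<And>w. w \<in> K \<Longrightarrow> z - w \<noteq> 0" if "z \<in> cball 0 r" for z
      using that by auto
    have "(\<lambda>z. \<Sum>w\<in>K. 1 / (z - w)\<^sup>2 - 1 / w\<^sup>2) holomorphic_on cball 0 r"
      using nz by (intro holomorphic_intros) auto
    then have "(\<lambda>z. \<Sum>w\<in>K. wp_term z w) holomorphic_on cball 0 r"
      by (rule holomorphic_transform) (simp add: eq)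
    then show "continuous_on (cball 0 r) (\<lambda>z. \<Sum>w\<in>K. wp_term z w) \<and> (\<lambda>z. \<Sum>w\<in>K. wp_term z w) holomorphic_on ball 0 r"
      by (meson ball_subset_cball holomorphic_on_imp_continuous_on holomorphic_on_subset)
  qed
  ultimately show ?thesis
    using holomorphic_uniform_limit[where F = "finite_subsets_at_top (far r)" and z = 0 and r = r
        and f = "\<lambda>K z. \<Sum>w\<in>K. wp_term z w"] by simp
qed

lemma wp_decomp:
  assumes "norm z < r"
  shows "wph z = 1 / z\<^sup>2 + ((\<Sum>w\<in>(half_lattice \<tau> \<inter> cball 0 (2 * r)) - {0}. 1 / (z - w)\<^sup>2 - 1 / w\<^sup>2)
      + (\<Sum>\<^sub>\<infinity>w\<in>far r. wp_term z w))"
proof -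
  have r: "r > 0" using assms norm_ge_zero[of z] by linarith
  let ?F = "(half_lattice \<tau> \<inter> cball 0 (2 * r)) - {0}"
  have fin: "finite ?F" using finite_half_lattice_cball[OF \<tau>] by auto
  have 0: "(wp_term z has_sum wp_term z 0) {0}" using has_sum_finite[of "{0}" "wp_term z"] by simp
  have "(wp_term z has_sum wp_term z 0 + (sum (wp_term z) ?F + (\<Sum>\<^sub>\<infinity>w\<in>far r. wp_term z w))) ({0} \<union> (?F \<union> far r))"
    using wp_term_summable_far[of z r] assms r fin
    by (intro has_sum_Un_disjoint 0 has_sum_finite has_sum_infsum) auto
  also have "{0} \<union> (?F \<union> far r) = half_lattice \<tau>" using r by auto
  finally have "wph z = wp_term z 0 + (sum (wp_term z) ?F + (\<Sum>\<^sub>\<infinity>w\<in>far r. wp_term z w))"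
    using has_sum_unique[OF wp_term_has_sum] by blast
  also have "sum (wp_term z) ?F = (\<Sum>w\<in>?F. 1 / (z - w)\<^sup>2 - 1 / w\<^sup>2)"
    by (rule sum.cong) (auto simp: wp_term_def)
  finally show ?thesis by (simp add: wp_term_def)
qed

lemma wp_regular_part: "\<exists>g. g analytic_on {0} \<and> (\<forall>\<^sub>F z in nhds 0. wph z = 1 / z\<^sup>2 + g z)"
proof -
  define g where "g = (\<lambda>z. (\<Sum>w\<in>(half_lattice \<tau> \<inter> cball 0 (2 * 1)) - {0}. 1 / (z - w)\<^sup>2 - 1 / w\<^sup>2)
      + (\<Sum>\<^sub>\<infinity>w\<in>far 1. wp_term z w))"
  have "(\<lambda>z. \<Sum>\<^sub>\<infinity>w\<in>far 1. wp_term z w) analytic_on {0}"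
    using wp_far_holomorphic[of 1] by (auto simp: analytic_at intro!: exI[of _ "ball 0 1"])
  then have "g analytic_on {0}"
    unfolding g_def by (intro analytic_on_add analytic_on_sum analytic_on_diff analytic_on_divide analytic_on_power
      analytic_on_const analytic_on_ident) auto
  moreover have "\<forall>\<^sub>F z in nhds 0. wph z = 1 / z\<^sup>2 + g z"
    unfolding eventually_nhds using wp_decomp[of _ 1] by (intro exI[of _ "ball 0 1"]) (auto simp: g_def)
  ultimately show ?thesis by blast
qed

lemma wp_analytic:
  assumes z: "z \<notin> half_lattice \<tau>"
  shows "wph analytic_on {z}"
proof -
  define r where "r = norm z + 1"
  have r: "norm z < r" "r > 0" by (auto simp: r_def add_nonneg_pos)
  define g where "g = (\<lambda>z. 1 / z\<^sup>2 + ((\<Sum>w\<in>(half_lattice \<tau> \<inter> cball 0 (2 * r)) - {0}. 1 / (z - w)\<^sup>2 - 1 / w\<^sup>2)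
      + (\<Sum>\<^sub>\<infinity>w\<in>far r. wp_term z w)))"
  have "(\<lambda>z. \<Sum>\<^sub>\<infinity>w\<in>far r. wp_term z w) analytic_on {z}"
    using wp_far_holomorphic[OF r(2)] r by (auto simp: analytic_at intro!: exI[of _ "ball 0 r"])
  moreover have "z \<noteq> 0" using z by auto
  ultimately have "g analytic_on {z}"
    unfolding g_def using z by (intro analytic_on_add analytic_on_sum analytic_on_diff analytic_on_divide analytic_on_power
      analytic_on_const analytic_on_ident) auto
  moreover have "\<forall>\<^sub>F w in nhds z. g w = wph w"
    unfolding eventually_nhds using wp_decomp[of _ r] r by (intro exI[of _ "ball 0 r"]) (auto simp: g_def)
  ultimately show ?thesis
    using analytic_at_cong[of g wph z z] by simp
qed

lemma wp_meromorphic: "wph meromorphic_on UNIV"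
proof -
  obtain g where g: "g analytic_on {0}" "\<forall>\<^sub>F z in nhds 0. wph z = 1 / z\<^sup>2 + g z"
    using wp_regular_part by blast
  have "(\<lambda>z. 1 / z\<^sup>2 + g z) meromorphic_on {0}"
    using g(1) by (intro meromorphic_intros analytic_on_imp_meromorphic_on)
  moreover have "\<forall>\<^sub>F z in at 0. wph z = 1 / z\<^sup>2 + g z"
    using g(2) by (rule eventually_nhds_conv_at[THEN iffD1, THEN conjunct1])
  ultimately have 0: "wph meromorphic_on {0}"
    using meromorphic_on_cong[of "{0}" wph "\<lambda>z. 1 / z\<^sup>2 + g z" "{0}"] by simp
  have "wph meromorphic_on {z}" for z
  proof (cases "z \<in> half_lattice \<tau>")
    case True
    have "(\<lambda>x. wph (x - z)) meromorphic_on {z}"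
      by (rule meromorphic_on_compose[OF 0]) (auto intro!: analytic_intros)
    moreover have "(\<lambda>x. wph (x - z)) = wph"
      using wp_shift_gen[of "- z"] True by (simp add: fun_eq_iff)
    ultimately show ?thesis by simp
  next
    case False
    then show ?thesis using wp_analytic analytic_on_imp_meromorphic_on by blast
  qed
  then show ?thesis using meromorphic_on_meromorphic_at by blast
qed

lemma deriv_wp_shift: "v \<in> half_lattice \<tau> \<Longrightarrow> deriv wph (z + v) = deriv wph z"
proof -
  assume v: "v \<in> half_lattice \<tau>"
  have "(\<lambda>x. wph (x + v)) = wph" using wp_shift_gen[OF v] by auto
  then show ?thesis
    unfolding deriv_def using DERIV_shift[of wph _ z v] by simp
qed

lemma wp_tendsto: "((\<lambda>z. wph z * z ^ 2) \<longlongrightarrow> 1) (at 0)" "((\<lambda>z. deriv wph z * z ^ 3) \<longlongrightarrow> - 2) (at 0)"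
proof -
  obtain g where g: "g analytic_on {0}" "\<forall>\<^sub>F z in nhds 0. wph z = 1 / z\<^sup>2 + g z"
    using wp_regular_part by blast
  have ev: "\<forall>\<^sub>F z in at 0. wph z = 1 / z\<^sup>2 + g z"
    using g(2) by (rule eventually_nhds_conv_at[THEN iffD1, THEN conjunct1])
  have lim: "(h \<longlongrightarrow> h 0) (at 0)" if "h analytic_on {0}" for h :: "complex \<Rightarrow> complex"
    using that by (auto intro!: isContD analytic_at_imp_isCont)
  have "((\<lambda>z. 1 + g z * z ^ 2) \<longlongrightarrow> 1 + g 0 * 0 ^ 2) (at 0)"
    by (intro tendsto_intros lim g)
  moreover have "\<forall>\<^sub>F z in at 0. 1 + g z * z ^ 2 = wph z * z ^ 2"
    using ev eventually_neq_at_within[of 0 0 UNIV]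
    by eventually_elim (simp add: field_simps)
  ultimately show "((\<lambda>z. wph z * z ^ 2) \<longlongrightarrow> 1) (at 0)"
    by (simp add: tendsto_cong)
  obtain e where e: "e > 0" "\<And>z. dist z 0 < e \<Longrightarrow> wph z = 1 / z\<^sup>2 + g z"
    using g(2) by (auto simp: eventually_nhds_metric)
  obtain d where d: "d > 0" "g holomorphic_on ball 0 d"
    using g(1) by (auto simp: analytic_on_def)
  have dw: "deriv wph z = - 2 / z ^ 3 + deriv g z" if z: "z \<noteq> 0" "norm z < min e d" for z
  proof -
    have g': "(g has_field_derivative deriv g z) (at z)"
      using holomorphic_derivI[OF d(2) open_ball, of z] z by simp
    have "((\<lambda>z. 1 / z\<^sup>2 + g z) has_field_derivative - 2 / z ^ 3 + deriv g z) (at z)"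
      by (rule derivative_eq_intros g' refl | use z in \<open>simp add: field_simps power2_eq_square power3_eq_cube\<close>)+
    then have "(wph has_field_derivative - 2 / z ^ 3 + deriv g z) (at z)"
      by (rule has_field_derivative_transform_within_open[of _ _ _ "ball 0 e"]) (use z e(2) in auto)
    then show ?thesis by (rule DERIV_imp_deriv)
  qed
  have "((\<lambda>z. - 2 + deriv g z * z ^ 3) \<longlongrightarrow> - 2 + deriv g 0 * 0 ^ 3) (at 0)"
    by (intro tendsto_intros lim analytic_deriv g)
  moreover have "\<forall>\<^sub>F z in at 0. - 2 + deriv g z * z ^ 3 = deriv wph z * z ^ 3"
    unfolding eventually_at using e(1) d(1) dw by (intro exI[of _ "min e d"]) (auto simp: field_simps)
  ultimately show "((\<lambda>z. deriv wph z * z ^ 3) \<longlongrightarrow> - 2) (at 0)"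
    by (simp add: tendsto_cong)
qed

end

subsection \<open>Orders of poles\<close>

text \<open>Orders are expressed by limits, so that the zero function is included and sums need no
  case distinction; \<open>pole_eq\<close> asks for a nonzero leading coefficient.\<close>

definition pole_le :: "complex \<Rightarrow> nat \<Rightarrow> (complex \<Rightarrow> complex) \<Rightarrow> bool" where
  "pole_le q k f \<longleftrightarrow> f meromorphic_on {q} \<and> (\<exists>c. ((\<lambda>z. f z * (z - q) ^ k) \<longlongrightarrow> c) (at q))"

definition pole_eq :: "complex \<Rightarrow> nat \<Rightarrow> (complex \<Rightarrow> complex) \<Rightarrow> bool" where
  "pole_eq q k f \<longleftrightarrow> f meromorphic_on {q} \<and> (\<exists>c. c \<noteq> 0 \<and> ((\<lambda>z. f z * (z - q) ^ k) \<longlongrightarrow> c) (at q))"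

lemma pole_le_add:
  assumes "pole_le q k f" "pole_le q k g"
  shows "pole_le q k (\<lambda>z. f z + g z)"
proof -
  obtain c d where "((\<lambda>z. f z * (z - q) ^ k) \<longlongrightarrow> c) (at q)" "((\<lambda>z. g z * (z - q) ^ k) \<longlongrightarrow> d) (at q)"
    using assms by (auto simp: pole_le_def)
  from tendsto_add[OF this] have "((\<lambda>z. (f z + g z) * (z - q) ^ k) \<longlongrightarrow> c + d) (at q)"
    by (simp add: distrib_right)
  then show ?thesis using assms by (auto simp: pole_le_def intro!: meromorphic_intros)
qed

lemma pole_le_scale:
  assumes "pole_le q k f"
  shows "pole_le q k (\<lambda>z. a * f z)"
proof -
  obtain c where "((\<lambda>z. f z * (z - q) ^ k) \<longlongrightarrow> c) (at q)"
    using assms by (auto simp: pole_le_def)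
  from tendsto_mult[OF tendsto_const[of a] this] have "((\<lambda>z. (a * f z) * (z - q) ^ k) \<longlongrightarrow> a * c) (at q)"
    by (simp add: mult.assoc)
  then show ?thesis using assms by (auto simp: pole_le_def intro!: meromorphic_intros)
qed

lemma pole_le_diff: "pole_le q k f \<Longrightarrow> pole_le q k g \<Longrightarrow> pole_le q k (\<lambda>z. f z - g z)"
  using pole_le_add[of q k f "\<lambda>z. - 1 * g z"] pole_le_scale[of q k g "-1"] by simp

lemma pole_le_mono:
  assumes "pole_le q k f" "k \<le> l"
  shows "pole_le q l f"
proof -
  obtain c where c: "((\<lambda>z. f z * (z - q) ^ k) \<longlongrightarrow> c) (at q)" using assms by (auto simp: pole_le_def)
  have "((\<lambda>z. (f z * (z - q) ^ k) * (z - q) ^ (l - k)) \<longlongrightarrow> c * (q - q) ^ (l - k)) (at q)"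
    by (intro tendsto_intros c)
  moreover have "(f z * (z - q) ^ k) * (z - q) ^ (l - k) = f z * (z - q) ^ l" for z
    using assms(2) by (simp add: mult.assoc power_add [symmetric])
  ultimately show ?thesis using assms(1) by (auto simp: pole_le_def)
qed

lemma pole_eq_mult:
  assumes "pole_eq q k f" "pole_eq q l g"
  shows "pole_eq q (k + l) (\<lambda>z. f z * g z)"
proof -
  obtain c d where cd: "c \<noteq> 0" "((\<lambda>z. f z * (z - q) ^ k) \<longlongrightarrow> c) (at q)" "d \<noteq> 0" "((\<lambda>z. g z * (z - q) ^ l) \<longlongrightarrow> d) (at q)"
    using assms by (auto simp: pole_eq_def)
  from tendsto_mult[OF cd(2,4)] have "((\<lambda>z. (f z * g z) * (z - q) ^ (k + l)) \<longlongrightarrow> c * d) (at q)"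
    by (simp add: power_add mult_ac)
  moreover have "c * d \<noteq> 0" using cd by simp
  moreover have "(\<lambda>z. f z * g z) meromorphic_on {q}"
    using assms by (auto simp: pole_eq_def intro!: meromorphic_intros)
  ultimately show ?thesis unfolding pole_eq_def by blast
qed

lemma pole_eq_cong:
  assumes "pole_eq q k f" "\<forall>\<^sub>F z in at q. f z = g z"
  shows "pole_eq q k g"
proof -
  obtain c where c: "c \<noteq> 0" "((\<lambda>z. f z * (z - q) ^ k) \<longlongrightarrow> c) (at q)" using assms by (auto simp: pole_eq_def)
  have "\<forall>\<^sub>F z in at q. f z * (z - q) ^ k = g z * (z - q) ^ k"
    using assms(2) by (rule eventually_mono) simp
  from Lim_transform_eventually[OF c(2) this] c(1)
  show ?thesis using assms meromorphic_on_cong[of "{q}" f g "{q}"] by (auto simp: pole_eq_def)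
qed

lemma pole_le_cong:
  assumes "pole_le q k f" "\<forall>\<^sub>F z in at q. f z = g z"
  shows "pole_le q k g"
proof -
  obtain c where c: "((\<lambda>z. f z * (z - q) ^ k) \<longlongrightarrow> c) (at q)" using assms by (auto simp: pole_le_def)
  have "\<forall>\<^sub>F z in at q. f z * (z - q) ^ k = g z * (z - q) ^ k"
    using assms(2) by (rule eventually_mono) simp
  from Lim_transform_eventually[OF c this]
  show ?thesis using assms meromorphic_on_cong[of "{q}" f g "{q}"] by (auto simp: pole_le_def)
qed

lemma analytic_tendsto: "f analytic_on {q} \<Longrightarrow> (f \<longlongrightarrow> f q) (at q)"
  by (auto intro!: isContD analytic_at_imp_isCont)

lemma pole_le_analytic: "f analytic_on {q} \<Longrightarrow> pole_le q 0 f"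
  using analytic_tendsto[of f q] analytic_on_imp_meromorphic_on[of f "{q}"] by (auto simp: pole_le_def)

lemma pole_eq_analytic: "f analytic_on {q} \<Longrightarrow> f q \<noteq> 0 \<Longrightarrow> pole_eq q 0 f"
  using analytic_tendsto[of f q] analytic_on_imp_meromorphic_on[of f "{q}"] by (auto simp: pole_eq_def)

lemma meromorphic_pole_le:
  assumes "f meromorphic_on {q}"
  shows "\<exists>k. pole_le q k f"
proof -
  have sing: "isolated_singularity_at f q" "not_essential f q"
    using assms by (auto simp: meromorphic_at_iff)
  show ?thesis
  proof (cases "is_pole f q")
    case False
    then obtain c where "(f \<longlongrightarrow> c) (at q)" using sing(2) by (auto simp: not_essential_def)
    then have "pole_le q 0 f" using assms by (auto simp: pole_le_def)
    then show ?thesis ..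
  next
    case True
    obtain r where r: "r > 0" "f holomorphic_on ball q r - {q}"
      using sing(1) by (auto simp: isolated_singularity_at_def analytic_imp_holomorphic)
    define n where "n = nat (- zorder f q)"
    obtain s where s: "s > 0" "zor_poly f q holomorphic_on cball q s"
      "\<And>w. w \<in> cball q s - {q} \<Longrightarrow> f w = zor_poly f q w / (w - q) ^ n"
      using zorder_exist_pole[OF r(2) open_ball _ True] r(1) by (auto simp: n_def)
    have "zor_poly f q analytic_on {q}"
      using s(1) holomorphic_on_subset[OF s(2) ball_subset_cball] by (auto simp: analytic_on_def)
    from analytic_tendsto[OF this]
    have "(zor_poly f q \<longlongrightarrow> zor_poly f q q) (at q)" .
    moreover have "\<forall>\<^sub>F w in at q. zor_poly f q w = f w * (w - q) ^ n"
      unfolding eventually_at using s(1,3) by (intro exI[of _ s]) (auto simp: dist_commute)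
    ultimately have "((\<lambda>w. f w * (w - q) ^ n) \<longlongrightarrow> zor_poly f q q) (at q)"
      by (rule Lim_transform_eventually)
    then show ?thesis using assms by (auto simp: pole_le_def)
  qed
qed

text \<open>The product extends analytically with value 0 at q, so dividing it by z - q leaves the
  difference quotient, whose limit is the derivative.\<close>

lemma meromorphic_mult_tendsto_0:
  assumes "f meromorphic_on {q}" "((\<lambda>z. f z * (z - q)) \<longlongrightarrow> 0) (at q)"
  shows "\<exists>c. (f \<longlongrightarrow> c) (at q)"
proof -
  define u where "u = remove_sings (\<lambda>z. f z * (z - q))"
  have "(\<lambda>z. f z * (z - q)) meromorphic_on {q}" using assms(1) by (intro meromorphic_intros)
  then have sing: "isolated_singularity_at (\<lambda>z. f z * (z - q)) q" by (simp add: meromorphic_at_iff)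
  have u: "u analytic_on {q}" unfolding u_def by (rule remove_sings_analytic_at[OF sing assms(2)])
  have u0: "u q = 0" unfolding u_def using assms(2) by (rule remove_sings_eqI)
  have "((\<lambda>z. u z / (z - q)) \<longlongrightarrow> deriv u q) (at q)"
    using analytic_derivI[OF u] u0 by (simp add: has_field_derivative_iff)
  moreover have "\<forall>\<^sub>F z in at q. u z / (z - q) = f z"
    using eventually_remove_sings_eq_at[OF sing] eventually_neq_at_within[of q q UNIV]
    by eventually_elim (simp add: u_def)
  ultimately show ?thesis using Lim_transform_eventually by blast
qed

text \<open>c is the quotient of the leading coefficients. The difference times the next lower power
  of z - q has at most a removable singularity.\<close>

lemma pole_le_reduce:
  assumes "pole_le q (Suc k) f" "pole_eq q (Suc k) g"
  shows "\<exists>c. pole_le q k (\<lambda>z. f z - c * g z)"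
proof -
  obtain a b where a: "((\<lambda>z. f z * (z - q) ^ Suc k) \<longlongrightarrow> a) (at q)"
    and b: "b \<noteq> 0" "((\<lambda>z. g z * (z - q) ^ Suc k) \<longlongrightarrow> b) (at q)"
    using assms by (auto simp: pole_le_def pole_eq_def)
  let ?h = "\<lambda>z. f z - (a / b) * g z"
  have mero: "?h meromorphic_on {q}"
    using assms by (auto simp: pole_le_def pole_eq_def intro!: meromorphic_intros)
  have "((\<lambda>z. f z * (z - q) ^ Suc k - (a / b) * (g z * (z - q) ^ Suc k)) \<longlongrightarrow> a - (a / b) * b) (at q)"
    by (intro tendsto_intros a b)
  moreover have "f z * (z - q) ^ Suc k - (a / b) * (g z * (z - q) ^ Suc k) = (?h z * (z - q) ^ k) * (z - q)" for z
    unfolding power_Suc2 by (simp only: left_diff_distrib mult.assoc)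
  moreover have "a - (a / b) * b = 0" using b(1) by simp
  ultimately have lim: "((\<lambda>z. (?h z * (z - q) ^ k) * (z - q)) \<longlongrightarrow> 0) (at q)" by simp
  have "(\<lambda>z. ?h z * (z - q) ^ k) meromorphic_on {q}"
    by (intro meromorphic_intros mero)
  from meromorphic_mult_tendsto_0[OF this lim] mero have "pole_le q k ?h"
    unfolding pole_le_def by blast
  then show ?thesis ..
qed

lemma pole_le_shift:
  assumes "\<And>z. f (z + w) = f z"
  shows "pole_le (q + w) k f \<longleftrightarrow> pole_le q k f"
proof -
  have sh: "pole_le (q + w) k f" if le: "pole_le q k f" and per: "\<And>z. f (z + w) = f z" for q w
  proof -
    have f: "f (z - w) = f z" for z using per[of "z - w"] by simp
    obtain c where "((\<lambda>z. f z * (z - q) ^ k) \<longlongrightarrow> c) (at q)" using le by (auto simp: pole_le_def)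
    from LIM_offset[OF this, of "- w"] have "((\<lambda>z. f z * (z - (q + w)) ^ k) \<longlongrightarrow> c) (at (q + w))"
      by (simp add: f algebra_simps)
    moreover have "(\<lambda>z. f (z - w)) meromorphic_on {q + w}"
      by (rule meromorphic_on_compose[of f "{q}"]) (use le in \<open>auto simp: pole_le_def intro!: analytic_intros\<close>)
    then have "f meromorphic_on {q + w}" by (simp add: f)
    ultimately show ?thesis by (auto simp: pole_le_def)
  qed
  have "f (z + - w) = f z" for z using assms[of "z - w"] by simp
  then show ?thesis using sh[of q w] sh[of "q + w" "- w"] assms by auto
qed

text \<open>Induction on the order, removing one leading term at a time until only orders up to m
  remain. Outside the origin this is used with m = 0, at the origin with m = 1.\<close>

lemma eliminate_pole:
  assumes zero: "(\<lambda>z. 0) \<in> C" and add: "\<And>f g. f \<in> C \<Longrightarrow> g \<in> C \<Longrightarrow> (\<lambda>z. f z + g z) \<in> C"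
    and scale: "\<And>f a. f \<in> C \<Longrightarrow> (\<lambda>z. a * f z) \<in> C"
    and ex: "\<And>j. j > m \<Longrightarrow> \<exists>g\<in>C. pole_eq q j g"
    and f: "pole_le q k f"
  shows "\<exists>g\<in>C. pole_le q m (\<lambda>z. f z - g z)"
  using f
proof (induction k arbitrary: f)
  case 0
  then show ?case using zero pole_le_mono[of q 0 f m] by (intro bexI[of _ "\<lambda>z. 0"]) auto
next
  case (Suc k)
  show ?case
  proof (cases "Suc k \<le> m")
    case True
    then show ?thesis using zero pole_le_mono[OF Suc.prems True] by (intro bexI[of _ "\<lambda>z. 0"]) auto
  next
    case False
    then obtain g where g: "g \<in> C" "pole_eq q (Suc k) g" using ex[of "Suc k"] by auto
    obtain c where "pole_le q k (\<lambda>z. f z - c * g z)" using pole_le_reduce[OF Suc.prems g(2)] by blast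
    from Suc.IH[OF this] obtain h where h: "h \<in> C" "pole_le q m (\<lambda>z. f z - c * g z - h z)" by blast
    have "(\<lambda>z. c * g z + h z) \<in> C" by (intro add scale g h)
    then show ?thesis using h(2) by (intro bexI[of _ "\<lambda>z. c * g z + h z"]) (auto simp: algebra_simps)
  qed
qed

subsection \<open>The ring of invariants\<close>

lemma half_lattice_periodic:
  assumes "\<And>z. f (z + 1/2) = f z" "\<And>z. f (z + \<tau>/2) = f z" "w \<in> half_lattice \<tau>"
  shows "f (z + w) = f z"
proof -
  have "doubly_periodic \<tau> (\<lambda>x. f (x / 2))"
    using assms(1,2) by (simp add: doubly_periodic_def add_divide_distrib)
  from doubly_periodic_lattice[OF this, of "2 * w" "2 * z"] assms(3) show ?thesis
    by (simp add: half_lattice_iff add_divide_distrib)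
qed

context torus_setting
begin

lemma double_holo: "(\<lambda>z. 2 * z) holomorphic_on (UNIV :: complex set)"
  by (intro holomorphic_intros)

lemma mu1_meromorphic: "mu1 \<tau> meromorphic_on A"
  unfolding mu1_def
  by (intro meromorphic_intros holomorphic_imp_meromorphic holomorphic_intros theta_holo \<tau>)

lemma mu1_analytic: "z \<notin> half_lattice \<tau> \<Longrightarrow> mu1 \<tau> analytic_on {z}"
  unfolding mu1_def
  by (intro analytic_on_mult analytic_on_divide analytic_on_const holomorphic_imp_analytic holomorphic_intros theta_holo \<tau>)
    (simp add: theta1_zero_iff[OF \<tau>] half_lattice_iff)

text \<open>The sign under \<tau> / 2 is the reason why \<open>xi\<close> is a product of two
  translates, in which the signs cancel.\<close>

lemma mu1_shift: "mu1 \<tau> (z + 1/2) = mu1 \<tau> z" "mu1 \<tau> (z + \<tau>/2) = - mu1 \<tau> z"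
  by (simp_all add: mu1_def ring_distribs theta_add_1 theta_add_tau[OF \<tau>] qfac_nonzero)

lemma xi_periodic: "w \<in> half_lattice \<tau> \<Longrightarrow> xi \<tau> p (z + w) = xi \<tau> p z"
proof (rule half_lattice_periodic)
  fix z
  show "xi \<tau> p (z + 1/2) = xi \<tau> p z"
    using mu1_shift(1)[of z] mu1_shift(1)[of "z - p"] by (simp add: xi_def algebra_simps)
  show "xi \<tau> p (z + \<tau>/2) = xi \<tau> p z"
    using mu1_shift(2)[of z] mu1_shift(2)[of "z - p"] by (simp add: xi_def algebra_simps)
qed

lemma mu1_translate_meromorphic: "(\<lambda>z. mu1 \<tau> (z - p)) meromorphic_on UNIV"
  by (rule meromorphic_on_compose[OF mu1_meromorphic[of UNIV]]) (auto intro!: analytic_intros)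

lemma xi_meromorphic: "xi \<tau> p meromorphic_on UNIV"
  unfolding xi_def by (intro meromorphic_on_mult mu1_meromorphic mu1_translate_meromorphic)

lemma xi_analytic:
  assumes "z \<notin> half_lattice \<tau>" "z - p \<notin> half_lattice \<tau>"
  shows "xi \<tau> p analytic_on {z}"
proof -
  have "(mu1 \<tau> \<circ> (\<lambda>z. z - p)) analytic_on {z}"
    using mu1_analytic[OF assms(2)] by (intro analytic_on_compose) (auto intro!: analytic_intros)
  then show ?thesis
    unfolding xi_def using mu1_analytic[OF assms(1)] by (intro analytic_on_mult) (simp_all add: o_def)
qed

lemma theta1_double_tendsto:
  assumes "q \<in> half_lattice \<tau>"
  shows "((\<lambda>z. theta1 (2 * z) \<tau> / (z - q)) \<longlongrightarrow> 2 * deriv (\<lambda>z. theta1 z \<tau>) (2 * q)) (at q)"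
proof -
  have "((\<lambda>z. theta1 (2 * z) \<tau>) has_field_derivative deriv (\<lambda>z. theta1 z \<tau>) (2 * q) * 2) (at q)"
    by (rule DERIV_chain2[OF theta1_deriv[OF \<tau>]]) (auto intro!: derivative_eq_intros)
  moreover have "theta1 (2 * q) \<tau> = 0" using assms by (simp add: theta1_zero_iff[OF \<tau>] half_lattice_iff)
  ultimately show ?thesis by (simp add: has_field_derivative_iff mult.commute)
qed

lemma mu1_pole: "\<exists>c. c \<noteq> 0 \<and> ((\<lambda>z. mu1 \<tau> z * z) \<longlongrightarrow> c) (at 0)"
proof -
  let ?d = "deriv (\<lambda>z. theta1 z \<tau>) 0"
  have d: "?d \<noteq> 0" by (rule theta1_deriv_0[OF \<tau>])
  have t2: "theta2 0 \<tau> \<noteq> 0" by (rule theta_constants_nonzero[OF \<tau>])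
  have "(\<lambda>z. theta2 (2 * z) \<tau>) analytic_on {0}"
    by (intro holomorphic_imp_analytic theta_holo \<tau> double_holo)
  from analytic_tendsto[OF this] have 2: "((\<lambda>z. theta2 (2 * z) \<tau>) \<longlongrightarrow> theta2 0 \<tau>) (at 0)" by simp
  have "((\<lambda>z. ?d / theta2 0 \<tau> * (theta2 (2 * z) \<tau> / (theta1 (2 * z) \<tau> / (z - 0)))) \<longlongrightarrow>
      ?d / theta2 0 \<tau> * (theta2 0 \<tau> / (2 * deriv (\<lambda>z. theta1 z \<tau>) (2 * 0)))) (at 0)"
    using d by (intro tendsto_intros 2 theta1_double_tendsto) auto
  moreover have "?d / theta2 0 \<tau> * (theta2 (2 * z) \<tau> / (theta1 (2 * z) \<tau> / (z - 0))) = mu1 \<tau> z * z" for z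
    by (simp add: mu1_def)
  ultimately have "((\<lambda>z. mu1 \<tau> z * z) \<longlongrightarrow> ?d / theta2 0 \<tau> * (theta2 0 \<tau> / (2 * ?d))) (at 0)" by simp
  then show ?thesis using d t2 by (intro exI[of _ "?d / theta2 0 \<tau> * (theta2 0 \<tau> / (2 * ?d))"]) simp
qed

lemma xi_pole:
  assumes q: "q \<notin> half_lattice \<tau>" "q - 1/4 \<notin> half_lattice \<tau>"
  shows "pole_eq q 1 (xi \<tau> q)"
proof -
  have "theta2 (2 * q) \<tau> \<noteq> 0"
    using half_lattice_add_cancel[of "1/2" \<tau> "q - 1/4"] q(2)
    by (simp add: theta2_zero_iff[OF \<tau>] half_lattice_iff algebra_simps)
  then have "mu1 \<tau> q \<noteq> 0"
    using q(1) theta1_deriv_0[OF \<tau>] theta_constants_nonzero(1)[OF \<tau>]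
    by (simp add: mu1_def theta1_zero_iff[OF \<tau>] half_lattice_iff)
  then have 1: "pole_eq q 0 (mu1 \<tau>)" by (intro pole_eq_analytic mu1_analytic q(1))
  obtain c where c: "c \<noteq> 0" "((\<lambda>z. mu1 \<tau> z * z) \<longlongrightarrow> c) (at 0)" using mu1_pole by blast
  from LIM_offset[OF c(2), of "- q"] have "((\<lambda>z. mu1 \<tau> (z - q) * (z - q) ^ 1) \<longlongrightarrow> c) (at q)" by simp
  then have "pole_eq q 1 (\<lambda>z. mu1 \<tau> (z - q))"
    using c(1) meromorphic_on_subset[OF mu1_translate_meromorphic, of "{q}"] by (auto simp: pole_eq_def)
  from pole_eq_mult[OF 1 this] show ?thesis by (simp add: xi_def [abs_def])
qed

abbreviation lift :: "(complex set \<Rightarrow> complex) \<Rightarrow> complex \<Rightarrow> complex" where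
  "lift f \<equiv> \<lambda>z. f (tproj \<tau> z)"

lemma lift_zero_off:
  assumes "\<And>z w. w \<in> half_lattice \<tau> \<Longrightarrow> H (z + w) = H z"
  shows "lift (zero_off U (\<lambda>p. H (rep p))) z = (if z \<in> poles then 0 else H z)"
proof -
  have "H (z + (rep (tproj \<tau> z) - z)) = H z"
    by (rule assms[OF lattice_subset_half[OF rep_tproj]])
  then show ?thesis by (simp add: zero_off_def tproj_U_iff)
qed

lemma eventually_lift_zero_off:
  assumes "\<And>z w. w \<in> half_lattice \<tau> \<Longrightarrow> H (z + w) = H z"
  shows "\<forall>\<^sub>F z in at q. H z = lift (zero_off U (\<lambda>p. H (rep p))) z"
  using eventually_notin_poles by (rule eventually_mono) (use lift_zero_off[of H] assms in simp)

lemma inv_ring_zero_off: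
  assumes per: "\<And>z w. w \<in> half_lattice \<tau> \<Longrightarrow> H (z + w) = H z"
    and "H meromorphic_on UNIV" "\<And>z. z \<notin> poles \<Longrightarrow> H analytic_on {z}"
  shows "zero_off U (\<lambda>p. H (rep p)) \<in> \<O>\<^sub>D"
  unfolding inv_ring_iff_periodic
proof (intro conjI ballI allI)
  show "zero_off U (\<lambda>p. H (rep p)) \<in> \<O>"
    using assms lift_zero_off[of H] by (intro mero_ringI[of _ H]) (auto simp: zero_off_def)
  show "zero_off U (\<lambda>p. H (rep p)) (tproj \<tau> (z + w)) = zero_off U (\<lambda>p. H (rep p)) (tproj \<tau> z)"
    if "w \<in> half_lattice \<tau>" for w z
    using that lift_zero_off[of H, OF per] by (simp add: poles_add_half per)
qed

section \<open>The algebra generated by the Weierstrass function, its derivative and the functions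
  xi\<close>

abbreviation "\<W> \<equiv> wp_xi_ring \<tau> U n P"

abbreviation "wp_gen \<equiv> zero_off U (\<lambda>p. wp (half_lattice \<tau>) (rep p))"

abbreviation "wp'_gen \<equiv> zero_off U (\<lambda>p. deriv (wp (half_lattice \<tau>)) (rep p))"

abbreviation "xi_gen i \<equiv> zero_off U (\<lambda>p. xi \<tau> (pt i) (rep p))"

lemma notin_poles: "z \<notin> poles \<Longrightarrow> z \<notin> half_lattice \<tau>" "z \<notin> poles \<Longrightarrow> i < n \<Longrightarrow> z - pt i \<notin> half_lattice \<tau>"
  using half_lattice_poles by (auto simp: poles_def)

lemma wp_gen_inv: "wp_gen \<in> \<O>\<^sub>D"
  by (intro inv_ring_zero_off wp_shift_gen wp_meromorphic wp_analytic \<tau> notin_poles)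

lemma wp'_gen_inv: "wp'_gen \<in> \<O>\<^sub>D"
  by (intro inv_ring_zero_off deriv_wp_shift meromorphic_on_deriv wp_meromorphic analytic_deriv wp_analytic \<tau> notin_poles)

lemma xi_gen_inv: "i < n \<Longrightarrow> xi_gen i \<in> \<O>\<^sub>D"
  by (intro inv_ring_zero_off xi_periodic xi_meromorphic xi_analytic notin_poles)

lemma wp_xi_subset: "f \<in> \<W> \<Longrightarrow> f \<in> \<O>\<^sub>D"
  unfolding wp_xi_ring_def
proof (induction rule: generated_algebra.induct)
  case (gen g)
  then show ?case using wp_gen_inv wp'_gen_inv xi_gen_inv by (auto simp: pt_def)
qed (auto intro: inv_ring_const inv_ring_add inv_ring_mult)

lemma W_gens: "wp_gen \<in> \<W>" "wp'_gen \<in> \<W>" "1 \<le> i \<Longrightarrow> i < n \<Longrightarrow> xi_gen i \<in> \<W>"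
  unfolding wp_xi_ring_def by (rule generated_algebra.gen; auto simp: pt_def)+

lemma W_add: "f \<in> \<W> \<Longrightarrow> g \<in> \<W> \<Longrightarrow> (\<lambda>p. f p + g p) \<in> \<W>"
  and W_mult: "f \<in> \<W> \<Longrightarrow> g \<in> \<W> \<Longrightarrow> (\<lambda>p. f p * g p) \<in> \<W>"
  and W_const: "zero_off U (\<lambda>p. c) \<in> \<W>"
  unfolding wp_xi_ring_def by (auto intro: generated_algebra.intros)

lemma W_off_U: "f \<in> \<W> \<Longrightarrow> p \<notin> U \<Longrightarrow> f p = 0"
  using mero_ringD(1) inv_ring_subset wp_xi_subset by blast

lemma W_scale: "f \<in> \<W> \<Longrightarrow> (\<lambda>p. a * f p) \<in> \<W>"
proof -
  assume f: "f \<in> \<W>"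
  have "(\<lambda>p. zero_off U (\<lambda>p. a) p * f p) \<in> \<W>" by (rule W_mult[OF W_const f])
  moreover have "(\<lambda>p. zero_off U (\<lambda>p. a) p * f p) = (\<lambda>p. a * f p)"
    using W_off_U[OF f] by (auto simp: zero_off_def fun_eq_iff)
  ultimately show ?thesis by simp
qed

text \<open>Exponent 0 is excluded because p \<mapsto> 1 does not vanish off U.\<close>

lemma W_power: "f \<in> \<W> \<Longrightarrow> j > 0 \<Longrightarrow> (\<lambda>p. f p ^ j) \<in> \<W>"
proof (induction j)
  case (Suc j)
  then show ?case by (cases "j = 0") (auto intro: W_mult)
qed simp

lemma lift_pole_eq_power:
  assumes "pole_eq q k (lift f)"
  shows "j > 0 \<Longrightarrow> pole_eq q (k * j) (lift (\<lambda>p. f p ^ j))"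
proof (induction j)
  case (Suc j)
  then show ?case using pole_eq_mult[OF assms, of "k * j"] assms by (cases "j = 0") auto
qed simp

lemma inv_lift_meromorphic: "f \<in> \<O>\<^sub>D \<Longrightarrow> lift f meromorphic_on {q}"
  using mero_ringD(2) inv_ring_subset meromorphic_on_subset by blast

lemma inv_lift_shift: "f \<in> \<O>\<^sub>D \<Longrightarrow> w \<in> half_lattice \<tau> \<Longrightarrow> lift f (z + w) = lift f z"
  by (simp add: inv_ring_iff_periodic)

lemma pole_le_lift_analytic:
  assumes "\<And>z w. w \<in> half_lattice \<tau> \<Longrightarrow> H (z + w) = H z" "H analytic_on {q}"
  shows "pole_le q 0 (lift (zero_off U (\<lambda>p. H (rep p))))"
  using pole_le_cong[OF pole_le_analytic[OF assms(2)] eventually_lift_zero_off[OF assms(1)]] .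

lemma pole_le_lift_power:
  assumes "pole_le q 0 (lift f)"
  shows "pole_le q 0 (lift (\<lambda>p. f p ^ j))"
proof -
  obtain c where c: "(lift f \<longlongrightarrow> c) (at q)" using assms by (auto simp: pole_le_def)
  have "(lift (\<lambda>p. f p ^ j) \<longlongrightarrow> c ^ j) (at q)" by (rule tendsto_power[OF c])
  then show ?thesis using assms by (auto simp: pole_le_def intro!: meromorphic_intros)
qed

lemma pole_le_lift_mult:
  assumes "pole_le q 0 (lift f)" "pole_le q 0 (lift g)"
  shows "pole_le q 0 (lift (\<lambda>p. f p * g p))"
proof -
  obtain c d where cd: "(lift f \<longlongrightarrow> c) (at q)" "(lift g \<longlongrightarrow> d) (at q)" using assms by (auto simp: pole_le_def)
  have "(lift (\<lambda>p. f p * g p) \<longlongrightarrow> c * d) (at q)" by (rule tendsto_mult[OF cd])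
  then show ?thesis using assms by (auto simp: pole_le_def intro!: meromorphic_intros)
qed

text \<open>V is a linear subspace, later the elements of the generated algebra that are regular at
  chosen points, so that removing a pole at q creates none there.\<close>

lemma eliminate_pole_W:
  assumes V: "\<And>f g. f \<in> V \<Longrightarrow> g \<in> V \<Longrightarrow> (\<lambda>p. f p + g p) \<in> V" "\<And>f a. f \<in> V \<Longrightarrow> (\<lambda>p. a * f p) \<in> V"
      "V \<noteq> {}"
    and ex: "\<And>j. j > m \<Longrightarrow> \<exists>g\<in>V. pole_eq q j (lift g)"
    and f: "f \<in> \<O>\<^sub>D"
  shows "\<exists>g\<in>V. pole_le q m (lift (\<lambda>p. f p - g p))"
proof -
  obtain k where k: "pole_le q k (lift f)" using meromorphic_pole_le[OF inv_lift_meromorphic[OF f]] by blast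
  obtain v where "v \<in> V" using V(3) by blast
  then have "(\<lambda>p. 0 * v p) \<in> V" by (rule V(2))
  then have "(\<lambda>z. 0) \<in> lift ` V" by (intro image_eqI[of _ _ "\<lambda>p. 0 * v p"]) auto
  then have "\<exists>g\<in>lift ` V. pole_le q m (\<lambda>z. lift f z - g z)"
  proof (rule eliminate_pole[OF _ _ _ _ k])
    show "(\<lambda>z. f z + g z) \<in> lift ` V" if "f \<in> lift ` V" "g \<in> lift ` V" for f g
      using that V(1) by (auto intro!: image_eqI[of _ _ "\<lambda>p. _ p + _ p"])
    show "(\<lambda>z. a * f z) \<in> lift ` V" if "f \<in> lift ` V" for f a
      using that V(2) by (auto intro!: image_eqI[of _ _ "\<lambda>p. a * _ p"])
    show "\<exists>g\<in>lift ` V. pole_eq q j g" if "j > m" for j using ex[OF that] by auto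
  qed
  then show ?thesis by auto
qed

lemma inv_ring_diff: "f \<in> \<O>\<^sub>D \<Longrightarrow> g \<in> \<O>\<^sub>D \<Longrightarrow> (\<lambda>p. f p - g p) \<in> \<O>\<^sub>D"
  using inv_ring_add[of f "\<lambda>p. - 1 * g p"] inv_ring_scale[of g "- 1"] by simp

context
  assumes quarter: "\<And>i. i < n \<Longrightarrow> pt i - 1/4 \<notin> half_lattice \<tau>"
begin

text \<open>Corrections at \<open>pt m\<close> are taken among elements regular at the earlier outer
  points, so what has been achieved is kept. Powers of xi may worsen the pole at the origin, which
  is therefore treated last.\<close>

lemma eliminate_outer_poles:
  assumes f: "f \<in> \<O>\<^sub>D" and "m \<le> n"
  shows "\<exists>w\<in>\<W>. \<forall>j<m. pt j \<notin> half_lattice \<tau> \<longrightarrow> pole_le (pt j) 0 (lift (\<lambda>p. f p - w p))"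
  using \<open>m \<le> n\<close>
proof (induction m)
  case 0
  then show ?case using W_const by blast
next
  case (Suc m)
  then obtain w where w: "w \<in> \<W>" "\<And>j. j < m \<Longrightarrow> pt j \<notin> half_lattice \<tau> \<Longrightarrow> pole_le (pt j) 0 (lift (\<lambda>p. f p - w p))"
    by auto
  define f' where "f' = (\<lambda>p. f p - w p)"
  have f': "f' \<in> \<O>\<^sub>D" unfolding f'_def by (intro inv_ring_diff f wp_xi_subset w)
  \<comment> \<open>A point of the half lattice counts as the origin, and a point congruent to an
    earlier one is settled by periodicity. Only a new point calls for a subtraction.\<close>
  consider "pt m \<in> half_lattice \<tau>" | j where "j < m" "pt j - pt m \<in> half_lattice \<tau>" "pt m \<notin> half_lattice \<tau>"
    | "pt m \<notin> half_lattice \<tau>" "\<And>j. j < m \<Longrightarrow> pt j - pt m \<notin> half_lattice \<tau>" by blast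
  then show ?case
  proof cases
    case 1
    then show ?thesis using w by (intro bexI[of _ w]) (auto simp: less_Suc_eq)
  next
    case (2 j)
    have "pt j \<notin> half_lattice \<tau>"
      using 2(2,3) half_lattice_diff[of "pt j" \<tau> "pt j - pt m"] by auto
    then have "pole_le (pt j) 0 (lift f')" using w(2)[OF 2(1)] by (simp add: f'_def)
    then have "pole_le (pt m + (pt j - pt m)) 0 (lift f')" by simp
    then have "pole_le (pt m) 0 (lift f')"
      using pole_le_shift[of "lift f'" "pt j - pt m"] inv_lift_shift[OF f' 2(2)] by blast
    then show ?thesis using w by (intro bexI[of _ w]) (auto simp: less_Suc_eq f'_def)
  next
    case 3
    define V where "V = {v \<in> \<W>. \<forall>j<m. pt j \<notin> half_lattice \<tau> \<longrightarrow> pole_le (pt j) 0 (lift v)}"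
    \<comment> \<open>\<open>pt 0\<close> is a lattice point, so m = 0, for which there is no
      generator xi, cannot occur here.\<close>
    have m: "1 \<le> m" "m < n" using 3(1) pt_0 lattice_subset_half[of "pt 0"] Suc.prems by (cases m; auto)+
    have "\<exists>v\<in>V. pole_le (pt m) 0 (lift (\<lambda>p. f' p - v p))"
    proof (rule eliminate_pole_W[OF _ _ _ _ f'])
      show "(\<lambda>p. f p + g p) \<in> V" if "f \<in> V" "g \<in> V" for f g
        using that by (auto simp: V_def intro: W_add pole_le_add)
      show "(\<lambda>p. a * f p) \<in> V" if "f \<in> V" for f a
        using that by (auto simp: V_def intro: W_scale pole_le_scale)
      have pw: "(\<lambda>p. xi_gen m p ^ j) \<in> V" if "j > 0" for j
        unfolding V_def
      proof (intro CollectI conjI allI impI)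
        show "(\<lambda>p. xi_gen m p ^ j) \<in> \<W>" using that m by (intro W_power W_gens)
        fix i assume "i < m" "pt i \<notin> half_lattice \<tau>"
        then have "xi \<tau> (pt m) analytic_on {pt i}" using 3(2) by (intro xi_analytic)
        then show "pole_le (pt i) 0 (lift (\<lambda>p. xi_gen m p ^ j))"
          by (intro pole_le_lift_power pole_le_lift_analytic xi_periodic)
      qed
      then show "V \<noteq> {}" by (metis empty_iff zero_less_one)
      show "\<exists>g\<in>V. pole_eq (pt m) j (lift g)" if "j > 0" for j
      proof (rule bexI[OF _ pw[OF that]])
        have "pole_eq (pt m) 1 (lift (xi_gen m))"
          by (rule pole_eq_cong[OF xi_pole eventually_lift_zero_off]) (use 3(1) quarter[OF m(2)] xi_periodic in auto)
        from lift_pole_eq_power[OF this that] show "pole_eq (pt m) j (lift (\<lambda>p. xi_gen m p ^ j))" by simp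
      qed
    qed
    then obtain v where v: "v \<in> \<W>" "\<And>j. j < m \<Longrightarrow> pt j \<notin> half_lattice \<tau> \<Longrightarrow> pole_le (pt j) 0 (lift v)"
      "pole_le (pt m) 0 (lift (\<lambda>p. f' p - v p))" by (auto simp: V_def)
    show ?thesis
    proof (intro bexI[of _ "\<lambda>p. w p + v p"] allI impI W_add w v)
      fix j assume j: "j < Suc m" "pt j \<notin> half_lattice \<tau>"
      have "pole_le (pt j) 0 (lift (\<lambda>p. f' p - v p))"
      proof (cases "j = m")
        case False
        then have "j < m" using j by simp
        then show ?thesis using pole_le_diff[OF w(2)[OF _ j(2)] v(2)[OF _ j(2)]] by (simp add: f'_def)
      qed (use v(3) in simp)
      then show "pole_le (pt j) 0 (lift (\<lambda>p. f p - (w p + v p)))" by (simp add: f'_def diff_diff_eq)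
    qed
  qed
qed

lemma eliminate_all_poles:
  assumes f: "f \<in> \<O>\<^sub>D"
  shows "\<exists>w\<in>\<W>. (\<forall>j<n. pt j \<notin> half_lattice \<tau> \<longrightarrow> pole_le (pt j) 0 (lift (\<lambda>p. f p - w p))) \<and>
    pole_le 0 1 (lift (\<lambda>p. f p - w p))"
proof -
  obtain w where w: "w \<in> \<W>" "\<And>j. j < n \<Longrightarrow> pt j \<notin> half_lattice \<tau> \<Longrightarrow> pole_le (pt j) 0 (lift (\<lambda>p. f p - w p))"
    using eliminate_outer_poles[OF f order_refl] by blast
  define f' where "f' = (\<lambda>p. f p - w p)"
  have f': "f' \<in> \<O>\<^sub>D" unfolding f'_def by (intro inv_ring_diff f wp_xi_subset w)
  define V where "V = {v \<in> \<W>. \<forall>j<n. pt j \<notin> half_lattice \<tau> \<longrightarrow> pole_le (pt j) 0 (lift v)}"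
  have gens: "wp_gen \<in> V" "wp'_gen \<in> V"
    using W_gens by (auto simp: V_def intro!: pole_le_lift_analytic wp_shift_gen deriv_wp_shift analytic_deriv wp_analytic \<tau>)
  have V_power: "(\<lambda>p. v p ^ j) \<in> V" if "v \<in> V" "j > 0" for v j
    using that by (auto simp: V_def intro: W_power pole_le_lift_power)
  have V_mult: "(\<lambda>p. v p * v' p) \<in> V" if "v \<in> V" "v' \<in> V" for v v'
    using that by (auto simp: V_def intro: W_mult pole_le_lift_mult)
  have mero: "wp (half_lattice \<tau>) meromorphic_on {0}"
    by (rule meromorphic_on_subset[OF wp_meromorphic[OF \<tau>]]) simp
  have "pole_eq 0 2 (wp (half_lattice \<tau>))"
    unfolding pole_eq_def diff_zero by (intro conjI mero exI[of _ 1] wp_tendsto(1)[OF \<tau>]) simp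
  moreover have "pole_eq 0 3 (deriv (wp (half_lattice \<tau>)))"
    unfolding pole_eq_def diff_zero
    by (intro conjI meromorphic_on_deriv mero exI[of _ "- 2"] wp_tendsto(2)[OF \<tau>]) simp
  ultimately have p23: "pole_eq 0 2 (lift wp_gen)" "pole_eq 0 3 (lift wp'_gen)"
    by (auto intro: pole_eq_cong[OF _ eventually_lift_zero_off] wp_shift_gen deriv_wp_shift \<tau>)
  have "\<exists>v\<in>V. pole_le 0 1 (lift (\<lambda>p. f' p - v p))"
  proof (rule eliminate_pole_W[OF _ _ _ _ f'])
    show "(\<lambda>p. f p + g p) \<in> V" if "f \<in> V" "g \<in> V" for f g
      using that by (auto simp: V_def intro: W_add pole_le_add)
    show "(\<lambda>p. a * f p) \<in> V" if "f \<in> V" for f a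
      using that by (auto simp: V_def intro: W_scale pole_le_scale)
    show "V \<noteq> {}" using gens by blast
    fix j :: nat assume j: "j > 1"
    \<comment> \<open>The orders 2 a and 2 a + 3 are realised by powers of wp without and with a
      factor wp'. Order 3 is separate because \<open>W_power\<close> needs a positive
      exponent.\<close>
    consider (even) a where "j = 2 * a" "a > 0" | (three) "j = 3" | (odd) a where "j = 2 * a + 3" "a > 0"
    proof -
      have "j = 2 * (j div 2) \<and> j div 2 > 0 \<or> j = 3 \<or> j = 2 * ((j - 3) div 2) + 3 \<and> (j - 3) div 2 > 0"
        using j by presburger
      then show ?thesis using that by blast
    qed
    then show "\<exists>g\<in>V. pole_eq 0 j (lift g)"
    proof cases
      case even
      then show ?thesis using lift_pole_eq_power[OF p23(1) even(2)] V_power[OF gens(1) even(2)]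
        by (intro bexI[of _ "\<lambda>p. wp_gen p ^ a"]) simp_all
    next
      case three
      then show ?thesis using p23(2) gens(2) by blast
    next
      case odd
      from pole_eq_mult[OF lift_pole_eq_power[OF p23(1) odd(2)] p23(2)]
      show ?thesis using V_mult[OF V_power[OF gens(1) odd(2)] gens(2)] odd(1)
        by (intro bexI[of _ "\<lambda>p. wp_gen p ^ a * wp'_gen p"]) simp_all
    qed
  qed
  then obtain v where v: "v \<in> \<W>" "\<And>j. j < n \<Longrightarrow> pt j \<notin> half_lattice \<tau> \<Longrightarrow> pole_le (pt j) 0 (lift v)"
    "pole_le 0 1 (lift (\<lambda>p. f' p - v p))" by (auto simp: V_def)
  show ?thesis
  proof (intro bexI[of _ "\<lambda>p. w p + v p"] conjI allI impI W_add w v)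
    show "pole_le (pt j) 0 (lift (\<lambda>p. f p - (w p + v p)))" if "j < n" "pt j \<notin> half_lattice \<tau>" for j
      using pole_le_diff[OF w(2)[OF that] v(2)[OF that]] by (simp add: diff_diff_eq)
    show "pole_le 0 1 (lift (\<lambda>p. f p - (w p + v p)))" using v(3) by (simp add: f'_def diff_diff_eq)
  qed
qed

end

text \<open>The logarithmic derivative of \<open>theta1\<close> is quasi-periodic with an additive constant, which
  prevents an invariant function from having a single simple pole.\<close>

definition theta_log :: "complex \<Rightarrow> complex" where
  "theta_log z = deriv (\<lambda>z. theta1 z \<tau>) (2 * z) / theta1 (2 * z) \<tau>"

lemma theta1_deriv_holo: "deriv (\<lambda>z. theta1 z \<tau>) holomorphic_on UNIV"
  by (intro holomorphic_deriv theta_holo \<tau> holomorphic_intros open_UNIV)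

lemma theta1_deriv_double_holo: "(\<lambda>z. deriv (\<lambda>z. theta1 z \<tau>) (2 * z)) holomorphic_on UNIV"
  using holomorphic_on_compose_gen[OF double_holo theta1_deriv_holo] by (simp add: o_def)

lemma theta_log_meromorphic: "theta_log meromorphic_on A"
  unfolding theta_log_def
  by (intro meromorphic_on_divide holomorphic_imp_meromorphic theta1_deriv_double_holo theta_holo \<tau> double_holo)

lemma theta_log_analytic: "z \<notin> half_lattice \<tau> \<Longrightarrow> theta_log analytic_on {z}"
  unfolding theta_log_def
  by (intro analytic_on_divide holomorphic_imp_analytic theta1_deriv_double_holo theta_holo \<tau> double_holo)
    (simp add: theta1_zero_iff[OF \<tau>] half_lattice_iff)

lemma theta_log_pole:
  assumes q: "q \<in> half_lattice \<tau>"
  shows "((\<lambda>z. theta_log z * (z - q)) \<longlongrightarrow> 1 / 2) (at q)"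
proof -
  let ?d = "deriv (\<lambda>z. theta1 z \<tau>)"
  have d: "?d (2 * q) \<noteq> 0" using theta1_deriv_lattice[OF \<tau>, of "2 * q"] q by (simp add: half_lattice_iff)
  have "((\<lambda>z. ?d (2 * z)) \<longlongrightarrow> ?d (2 * q)) (at q)"
    using analytic_tendsto[OF holomorphic_imp_analytic[OF theta1_deriv_double_holo]] .
  then have "((\<lambda>z. ?d (2 * z) / (theta1 (2 * z) \<tau> / (z - q))) \<longlongrightarrow> ?d (2 * q) / (2 * ?d (2 * q))) (at q)"
    using d by (intro tendsto_divide theta1_double_tendsto q) auto
  then show ?thesis using d by (simp add: theta_log_def)
qed

lemma theta_log_shift:
  "theta_log (z + 1/2) = theta_log z"
  "z \<notin> half_lattice \<tau> \<Longrightarrow> theta_log (z + \<tau>/2) = theta_log z - 2 * of_real pi * \<i>"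
proof -
  let ?t = "\<lambda>z. theta1 z \<tau>"
  have "(?t has_field_derivative deriv ?t (w + 1)) (at (w + 1))" for w by (rule theta1_deriv[OF \<tau>])
  then have "((\<lambda>w. ?t (w + 1)) has_field_derivative deriv ?t (w + 1)) (at w)" for w
    by (simp add: DERIV_shift)
  moreover have "((\<lambda>w. ?t (w + 1)) has_field_derivative - deriv ?t w) (at w)" for w
    unfolding theta_add_1 by (intro DERIV_minus theta1_deriv \<tau>)
  ultimately have d1: "deriv ?t (w + 1) = - deriv ?t w" for w by (rule DERIV_unique)
  show "theta_log (z + 1/2) = theta_log z"
    by (simp add: theta_log_def ring_distribs d1 theta_add_1)
  have "(?t has_field_derivative deriv ?t (w + \<tau>)) (at (w + \<tau>))" for w by (rule theta1_deriv[OF \<tau>])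
  then have "((\<lambda>w. ?t (w + \<tau>)) has_field_derivative deriv ?t (w + \<tau>)) (at w)" for w
    by (simp add: DERIV_shift)
  moreover have "((\<lambda>w. ?t (w + \<tau>)) has_field_derivative
      2 * of_real pi * \<i> * qfac \<tau> w * theta1 w \<tau> - qfac \<tau> w * deriv ?t w) (at w)" for w
    unfolding theta_add_tau[OF \<tau>] qfac_def
    by (rule derivative_eq_intros theta1_deriv[OF \<tau>] refl | simp add: algebra_simps)+
  ultimately have d2: "deriv ?t (w + \<tau>) = 2 * of_real pi * \<i> * qfac \<tau> w * theta1 w \<tau> - qfac \<tau> w * deriv ?t w" for w
    by (rule DERIV_unique)
  show "theta_log (z + \<tau>/2) = theta_log z - 2 * of_real pi * \<i>" if "z \<notin> half_lattice \<tau>"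
  proof -
    have t0: "theta1 (2 * z) \<tau> \<noteq> 0" using that by (simp add: theta1_zero_iff[OF \<tau>] half_lattice_iff)
    have "theta_log (z + \<tau>/2) = (2 * of_real pi * \<i> * qfac \<tau> (2 * z) * theta1 (2 * z) \<tau> - qfac \<tau> (2 * z) * deriv ?t (2 * z))
        / (- qfac \<tau> (2 * z) * theta1 (2 * z) \<tau>)"
      by (simp add: theta_log_def ring_distribs d2 theta_add_tau[OF \<tau>])
    moreover have "(x * q * t - q * d) / (- q * t) = d / t - x" if "q \<noteq> 0" "t \<noteq> 0" for x q t d :: complex
      using that by (simp add: field_simps)
    ultimately show ?thesis using t0 qfac_nonzero(1)[of \<tau> "2 * z"] by (simp add: theta_log_def)
  qed
qed

text \<open>Subtracting a multiple of \<open>theta_log\<close> leaves an entire function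
  \<open>E\<close> with period 1/2 and additive quasi-period 4 \<pi> i c at \<tau> / 2. Its
  derivative is elliptic, hence constant, so \<open>E\<close> is affine; the period 1 makes it
  constant, and then the quasi-period forces c = 0.\<close>

lemma simple_pole_constant:
  assumes f: "f \<in> \<O>\<^sub>D" and outer: "\<And>j. j < n \<Longrightarrow> pt j \<notin> half_lattice \<tau> \<Longrightarrow> pole_le (pt j) 0 (lift f)"
    and zero: "pole_le 0 1 (lift f)"
  shows "\<exists>d. f = zero_off U (\<lambda>p. d)"
proof -
  obtain c where c: "((\<lambda>z. lift f z * z) \<longlongrightarrow> c) (at 0)" using zero by (auto simp: pole_le_def)
  \<comment> \<open>The residue of \<open>theta_log\<close> at every point of the half lattice is
    1/2, hence the factor 2 c.\<close>
  define K where "K = (\<lambda>z. lift f z - 2 * c * theta_log z)"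
  have K_mero: "K meromorphic_on {q}" for q
    unfolding K_def by (intro meromorphic_intros inv_lift_meromorphic f theta_log_meromorphic)
  have K_ana: "K analytic_on {z}" if "z \<notin> poles" for z
    unfolding K_def using that
    by (intro analytic_on_diff analytic_on_mult analytic_on_const mero_ringD(3) inv_ring_subset f theta_log_analytic notin_poles)
  have K_lim: "\<exists>l. (K \<longlongrightarrow> l) (at q)" for q
  proof -
    consider "q \<notin> poles" | "q \<in> half_lattice \<tau>" | "q \<in> poles" "q \<notin> half_lattice \<tau>" by blast
    then show ?thesis
    proof cases
      case 1
      then show ?thesis using analytic_tendsto[OF K_ana] by blast
    next
      case 2
      have per: "lift f (z - q) = lift f z" for z
        using inv_lift_shift[OF f, of "- q" z] 2 by simp
      from LIM_offset[OF c, of "- q"] have "((\<lambda>z. lift f z * (z - q)) \<longlongrightarrow> c) (at q)" by (simp add: per)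
      from tendsto_diff[OF this tendsto_mult[OF tendsto_const[of "2 * c"] theta_log_pole[OF 2]]]
      have "((\<lambda>z. K z * (z - q)) \<longlongrightarrow> 0) (at q)" by (simp add: K_def algebra_simps)
      then show ?thesis by (rule meromorphic_mult_tendsto_0[OF K_mero])
    next
      case 3
      then obtain i where i: "i < n" "q - pt i \<in> half_lattice \<tau>" by (auto simp: poles_def)
      have "pt i \<notin> half_lattice \<tau>" using half_lattice_add[OF i(2), of "pt i"] 3(2) by auto
      then have "pole_le (pt i) 0 (lift f)" using outer i(1) by blast
      then have "pole_le (pt i + (q - pt i)) 0 (lift f)"
        using pole_le_shift[of "lift f" "q - pt i"] inv_lift_shift[OF f i(2)] by blast
      then obtain l where "(lift f \<longlongrightarrow> l) (at q)" by (auto simp: pole_le_def)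
      from tendsto_diff[OF this tendsto_mult[OF tendsto_const[of "2 * c"] analytic_tendsto[OF theta_log_analytic[OF 3(2)]]]]
      show ?thesis unfolding K_def by blast
    qed
  qed
  define E where "E = remove_sings K"
  have E_ana: "E analytic_on {z}" for z
  proof -
    obtain l where "(K \<longlongrightarrow> l) (at z)" using K_lim by blast
    then show ?thesis unfolding E_def using K_mero[of z] by (intro remove_sings_analytic_at) (auto simp: meromorphic_at_iff)
  qed
  have E_K: "E z = K z" if "z \<notin> poles" for z
    unfolding E_def using K_ana[OF that] by simp
  have E_holo: "E holomorphic_on UNIV"
    using E_ana by (intro analytic_imp_holomorphic) (simp add: analytic_on_analytic_at[of _ UNIV])
  have E_compose: "(\<lambda>z. E (z + w)) analytic_on {z}" for w z
    using analytic_on_compose[of "\<lambda>z. z + w" "{z}" E] E_ana by (simp add: o_def analytic_intros)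
  have half: "1/2 \<in> half_lattice \<tau>" "\<tau>/2 \<in> half_lattice \<tau>" by (simp_all add: half_lattice_iff)
  have E1: "E (z + 1/2) = E z" for z
  proof (rule analytic_eq_at[OF E_compose E_ana])
    show "\<forall>\<^sub>F w in at z. E (w + 1/2) = E w"
      using eventually_notin_poles
    proof eventually_elim
      case (elim w)
      have "w + 1/2 \<notin> poles" using poles_add_half[OF half(1)] elim by simp
      then show ?case
        using inv_lift_shift[OF f half(1), of w] elim by (simp add: E_K K_def theta_log_shift(1))
    qed
  qed
  have E2: "E (z + \<tau>/2) = E z + 4 * c * of_real pi * \<i>" for z
  proof (rule analytic_eq_at[OF E_compose])
    show "(\<lambda>z. E z + 4 * c * of_real pi * \<i>) analytic_on {z}"
      by (intro analytic_on_add analytic_on_const E_ana)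
    show "\<forall>\<^sub>F w in at z. E (w + \<tau>/2) = E w + 4 * c * of_real pi * \<i>"
      using eventually_notin_poles
    proof eventually_elim
      case (elim w)
      have "w + \<tau>/2 \<notin> poles" using poles_add_half[OF half(2)] elim by simp
      then show ?case
        using inv_lift_shift[OF f half(2), of w] elim
        by (simp add: E_K K_def theta_log_shift(2)[OF notin_poles(1)] algebra_simps)
    qed
  qed
  \<comment> \<open>Doubling the half periods brings \<open>E\<close> into the scope of
    \<open>elliptic_entire_const\<close>, which is stated for 1 and \<tau>.\<close>
  have E1': "E (z + 1) = E z" for z using E1[of "z + 1/2"] E1[of z] by (simp add: add.assoc)
  have E2': "E (z + \<tau>) = E z + 8 * c * of_real pi * \<i>" for z
    using E2[of "z + \<tau>/2"] E2[of z] by (simp add: add.assoc)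
  have dE: "(E has_field_derivative deriv E z) (at z)" for z
    using E_holo by (intro holomorphic_derivI[of _ UNIV]) auto
  have "doubly_periodic \<tau> (deriv E)"
    unfolding doubly_periodic_def
  proof (intro conjI allI)
    fix z
    have "((\<lambda>z. E (z + 1)) has_field_derivative deriv E (z + 1)) (at z)"
      using dE[of "z + 1"] by (simp add: DERIV_shift)
    then show "deriv E (z + 1) = deriv E z"
      using DERIV_unique[OF _ dE[of z]] by (simp add: E1')
    have "((\<lambda>z. E (z + \<tau>)) has_field_derivative deriv E (z + \<tau>)) (at z)"
      using dE[of "z + \<tau>"] by (simp add: DERIV_shift)
    moreover have "((\<lambda>z. E z + 8 * c * of_real pi * \<i>) has_field_derivative deriv E z) (at z)"
      by (auto intro!: derivative_eq_intros dE)
    ultimately show "deriv E (z + \<tau>) = deriv E z"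
      using DERIV_unique by (simp add: E2') blast
  qed
  then obtain k where k: "\<And>z. deriv E z = k"
    using elliptic_entire_const[OF \<tau> holomorphic_deriv[OF E_holo open_UNIV]] by blast
  have "((\<lambda>z. E z - k * z) has_field_derivative 0) (at z)" for z
    using dE[of z] k by (auto intro!: derivative_eq_intros)
  then obtain d where d: "\<And>z. E z - k * z = d"
    using has_field_derivative_zero_constant[of UNIV "\<lambda>z. E z - k * z"] by auto
  have "k = 0" using d[of 0] d[of 1] E1'[of 0] by simp
  then have E_d: "E z = d" for z using d[of z] by simp
  then have c0: "c = 0" using E2'[of 0] by simp
  have "f p = zero_off U (\<lambda>p. d) p" for p
  proof (cases "p \<in> U")
    case True
    have p: "tproj \<tau> (rep p) = p" using tproj_rep[OF U_torus[OF True]] .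
    then have "rep p \<notin> poles" using True tproj_U_iff[of "rep p"] by simp
    from E_K[OF this] show ?thesis using True by (simp add: E_d K_def c0 p zero_off_def)
  next
    case False
    then show ?thesis using mero_ringD(1)[OF inv_ring_subset[OF f]] by (simp add: zero_off_def)
  qed
  then show ?thesis by blast
qed

lemma inv_ring_eq_wp_xi:
  assumes "\<forall>i<n. \<forall>\<omega>\<in>half_lattice \<tau>. P i \<noteq> tproj \<tau> (1/4 + \<omega>)"
  shows "\<O>\<^sub>D = \<W>"
proof
  have quarter: "pt i - 1/4 \<notin> half_lattice \<tau>" if "i < n" for i
  proof
    assume "pt i - 1/4 \<in> half_lattice \<tau>"
    then have "P i \<noteq> tproj \<tau> (1/4 + (pt i - 1/4))" using assms that by blast
    then show False using tproj_pt[OF that] by simp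
  qed
  show "\<O>\<^sub>D \<subseteq> \<W>"
  proof
    fix f assume f: "f \<in> \<O>\<^sub>D"
    obtain w where w: "w \<in> \<W>" "\<And>j. j < n \<Longrightarrow> pt j \<notin> half_lattice \<tau> \<Longrightarrow> pole_le (pt j) 0 (lift (\<lambda>p. f p - w p))"
      "pole_le 0 1 (lift (\<lambda>p. f p - w p))"
      using eliminate_all_poles[OF quarter f] by blast
    have "(\<lambda>p. f p - w p) \<in> \<O>\<^sub>D" by (intro inv_ring_diff f wp_xi_subset w)
    then obtain d where d: "(\<lambda>p. f p - w p) = zero_off U (\<lambda>p. d)"
      using simple_pole_constant[OF _ w(2,3)] by blast
    have "(\<lambda>p. zero_off U (\<lambda>p. d) p + w p) \<in> \<W>" by (intro W_add W_const w)
    moreover have "(\<lambda>p. zero_off U (\<lambda>p. d) p + w p) = f" unfolding d [symmetric] by simp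
    ultimately show "f \<in> \<W>" by simp
  qed
  show "\<W> \<subseteq> \<O>\<^sub>D" using wp_xi_subset by blast
qed

end

section \<open>Normal forms by the explicit intertwiner, and assembly of the theorem\<close>

context automorphic_pgl2
begin

lemma normal_form_intertwiner:
  assumes M: "conjugates_standard s1 s2 \<delta> M" and b: "basis_family K b"
  shows "normal_form \<O>\<^sub>D \<L> K b (\<lambda>k. intertwiner \<tau> U \<rho>b M (elem_tensor (b k) (zero_off U (\<lambda>p. 1))))"
proof -
  have "intertwiner \<tau> U \<rho>b M (elem_tensor v (zero_off U (\<lambda>p. 1))) = zero_off U (\<lambda>p. Omega_rep \<tau> \<rho>b M p v)" for v
    by (auto simp: intertwiner_def elem_tensor_def zero_off_def)
  then show ?thesis
    using normal_form_of_trivialisation[OF trivialises_Omega[OF M] b] by simp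
qed

end

text \<open>The normal form appears twice: for arbitrary \<delta> with some basis B, and for
  injective \<delta> with the explicit one. The latter is asserted for every M that conjugates the
  standard embedding to \<delta>; the existence of such an M is stated alongside, so that the claim
  is not vacuous.\<close>

theorem theorem2p9:
  fixes scale :: "complex \<Rightarrow> 'g::ab_group_add \<Rightarrow> 'g"
    and bracket :: "'g \<Rightarrow> 'g \<Rightarrow> 'g"
    and \<rho> :: "int \<times> int \<Rightarrow> 'g \<Rightarrow> 'g"
    and \<rho>b :: "(complex^2^2) set \<Rightarrow> 'g \<Rightarrow> 'g"
    and \<delta> :: "int \<times> int \<Rightarrow> (complex^2^2) set"
    and \<sigma> :: "int \<times> int \<Rightarrow> complex set \<Rightarrow> complex set"
    and \<tau> :: complex and n :: nat and P :: "nat \<Rightarrow> complex set"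
    and S U :: "complex set set"
    and O_inv W :: "(complex set \<Rightarrow> complex) set" and L :: "(complex set \<Rightarrow> 'g) set"
  assumes lie: "fd_lie_algebra scale bracket"
    and reductive: "fd_lie_algebra.reductive scale bracket"
    and \<rho>: "\<rho> \<in> hom D2 (fd_lie_algebra.Inn scale bracket)"
    and \<rho>b: "fd_lie_algebra.PGL2_rep scale bracket \<rho>b"
    and \<delta>: "\<delta> \<in> hom D2 PGL2"
    and factors: "\<forall>t\<in>carrier D2. \<rho> t = \<rho>b (\<delta> t)"
    and \<tau>: "Im \<tau> > 0"
    and \<sigma>: "\<sigma> \<in> hom D2 (torus_aut \<tau>)"
    and \<sigma>_inj: "inj_on \<sigma> (carrier D2)"
    and \<sigma>_translations: "\<forall>t\<in>carrier D2. \<exists>c. \<sigma> t = translation \<tau> c"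
    and n: "n \<ge> 1"
    and P: "\<forall>i<n. P i \<in> torus \<tau>"
    and P0: "P 0 = tproj \<tau> 0"
    and S_def: "S = P ` {..<n}"
    and U_def: "U = torus \<tau> - orbit_of \<sigma> S"
    and O_inv_def: "O_inv = inv_ring \<tau> \<sigma> U"
    and W_def: "W = wp_xi_ring \<tau> U n P"
    and L_def: "L = fd_lie_algebra.automorphic_lie_algebra scale \<tau> \<sigma> \<rho> U"
  shows "(\<exists>\<Psi>. fd_lie_algebra.lie_module_iso scale bracket O_inv L
              (fd_lie_algebra.tensor scale O_inv) \<Psi>)
       \<and> ((\<forall>i<n. \<forall>\<omega>\<in>half_lattice \<tau>. P i \<noteq> tproj \<tau> (1/4 + \<omega>)) \<longrightarrow>
            O_inv = W \<and>
            (\<exists>\<Psi>. fd_lie_algebra.lie_module_iso scale bracket O_inv L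
              (fd_lie_algebra.tensor scale W) \<Psi>))
       \<and> (fd_lie_algebra.simple scale bracket \<longrightarrow>
            (\<forall>H l h a. fd_lie_algebra.chevalley_basis scale bracket H l h a \<longrightarrow>
               (\<exists>B. fd_lie_algebra.normal_form scale bracket O_inv L
                  (fd_lie_algebra.chevalley_index scale bracket H l) (case_sum h a) B) \<and>
               (inj_on \<delta> (carrier D2) \<longrightarrow>
                  (\<exists>s1\<in>carrier D2. \<exists>s2\<in>carrier D2.
                     \<sigma> s1 = translation \<tau> (1/2) \<and> \<sigma> s2 = translation \<tau> (\<tau>/2) \<and>
                     (\<exists>M. conjugates_standard s1 s2 \<delta> M) \<and>
                     (\<forall>M. conjugates_standard s1 s2 \<delta> M \<longrightarrow>
                        fd_lie_algebra.normal_form scale bracket O_inv L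
                          (fd_lie_algebra.chevalley_index scale bracket H l) (case_sum h a)
                          (\<lambda>k. intertwiner \<tau> U \<rho>b M
                             (fd_lie_algebra.elem_tensor scale (case_sum h a k) (zero_off U (\<lambda>p. 1)))))))))"
proof -
  interpret automorphic_pgl2 scale bracket \<tau> \<sigma> n P U \<rho> \<rho>b \<delta>
    using lie \<rho> \<rho>b \<delta> factors \<tau> \<sigma> \<sigma>_inj \<sigma>_translations n P P0 U_def[unfolded S_def]
    by (intro automorphic_pgl2.intro automorphic_setting.intro torus_setting.intro pgl2_representation.intro
        automorphic_setting_axioms.intro pgl2_representation_axioms.intro automorphic_pgl2_axioms.intro)
  obtain T where T: "trivialises T" using ex_trivialisation by blast
  note iso = untwist_iso[OF T]
  show ?thesis
    unfolding O_inv_def L_def W_def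
  proof (intro conjI impI allI)
    show "\<exists>\<Psi>. lie_module_iso \<O>\<^sub>D \<L> (tensor \<O>\<^sub>D) \<Psi>" using iso by blast
  next
    assume "\<forall>i<n. \<forall>\<omega>\<in>half_lattice \<tau>. P i \<noteq> tproj \<tau> (1/4 + \<omega>)"
    then show eq: "\<O>\<^sub>D = \<W>" by (rule inv_ring_eq_wp_xi)
    show "\<exists>\<Psi>. lie_module_iso \<O>\<^sub>D \<L> (tensor \<W>) \<Psi>" using iso unfolding eq by blast
  next
    fix H l h a
    assume "chevalley_basis H l h a"
    then have b: "basis_family (chevalley_index H l) (case_sum h a)" by (simp add: chevalley_basis_def)
    show "\<exists>B. normal_form \<O>\<^sub>D \<L> (chevalley_index H l) (case_sum h a) B"
      using normal_form_of_trivialisation[OF T b] by blast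
    assume "inj_on \<delta> (carrier D2)"
    then show "\<exists>s1\<in>carrier D2. \<exists>s2\<in>carrier D2.
        \<sigma> s1 = translation \<tau> (1/2) \<and> \<sigma> s2 = translation \<tau> (\<tau>/2) \<and>
        (\<exists>M. conjugates_standard s1 s2 \<delta> M) \<and>
        (\<forall>M. conjugates_standard s1 s2 \<delta> M \<longrightarrow>
           normal_form \<O>\<^sub>D \<L> (chevalley_index H l) (case_sum h a)
             (\<lambda>k. intertwiner \<tau> U \<rho>b M (elem_tensor (case_sum h a k) (zero_off U (\<lambda>p. 1)))))"
      by (intro bexI[OF _ s1(1)] bexI[OF _ s2(1)] conjI sigma_s ex_conjugates_standard allI impI
          normal_form_intertwiner b)
  qed
qed

end
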